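(* Let $J^\alpha$, $J^0$, $S_A$, $\overline S_A$ be as in the context. Let $(u^{\alpha_k})_{k\in\mathbb{N}}$ be a sequence of functions such that $\alpha_k\to0$ as $k\to\infty$ and, for every $k\in\mathbb{N}$, the function $u^{\alpha_k}:\mathbb{R}^n\to\mathbb{R}^m$ is an energy minimizer of $J^{\alpha_k}$. Assume that $$u^{\alpha_k}(x)\in\overline S_A\quad\text{for all }x\in\mathbb{R}^n,\ k\in\mathbb{N}.$$ Then there exists a subsequence (not relabelled) such that $$u^{\alpha_k}\rightharpoonup\tilde u\ \text{ in } W^{1,2}(\mathbb{R}^n;\mathbb{R}^m)\ \text{ as }k\to\infty,$$ with $\tilde u$ a local energy minimizer of the functional $$J^0(\Omega,u)=\int_\Omega\left(\tfrac12|\nabla u|^2+W^0(u(x))\right)dx.$$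
   Context: $A=\{a_1,\dots,a_N\}$ is a set of distinct points of $\mathbb{R}^m$, $N\ge2$. For $0<\alpha<2$, $W^\alpha(u)=\prod_{i=1}^N|u-a_i|^\alpha$ and $J^\alpha(\Omega,u)=\int_\Omega\left(\tfrac12|\nabla u|^2+W^\alpha(u)\right)dx$; the $\alpha_k$ lie in $(0,2)$. Further, $$S_A=\left\{\sum_{i=1}^N\lambda_ia_i:\ \sum_{i=1}^N\lambda_i=1,\ \lambda_i\in[0,1),\ i\in\{1,\dots,N\}\right\}$$ (i.e. the convex hull of the points of $A$ except the points themselves), $\overline S_A=S_A\cup A$, and $W^0(u)=\chi_{\{u\in S_A\}}$. An energy minimizer (local energy minimizer) of a functional $J(\Omega,u)$ of this type is a map $u\in W^{1,2}_{loc}(\mathbb{R}^n,\mathbb{R}^m)\cap L^\infty(\mathbb{R}^n;\mathbb{R}^m)$ such that $J(\Omega,u+v)\ge J(\Omega,u)$ for every open bounded Lipschitz set $\Omega\subset\mathbb{R}^n$ and every $v\in W^{1,2}_0(\Omega,\mathbb{R}^m)\cap L^\infty(\Omega;\mathbb{R}^m)$. The symbol $\rightharpoonup$ denotes weak convergence.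
   Formalization: Minimality of ũ for J^0 is among competitors with values in \overline S_A (unrestricted it fails for m≥2); weak convergence is in W^{1,2} of each bounded open set (global convergence fails for nonzero constants); S_A is the convex hull minus all points of A. *)

theory Defs
  imports "HOL-Analysis.Analysis"
begin

section \<open>Sobolev spaces\<close>

definition partial_deriv :: "'n::finite \<Rightarrow> (real^'n \<Rightarrow> 'b::real_normed_vector) \<Rightarrow> real^'n \<Rightarrow> 'b" where
  "partial_deriv i f x = frechet_derivative f (at x) (axis i 1)"

primrec Ck :: "nat \<Rightarrow> (real^'n::finite \<Rightarrow> 'b::real_normed_vector) \<Rightarrow> bool" where
  "Ck 0 f \<longleftrightarrow> continuous_on UNIV f"
| "Ck (Suc k) f \<longleftrightarrow> (\<forall>x. f differentiable (at x)) \<and> (\<forall>i. Ck k (partial_deriv i f))"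

definition test_function :: "(real^'n::finite) set \<Rightarrow> (real^'n \<Rightarrow> 'b::real_normed_vector) \<Rightarrow> bool" where
  "test_function \<Omega> \<phi> \<longleftrightarrow>
     (\<forall>k. Ck k \<phi>) \<and> compact (closure {x. \<phi> x \<noteq> 0}) \<and> closure {x. \<phi> x \<noteq> 0} \<subseteq> \<Omega>"

definition locally_integrable :: "(real^'n::finite) set \<Rightarrow> (real^'n \<Rightarrow> 'b::euclidean_space) \<Rightarrow> bool" where
  "locally_integrable \<Omega> f \<longleftrightarrow> (\<forall>K. compact K \<and> K \<subseteq> \<Omega> \<longrightarrow> integrable (lebesgue_on K) f)"

text \<open>The gradient of a map into \<open>real^'m\<close> is the Jacobian matrix, with \<open>G x $ j $ i\<close> the
  derivative of the \<open>j\<close>-th component in direction \<open>i\<close>.  The norm of the type \<open>real^'n^'m\<close> is the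
  Frobenius norm, so \<open>(norm (G x))\<^sup>2\<close> is the usual squared length of the gradient.\<close>

definition has_weak_gradient ::
  "(real^'n::finite) set \<Rightarrow> (real^'n \<Rightarrow> real^'m::finite) \<Rightarrow> (real^'n \<Rightarrow> real^'n^'m) \<Rightarrow> bool" where
  "has_weak_gradient \<Omega> u G \<longleftrightarrow>
     locally_integrable \<Omega> u \<and> locally_integrable \<Omega> G \<and>
     (\<forall>\<phi> :: real^'n \<Rightarrow> real. test_function \<Omega> \<phi> \<longrightarrow>
        (\<forall>i j. (LINT x|lebesgue_on \<Omega>. u x $ j * partial_deriv i \<phi> x)
              = - (LINT x|lebesgue_on \<Omega>. G x $ j $ i * \<phi> x)))"

text \<open>Determined up to a null set of \<open>\<Omega>\<close>, and meaningful only if a weak gradient exists.\<close>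

definition weak_gradient ::
  "(real^'n::finite) set \<Rightarrow> (real^'n \<Rightarrow> real^'m::finite) \<Rightarrow> real^'n \<Rightarrow> real^'n^'m" where
  "weak_gradient \<Omega> u = (SOME G. has_weak_gradient \<Omega> u G)"

definition L2 :: "(real^'n::finite) set \<Rightarrow> (real^'n \<Rightarrow> 'b::euclidean_space) \<Rightarrow> bool" where
  "L2 \<Omega> f \<longleftrightarrow> f \<in> borel_measurable (lebesgue_on \<Omega>) \<and>
     integrable (lebesgue_on \<Omega>) (\<lambda>x. (norm (f x))\<^sup>2)"

definition Linf :: "(real^'n::finite) set \<Rightarrow> (real^'n \<Rightarrow> 'b::euclidean_space) \<Rightarrow> bool" where
  "Linf \<Omega> f \<longleftrightarrow> f \<in> borel_measurable (lebesgue_on \<Omega>) \<and>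
     (\<exists>C. AE x in lebesgue_on \<Omega>. norm (f x) \<le> C)"

definition W12 :: "(real^'n::finite) set \<Rightarrow> (real^'n \<Rightarrow> real^'m::finite) set" where
  "W12 \<Omega> = {u. L2 \<Omega> u \<and> (\<exists>G. has_weak_gradient \<Omega> u G \<and> L2 \<Omega> G)}"

definition W12_norm :: "(real^'n::finite) set \<Rightarrow> (real^'n \<Rightarrow> real^'m::finite) \<Rightarrow> real" where
  "W12_norm \<Omega> u =
     sqrt (LINT x|lebesgue_on \<Omega>. (norm (u x))\<^sup>2 + (norm (weak_gradient \<Omega> u x))\<^sup>2)"

definition W12_loc :: "(real^'n::finite \<Rightarrow> real^'m::finite) set" where
  "W12_loc = {u. \<forall>\<Omega>. open \<Omega> \<and> bounded \<Omega> \<longrightarrow> u \<in> W12 \<Omega>}"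

text \<open>The closure of the compactly supported smooth maps in \<open>W12 \<Omega>\<close>.\<close>

definition W12_0 :: "(real^'n::finite) set \<Rightarrow> (real^'n \<Rightarrow> real^'m::finite) set" where
  "W12_0 \<Omega> = {v \<in> W12 \<Omega>. \<exists>\<phi> :: nat \<Rightarrow> real^'n \<Rightarrow> real^'m.
     (\<forall>k. test_function \<Omega> (\<phi> k)) \<and> (\<lambda>k. W12_norm \<Omega> (\<lambda>x. \<phi> k x - v x)) \<longlonglongrightarrow> 0}"

text \<open>Elements of the dual space of \<open>W12 \<Omega>\<close>.  The bound makes them independent of the chosen
  representative, because \<open>W12_norm \<Omega>\<close> vanishes on maps that are zero almost everywhere.\<close>

definition W12_dual ::
  "(real^'n::finite) set \<Rightarrow> ((real^'n \<Rightarrow> real^'m::finite) \<Rightarrow> real) set" where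
  "W12_dual \<Omega> = {l.
     (\<forall>f\<in>W12 \<Omega>. \<forall>g\<in>W12 \<Omega>. l (\<lambda>x. f x + g x) = l f + l g) \<and>
     (\<forall>c. \<forall>f\<in>W12 \<Omega>. l (\<lambda>x. c *\<^sub>R f x) = c * l f) \<and>
     (\<exists>C. \<forall>f\<in>W12 \<Omega>. \<bar>l f\<bar> \<le> C * W12_norm \<Omega> f)}"

definition weakly_converges_W12 ::
  "(real^'n::finite) set \<Rightarrow> (nat \<Rightarrow> real^'n \<Rightarrow> real^'m::finite) \<Rightarrow> (real^'n \<Rightarrow> real^'m) \<Rightarrow> bool" where
  "weakly_converges_W12 \<Omega> u w \<longleftrightarrow>
     (\<forall>k. u k \<in> W12 \<Omega>) \<and> w \<in> W12 \<Omega> \<and> (\<forall>l\<in>W12_dual \<Omega>. (\<lambda>k. l (u k)) \<longlonglongrightarrow> l w)"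

text \<open>Maps of class \<open>W12_loc\<close> on the whole space (constants, for instance) are in general not
  square integrable, so weak convergence on the whole space is tested on bounded open sets.\<close>

definition weakly_converges_W12_loc ::
  "(nat \<Rightarrow> real^'n::finite \<Rightarrow> real^'m::finite) \<Rightarrow> (real^'n \<Rightarrow> real^'m) \<Rightarrow> bool" where
  "weakly_converges_W12_loc u w \<longleftrightarrow>
     (\<forall>\<Omega>. open \<Omega> \<and> bounded \<Omega> \<longrightarrow> weakly_converges_W12 \<Omega> u w)"


section \<open>Lipschitz sets and minimizers\<close>

text \<open>Near each boundary point, \<open>\<Omega>\<close> is the part of a ball strictly above the graph of a Lipschitz
  function over the hyperplane orthogonal to some unit vector \<open>\<nu>\<close>; only the values of \<open>\<gamma>\<close> on that
  hyperplane matter.\<close>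

definition lipschitz_domain :: "(real^'n::finite) set \<Rightarrow> bool" where
  "lipschitz_domain \<Omega> \<longleftrightarrow>
     (\<forall>p\<in>frontier \<Omega>. \<exists>r>0. \<exists>\<nu> \<gamma> L. norm \<nu> = 1 \<and> L-lipschitz_on UNIV (\<gamma> :: real^'n \<Rightarrow> real) \<and>
        \<Omega> \<inter> ball p r = {x \<in> ball p r. \<gamma> (x - (x \<bullet> \<nu>) *\<^sub>R \<nu>) < x \<bullet> \<nu>})"

text \<open>\<open>K\<close> is the set of values on which the functional is considered: a minimizer and its
  competitors take values in \<open>K\<close> almost everywhere.  With \<open>K = UNIV\<close> this is no restriction.\<close>

definition energy_minimizer_in ::
  "(real^'m::finite) set \<Rightarrow> ((real^'n::finite) set \<Rightarrow> (real^'n \<Rightarrow> real^'m) \<Rightarrow> ennreal) \<Rightarrow>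
   (real^'n \<Rightarrow> real^'m) \<Rightarrow> bool" where
  "energy_minimizer_in K J u \<longleftrightarrow>
     u \<in> W12_loc \<and> Linf UNIV u \<and> (AE x in lebesgue. u x \<in> K) \<and>
     (\<forall>\<Omega> v. open \<Omega> \<and> bounded \<Omega> \<and> lipschitz_domain \<Omega> \<and> v \<in> W12_0 \<Omega> \<and> Linf \<Omega> v \<and>
        (AE x in lebesgue_on \<Omega>. u x + v x \<in> K) \<longrightarrow> J \<Omega> (\<lambda>x. u x + v x) \<ge> J \<Omega> u)"

abbreviation energy_minimizer ::
  "((real^'n::finite) set \<Rightarrow> (real^'n \<Rightarrow> real^'m::finite) \<Rightarrow> ennreal) \<Rightarrow>
   (real^'n \<Rightarrow> real^'m) \<Rightarrow> bool" where
  "energy_minimizer \<equiv> energy_minimizer_in UNIV"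


section \<open>The functionals\<close>

definition energy ::
  "(real^'m::finite \<Rightarrow> real) \<Rightarrow> (real^'n::finite) set \<Rightarrow> (real^'n \<Rightarrow> real^'m) \<Rightarrow> ennreal" where
  "energy W \<Omega> u =
     (\<integral>\<^sup>+x. ennreal (1/2 * (norm (weak_gradient \<Omega> u x))\<^sup>2 + W (u x)) \<partial>lebesgue_on \<Omega>)"

definition W_alpha :: "(real^'m::finite) set \<Rightarrow> real \<Rightarrow> real^'m \<Rightarrow> real" where
  "W_alpha A \<alpha> p = (\<Prod>a\<in>A. norm (p - a) powr \<alpha>)"

text \<open>The convex hull of \<open>A\<close> without the points of \<open>A\<close>.  Removing \<open>A\<close> explicitly matters only for
  those points of \<open>A\<close> that are convex combinations of the other ones: the condition \<open>c a < 1\<close>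
  alone would keep them.\<close>

definition S_hull :: "(real^'m::finite) set \<Rightarrow> (real^'m) set" where
  "S_hull A = {(\<Sum>a\<in>A. c a *\<^sub>R a) | c. (\<Sum>a\<in>A. c a) = 1 \<and> (\<forall>a\<in>A. 0 \<le> c a \<and> c a < 1)} - A"

definition S_hull_closed :: "(real^'m::finite) set \<Rightarrow> (real^'m) set" where
  "S_hull_closed A = S_hull A \<union> A"

text \<open>The potential \<open>W_zero A\<close> is meant on \<open>S_hull_closed A\<close>, where it is the limit of \<open>W_alpha A \<alpha>\<close>
  as \<open>\<alpha>\<close> tends to 0.  Outside it would be 0 while the limit is 1, so that arbitrarily
  small perturbations leaving the convex hull would remove the potential energy; minimizers of
  \<open>J_zero A\<close> are therefore taken among maps with values in \<open>S_hull_closed A\<close>.\<close>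

definition W_zero :: "(real^'m::finite) set \<Rightarrow> real^'m \<Rightarrow> real" where
  "W_zero A = indicator (S_hull A)"

definition J_alpha ::
  "(real^'m::finite) set \<Rightarrow> real \<Rightarrow> (real^'n::finite) set \<Rightarrow> (real^'n \<Rightarrow> real^'m) \<Rightarrow> ennreal" where
  "J_alpha A \<alpha> = energy (W_alpha A \<alpha>)"

definition J_zero ::
  "(real^'m::finite) set \<Rightarrow> (real^'n::finite) set \<Rightarrow> (real^'n \<Rightarrow> real^'m) \<Rightarrow> ennreal" where
  "J_zero A = energy (W_zero A)"

end

theory Submission
  imports Defs "HOL-Library.Diagonal_Subsequence"
begin

text \<open>Comparing a minimizer with its pull \<open>u + \<eta> (a - u)\<close> towards a point \<open>a\<close> of
  \<open>A\<close>, \<open>\<eta>\<close> a squared cutoff, bounds its gradient in \<open>L\<^sup>2\<close> of every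
  ball, uniformly in the exponent. Mollification at a small scale, whose \<open>L\<^sup>2\<close> error is controlled
  by the gradient, gives a subsequence that converges almost everywhere and locally in \<open>L\<^sup>2\<close> to
  some \<open>w\<close>, and Mazur's lemma upgrades this to weak convergence in
  \<open>W\<^sup>1\<^sup>,\<^sup>2\<close> without any description of the dual space.

  Given a competitor \<open>z\<close> that agrees with \<open>w\<close> outside \<open>\<Omega>\<close>, the
  minimality of \<open>u k\<close> is applied, on a large ball, to \<open>u k + \<eta> (z - u k)\<close> with a cutoff
  \<open>\<eta>\<close> that is 1 on the closure of \<open>\<Omega>\<close>. Its values stay in the convex hull of
  \<open>A\<close>. Convexity of the squared norm leaves the gradient of \<open>u k\<close> only with the weight
  \<open>\<eta>\<close>, which is weakly lower semicontinuous, and \<open>\<nabla>\<eta>\<close> lives where \<open>z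
  - u k\<close> tends to 0. Where \<open>w\<close> is not in \<open>A\<close> the potentials converge to 1, elsewhere
  their limit inferior is at least 0; where \<open>\<eta> = 1\<close> the competitor is \<open>z\<close>, and the
  measure of the layer \<open>0 < \<eta> < 1\<close> is made arbitrarily small.\<close>

section \<open>Functions of class \<open>C\<^sup>k\<close>\<close>

text \<open>Two obstacles shape the passage to the limit. A variation \<open>v\<close> of
  \<open>w\<close> cannot simply be added to \<open>u k\<close>, whose values on the boundary of
  \<Omega> differ from those of \<open>w\<close>; gluing pays for this outside \<Omega>, where the
  extended competitor equals \<open>w\<close>, so that the price is controlled by
  \<open>u k - w\<close> in \<open>L\<^sup>2\<close>. And the potentials converge at a fixed point
  only: if \<open>u k x\<close> tends to a point of \<open>A\<close>, then
  \<open>W_alpha A (\<alpha> k) (u k x)\<close> may tend to anything between 0 and 1, depending on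
  the two rates. Convergence is therefore used for the competitor, which does not depend on
  \<open>k\<close> where it matters, and mere nonnegativity for \<open>u k\<close> where
  \<open>w\<close> lies in \<open>A\<close>. The limits are taken in a fixed order: \<open>k\<close>
  to infinity for a fixed cutoff, then the layer shrinks. All bounds are uniform in \<open>k\<close>
  because the values lie in a set of finite diameter and the exponents stay below 2. The square in
  the cutoff of the gradient bound is Caccioppoli's device: its gradient retains a factor of the
  cutoff, which lets the mixed term be absorbed.\<close>

lemma Ck_imp_continuous: "Ck k f \<Longrightarrow> continuous_on UNIV f"
  by (cases k) (auto intro!: differentiable_imp_continuous_on simp: differentiable_on_def
      intro: differentiable_at_withinI)

lemma Ck_SucD: "Ck (Suc k) f \<Longrightarrow> Ck k f"
proof (induction k arbitrary: f)
  case 0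
  then show ?case using Ck_imp_continuous by (metis Ck.simps(1))
next
  case (Suc k)
  then show ?case by (metis Ck.simps(2))
qed

lemma partial_deriv_eqI:
  assumes "(f has_derivative f') (at x)"
  shows "partial_deriv i f x = f' (axis i 1)"
  using frechet_derivative_at[OF assms] by (simp add: partial_deriv_def)

lemma has_derivative_partial_deriv:
  fixes f :: "real^'n::finite \<Rightarrow> 'b::real_normed_vector"
  assumes "f differentiable (at x)"
  shows "(f has_derivative (\<lambda>h. \<Sum>i\<in>UNIV. h $ i *\<^sub>R partial_deriv i f x)) (at x)"
proof -
  have d: "(f has_derivative frechet_derivative f (at x)) (at x)"
    using assms frechet_derivative_works by blast
  then have lin: "linear (frechet_derivative f (at x))"
    by (rule has_derivative_linear)
  have "frechet_derivative f (at x) h = (\<Sum>i\<in>UNIV. h $ i *\<^sub>R partial_deriv i f x)" for h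
  proof -
    have "h = (\<Sum>i\<in>UNIV. h $ i *\<^sub>R axis i 1)"
      using basis_expansion[of h] by (simp add: scalar_mult_eq_scaleR)
    then have "frechet_derivative f (at x) h = frechet_derivative f (at x) (\<Sum>i\<in>UNIV. h $ i *\<^sub>R axis i 1)"
      by simp
    also have "\<dots> = (\<Sum>i\<in>UNIV. h $ i *\<^sub>R frechet_derivative f (at x) (axis i 1))"
      by (simp add: linear_sum[OF lin] linear_cmul[OF lin])
    finally show ?thesis by (simp add: partial_deriv_def)
  qed
  then have "frechet_derivative f (at x) = (\<lambda>h. \<Sum>i\<in>UNIV. h $ i *\<^sub>R partial_deriv i f x)" by (rule ext)
  then show ?thesis using d by simp
qed

section \<open>Algebra of functions of class \<open>C\<^sup>k\<close>\<close>

lemma Ck_const [simp]: "Ck k (\<lambda>x::real^'n::finite. c)"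
proof (induction k arbitrary: c)
  case (Suc k)
  have "partial_deriv i (\<lambda>x::real^'n. c) = (\<lambda>x. 0)" for i
    by (rule ext) (simp add: partial_deriv_eqI[OF has_derivative_const])
  then show ?case using Suc by simp
qed simp

lemma Ck_add: "Ck k f \<Longrightarrow> Ck k g \<Longrightarrow> Ck k (\<lambda>x. f x + g x)"
proof (induction k arbitrary: f g)
  case 0
  then show ?case by (simp add: continuous_on_add)
next
  case (Suc k)
  have "partial_deriv i (\<lambda>x. f x + g x) = (\<lambda>x. partial_deriv i f x + partial_deriv i g x)" for i
  proof
    fix x
    have "(f has_derivative frechet_derivative f (at x)) (at x)"
         "(g has_derivative frechet_derivative g (at x)) (at x)"
      using Suc.prems by (simp_all flip: frechet_derivative_works)
    from partial_deriv_eqI[OF has_derivative_add[OF this]]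
    show "partial_deriv i (\<lambda>x. f x + g x) x = partial_deriv i f x + partial_deriv i g x"
      by (simp add: partial_deriv_def)
  qed
  then show ?case using Suc by (auto intro: differentiable_add)
qed

lemma partial_deriv_scaleR:
  fixes f :: "real^'n::finite \<Rightarrow> real"
  assumes "f differentiable (at x)" "g differentiable (at x)"
  shows "partial_deriv i (\<lambda>x. f x *\<^sub>R g x) x
       = f x *\<^sub>R partial_deriv i g x + partial_deriv i f x *\<^sub>R g x"
proof -
  have "(f has_derivative frechet_derivative f (at x)) (at x)"
       "(g has_derivative frechet_derivative g (at x)) (at x)"
    using assms frechet_derivative_works by auto
  from partial_deriv_eqI[OF has_derivative_scaleR[OF this]]
  show ?thesis by (simp add: partial_deriv_def)
qed

lemma Ck_scaleR:
  fixes f :: "real^'n::finite \<Rightarrow> real"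
  shows "Ck k f \<Longrightarrow> Ck k g \<Longrightarrow> Ck k (\<lambda>x. f x *\<^sub>R g x)"
proof (induction k arbitrary: f g)
  case 0
  then show ?case by (simp add: continuous_on_scaleR)
next
  case (Suc k)
  have "partial_deriv i (\<lambda>x. f x *\<^sub>R g x)
      = (\<lambda>x. f x *\<^sub>R partial_deriv i g x + partial_deriv i f x *\<^sub>R g x)" for i
    using Suc.prems by (auto intro!: partial_deriv_scaleR)
  moreover have "Ck k f" "Ck k g" using Suc.prems Ck_SucD by blast+
  ultimately show ?case using Suc by (auto intro!: differentiable_scaleR Ck_add)
qed

lemma Ck_mult:
  fixes f g :: "real^'n::finite \<Rightarrow> real"
  shows "Ck k f \<Longrightarrow> Ck k g \<Longrightarrow> Ck k (\<lambda>x. f x * g x)"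
  using Ck_scaleR[of k f g] by simp

lemma Ck_linear:
  fixes f :: "real^'n::finite \<Rightarrow> 'b::real_normed_vector"
  assumes "bounded_linear f"
  shows "Ck k f"
proof (cases k)
  case 0
  then show ?thesis using assms by (simp add: linear_continuous_on)
next
  case (Suc l)
  have d: "(f has_derivative f) (at x)" for x
    using assms bounded_linear_imp_has_derivative by blast
  have "partial_deriv i f = (\<lambda>x. f (axis i 1))" for i
    using partial_deriv_eqI[OF d] by auto
  then show ?thesis using Suc d by (auto simp: differentiable_def)
qed

lemma partial_deriv_affine:
  fixes f :: "real^'n::finite \<Rightarrow> 'b::real_normed_vector"
  assumes "f differentiable (at (a + c *\<^sub>R x))"
  shows "partial_deriv i (\<lambda>x. f (a + c *\<^sub>R x)) x = c *\<^sub>R partial_deriv i f (a + c *\<^sub>R x)"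
    and "(\<lambda>x. f (a + c *\<^sub>R x)) differentiable (at x)"
proof -
  have f: "(f has_derivative frechet_derivative f (at (a + c *\<^sub>R x))) (at (a + c *\<^sub>R x))"
    using assms frechet_derivative_works by auto
  have g: "((\<lambda>x. a + c *\<^sub>R x) has_derivative (\<lambda>h. c *\<^sub>R h)) (at x)"
    by (auto intro!: derivative_eq_intros)
  note d = has_derivative_compose[OF g f]
  have lin: "linear (frechet_derivative f (at (a + c *\<^sub>R x)))"
    using f by (rule has_derivative_linear)
  show "partial_deriv i (\<lambda>x. f (a + c *\<^sub>R x)) x = c *\<^sub>R partial_deriv i f (a + c *\<^sub>R x)"
    using partial_deriv_eqI[OF d, of i] by (simp add: partial_deriv_def linear_cmul[OF lin])
  show "(\<lambda>x. f (a + c *\<^sub>R x)) differentiable (at x)"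
    using d by (auto simp: differentiable_def)
qed

text \<open>The cases in use are the scaling of the bump and, with \<open>c = -1\<close>, the
  reflection \<open>y \<mapsto> x - y\<close> inside a convolution.\<close>

lemma Ck_affine:
  fixes f :: "real^'n::finite \<Rightarrow> 'b::real_normed_vector"
  shows "Ck k f \<Longrightarrow> Ck k (\<lambda>x. f (a + c *\<^sub>R x))"
proof (induction k arbitrary: f)
  case 0
  have "continuous_on UNIV (f \<circ> (\<lambda>x. a + c *\<^sub>R x))"
    by (rule continuous_on_compose) (use 0 in \<open>auto intro!: continuous_intros intro: continuous_on_subset\<close>)
  then show ?case by (simp add: o_def)
next
  case (Suc k)
  have "partial_deriv i (\<lambda>x. f (a + c *\<^sub>R x)) = (\<lambda>x. c *\<^sub>R partial_deriv i f (a + c *\<^sub>R x))" for i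
    using Suc.prems by (auto intro!: partial_deriv_affine)
  moreover have "Ck k (\<lambda>x. c *\<^sub>R partial_deriv i f (a + c *\<^sub>R x))" for i
    using Suc by (auto intro!: Ck_scaleR)
  ultimately show ?case using Suc.prems by (auto intro!: partial_deriv_affine)
qed

lemma partial_deriv_component:
  fixes f :: "real^'n::finite \<Rightarrow> real^'m::finite"
  assumes "f differentiable (at x)"
  shows "partial_deriv i (\<lambda>x. f x $ j) x = partial_deriv i f x $ j"
    and "(\<lambda>x. f x $ j) differentiable (at x)"
proof -
  have f: "(f has_derivative frechet_derivative f (at x)) (at x)"
    using assms frechet_derivative_works by auto
  note d = bounded_linear.has_derivative[OF bounded_linear_vec_nth f, of j]
  show "partial_deriv i (\<lambda>x. f x $ j) x = partial_deriv i f x $ j"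
    using partial_deriv_eqI[OF d, of i] by (simp add: partial_deriv_def)
  show "(\<lambda>x. f x $ j) differentiable (at x)"
    using d by (auto simp: differentiable_def)
qed

lemma Ck_component:
  fixes f :: "real^'n::finite \<Rightarrow> real^'m::finite"
  shows "Ck k f \<Longrightarrow> Ck k (\<lambda>x. f x $ j)"
proof (induction k arbitrary: f)
  case 0
  then show ?case by (auto intro!: continuous_intros)
next
  case (Suc k)
  have "partial_deriv i (\<lambda>x. f x $ j) = (\<lambda>x. partial_deriv i f x $ j)" for i
    using Suc.prems by (auto intro!: partial_deriv_component)
  then show ?case using Suc by (auto intro!: partial_deriv_component)
qed

subsection \<open>Test functions\<close>

lemma support_partial_deriv:
  "{x. partial_deriv i f x \<noteq> 0} \<subseteq> closure {x. f x \<noteq> 0}"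
proof (rule subsetI, rule ccontr)
  fix x assume x: "x \<in> {x. partial_deriv i f x \<noteq> 0}" and n: "x \<notin> closure {x. f x \<noteq> 0}"
  define S where "S = - closure {x. f x \<noteq> 0}"
  have "open S" "x \<in> S" using n by (auto simp: S_def)
  have z: "f y = 0" if "y \<in> S" for y
    using that closure_subset[of "{x. f x \<noteq> 0}"] by (auto simp: S_def)
  have "(f has_derivative (\<lambda>h. 0)) (at x)"
    by (rule has_derivative_transform_within_open[of "\<lambda>_. 0" _ _ UNIV S])
       (use \<open>open S\<close> \<open>x \<in> S\<close> z in auto)
  then show False using x partial_deriv_eqI[of f "\<lambda>h. 0" x i] by simp
qed

lemma test_functionD:
  assumes "test_function \<Omega> \<phi>"
  shows "Ck k \<phi>" "continuous_on UNIV \<phi>" "\<phi> differentiable (at x)" "compact (closure {x. \<phi> x \<noteq> 0})"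
    "closure {x. \<phi> x \<noteq> 0} \<subseteq> \<Omega>" "x \<notin> \<Omega> \<Longrightarrow> \<phi> x = 0"
proof -
  show "Ck k \<phi>" "compact (closure {x. \<phi> x \<noteq> 0})"
    using assms by (auto simp: test_function_def)
  show s: "closure {x. \<phi> x \<noteq> 0} \<subseteq> \<Omega>" using assms by (auto simp: test_function_def)
  then show "x \<notin> \<Omega> \<Longrightarrow> \<phi> x = 0" using closure_subset[of "{x. \<phi> x \<noteq> 0}"] by blast
  have "Ck 0 \<phi>" "Ck (Suc 0) \<phi>" using assms unfolding test_function_def by blast+
  then show "continuous_on UNIV \<phi>" "\<phi> differentiable (at x)" by simp_all
qed

text \<open>Any compact set in \<Omega> outside of which \<phi> vanishes will do, so exact supports
  never have to be computed.\<close>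

lemma test_functionI:
  assumes "\<And>k. Ck k \<phi>" "compact S" "S \<subseteq> \<Omega>" "\<And>x. x \<notin> S \<Longrightarrow> \<phi> x = 0"
  shows "test_function \<Omega> \<phi>"
proof -
  have "closure {x. \<phi> x \<noteq> 0} \<subseteq> S"
    by (rule closure_minimal) (use assms compact_imp_closed in auto)
  moreover from this have "compact (closure {x. \<phi> x \<noteq> 0})"
    using compact_Int_closed[OF assms(2) closed_closure, of "{x. \<phi> x \<noteq> 0}"] by (simp add: Int_absorb1)
  ultimately show ?thesis using assms(1,3) unfolding test_function_def by blast
qed

lemma test_function_mono: "test_function \<Omega> \<phi> \<Longrightarrow> \<Omega> \<subseteq> \<Omega>' \<Longrightarrow> test_function \<Omega>' \<phi>"
  by (auto simp: test_function_def)

lemma test_function_partial_deriv: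
  assumes "test_function \<Omega> \<phi>"
  shows "test_function \<Omega> (partial_deriv i \<phi>)"
proof (rule test_functionI[of _ "closure {x. \<phi> x \<noteq> 0}"])
  show "Ck k (partial_deriv i \<phi>)" for k
    using test_functionD(1)[OF assms, of "Suc k"] by simp
  show "partial_deriv i \<phi> x = 0" if "x \<notin> closure {x. \<phi> x \<noteq> 0}" for x
    using support_partial_deriv[of i \<phi>] that by auto
qed (use test_functionD[OF assms] in auto)

lemma test_function_scaleR:
  fixes \<phi> :: "real^'n::finite \<Rightarrow> real"
  assumes "test_function \<Omega> \<phi>" "\<And>k. Ck k \<psi>"
  shows "test_function \<Omega> (\<lambda>x. \<phi> x *\<^sub>R \<psi> x)"
proof (rule test_functionI[of _ "closure {x. \<phi> x \<noteq> 0}"])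
  show "\<phi> x *\<^sub>R \<psi> x = 0" if "x \<notin> closure {x. \<phi> x \<noteq> 0}" for x
    using that closure_subset[of "{x. \<phi> x \<noteq> 0}"] by auto
qed (use test_functionD[OF assms(1)] assms(2) in \<open>auto intro: Ck_scaleR\<close>)

lemma test_function_mult:
  fixes \<phi> :: "real^'n::finite \<Rightarrow> real"
  assumes "test_function \<Omega> \<phi>" "\<And>k. Ck k \<psi>"
  shows "test_function \<Omega> (\<lambda>x. \<phi> x * \<psi> x)"
  using test_function_scaleR[OF assms] by simp

lemma test_function_reflect:
  assumes "test_function \<Omega> \<phi>"
  shows "test_function UNIV (\<lambda>y. \<phi> (x - y))"
proof (rule test_functionI[of _ "(\<lambda>y. x - y) ` closure {x. \<phi> x \<noteq> 0}"])
  show "Ck k (\<lambda>y. \<phi> (x - y))" for k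
    using Ck_affine[OF test_functionD(1)[OF assms], of k x "-1"] by simp
  show "compact ((\<lambda>y. x - y) ` closure {x. \<phi> x \<noteq> 0})"
    using test_functionD(4)[OF assms] by (intro compact_continuous_image continuous_intros)
  show "\<phi> (x - y) = 0" if y: "y \<notin> (\<lambda>y. x - y) ` closure {x. \<phi> x \<noteq> 0}" for y
  proof (rule ccontr)
    assume "\<phi> (x - y) \<noteq> 0"
    then have "x - y \<in> closure {x. \<phi> x \<noteq> 0}" using closure_subset by fastforce
    then have "x - (x - y) \<in> (\<lambda>y. x - y) ` closure {x. \<phi> x \<noteq> 0}" by blast
    then show False using y by simp
  qed
qed simp

lemma test_function_bounded:
  assumes "test_function \<Omega> \<phi>"
  obtains C where "C > 0" "\<And>x. norm (\<phi> x) \<le> C"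
proof -
  have "compact (\<phi> ` closure {x. \<phi> x \<noteq> 0})"
    using test_functionD(2,4)[OF assms] by (blast intro: compact_continuous_image continuous_on_subset)
  then obtain C where C: "C > 0" "\<And>x. x \<in> closure {x. \<phi> x \<noteq> 0} \<Longrightarrow> norm (\<phi> x) \<le> C"
    using compact_imp_bounded bounded_pos by (metis imageI)
  have "norm (\<phi> x) \<le> C" for x
    using C closure_subset[of "{x. \<phi> x \<noteq> 0}"] by (cases "\<phi> x = 0") auto
  then show ?thesis using C(1) that by blast
qed

subsection \<open>A smooth bump\<close>

text \<open>The powers of \<open>1 / t\<close> in front of \<open>exp (- (1 / t))\<close> make the
  family closed under differentiation up to linear combinations, so that one induction, general in
  \<open>m\<close>, shows that the bump is smooth.\<close>

definition flat :: "nat \<Rightarrow> real \<Rightarrow> real" where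
  "flat m t = (if t > 0 then (1 / t) ^ m * exp (- (1 / t)) else 0)"

lemma exp_ge_power: "s \<ge> 0 \<Longrightarrow> s ^ k / fact k \<le> exp (s::real)"
proof -
  assume s: "s \<ge> 0"
  have "(\<Sum>n\<in>{k}. s ^ n /\<^sub>R fact n) \<le> (\<Sum>n. s ^ n /\<^sub>R fact n)"
  proof (rule sum_le_suminf)
    show "summable (\<lambda>n. s ^ n /\<^sub>R fact n)" by (rule summable_exp_generic)
    show "0 \<le> s ^ n /\<^sub>R fact n" for n using s by simp
  qed simp
  then show ?thesis by (simp add: exp_def divide_inverse mult.commute)
qed

text \<open>A single term of the exponential series, the one of order \<open>m + 2\<close>, beats
  the factor \<open>(1 / t) ^ m\<close> and leaves \<open>t\<^sup>2\<close>. One power of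
  \<open>t\<close> is spent on the difference quotient at 0, the other makes it tend to 0.\<close>

lemma flat_bound: "\<bar>flat m t\<bar> \<le> fact (m + 2) * t\<^sup>2"
proof (cases "t > 0")
  case True
  define s where "s = 1 / t"
  have s: "s > 0" using True by (simp add: s_def)
  have "s ^ (m + 2) / fact (m + 2) \<le> exp s"
    using s by (intro exp_ge_power) auto
  then have "s ^ (m + 2) \<le> fact (m + 2) * exp s"
    by (simp add: divide_le_eq mult.commute del: fact_Suc)
  then have "s ^ m * exp (- s) \<le> fact (m + 2) / s\<^sup>2"
    using s by (simp add: exp_minus power_add divide_simps del: fact_Suc add_2_eq_Suc')
  then show ?thesis using True s by (simp add: flat_def s_def power_divide mult.commute)
qed (simp add: flat_def)

lemma flat_has_derivative:
  "(flat m has_real_derivative (flat (m + 2) t - of_nat m * flat (m + 1) t)) (at t)"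
proof -
  consider "t > 0" | "t < 0" | "t = 0" by linarith
  then show ?thesis
  proof cases
    case 1
    have "((\<lambda>t. (1 / t) ^ m * exp (- (1 / t))) has_real_derivative
        (1 / t) ^ m * ((1 / t)\<^sup>2 * exp (- (1 / t))) + of_nat m * (- (1 / t)\<^sup>2) * (1 / t) ^ (m - 1) * exp (- (1 / t))) (at t)"
      using 1 by (auto intro!: derivative_eq_intros simp: power2_eq_square)
    moreover have "of_nat m * (- s\<^sup>2) * s ^ (m - 1) = - of_nat m * s ^ (m + 1)" for s :: real
      by (cases m) (auto simp: power2_eq_square algebra_simps)
    ultimately have "((\<lambda>t. (1 / t) ^ m * exp (- (1 / t))) has_real_derivative
        (flat (m + 2) t - of_nat m * flat (m + 1) t)) (at t)"
      using 1 by (simp only: flat_def power_add if_True) (simp add: mult_ac)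
    then show ?thesis
      by (rule DERIV_cong_ev[THEN iffD1, rotated -1, OF _ refl _ refl])
         (use 1 in \<open>auto simp: flat_def eventually_nhds intro!: exI[of _ "{0<..}"]\<close>)
  next
    case 2
    have "((\<lambda>t. 0) has_real_derivative (flat (m + 2) t - of_nat m * flat (m + 1) t)) (at t)"
      using 2 by (simp add: flat_def)
    then show ?thesis
      by (rule DERIV_cong_ev[THEN iffD1, rotated -1, OF _ refl _ refl])
         (use 2 in \<open>auto simp: flat_def eventually_nhds intro!: exI[of _ "{..<0}"]\<close>)
  next
    \<comment> \<open>The two one-sided formulas do not meet at 0; there the difference quotient is
      squeezed by \<open>flat_bound\<close>.\<close>
    case 3
    have "((\<lambda>h. flat m h / h) \<longlongrightarrow> 0) (at 0)"
    proof (rule Lim_null_comparison)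
      show "eventually (\<lambda>h. norm (flat m h / h) \<le> fact (m + 2) * \<bar>h\<bar>) (at 0)"
      proof (rule eventually_at_topological[THEN iffD2], intro exI[of _ UNIV] conjI ballI impI)
        fix h :: real assume "h \<noteq> 0"
        have "\<bar>flat m h\<bar> \<le> (fact (m + 2) * \<bar>h\<bar>) * \<bar>h\<bar>"
          using flat_bound[of m h] by (simp add: power2_eq_square abs_mult_self_eq mult.assoc)
        then show "norm (flat m h / h) \<le> fact (m + 2) * \<bar>h\<bar>"
          using \<open>h \<noteq> 0\<close> by (simp add: divide_le_eq)
      qed auto
      show "((\<lambda>h. fact (m + 2) * \<bar>h\<bar>) \<longlongrightarrow> 0) (at (0::real))"
        by (auto intro!: tendsto_eq_intros)
    qed
    then show ?thesis using 3 by (simp add: has_field_derivative_iff flat_def)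
  qed
qed

lemma Ck_flat: "Ck k (\<lambda>x::real^'n::finite. flat m (1 - (norm x)\<^sup>2))"
proof (induction k arbitrary: m)
  case 0
  have "continuous_on UNIV (flat m)"
    using flat_has_derivative by (meson DERIV_isCont continuous_at_imp_continuous_on)
  then have "continuous_on UNIV (flat m \<circ> (\<lambda>x::real^'n. 1 - (norm x)\<^sup>2))"
    by (intro continuous_on_compose) (auto intro!: continuous_intros intro: continuous_on_subset)
  then show ?case by (simp add: o_def)
next
  case (Suc k)
  have n: "((\<lambda>x::real^'n. 1 - (norm x)\<^sup>2) has_derivative (\<lambda>h. - 2 * (x \<bullet> h))) (at x)" for x
    unfolding power2_norm_eq_inner
    by (auto intro!: derivative_eq_intros simp: inner_commute)
  have d: "((\<lambda>x::real^'n. flat m (1 - (norm x)\<^sup>2)) has_derivative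
      (\<lambda>h. (flat (m + 2) (1 - (norm x)\<^sup>2) - of_nat m * flat (m + 1) (1 - (norm x)\<^sup>2)) * (- 2 * (x \<bullet> h)))) (at x)" for x
    using has_derivative_compose[OF n flat_has_derivative[unfolded has_field_derivative_def]]
    by simp
  have "partial_deriv i (\<lambda>x::real^'n. flat m (1 - (norm x)\<^sup>2)) =
      (\<lambda>x. (flat (m + 2) (1 - (norm x)\<^sup>2) + (- of_nat m) * flat (m + 1) (1 - (norm x)\<^sup>2)) * (- 2 * x $ i))" for i
    by (rule ext) (simp add: partial_deriv_eqI[OF d] cart_eq_inner_axis)
  moreover have "Ck k (\<lambda>x::real^'n. (flat (m + 2) (1 - (norm x)\<^sup>2) + (- of_nat m) * flat (m + 1) (1 - (norm x)\<^sup>2)) * (- 2 * x $ i))" for i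
    by (intro Ck_mult Ck_add Ck_const Suc Ck_linear bounded_linear_vec_nth)
  ultimately show ?case using d by (auto simp: differentiable_def)
qed

definition bump :: "real^'n::finite \<Rightarrow> real" where
  "bump x = flat 0 (1 - (norm x)\<^sup>2)"

lemma bump_nonneg: "bump x \<ge> 0" and bump_pos: "norm x < 1 \<Longrightarrow> bump x > 0"
  and bump_zero: "norm x \<ge> 1 \<Longrightarrow> bump x = 0"
proof -
  show "bump x \<ge> 0" by (simp add: bump_def flat_def)
  show "norm x < 1 \<Longrightarrow> bump x > 0"
    using power_less_one_iff[of "norm x" 2] by (simp add: bump_def flat_def)
  show "norm x \<ge> 1 \<Longrightarrow> bump x = 0"
    using one_le_power[of "norm x" 2] by (simp add: bump_def flat_def not_less del: one_le_power)
qed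

lemma test_function_bump: "test_function UNIV (bump :: real^'n::finite \<Rightarrow> real)"
proof (rule test_functionI[of _ "cball 0 1"])
  have "bump = (\<lambda>x::real^'n. flat 0 (1 - (norm x)\<^sup>2))" by (auto simp: bump_def)
  then show "Ck k (bump :: real^'n \<Rightarrow> real)" for k using Ck_flat[of k 0] by metis
  show "bump x = 0" if "x \<notin> cball 0 1" for x :: "real^'n" using that by (auto intro: bump_zero)
qed auto

section \<open>Squared \<open>L\<^sup>2\<close> seminorms and translations\<close>

text \<open>Taking values in \<open>ennreal\<close> lets estimates come before integrability, which
  is then finiteness. The square is kept because the triangle inequality is only used in the form
  \<open>2 * a + 2 * b\<close>, the source of most numerical factors below.\<close>

definition sqn :: "'a measure \<Rightarrow> ('a \<Rightarrow> 'b::euclidean_space) \<Rightarrow> ennreal" where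
  "sqn M f = (\<integral>\<^sup>+x. ennreal ((norm (f x))\<^sup>2) \<partial>M)"

lemma sqn_cong_AE: "(AE x in M. norm (f x) = norm (g x)) \<Longrightarrow> sqn M f = sqn M g"
  unfolding sqn_def by (intro nn_integral_cong_AE) auto

lemma sqn_mono_AE: "(AE x in M. norm (f x) \<le> norm (g x)) \<Longrightarrow> sqn M f \<le> sqn M g"
  unfolding sqn_def by (intro nn_integral_mono_AE) (auto elim!: eventually_mono intro!: ennreal_leI power_mono)

lemma norm_add_sq_le: "(norm (a + b :: 'b::real_inner))\<^sup>2 \<le> 2 * (norm a)\<^sup>2 + 2 * (norm b)\<^sup>2"
proof -
  have "(norm (a + b))\<^sup>2 + (norm (a - b))\<^sup>2 = 2 * (norm a)\<^sup>2 + 2 * (norm b)\<^sup>2"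
    by (simp add: power2_norm_eq_inner inner_simps inner_commute)
  then show ?thesis by (smt (verit) zero_le_power2)
qed

lemma two_mult_ennreal: "2 * ennreal x = ennreal (2 * x)"
  by (simp add: ennreal_mult')

lemma sqn_add_le:
  assumes [measurable]: "f \<in> borel_measurable M" "g \<in> borel_measurable M"
  shows "sqn M (\<lambda>x. f x + g x) \<le> 2 * sqn M f + 2 * sqn M g"
proof -
  have "sqn M (\<lambda>x. f x + g x) \<le> (\<integral>\<^sup>+x. 2 * ennreal ((norm (f x))\<^sup>2) + 2 * ennreal ((norm (g x))\<^sup>2) \<partial>M)"
    unfolding sqn_def
  proof (intro nn_integral_mono)
    fix x
    have "ennreal ((norm (f x + g x))\<^sup>2) \<le> ennreal (2 * (norm (f x))\<^sup>2 + 2 * (norm (g x))\<^sup>2)"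
      by (intro ennreal_leI norm_add_sq_le)
    then show "ennreal ((norm (f x + g x))\<^sup>2) \<le> 2 * ennreal ((norm (f x))\<^sup>2) + 2 * ennreal ((norm (g x))\<^sup>2)"
      by (simp add: ennreal_mult' ennreal_plus)
  qed
  also have "\<dots> = 2 * sqn M f + 2 * sqn M g"
    unfolding sqn_def by (simp add: nn_integral_add nn_integral_cmult)
  finally show ?thesis .
qed

lemma sqn_uminus: "sqn M (\<lambda>x. - f x) = sqn M f"
  by (simp add: sqn_def)

lemma sqn_minus_commute: "sqn M (\<lambda>x. f x - g x) = sqn M (\<lambda>x. g x - f x)"
  by (simp add: sqn_def norm_minus_commute)

lemma sqn_diff_le:
  assumes "f \<in> borel_measurable M" "g \<in> borel_measurable M"
  shows "sqn M (\<lambda>x. f x - g x) \<le> 2 * sqn M f + 2 * sqn M g"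
  using sqn_add_le[of f M "\<lambda>x. - g x"] assms by (simp add: sqn_uminus)

lemma distr_lborel_translation:
  "distr lborel borel (\<lambda>x. x - y) = (lborel :: 'a::euclidean_space measure)"
proof -
  have "(\<lambda>x. x - y) = (+) (- y)" by auto
  then show ?thesis using lborel_distr_plus[of "- y"] by simp
qed

lemma distr_lborel_reflection:
  "distr lborel borel (\<lambda>y. x - y) = (lborel :: 'a::euclidean_space measure)"
  by (subst (2) lborel_affine[of "-1" x]) (auto simp: density_1)

lemma sqn_translation:
  fixes f :: "'a::euclidean_space \<Rightarrow> 'b::euclidean_space"
  assumes [measurable]: "f \<in> borel_measurable borel"
  shows "sqn lborel (\<lambda>x. f (x - y)) = sqn lborel f"
proof -
  have "sqn lborel f = sqn (distr lborel borel (\<lambda>x. x - y)) f"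
    by (simp only: distr_lborel_translation)
  also have "\<dots> = sqn lborel (\<lambda>x. f (x - y))"
    unfolding sqn_def by (subst nn_integral_distr) auto
  finally show ?thesis by simp
qed

text \<open>Jensen's inequality for the square over a probability measure, from Cauchy-Schwarz
  against the constant 1. It serves averages against a mollifier and averages along a
  segment.\<close>

lemma norm_integral_sq_le:
  fixes F :: "'a \<Rightarrow> 'b::euclidean_space"
  assumes "emeasure M (space M) = 1" "integrable M F"
  shows "ennreal ((norm (\<integral>x. F x \<partial>M))\<^sup>2) \<le> (\<integral>\<^sup>+x. ennreal ((norm (F x))\<^sup>2) \<partial>M)"
proof -
  have [measurable]: "F \<in> borel_measurable M" using assms by simp
  have "ennreal (norm (\<integral>x. F x \<partial>M)) \<le> (\<integral>\<^sup>+x. ennreal (norm (F x)) \<partial>M)"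
    using assms by (intro integral_norm_bound_ennreal)
  then have "(ennreal (norm (\<integral>x. F x \<partial>M)))\<^sup>2 \<le> (\<integral>\<^sup>+x. ennreal (norm (F x)) * 1 \<partial>M)\<^sup>2"
    by (simp add: power_mono)
  also have "\<dots> \<le> (\<integral>\<^sup>+x. (ennreal (norm (F x)))\<^sup>2 \<partial>M) * (\<integral>\<^sup>+x. 1\<^sup>2 \<partial>M)"
    by (rule Cauchy_Schwarz_nn_integral) auto
  finally show ?thesis using assms by (simp add: ennreal_power)
qed

lemma sqn_tendsto_zero_dominated:
  fixes f :: "nat \<Rightarrow> 'a \<Rightarrow> 'b::euclidean_space"
  assumes [measurable]: "\<And>k. f k \<in> borel_measurable M" "w \<in> borel_measurable M"
    and "\<And>k. AE x in M. ennreal ((norm (f k x))\<^sup>2) \<le> w x" "(\<integral>\<^sup>+x. w x \<partial>M) < \<infinity>"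
    and lim: "AE x in M. (\<lambda>k. f k x) \<longlonglongrightarrow> 0"
  shows "(\<lambda>k. sqn M (f k)) \<longlonglongrightarrow> 0"
proof -
  have "(\<lambda>k. sqn M (f k)) \<longlonglongrightarrow> (\<integral>\<^sup>+x. 0 \<partial>M)"
    unfolding sqn_def
  proof (rule nn_integral_dominated_convergence[where w=w])
    show "AE x in M. (\<lambda>k. ennreal ((norm (f k x))\<^sup>2)) \<longlonglongrightarrow> 0"
      using lim
    proof eventually_elim
      case (elim x)
      then have "(\<lambda>k. (norm (f k x))\<^sup>2) \<longlonglongrightarrow> 0"
        by (auto intro!: tendsto_eq_intros tendsto_norm_zero)
      then show ?case by (rule tendsto_ennrealI[where x=0, simplified])
    qed
  qed (use assms in auto)
  then show ?thesis by simp
qed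

text \<open>Truncation in domain and range costs little by dominated convergence. The truncated
  function is an almost everywhere limit of continuous functions, and these are made to satisfy a
  common bound and to have a common support, so that dominated convergence applies a second
  time.\<close>

lemma continuous_compact_support_dense:
  fixes f :: "'a::euclidean_space \<Rightarrow> 'b::euclidean_space"
  assumes [measurable]: "f \<in> borel_measurable borel" and fin: "sqn lborel f < \<infinity>" and e: "e > 0"
  obtains g R where "continuous_on UNIV g" "\<And>x. norm x > R \<Longrightarrow> g x = 0"
    "sqn lborel (\<lambda>x. f x - g x) \<le> ennreal e"
proof -
  define t where "t k x = (if norm x \<le> real k \<and> norm (f x) \<le> real k then f x else 0)" for k x
  have [measurable]: "t k \<in> borel_measurable borel" for k
    unfolding t_def by measurable
  have e4: "ennreal (e / 4) > 0" using e by simp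
  have "(\<lambda>k. sqn lborel (\<lambda>x. f x - t k x)) \<longlonglongrightarrow> 0"
  proof (rule sqn_tendsto_zero_dominated[where w="\<lambda>x. ennreal ((norm (f x))\<^sup>2)"])
    show "AE x in lborel. (\<lambda>k. f x - t k x) \<longlonglongrightarrow> 0"
    proof (rule AE_I2)
      fix x
      obtain n where n: "max (norm x) (norm (f x)) \<le> real n" using real_arch_simple by blast
      have "\<forall>\<^sub>F k in sequentially. f x - t k x = 0"
        using eventually_ge_at_top[of n] by eventually_elim (use n in \<open>auto simp: t_def\<close>)
      then show "(\<lambda>k. f x - t k x) \<longlonglongrightarrow> 0" by (rule tendsto_eventually)
    qed
  qed (use fin in \<open>auto simp: t_def sqn_def\<close>)
  then have "\<forall>\<^sub>F k in sequentially. sqn lborel (\<lambda>x. f x - t k x) < ennreal (e / 4)"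
    using e4 order_tendstoD(2) by blast
  then obtain k where k: "sqn lborel (\<lambda>x. f x - t k x) < ennreal (e / 4)"
    using eventually_happens'[OF sequentially_bot] by blast
  have "t k \<in> borel_measurable lebesgue" by (intro measurable_completion) simp
  then have "t k measurable_on UNIV" by (simp add: lebesgue_measurable_imp_measurable_on)
  then obtain N g where N: "negligible N" and g: "\<And>n. continuous_on UNIV (g n)"
    and lim: "\<And>x. x \<notin> N \<Longrightarrow> (\<lambda>n. g n x) \<longlonglongrightarrow> t k x"
    unfolding measurable_on_def by force
  \<comment> \<open>Projecting the values to the ball of radius \<open>k\<close> and cutting off in
    space do not change the limit \<open>t k\<close>, which already has values in this ball and
    vanishes for \<open>norm x > k\<close>.\<close>
  define c where "c = closest_point (cball 0 (real k) :: 'b set)"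
  define \<eta> where "\<eta> x = max 0 (min 1 (real k + 1 - norm x))" for x :: 'a
  define h where "h n x = \<eta> x *\<^sub>R c (g n x)" for n x
  have cc: "continuous_on UNIV c"
    unfolding c_def by (rule continuous_on_closest_point) auto
  have cn: "norm (c y) \<le> real k" for y
    using closest_point_in_set[of "cball 0 (real k)" y] by (simp add: c_def)
  have ch: "continuous_on UNIV (h n)" for n
    unfolding h_def \<eta>_def
    by (intro continuous_intros continuous_on_compose2[OF cc g]) auto
  have [measurable]: "cball (0::'a) (real k + 1) \<in> sets borel" by simp
  have [measurable]: "h n \<in> borel_measurable borel" for n
    using ch by (rule borel_measurable_continuous_onI)
  have \<eta>: "0 \<le> \<eta> x" "\<eta> x \<le> 1" "norm x > real k + 1 \<Longrightarrow> \<eta> x = 0" "norm x \<le> real k \<Longrightarrow> \<eta> x = 1" for x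
    by (auto simp: \<eta>_def)
  have hb: "norm (h n x) \<le> real k" for n x
    using mult_mono[OF \<eta>(2)[of x] cn[of "g n x"]] \<eta>(1)[of x] by (simp add: h_def)
  have hz: "norm x > real k + 1 \<Longrightarrow> h n x = 0" for n x using \<eta>(3) by (simp add: h_def)
  have "(\<lambda>n. sqn lborel (\<lambda>x. t k x - h n x)) \<longlonglongrightarrow> 0"
  proof (rule sqn_tendsto_zero_dominated[where w="\<lambda>x. ennreal ((2 * real k)\<^sup>2) * indicator (cball 0 (real k + 1)) x"])
    have "AE x in lebesgue. x \<notin> N" using N by (simp add: AE_not_in negligible_iff_null_sets)
    then have "AE x in lborel. x \<notin> N" by (simp add: AE_completion_iff)
    then show "AE x in lborel. (\<lambda>n. t k x - h n x) \<longlonglongrightarrow> 0"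
    proof eventually_elim
      case (elim x)
      have "(\<lambda>n. h n x) \<longlonglongrightarrow> \<eta> x *\<^sub>R c (t k x)"
        unfolding h_def using lim[OF elim] cc
        by (intro tendsto_intros continuous_on_tendsto_compose[OF cc]) auto
      moreover have "\<eta> x *\<^sub>R c (t k x) = t k x"
      proof (cases "norm x \<le> real k")
        case True
        then show ?thesis using \<eta>(4) by (auto simp: t_def c_def intro!: closest_point_self)
      next
        case False
        then show ?thesis by (simp add: t_def c_def closest_point_self)
      qed
      ultimately have "(\<lambda>n. t k x - h n x) \<longlonglongrightarrow> t k x - t k x" by (intro tendsto_intros) simp
      then show ?case by simp
    qed
    show "AE x in lborel. ennreal ((norm (t k x - h n x))\<^sup>2) \<le> ennreal ((2 * real k)\<^sup>2) * indicator (cball 0 (real k + 1)) x" for n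
    proof (rule AE_I2)
      fix x
      show "ennreal ((norm (t k x - h n x))\<^sup>2) \<le> ennreal ((2 * real k)\<^sup>2) * indicator (cball 0 (real k + 1)) x"
      proof (cases "norm x \<le> real k + 1")
        case True
        have "norm (t k x - h n x) \<le> 2 * real k"
          using norm_triangle_ineq4[of "t k x" "h n x"] hb[of n x] by (auto simp: t_def split: if_splits)
        then have "(norm (t k x - h n x))\<^sup>2 \<le> (2 * real k)\<^sup>2" by (intro power_mono) auto
        then show ?thesis using True by (simp add: ennreal_leI)
      qed (use hz in \<open>auto simp: t_def\<close>)
    qed
    have "emeasure lborel (cball (0::'a) (real k + 1)) < \<infinity>"
      by (rule emeasure_bounded_finite) auto
    then show "(\<integral>\<^sup>+x. ennreal ((2 * real k)\<^sup>2) * indicator (cball (0::'a) (real k + 1)) x \<partial>lborel) < \<infinity>"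
      by (simp add: nn_integral_cmult_indicator ennreal_mult_less_top)
  qed measurable
  then have "\<forall>\<^sub>F n in sequentially. sqn lborel (\<lambda>x. t k x - h n x) < ennreal (e / 4)"
    using e4 order_tendstoD(2) by blast
  then obtain n where n: "sqn lborel (\<lambda>x. t k x - h n x) < ennreal (e / 4)"
    using eventually_happens'[OF sequentially_bot] by blast
  have "sqn lborel (\<lambda>x. f x - h n x) = sqn lborel (\<lambda>x. (f x - t k x) + (t k x - h n x))" by simp
  also have "\<dots> \<le> 2 * sqn lborel (\<lambda>x. f x - t k x) + 2 * sqn lborel (\<lambda>x. t k x - h n x)"
    by (rule sqn_add_le) auto
  also have "\<dots> \<le> 2 * ennreal (e / 4) + 2 * ennreal (e / 4)"
    using k n by (intro add_mono mult_left_mono) auto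
  also have "\<dots> = ennreal (2 * (e / 4) + 2 * (e / 4))"
    using e by (simp add: two_mult_ennreal flip: ennreal_plus)
  also have "\<dots> = ennreal e" by simp
  finally show ?thesis using that[OF ch[of n] hz[of _ n]] by auto
qed

text \<open>For a continuous \<open>g\<close> of compact support this is uniform continuity on a set
  of finite measure. Density carries it over to \<open>f\<close>, since translating
  \<open>f - g\<close> does not change its seminorm.\<close>

lemma sqn_translation_continuous:
  fixes f :: "'a::euclidean_space \<Rightarrow> 'b::euclidean_space"
  assumes [measurable]: "f \<in> borel_measurable borel" and fin: "sqn lborel f < \<infinity>" and e: "e > 0"
  obtains d where "d > 0" "\<And>y. norm y \<le> d \<Longrightarrow> sqn lborel (\<lambda>x. f (x - y) - f x) \<le> ennreal e"
proof -
  \<comment> \<open>The two copies of \<open>f - g\<close>, translated and not, are each multiplied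
    by 4 in the splitting below, so \<open>e / 16\<close> makes them cost \<open>e / 2\<close>
    together.\<close>
  obtain g R where g: "continuous_on UNIV g" and R: "\<And>x. norm x > R \<Longrightarrow> g x = 0"
    and s: "sqn lborel (\<lambda>x. f x - g x) \<le> ennreal (e / 16)"
    using continuous_compact_support_dense[of f "e / 16"] fin e by auto
  have [measurable]: "g \<in> borel_measurable borel" using g by (rule borel_measurable_continuous_onI)
  \<comment> \<open>Shifts have length at most 1, so \<open>g (x - y) - g x\<close> vanishes outside
    the ball of radius \<open>R + 1\<close>.\<close>
  define B where "B = cball (0::'a) (R + 1)"
  define V where "V = measure lborel B"
  have V: "emeasure lborel B = ennreal V"
    using emeasure_bounded_finite[of "cball (0::'a) (R + 1)"] unfolding V_def B_def
    by (intro emeasure_eq_ennreal_measure) auto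
  have V0: "V \<ge> 0" by (simp add: V_def)
  define \<epsilon> where "\<epsilon> = sqrt (e / (4 * (V + 1)))"
  have \<epsilon>: "\<epsilon> > 0" "\<epsilon>\<^sup>2 * V \<le> e / 4"
  proof -
    show "\<epsilon> > 0" using e V0 by (simp add: \<epsilon>_def)
    have "\<epsilon>\<^sup>2 = e / (4 * (V + 1))" using e V0 by (simp add: \<epsilon>_def)
    then have "\<epsilon>\<^sup>2 * V + \<epsilon>\<^sup>2 = e / 4" using e V0 by (simp add: field_simps)
    then show "\<epsilon>\<^sup>2 * V \<le> e / 4" by (smt (verit) zero_le_power2)
  qed
  have "uniformly_continuous_on (cball 0 (R + 2)) g"
    by (rule compact_uniformly_continuous) (use g continuous_on_subset in auto)
  then obtain d where d: "d > 0" and ud: "\<And>x x'. x \<in> cball 0 (R + 2) \<Longrightarrow> x' \<in> cball 0 (R + 2) \<Longrightarrow> dist x' x < d \<Longrightarrow> dist (g x') (g x) < \<epsilon>"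
    unfolding uniformly_continuous_on_def using \<epsilon>(1) by metis
  define d' where "d' = min (d / 2) 1"
  have d': "d' > 0" "d' \<le> 1" "d' < d" using d by (auto simp: d'_def)
  show ?thesis
  proof (rule that[OF d'(1)])
    fix y :: 'a assume y: "norm y \<le> d'"
    have "sqn lborel (\<lambda>x. g (x - y) - g x) \<le> (\<integral>\<^sup>+x. ennreal (\<epsilon>\<^sup>2) * indicator B x \<partial>lborel)"
      unfolding sqn_def
    proof (rule nn_integral_mono)
      fix x
      show "ennreal ((norm (g (x - y) - g x))\<^sup>2) \<le> ennreal (\<epsilon>\<^sup>2) * indicator B x"
      proof (cases "x \<in> B")
        case True
        have "norm (x - y) \<le> R + 2" using True y d' norm_triangle_ineq4[of x y] by (simp add: B_def)
        moreover have "norm x \<le> R + 2" using True by (simp add: B_def)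
        ultimately have "dist (g (x - y)) (g x) < \<epsilon>" using y d' by (intro ud) (auto simp: dist_norm mem_cball_0 simp del: mem_cball)
        then have "(norm (g (x - y) - g x))\<^sup>2 \<le> \<epsilon>\<^sup>2" by (intro power_mono) (auto simp: dist_norm)
        then show ?thesis using True by (simp add: ennreal_leI)
      next
        case False
        then have "norm x > R + 1" by (simp add: B_def)
        moreover have "norm (x - y) > R" using calculation y d' norm_triangle_ineq2[of x y] by linarith
        ultimately show ?thesis using R[of x] R[of "x - y"] False by simp
      qed
    qed
    also have "\<dots> = ennreal (\<epsilon>\<^sup>2 * V)"
      using V V0 by (subst nn_integral_cmult_indicator) (auto simp: B_def ennreal_mult)
    also have "\<dots> \<le> ennreal (e / 4)" using \<epsilon> by (intro ennreal_leI)
    finally have 1: "sqn lborel (\<lambda>x. g (x - y) - g x) \<le> ennreal (e / 4)" .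
    have "sqn lborel (\<lambda>x. f (x - y) - f x)
        = sqn lborel (\<lambda>x. ((f (x - y) - g (x - y)) - (f x - g x)) + (g (x - y) - g x))" by (simp add: algebra_simps)
    also have "\<dots> \<le> 2 * sqn lborel (\<lambda>x. (f (x - y) - g (x - y)) - (f x - g x)) + 2 * sqn lborel (\<lambda>x. g (x - y) - g x)"
      by (rule sqn_add_le) auto
    also have "\<dots> \<le> 2 * (2 * sqn lborel (\<lambda>x. (f (x - y) - g (x - y))) + 2 * sqn lborel (\<lambda>x. f x - g x)) + 2 * sqn lborel (\<lambda>x. g (x - y) - g x)"
      by (intro add_mono mult_left_mono sqn_diff_le) auto
    also have "sqn lborel (\<lambda>x. (f (x - y) - g (x - y))) = sqn lborel (\<lambda>x. f x - g x)"
      by (rule sqn_translation[of "\<lambda>x. f x - g x"]) auto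
    also have "2 * (2 * sqn lborel (\<lambda>x. f x - g x) + 2 * sqn lborel (\<lambda>x. f x - g x)) + 2 * sqn lborel (\<lambda>x. g (x - y) - g x)
      \<le> 2 * (2 * ennreal (e / 16) + 2 * ennreal (e / 16)) + 2 * ennreal (e / 4)"
      using s 1 by (intro add_mono mult_left_mono) auto
    also have "\<dots> = ennreal (2 * (2 * (e / 16) + 2 * (e / 16)) + 2 * (e / 4))"
      using e by (simp add: two_mult_ennreal flip: ennreal_plus)
    also have "\<dots> = ennreal e" by simp
    finally show "sqn lborel (\<lambda>x. f (x - y) - f x) \<le> ennreal e" .
  qed
qed

section \<open>Mollification\<close>

text \<open>The integral is over \<open>lebesgue\<close> because Sobolev maps are only Lebesgue
  measurable; where Fubini or a substitution is needed, a Borel representative and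
  \<open>lborel\<close> take over.\<close>

definition mollify :: "('a::euclidean_space \<Rightarrow> real) \<Rightarrow> ('a \<Rightarrow> 'b::euclidean_space) \<Rightarrow> 'a \<Rightarrow> 'b" where
  "mollify \<rho> f x = (\<integral>y. \<rho> (x - y) *\<^sub>R f y \<partial>lebesgue)"

text \<open>The mollification error at \<open>x\<close> is the average of
  \<open>f (x - y) - f x\<close> against the probability density \<open>\<rho> y\<close>; Jensen and
  Fubini bound its seminorm by that of the worst translation. The bound \<open>B\<close> is left
  open: it is an arbitrary \<open>e\<close> for a fixed \<open>L\<^sup>2\<close> map, and of order
  \<open>\<epsilon>\<^sup>2\<close> for a map with gradient in \<open>L\<^sup>2\<close>.\<close>

lemma sqn_mollify_diff_le:
  fixes f :: "'a::euclidean_space \<Rightarrow> 'b::euclidean_space" and \<rho> :: "'a \<Rightarrow> real"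
  assumes f: "integrable lborel f" and [measurable]: "\<rho> \<in> borel_measurable borel"
    and \<rho>: "\<And>y. 0 \<le> \<rho> y" "\<And>y. \<rho> y \<le> C" "(\<integral>\<^sup>+y. ennreal (\<rho> y) \<partial>lborel) = 1" "\<And>y. norm y > \<epsilon> \<Longrightarrow> \<rho> y = 0"
    and B: "\<And>y. norm y \<le> \<epsilon> \<Longrightarrow> sqn lborel (\<lambda>x. f (x - y) - f x) \<le> B"
  shows "sqn lborel (\<lambda>x. mollify \<rho> f x - f x) \<le> B"
proof -
  have [measurable]: "f \<in> borel_measurable borel" using f by auto
  define M where "M = density lborel (\<lambda>y. ennreal (\<rho> y))"
  have [measurable_cong]: "sets M = sets borel" by (simp add: M_def)
  have sp: "emeasure M (space M) = 1"
    using \<rho>(3) by (simp add: M_def emeasure_density)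
  interpret M: finite_measure M by (rule finite_measureI) (simp add: sp)
  have sp': "measure M (space M) = 1" using sp by (simp add: measure_def)
  interpret P: pair_sigma_finite M lborel ..
  have int: "integrable M (\<lambda>y. f (x - y))" for x
  proof -
    have "integrable (distr lborel borel (\<lambda>y. x - y)) f"
      using f by (simp only: distr_lborel_reflection)
    then have "integrable lborel (\<lambda>y. f (x - y))" by (subst (asm) integrable_distr_eq) auto
    then have "integrable lborel (\<lambda>y. C *\<^sub>R f (x - y))" by (rule integrable_scaleR_right)
    then have "integrable lborel (\<lambda>y. \<rho> y *\<^sub>R f (x - y))"
    proof (rule Bochner_Integration.integrable_bound)
      show "AE y in lborel. norm (\<rho> y *\<^sub>R f (x - y)) \<le> norm (C *\<^sub>R f (x - y))"
      proof (rule AE_I2)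
        fix y
        have "\<bar>\<rho> y\<bar> \<le> \<bar>C\<bar>" using \<rho>(1,2)[of y] by linarith
        then show "norm (\<rho> y *\<^sub>R f (x - y)) \<le> norm (C *\<^sub>R f (x - y))"
          by (simp add: mult_right_mono)
      qed
    qed measurable
    then show ?thesis unfolding M_def using \<rho>(1) by (subst integrable_density) auto
  qed
  have moll: "mollify \<rho> f x - f x = (\<integral>y. f (x - y) - f x \<partial>M)" for x
  proof -
    have "mollify \<rho> f x = (\<integral>y. \<rho> (x - y) *\<^sub>R f y \<partial>lborel)"
      unfolding mollify_def by (rule integral_completion) measurable
    also have "\<dots> = (\<integral>y. \<rho> (x - y) *\<^sub>R f y \<partial>distr lborel borel (\<lambda>y. x - y))"
      by (simp only: distr_lborel_reflection)
    also have "\<dots> = (\<integral>y. \<rho> y *\<^sub>R f (x - y) \<partial>lborel)"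
      by (subst integral_distr) auto
    also have "\<dots> = (\<integral>y. f (x - y) \<partial>M)"
      unfolding M_def using \<rho>(1) by (subst integral_density) auto
    finally show ?thesis using int sp' by (simp add: Bochner_Integration.integral_diff)
  qed
  have "sqn lborel (\<lambda>x. mollify \<rho> f x - f x) \<le> (\<integral>\<^sup>+x. (\<integral>\<^sup>+y. ennreal ((norm (f (x - y) - f x))\<^sup>2) \<partial>M) \<partial>lborel)"
    unfolding sqn_def moll using int by (intro nn_integral_mono norm_integral_sq_le sp) auto
  also have "\<dots> = (\<integral>\<^sup>+y. (\<integral>\<^sup>+x. ennreal ((norm (f (x - y) - f x))\<^sup>2) \<partial>lborel) \<partial>M)"
    by (rule P.Fubini') measurable
  also have "\<dots> \<le> (\<integral>\<^sup>+y. B \<partial>M)"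
  proof (rule nn_integral_mono_AE)
    show "AE y in M. (\<integral>\<^sup>+x. ennreal ((norm (f (x - y) - f x))\<^sup>2) \<partial>lborel) \<le> B"
      unfolding M_def
    proof (subst AE_density, simp, rule AE_I2, rule impI)
      fix y assume "0 < ennreal (\<rho> y)"
      then have "norm y \<le> \<epsilon>" using \<rho>(4)[of y] by force
      then show "(\<integral>\<^sup>+x. ennreal ((norm (f (x - y) - f x))\<^sup>2) \<partial>lborel) \<le> B"
        using B[of y] by (simp add: sqn_def)
    qed
  qed
  also have "\<dots> = B" using sp by simp
  finally show ?thesis .
qed

lemma continuous_compact_support_uniform:
  fixes f :: "'a::euclidean_space \<Rightarrow> 'b::real_normed_vector"
  assumes f: "continuous_on UNIV f" and S: "compact S" "\<And>x. x \<notin> S \<Longrightarrow> f x = 0" and e: "e > 0"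
  obtains d where "d > 0" "\<And>x y. norm (x - y) < d \<Longrightarrow> norm (f x - f y) < e"
proof -
  obtain R where R: "\<And>x. x \<in> S \<Longrightarrow> norm x \<le> R"
    using S(1) compact_imp_bounded bounded_iff by metis
  have "uniformly_continuous_on (cball 0 (R + 1)) f"
    by (rule compact_uniformly_continuous) (use f continuous_on_subset in auto)
  then obtain d where d: "d > 0" and ud: "\<And>x x'. x \<in> cball 0 (R + 1) \<Longrightarrow> x' \<in> cball 0 (R + 1) \<Longrightarrow> dist x' x < d \<Longrightarrow> dist (f x') (f x) < e"
    unfolding uniformly_continuous_on_def using e by metis
  have "norm (f x - f y) < e" if xy: "norm (x - y) < min d 1" for x y
  proof (cases "x \<in> S \<or> y \<in> S")
    case True
    then have "norm x \<le> R + 1 \<and> norm y \<le> R + 1"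
      using R[of x] R[of y] xy norm_triangle_ineq2[of x y] norm_triangle_ineq2[of y x]
      by (auto simp: norm_minus_commute)
    then show ?thesis using ud[of y x] xy by (simp add: dist_norm norm_minus_commute)
  next
    case False
    then show ?thesis using S(2) e by simp
  qed
  then show ?thesis using that[of "min d 1"] d by auto
qed

text \<open>The partial derivatives are uniformly continuous, so the linearization error is uniform
  in the base point. This matters because inside a convolution the base point \<open>x - y\<close>
  runs through the whole space.\<close>

lemma test_function_linearization:
  fixes \<rho> :: "real^'n::finite \<Rightarrow> real"
  assumes \<rho>: "test_function UNIV \<rho>" and e: "e > 0"
  obtains d where "d > 0"
    "\<And>z h. norm h < d \<Longrightarrow> norm (\<rho> (z + h) - \<rho> z - (\<Sum>i\<in>UNIV. h $ i * partial_deriv i \<rho> z)) \<le> e * norm h"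
proof -
  define N where "N = real CARD('n)"
  have N: "N > 0" by (simp add: N_def)
  have "\<exists>d>0. \<forall>x y. norm (x - y) < d \<longrightarrow> norm (partial_deriv i \<rho> x - partial_deriv i \<rho> y) < e / N" for i
  proof -
    have t: "test_function UNIV (partial_deriv i \<rho>)" using test_function_partial_deriv[OF \<rho>] .
    show ?thesis
      by (rule continuous_compact_support_uniform[OF test_functionD(2)[OF t] test_functionD(4)[OF t], of "e / N"])
         (use e N closure_subset[of "{x. partial_deriv i \<rho> x \<noteq> 0}"] in \<open>auto\<close>)
  qed
  then obtain d where d: "\<And>i. d i > 0"
    and ud: "\<And>i x y. norm (x - y) < d i \<Longrightarrow> norm (partial_deriv i \<rho> x - partial_deriv i \<rho> y) < e / N"
    by metis
  define d' where "d' = Min (range d)"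
  have d': "d' > 0" "\<And>i. d' \<le> d i" using d by (auto simp: d'_def)
  show ?thesis
  proof (rule that[OF d'(1)])
    fix z h :: "real^'n" assume h: "norm h < d'"
    have "norm (\<rho> (z + h) - \<rho> z - (\<Sum>i\<in>UNIV. (z + h - z) $ i *\<^sub>R partial_deriv i \<rho> z)) \<le> norm (z + h - z) * e"
    proof (rule differentiable_bound_linearization[where S="ball z d'" and f=\<rho> and f'="\<lambda>x h. \<Sum>i\<in>UNIV. h $ i *\<^sub>R partial_deriv i \<rho> x"])
      show "z + t *\<^sub>R (z + h - z) \<in> ball z d'" if "t \<in> {0..1}" for t
      proof -
        have "norm (t *\<^sub>R h) \<le> 1 * norm h" using that mult_right_mono[of t 1 "norm h"] by simp
        then show ?thesis using h by (simp add: dist_norm)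
      qed
      show "(\<rho> has_derivative (\<lambda>h. \<Sum>i\<in>UNIV. h $ i *\<^sub>R partial_deriv i \<rho> x)) (at x within ball z d')" for x
        using has_derivative_partial_deriv[OF test_functionD(3)[OF \<rho>]] has_derivative_at_withinI by blast
      show "z \<in> ball z d'" using d' by simp
      fix x assume x: "x \<in> ball z d'"
      show "onorm ((\<lambda>h. \<Sum>i\<in>UNIV. h $ i *\<^sub>R partial_deriv i \<rho> x) - (\<lambda>h. \<Sum>i\<in>UNIV. h $ i *\<^sub>R partial_deriv i \<rho> z)) \<le> e"
        unfolding fun_diff_def
      proof (rule onorm_le)
        fix h :: "real^'n"
        have "norm ((\<Sum>i\<in>UNIV. h $ i *\<^sub>R partial_deriv i \<rho> x) - (\<Sum>i\<in>UNIV. h $ i *\<^sub>R partial_deriv i \<rho> z))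
            = norm (\<Sum>i\<in>UNIV. h $ i * (partial_deriv i \<rho> x - partial_deriv i \<rho> z))"
          by (simp add: sum_subtractf right_diff_distrib)
        also have "\<dots> \<le> (\<Sum>i\<in>(UNIV::'n set). norm h * (e / N))"
        proof (rule sum_norm_le)
          fix i
          have "norm (x - z) < d i" using x d'(2)[of i] by (auto simp: dist_norm norm_minus_commute)
          then have "norm (partial_deriv i \<rho> x - partial_deriv i \<rho> z) \<le> e / N" using ud by (simp add: less_imp_le)
          then show "norm (h $ i * (partial_deriv i \<rho> x - partial_deriv i \<rho> z)) \<le> norm h * (e / N)"
            unfolding norm_mult using component_le_norm_cart[of h i] by (intro mult_mono) auto
        qed
        also have "\<dots> = e * norm h" using N by (simp add: N_def)
        finally show "norm ((\<Sum>i\<in>UNIV. h $ i *\<^sub>R partial_deriv i \<rho> x) - (\<Sum>i\<in>UNIV. h $ i *\<^sub>R partial_deriv i \<rho> z)) \<le> e * norm h" .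
      qed
    qed
    then show "norm (\<rho> (z + h) - \<rho> z - (\<Sum>i\<in>UNIV. h $ i * partial_deriv i \<rho> z)) \<le> e * norm h"
      by (simp add: mult.commute)
  qed
qed

lemma integrable_bounded_continuous_scaleR:
  fixes f :: "'a::euclidean_space \<Rightarrow> 'b::euclidean_space" and \<phi> :: "'a \<Rightarrow> real"
  assumes f: "integrable lebesgue f" and \<phi>: "continuous_on UNIV \<phi>" "\<And>x. norm (\<phi> x) \<le> C"
  shows "integrable lebesgue (\<lambda>y. \<phi> y *\<^sub>R f y)"
proof (rule Bochner_Integration.integrable_bound)
  show "integrable lebesgue (\<lambda>y. C *\<^sub>R f y)" using f by (rule integrable_scaleR_right)
  have "\<phi> \<in> borel_measurable lebesgue"
    using \<phi>(1) by (intro measurable_completion) (simp add: borel_measurable_continuous_onI)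
  then show "(\<lambda>y. \<phi> y *\<^sub>R f y) \<in> borel_measurable lebesgue" using f by (intro borel_measurable_scaleR) auto
  show "AE y in lebesgue. norm (\<phi> y *\<^sub>R f y) \<le> norm (C *\<^sub>R f y)"
  proof (rule AE_I2)
    fix y
    have "\<bar>\<phi> y\<bar> \<le> \<bar>C\<bar>" using \<phi>(2)[of y] by simp
    then show "norm (\<phi> y *\<^sub>R f y) \<le> norm (C *\<^sub>R f y)" by (simp add: mult_right_mono)
  qed
qed

lemma integrable_test_scaleR:
  fixes f :: "real^'n::finite \<Rightarrow> 'b::euclidean_space"
  assumes f: "integrable lebesgue f" and \<phi>: "test_function UNIV (\<phi> :: real^'n \<Rightarrow> real)"
  shows "integrable lebesgue (\<lambda>y. \<phi> y *\<^sub>R f y)" "integrable lebesgue (\<lambda>y. \<phi> (x - y) *\<^sub>R f y)"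
proof -
  have "integrable lebesgue (\<lambda>y. \<phi> y *\<^sub>R f y)" if "test_function UNIV \<phi>" for \<phi> :: "real^'n \<Rightarrow> real"
    by (rule test_function_bounded[OF that])
       (rule integrable_bounded_continuous_scaleR[OF f test_functionD(2)[OF that]])
  from this[OF \<phi>] this[OF test_function_reflect[OF \<phi>]]
  show "integrable lebesgue (\<lambda>y. \<phi> y *\<^sub>R f y)" "integrable lebesgue (\<lambda>y. \<phi> (x - y) *\<^sub>R f y)" .
qed

text \<open>The uniform linearization of \<rho> bounds the remainder under the integral by a small
  multiple of \<open>norm h * norm (f z)\<close>, and \<open>f\<close> is integrable; no limit has
  to be exchanged with the integral.\<close>

lemma mollify_has_derivative:
  fixes f :: "real^'n::finite \<Rightarrow> 'b::euclidean_space"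
  assumes f: "integrable lebesgue f" and \<rho>: "test_function UNIV (\<rho> :: real^'n \<Rightarrow> real)"
  shows "(mollify \<rho> f has_derivative (\<lambda>h. \<Sum>i\<in>UNIV. h $ i *\<^sub>R mollify (partial_deriv i \<rho>) f x)) (at x)"
  unfolding has_derivative_at_alt
proof (intro conjI allI impI)
  show "bounded_linear (\<lambda>h. \<Sum>i\<in>UNIV. h $ i *\<^sub>R mollify (partial_deriv i \<rho>) f x)"
    by (intro bounded_linear_sum bounded_linear_scaleR_const bounded_linear_vec_nth)
next
  fix e :: real assume e: "e > 0"
  define I where "I = (\<integral>y. norm (f y) \<partial>lebesgue)"
  have I: "I \<ge> 0" by (simp add: I_def)
  define e' where "e' = e / (I + 1)"
  have e': "e' > 0" "e' * I \<le> e" using e I by (auto simp: e'_def divide_simps)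
  obtain d where d: "d > 0" and lin: "\<And>z h. norm h < d \<Longrightarrow>
      norm (\<rho> (z + h) - \<rho> z - (\<Sum>i\<in>UNIV. h $ i * partial_deriv i \<rho> z)) \<le> e' * norm h"
    using test_function_linearization[OF \<rho> e'(1)] by blast
  show "\<exists>d>0. \<forall>y. norm (y - x) < d \<longrightarrow>
      norm (mollify \<rho> f y - mollify \<rho> f x - (\<Sum>i\<in>UNIV. (y - x) $ i *\<^sub>R mollify (partial_deriv i \<rho>) f x)) \<le> e * norm (y - x)"
  proof (intro exI[of _ d] conjI d allI impI)
    fix y assume y: "norm (y - x) < d"
    define h where "h = y - x"
    note int = integrable_test_scaleR(2)[OF f]
    note tp = test_function_partial_deriv[OF \<rho>]
    have s: "(\<Sum>i\<in>UNIV. h $ i *\<^sub>R mollify (partial_deriv i \<rho>) f x) = (\<integral>z. (\<Sum>i\<in>UNIV. h $ i *\<^sub>R (partial_deriv i \<rho> (x - z) *\<^sub>R f z)) \<partial>lebesgue)"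
      unfolding mollify_def
      by (subst Bochner_Integration.integral_sum) (auto intro!: integrable_scaleR_right int tp simp del: scaleR_scaleR)
    have i: "integrable lebesgue (\<lambda>z. \<Sum>i\<in>UNIV. h $ i *\<^sub>R (partial_deriv i \<rho> (x - z) *\<^sub>R f z))"
      by (intro Bochner_Integration.integrable_sum integrable_scaleR_right int tp)
    have "mollify \<rho> f y - mollify \<rho> f x - (\<Sum>i\<in>UNIV. h $ i *\<^sub>R mollify (partial_deriv i \<rho>) f x)
        = (\<integral>z. \<rho> (y - z) *\<^sub>R f z - \<rho> (x - z) *\<^sub>R f z - (\<Sum>i\<in>UNIV. h $ i *\<^sub>R (partial_deriv i \<rho> (x - z) *\<^sub>R f z)) \<partial>lebesgue)"
      unfolding s using int[OF \<rho>] i by (simp add: mollify_def)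
    also have "\<dots> = (\<integral>z. (\<rho> ((x - z) + h) - \<rho> (x - z) - (\<Sum>i\<in>UNIV. h $ i * partial_deriv i \<rho> (x - z))) *\<^sub>R f z \<partial>lebesgue)"
      by (intro Bochner_Integration.integral_cong) (auto simp: h_def scaleR_left_diff_distrib scaleR_sum_left)
    also have "norm \<dots> \<le> (\<integral>z. (e' * norm h) * norm (f z) \<partial>lebesgue)"
    proof (rule order_trans[OF integral_norm_bound integral_mono])
      have "integrable lebesgue (\<lambda>z. (\<rho> ((x - z) + h) - \<rho> (x - z) - (\<Sum>i\<in>UNIV. h $ i * partial_deriv i \<rho> (x - z))) *\<^sub>R f z)"
        using Bochner_Integration.integrable_diff[OF Bochner_Integration.integrable_diff[OF int[OF \<rho>, of y] int[OF \<rho>, of x]] i]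
        by (rule Bochner_Integration.integrable_cong[THEN iffD1, rotated -1])
           (auto simp: h_def scaleR_left_diff_distrib scaleR_sum_left)
      then show "integrable lebesgue (\<lambda>z. norm ((\<rho> ((x - z) + h) - \<rho> (x - z) - (\<Sum>i\<in>UNIV. h $ i * partial_deriv i \<rho> (x - z))) *\<^sub>R f z))"
        by (rule integrable_norm)
      show "integrable lebesgue (\<lambda>z. (e' * norm h) * norm (f z))" using f by simp
      show "norm ((\<rho> ((x - z) + h) - \<rho> (x - z) - (\<Sum>i\<in>UNIV. h $ i * partial_deriv i \<rho> (x - z))) *\<^sub>R f z) \<le> (e' * norm h) * norm (f z)" for z
        using lin[of h "x - z"] y by (simp add: h_def mult_right_mono)
    qed
    also have "\<dots> = (e' * I) * norm h" by (simp add: I_def)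
    also have "\<dots> \<le> e * norm h" using e' by (intro mult_right_mono) auto
    finally show "norm (mollify \<rho> f y - mollify \<rho> f x - (\<Sum>i\<in>UNIV. (y - x) $ i *\<^sub>R mollify (partial_deriv i \<rho>) f x)) \<le> e * norm (y - x)"
      by (simp add: h_def)
  qed
qed

lemma partial_deriv_mollify:
  fixes f :: "real^'n::finite \<Rightarrow> 'b::euclidean_space"
  assumes f: "integrable lebesgue f" and \<rho>: "test_function UNIV (\<rho> :: real^'n \<Rightarrow> real)"
  shows "partial_deriv i (mollify \<rho> f) = mollify (partial_deriv i \<rho>) f"
proof
  fix x
  have "(\<Sum>j\<in>UNIV. axis i 1 $ j *\<^sub>R mollify (partial_deriv j \<rho>) f x) = mollify (partial_deriv i \<rho>) f x"
    by (subst sum.remove[of _ i]) (auto simp: axis_def intro!: sum.neutral)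
  then show "partial_deriv i (mollify \<rho> f) x = mollify (partial_deriv i \<rho>) f x"
    using partial_deriv_eqI[OF mollify_has_derivative[OF f \<rho>], of i x] by simp
qed

lemma Ck_mollify:
  fixes f :: "real^'n::finite \<Rightarrow> 'b::euclidean_space"
  assumes f: "integrable lebesgue f"
  shows "test_function UNIV (\<rho> :: real^'n \<Rightarrow> real) \<Longrightarrow> Ck k (mollify \<rho> f)"
proof (induction k arbitrary: \<rho>)
  case 0
  have "mollify \<rho> f differentiable (at x)" for x
    using mollify_has_derivative[OF f 0] by (auto simp: differentiable_def)
  then show ?case
    by (simp add: continuous_at_imp_continuous_on differentiable_imp_continuous_within)
next
  case (Suc k)
  have "mollify \<rho> f differentiable (at x)" for x
    using mollify_has_derivative[OF f Suc.prems] by (auto simp: differentiable_def)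
  then show ?case
    using Suc.IH[OF test_function_partial_deriv[OF Suc.prems]] by (simp add: partial_deriv_mollify[OF f Suc.prems])
qed

lemma mollify_eq_zero: "(\<And>y. f y \<noteq> 0 \<Longrightarrow> \<rho> (x - y) = 0) \<Longrightarrow> mollify \<rho> f x = 0"
proof -
  assume "\<And>y. f y \<noteq> 0 \<Longrightarrow> \<rho> (x - y) = 0"
  then have "(\<lambda>y. \<rho> (x - y) *\<^sub>R f y) = (\<lambda>y. 0)" by (metis scaleR_eq_0_iff)
  then show ?thesis by (simp add: mollify_def)
qed

lemma test_function_mollify:
  fixes f :: "real^'n::finite \<Rightarrow> 'b::euclidean_space"
  assumes f: "integrable lebesgue f" and \<rho>: "test_function UNIV (\<rho> :: real^'n \<Rightarrow> real)"
    and S: "compact S" "\<And>y. y \<notin> S \<Longrightarrow> f y = 0" and \<epsilon>: "\<And>y. norm y > \<epsilon> \<Longrightarrow> \<rho> y = 0"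
    and sub: "\<And>x y. x \<in> S \<Longrightarrow> norm (y - x) \<le> \<epsilon> \<Longrightarrow> y \<in> \<Omega>"
  shows "test_function \<Omega> (mollify \<rho> f)"
proof (rule test_functionI)
  show "Ck k (mollify \<rho> f)" for k using Ck_mollify[OF f \<rho>] .
  show "compact {x + y | x y. x \<in> S \<and> y \<in> cball 0 \<epsilon>}"
    using S by (intro compact_sums) auto
  show "{x + y | x y. x \<in> S \<and> y \<in> cball 0 \<epsilon>} \<subseteq> \<Omega>" using sub by auto
  show "mollify \<rho> f x = 0" if x: "x \<notin> {x + y | x y. x \<in> S \<and> y \<in> cball 0 \<epsilon>}" for x
  proof (rule mollify_eq_zero)
    fix y assume "f y \<noteq> 0"
    then have "y \<in> S" using S by blast
    show "\<rho> (x - y) = 0"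
    proof (rule \<epsilon>, rule ccontr)
      assume "\<not> \<epsilon> < norm (x - y)"
      then have "x = y + (x - y)" "x - y \<in> cball 0 \<epsilon>" by auto
      then show False using x \<open>y \<in> S\<close> by blast
    qed
  qed
qed

subsection \<open>The standard mollifier and cutoff functions\<close>

definition mollifier :: "real \<Rightarrow> real^'n::finite \<Rightarrow> real" where
  "mollifier \<epsilon> x = bump ((1 / \<epsilon>) *\<^sub>R x) / (\<integral>y. bump ((1 / \<epsilon>) *\<^sub>R y :: real^'n) \<partial>lborel)"

lemma integrable_test_function:
  fixes \<phi> :: "real^'n::finite \<Rightarrow> 'b::euclidean_space"
  assumes "test_function \<Omega> \<phi>"
  shows "integrable lborel \<phi>" "integrable lebesgue \<phi>" "\<phi> \<in> borel_measurable borel"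
proof -
  define K where "K = closure {x. \<phi> x \<noteq> 0}"
  show m: "\<phi> \<in> borel_measurable borel"
    using test_functionD(2)[OF assms] by (rule borel_measurable_continuous_onI)
  have "integrable lborel (\<lambda>x. indicator K x *\<^sub>R \<phi> x)"
    by (rule borel_integrable_compact) (use test_functionD(2,4)[OF assms] in \<open>auto simp: K_def intro: continuous_on_subset\<close>)
  moreover have "(\<lambda>x. indicator K x *\<^sub>R \<phi> x) = \<phi>"
    using closure_subset[of "{x. \<phi> x \<noteq> 0}"] by (auto simp: K_def indicator_def fun_eq_iff)
  ultimately show "integrable lborel \<phi>" by simp
  then show "integrable lebesgue \<phi>" using m by (simp add: integrable_completion)
qed

lemma mollifier:
  assumes \<epsilon>: "\<epsilon> > 0"
  shows "test_function UNIV (mollifier \<epsilon> :: real^'n::finite \<Rightarrow> real)"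
    and "mollifier \<epsilon> (x::real^'n) \<ge> 0"
    and "norm x \<ge> \<epsilon> \<Longrightarrow> mollifier \<epsilon> x = 0"
    and "(\<integral>\<^sup>+x. ennreal (mollifier \<epsilon> (x::real^'n)) \<partial>lborel) = 1"
proof -
  define b where "b x = bump ((1 / \<epsilon>) *\<^sub>R x)" for x :: "real^'n"
  define c where "c = (\<integral>y. b y \<partial>lborel)"
  have m: "mollifier \<epsilon> = (\<lambda>x. (1 / c) *\<^sub>R b x)" by (auto simp: mollifier_def b_def c_def fun_eq_iff)
  have z: "b x = 0" if "norm x \<ge> \<epsilon>" for x using that \<epsilon> by (simp add: b_def bump_zero)
  have nn: "b x \<ge> 0" for x by (simp add: b_def bump_nonneg)
  have t: "test_function UNIV b"
  proof (rule test_functionI[of _ "cball 0 \<epsilon>"])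
    show "Ck k b" for k
      using Ck_affine[OF test_functionD(1)[OF test_function_bump], of k 0 "1 / \<epsilon>"] by (simp add: b_def[abs_def])
  qed (use z in auto)
  note ib = integrable_test_function[OF t]
  have c: "c > 0"
  proof (rule ccontr)
    assume "\<not> c > 0"
    moreover have "c \<ge> 0" using nn by (simp add: c_def)
    ultimately have "c = 0" by simp
    then have "AE x in lborel. b x = 0"
      using integral_nonneg_eq_0_iff_AE[OF ib(1)] nn by (simp add: c_def)
    moreover have "b x \<noteq> 0" if "x \<in> ball 0 \<epsilon>" for x
    proof -
      have "norm ((1 / \<epsilon>) *\<^sub>R x) < 1" using that \<epsilon> by (simp add: divide_simps)
      from bump_pos[OF this] show ?thesis by (simp add: b_def)
    qed
    ultimately have "AE x in lborel. x \<notin> ball (0::real^'n) \<epsilon>" by (auto elim: eventually_mono)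
    then have "emeasure lborel (ball (0::real^'n) \<epsilon>) = 0"
      by (subst (asm) AE_iff_measurable[OF _ refl]) (auto simp: ball_def)
    moreover have "emeasure lborel (ball (0::real^'n) \<epsilon>) > 0"
      using \<epsilon> unit_ball_vol_pos[of "real DIM(real^'n)"] by (simp add: emeasure_ball del: DIM_cart)
    ultimately show False by simp
  qed
  show "test_function UNIV (mollifier \<epsilon> :: real^'n \<Rightarrow> real)"
    unfolding m
  proof (rule test_functionI[of _ "cball 0 \<epsilon>"])
    show "Ck k (\<lambda>x. (1 / c) *\<^sub>R b x)" for k
      by (intro Ck_scaleR Ck_const test_functionD(1)[OF t])
  qed (use z in auto)
  show "mollifier \<epsilon> (x::real^'n) \<ge> 0" using c nn by (simp add: m)
  show "norm x \<ge> \<epsilon> \<Longrightarrow> mollifier \<epsilon> x = 0" using z by (simp add: m)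
  have "(\<integral>\<^sup>+x. ennreal (b x) \<partial>lborel) = ennreal c"
    unfolding c_def using ib nn by (intro nn_integral_eq_integral) auto
  moreover have "(\<integral>\<^sup>+x. ennreal (mollifier \<epsilon> (x::real^'n)) \<partial>lborel) = ennreal (1 / c) * (\<integral>\<^sup>+x. ennreal (b x) \<partial>lborel)"
    unfolding m using c ib nn by (subst nn_integral_cmult[symmetric]) (auto simp: ennreal_mult'[symmetric])
  ultimately show "(\<integral>\<^sup>+x. ennreal (mollifier \<epsilon> (x::real^'n)) \<partial>lborel) = 1"
    using c by (simp flip: ennreal_mult)
qed

lemma integral_mollifier:
  assumes "\<epsilon> > 0"
  shows "(\<integral>y. mollifier \<epsilon> (x - y :: real^'n::finite) \<partial>lebesgue) = 1"
proof -
  note b = integrable_test_function[OF mollifier(1)[OF assms, where ?'n='n]]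
  have "(\<integral>y. mollifier \<epsilon> (x - y :: real^'n) \<partial>lebesgue) = (\<integral>y. mollifier \<epsilon> (x - y) \<partial>lborel)"
    using b(3) by (intro integral_completion) auto
  also have "\<dots> = (\<integral>y. mollifier \<epsilon> (y::real^'n) \<partial>distr lborel borel (\<lambda>y. x - y))"
    using b(3) by (subst integral_distr) auto
  also have "\<dots> = (\<integral>y. mollifier \<epsilon> (y::real^'n) \<partial>lborel)" by (simp only: distr_lborel_reflection)
  also have "\<dots> = 1"
    using nn_integral_eq_integral[OF b(1)] mollifier(2,4)[OF assms, where ?'n='n] by simp
  finally show ?thesis .
qed

text \<open>The indicator of the \<open>\<delta> / 2\<close> neighbourhood is mollified at scale
  \<open>\<delta> / 4\<close>: within distance \<open>\<delta> / 4\<close> of \<open>K\<close> the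
  average sees only the value 1, and beyond \<open>3 * \<delta> / 4\<close> only the value
  0.\<close>

lemma cutoff_exists:
  fixes K :: "(real^'n::finite) set"
  assumes K: "compact K" "K \<noteq> {}" and d: "\<delta> > 0"
  obtains \<eta> :: "real^'n \<Rightarrow> real" where "test_function {x. infdist x K < \<delta>} \<eta>"
    "\<And>x. 0 \<le> \<eta> x" "\<And>x. \<eta> x \<le> 1" "\<And>x. infdist x K \<le> \<delta> / 4 \<Longrightarrow> \<eta> x = 1"
proof -
  define S where "S = {x. infdist x K \<le> \<delta> / 2}"
  have S: "compact S" unfolding S_def using K d by (intro compact_infdist_le) auto
  have Sm: "S \<in> sets lebesgue" "emeasure lebesgue S < \<infinity>"
    using S lmeasurable_compact by (auto simp: fmeasurable_def)
  define f where "f = (indicator S :: real^'n \<Rightarrow> real)"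
  have f: "integrable lebesgue f" using Sm by (simp add: f_def)
  define \<rho> where "\<rho> = (mollifier (\<delta> / 4) :: real^'n \<Rightarrow> real)"
  have d4: "\<delta> / 4 > 0" using d by simp
  note \<rho> = mollifier[OF d4, where ?'n='n, folded \<rho>_def]
  note int\<rho> = integrable_test_function(2)[OF test_function_reflect[OF \<rho>(1)]]
  have le: "0 \<le> mollify \<rho> f x" "mollify \<rho> f x \<le> 1" for x
  proof -
    show "0 \<le> mollify \<rho> f x" unfolding mollify_def f_def
      using \<rho>(2) by (intro integral_nonneg_AE) auto
    have "mollify \<rho> f x \<le> (\<integral>y. \<rho> (x - y) \<partial>lebesgue)"
      unfolding mollify_def using \<rho>(2) integrable_test_scaleR(2)[OF f \<rho>(1)] int\<rho>
      by (intro integral_mono) (auto simp: f_def indicator_def)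
    then show "mollify \<rho> f x \<le> 1" using integral_mollifier[OF d4, of x] by (simp add: \<rho>_def)
  qed
  show ?thesis
  proof (rule that[of "mollify \<rho> f"])
    show "test_function {x. infdist x K < \<delta>} (mollify \<rho> f)"
    proof (rule test_function_mollify[OF f \<rho>(1) S, of "\<delta> / 4"])
      fix x y assume "x \<in> S" "norm (y - x) \<le> \<delta> / 4"
      then show "y \<in> {x. infdist x K < \<delta>}"
        using infdist_triangle[of y K x] d by (simp add: S_def dist_norm)
    qed (use \<rho>(3) in \<open>auto simp: f_def\<close>)
    show "mollify \<rho> f x = 1" if x: "infdist x K \<le> \<delta> / 4" for x
    proof -
      have "\<rho> (x - y) *\<^sub>R f y = \<rho> (x - y)" for y
      proof (cases "norm (x - y) \<ge> \<delta> / 4")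
        case True
        then show ?thesis using \<rho>(3) by simp
      next
        case False
        then have "y \<in> S" using infdist_triangle[of y K x] x by (simp add: S_def dist_norm norm_minus_commute)
        then show ?thesis by (simp add: f_def)
      qed
      then have "mollify \<rho> f x = (\<integral>y. \<rho> (x - y) \<partial>lebesgue)" unfolding mollify_def by (simp only:)
      then show ?thesis using integral_mollifier[OF d4, of x] by (simp add: \<rho>_def)
    qed
  qed (use le in auto)
qed

section \<open>Locally integrable functions\<close>

lemma integrable_lebesgue_on_iff:
  fixes f :: "'a::euclidean_space \<Rightarrow> 'b::euclidean_space"
  assumes "S \<in> sets lebesgue"
  shows "integrable (lebesgue_on S) f \<longleftrightarrow> integrable lebesgue (\<lambda>x. indicator S x *\<^sub>R f x)"
    and "integral\<^sup>L (lebesgue_on S) f = integral\<^sup>L lebesgue (\<lambda>x. indicator S x *\<^sub>R f x)"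
    and "f \<in> borel_measurable (lebesgue_on S) \<longleftrightarrow> (\<lambda>x. indicator S x *\<^sub>R f x) \<in> borel_measurable lebesgue"
  using assms by (auto intro!: integrable_restrict_space integral_restrict_space borel_measurable_restrict_space_iff)

lemma AE_lebesgue_on_iff:
  assumes "S \<in> sets lebesgue"
  shows "(AE x in lebesgue_on S. P x) \<longleftrightarrow> (AE x in lebesgue. x \<in> S \<longrightarrow> P x)"
  using assms by (simp add: AE_restrict_space_iff)

lemma sets_lebesgue_borel: "S \<in> sets borel \<Longrightarrow> S \<in> sets lebesgue" for S :: "'a::euclidean_space set"
  by auto

lemma compact_lebesgue: "compact S \<Longrightarrow> S \<in> sets lebesgue" for S :: "'a::euclidean_space set"
  by (auto intro: sets_lebesgue_borel borel_compact)

lemma open_lebesgue: "open S \<Longrightarrow> S \<in> sets lebesgue" for S :: "'a::euclidean_space set"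
  by (auto intro: sets_lebesgue_borel)

lemma integrable_lebesgue_on_subset:
  fixes f :: "'a::euclidean_space \<Rightarrow> 'b::euclidean_space"
  assumes "integrable (lebesgue_on S) f" "S \<in> sets lebesgue" "T \<in> sets lebesgue" "T \<subseteq> S"
  shows "integrable (lebesgue_on T) f"
proof -
  have "integrable lebesgue (\<lambda>x. indicator T x *\<^sub>R (indicator S x *\<^sub>R f x))"
    by (rule integrable_mult_indicator[OF assms(3)]) (use assms integrable_lebesgue_on_iff(1) in blast)
  moreover have "(\<lambda>x. indicator T x *\<^sub>R (indicator S x *\<^sub>R f x)) = (\<lambda>x. indicat_real T x *\<^sub>R f x)"
    using assms(4) by (auto simp: indicator_def fun_eq_iff)
  ultimately show ?thesis using assms by (simp add: integrable_lebesgue_on_iff)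
qed

lemma locally_integrable_integrable_on_compact:
  "locally_integrable \<Omega> f \<Longrightarrow> compact K \<Longrightarrow> K \<subseteq> \<Omega> \<Longrightarrow> integrable lebesgue (\<lambda>x. indicator K x *\<^sub>R f x)"
  by (auto simp: locally_integrable_def integrable_lebesgue_on_iff[OF compact_lebesgue])

lemma locally_integrable_mono: "locally_integrable \<Omega> f \<Longrightarrow> \<Omega>' \<subseteq> \<Omega> \<Longrightarrow> locally_integrable \<Omega>' f"
  by (auto simp: locally_integrable_def)

lemma locally_integrable_cong:
  "(\<And>x. x \<in> \<Omega> \<Longrightarrow> f x = g x) \<Longrightarrow> locally_integrable \<Omega> f \<longleftrightarrow> locally_integrable \<Omega> g"
  unfolding locally_integrable_def
  by (intro iff_allI imp_cong refl Bochner_Integration.integrable_cong) (auto simp: space_restrict_space)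

lemma locally_integrable_add:
  "locally_integrable \<Omega> f \<Longrightarrow> locally_integrable \<Omega> g \<Longrightarrow> locally_integrable \<Omega> (\<lambda>x. f x + g x)"
  by (auto simp: locally_integrable_def)

lemma locally_integrable_scaleR:
  "locally_integrable \<Omega> f \<Longrightarrow> locally_integrable \<Omega> (\<lambda>x. c *\<^sub>R f x)"
  by (auto simp: locally_integrable_def)

lemma locally_integrable_bounded_linear:
  assumes "locally_integrable \<Omega> f" "bounded_linear T"
  shows "locally_integrable \<Omega> (\<lambda>x. T (f x))"
  using assms by (auto simp: locally_integrable_def intro: integrable_bounded_linear)

lemma locally_integrable_of_integrable:
  "integrable lebesgue f \<Longrightarrow> locally_integrable \<Omega> f"
  unfolding locally_integrable_def
  by (auto simp: integrable_lebesgue_on_iff(1) compact_lebesgue intro!: integrable_mult_indicator)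

lemma measurable_of_locally_integrable:
  fixes f :: "real^'n::finite \<Rightarrow> 'b::euclidean_space"
  assumes "open \<Omega>" "locally_integrable \<Omega> f"
  shows "f \<in> borel_measurable (lebesgue_on \<Omega>)"
proof -
  obtain C where C: "\<And>n. compact (C n)" "\<And>n. C n \<subseteq> \<Omega>" "\<And>n. C n \<subseteq> interior (C (Suc n))" "\<Union>(range C) = \<Omega>"
    using open_Union_compact_subsets[OF assms(1)] by metis
  have mono: "m \<le> n \<Longrightarrow> C m \<subseteq> C n" for m n
    by (rule lift_Suc_mono_le[of C]) (use C(3) interior_subset in blast)
  have "(\<lambda>x. indicat_real \<Omega> x *\<^sub>R f x) \<in> borel_measurable lebesgue"
  proof (rule borel_measurable_LIMSEQ_metric)
    show "(\<lambda>x. indicat_real (C n) x *\<^sub>R f x) \<in> borel_measurable lebesgue" for n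
      by (rule borel_measurable_integrable[OF locally_integrable_integrable_on_compact[OF assms(2) C(1,2)]])
    fix x
    show "(\<lambda>n. indicat_real (C n) x *\<^sub>R f x) \<longlonglongrightarrow> indicat_real \<Omega> x *\<^sub>R f x"
    proof (rule tendsto_eventually)
      show "\<forall>\<^sub>F n in sequentially. indicat_real (C n) x *\<^sub>R f x = indicat_real \<Omega> x *\<^sub>R f x"
      proof (cases "x \<in> \<Omega>")
        case True
        then obtain m where m: "x \<in> C m" using C(4) by blast
        show ?thesis
          using eventually_ge_at_top[of m] by eventually_elim (use mono True m in \<open>auto simp: indicator_def\<close>)
      next
        case False
        then show ?thesis using C(2) by (intro always_eventually) (auto simp: indicator_def)
      qed
    qed
  qed
  then show ?thesis using open_lebesgue[OF assms(1)] by (simp add: integrable_lebesgue_on_iff)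
qed

lemma integrable_test_locally_integrable:
  fixes f :: "real^'n::finite \<Rightarrow> 'b::euclidean_space" and \<phi> :: "real^'n \<Rightarrow> real"
  assumes f: "locally_integrable \<Omega> f" and \<phi>: "test_function \<Omega> \<phi>"
  shows "integrable lebesgue (\<lambda>x. \<phi> x *\<^sub>R f x)"
proof -
  define K where "K = closure {x. \<phi> x \<noteq> 0}"
  have K: "compact K" "K \<subseteq> \<Omega>" using test_functionD[OF \<phi>] by (auto simp: K_def)
  have "integrable lebesgue (\<lambda>x. \<phi> x *\<^sub>R (indicator K x *\<^sub>R f x))"
    by (rule integrable_test_scaleR(1)[OF locally_integrable_integrable_on_compact[OF f K] test_function_mono[OF \<phi>]]) simp
  moreover have "(\<lambda>x. \<phi> x *\<^sub>R (indicator K x *\<^sub>R f x)) = (\<lambda>x. \<phi> x *\<^sub>R f x)"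
    using closure_subset[of "{x. \<phi> x \<noteq> 0}"] by (auto simp: K_def indicator_def fun_eq_iff)
  ultimately show ?thesis by simp
qed

lemma integral_lebesgue_on_support:
  fixes f :: "'a::euclidean_space \<Rightarrow> 'b::euclidean_space"
  assumes "S \<in> sets lebesgue" "\<And>x. x \<notin> S \<Longrightarrow> f x = 0"
  shows "integral\<^sup>L (lebesgue_on S) f = integral\<^sup>L lebesgue f"
proof -
  have "(\<lambda>x. indicator S x *\<^sub>R f x) = f" using assms(2) by (auto simp: indicator_def fun_eq_iff)
  then show ?thesis using integrable_lebesgue_on_iff(2)[OF assms(1), of f] by simp
qed

subsection \<open>The fundamental lemma of the calculus of variations\<close>

lemma infdist_neighbourhood:
  fixes K :: "'a::heine_borel set"
  assumes "compact K" "K \<noteq> {}" "open \<Omega>" "K \<subseteq> \<Omega>"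
  obtains \<delta> where "\<delta> > 0" "{x. infdist x K \<le> \<delta>} \<subseteq> \<Omega>"
proof -
  obtain \<delta> where \<delta>: "\<delta> > 0" "(\<Union>x\<in>K. cball x \<delta>) \<subseteq> \<Omega>"
    using compact_subset_open_imp_cball_epsilon_subset[OF assms(1,3,4)] by blast
  have "{x. infdist x K \<le> \<delta>} \<subseteq> \<Omega>"
  proof safe
    fix x assume x: "infdist x K \<le> \<delta>"
    obtain y where "y \<in> K" "infdist x K = dist x y"
      using infdist_attains_inf[OF compact_imp_closed[OF assms(1)] assms(2)] by blast
    then have "x \<in> (\<Union>x\<in>K. cball x \<delta>)" using x by (auto simp: dist_commute)
    then show "x \<in> \<Omega>" using \<delta>(2) by blast
  qed
  then show ?thesis using that \<delta> by blast
qed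

text \<open>Cutoffs for the neighbourhoods of radius \<open>\<delta> / Suc k\<close> converge
  pointwise to the indicator of \<open>K\<close> and are supported in the fixed compact set
  \<open>K'\<close>, where \<open>H\<close> is integrable.\<close>

lemma integral_compact_eq_zero:
  fixes H :: "real^'n::finite \<Rightarrow> real"
  assumes \<Omega>: "open \<Omega>" and H: "locally_integrable \<Omega> H"
    and z: "\<And>\<phi>. test_function \<Omega> \<phi> \<Longrightarrow> (\<integral>x. \<phi> x * H x \<partial>lebesgue) = 0"
    and K: "compact K" "K \<subseteq> \<Omega>"
  shows "(\<integral>x. indicator K x * H x \<partial>lebesgue) = 0"
proof (cases "K = {}")
  case False
  obtain \<delta> where \<delta>: "\<delta> > 0" "{x. infdist x K \<le> \<delta>} \<subseteq> \<Omega>"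
    using infdist_neighbourhood[OF K(1) False \<Omega> K(2)] .
  define K' where "K' = {x. infdist x K \<le> \<delta>}"
  have K': "compact K'" "K' \<subseteq> \<Omega>" using \<delta> compact_infdist_le[OF False K(1)] by (auto simp: K'_def)
  have "\<exists>\<eta>::real^'n \<Rightarrow> real. test_function {x. infdist x K < \<delta> / Suc k} \<eta> \<and> (\<forall>x. 0 \<le> \<eta> x \<and> \<eta> x \<le> 1)
      \<and> (\<forall>x. infdist x K \<le> \<delta> / Suc k / 4 \<longrightarrow> \<eta> x = 1)" for k
    by (rule cutoff_exists[OF K(1) False, of "\<delta> / Suc k"]) (use \<delta> in auto)
  then obtain \<eta> where \<eta>: "\<And>k. test_function {x. infdist x K < \<delta> / Suc k} (\<eta> k)"
    "\<And>k (x::real^'n). 0 \<le> \<eta> k x" "\<And>k x. \<eta> k x \<le> 1" "\<And>k x. infdist x K \<le> \<delta> / Suc k / 4 \<Longrightarrow> \<eta> k x = (1::real)"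
    by metis
  have le: "\<delta> / Suc k \<le> \<delta>" for k using \<delta> by (simp add: divide_simps)
  have t: "test_function \<Omega> (\<eta> k)" for k
  proof (rule test_function_mono[OF \<eta>(1)])
    show "{x. infdist x K < \<delta> / Suc k} \<subseteq> \<Omega>" using \<delta>(2) le[of k] by force
  qed
  have zero: "\<eta> k x = 0" if "infdist x K \<ge> \<delta> / Suc k" for k x
    using test_functionD(6)[OF \<eta>(1), of x k] that by auto
  have "(\<lambda>k. \<integral>x. \<eta> k x * H x \<partial>lebesgue) \<longlonglongrightarrow> (\<integral>x. indicator K x * H x \<partial>lebesgue)"
  proof (rule integral_dominated_convergence[where w="\<lambda>x. norm (indicator K' x *\<^sub>R H x)"])
    show "(\<lambda>x. indicator K x * H x) \<in> borel_measurable lebesgue"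
      using locally_integrable_integrable_on_compact[OF H K] by (simp add: borel_measurable_integrable)
    show "(\<lambda>x. \<eta> k x * H x) \<in> borel_measurable lebesgue" for k
      using integrable_test_locally_integrable[OF H t] by (simp add: borel_measurable_integrable)
    show "integrable lebesgue (\<lambda>x. norm (indicator K' x *\<^sub>R H x))"
      by (intro integrable_norm locally_integrable_integrable_on_compact[OF H K'])
    show "AE x in lebesgue. (\<lambda>k. \<eta> k x * H x) \<longlonglongrightarrow> indicator K x * H x"
    proof (rule AE_I2, rule tendsto_mult_right)
      fix x
      show "(\<lambda>k. \<eta> k x) \<longlonglongrightarrow> indicator K x"
      proof (cases "x \<in> K")
        case True
        then show ?thesis using \<eta>(4)[of x] \<delta> by simp
      next
        case False
        then have "infdist x K > 0"
          using K(1) \<open>K \<noteq> {}\<close> by (simp add: infdist_pos_not_in_closed compact_imp_closed)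
        then obtain n where n: "\<delta> / infdist x K \<le> real n" using real_arch_simple by blast
        have "\<forall>\<^sub>F k in sequentially. \<eta> k x = 0"
          using eventually_ge_at_top[of n]
        proof eventually_elim
          case (elim k)
          then have "\<delta> / infdist x K \<le> Suc k" using n by linarith
          then have "\<delta> / Suc k \<le> infdist x K"
            using \<open>infdist x K > 0\<close> by (simp add: divide_simps mult.commute)
          then show ?case by (rule zero)
        qed
        then show ?thesis using False by (auto intro: tendsto_eventually)
      qed
    qed
    show "AE x in lebesgue. norm (\<eta> k x * H x) \<le> norm (indicator K' x *\<^sub>R H x)" for k
    proof (rule AE_I2)
      fix x
      show "norm (\<eta> k x * H x) \<le> norm (indicator K' x *\<^sub>R H x)"
      proof (cases "x \<in> K'")
        case True
        then show ?thesis using \<eta>(2,3)[of k x] by (simp add: abs_mult mult_left_le_one_le)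
      next
        case False
        then have "\<eta> k x = 0" using le[of k] by (intro zero) (auto simp: K'_def)
        then show ?thesis by simp
      qed
    qed
  qed
  then show ?thesis using z[OF t] by (simp add: LIMSEQ_const_iff)
qed simp

text \<open>Inner regularity by closed sets; a closed set is the countable union of its compact
  intersections with balls.\<close>

lemma null_set_if_compact_subsets_null:
  fixes E :: "'a::euclidean_space set"
  assumes E: "E \<in> sets lebesgue" and K: "\<And>K. compact K \<Longrightarrow> K \<subseteq> E \<Longrightarrow> K \<in> null_sets lebesgue"
  shows "E \<in> null_sets lebesgue"
proof -
  have "emeasure lebesgue E \<le> ennreal e" if "e > 0" for e
  proof -
    obtain T where T: "closed T" "T \<subseteq> E" "E - T \<in> lmeasurable" "emeasure lebesgue (E - T) < ennreal e"
      using sets_lebesgue_inner_closed[OF E \<open>e > 0\<close>] by blast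
    have "(\<Union>n::nat. T \<inter> cball 0 n) \<in> null_sets lebesgue"
      using T by (intro null_sets_UN K) (auto intro: closed_Int_compact)
    also have "(\<Union>n::nat. T \<inter> cball 0 n) = T" using real_arch_simple by auto
    finally have "emeasure lebesgue ((E - T) \<union> T) = emeasure lebesgue (E - T)"
      using T(3) by (intro emeasure_Un_null_set) auto
    moreover have "(E - T) \<union> T = E" using T(2) by auto
    ultimately show ?thesis using T(4) by simp
  qed
  then have "emeasure lebesgue E = 0"
    by (metis ennreal_0 ennreal_le_epsilon add_0 less_eq_ennreal_def nle_le zero_le)
  then show ?thesis using E by auto
qed

text \<open>On a compact subset of \<open>{x \<in> \<Omega>. H x > 0}\<close> a positive function
  would have integral 0, so such subsets are null, and with them the whole set. The negative part is
  treated by passing to \<open>- H\<close>.\<close>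

lemma fundamental_lemma:
  fixes H :: "real^'n::finite \<Rightarrow> real"
  assumes \<Omega>: "open \<Omega>" and H: "locally_integrable \<Omega> H"
    and z: "\<And>\<phi>. test_function \<Omega> \<phi> \<Longrightarrow> (\<integral>x. \<phi> x * H x \<partial>lebesgue) = 0"
  shows "AE x in lebesgue_on \<Omega>. H x = 0"
proof -
  have pos: "{x \<in> \<Omega>. H x > 0} \<in> null_sets lebesgue"
    if H: "locally_integrable \<Omega> H" and z: "\<And>\<phi>. test_function \<Omega> \<phi> \<Longrightarrow> (\<integral>x. \<phi> x * H x \<partial>lebesgue) = 0"
    for H :: "real^'n \<Rightarrow> real"
  proof (rule null_set_if_compact_subsets_null)
    have m: "(\<lambda>x. indicat_real \<Omega> x *\<^sub>R H x) \<in> borel_measurable lebesgue"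
      using measurable_of_locally_integrable[OF \<Omega> H] by (simp add: integrable_lebesgue_on_iff open_lebesgue[OF \<Omega>])
    have "{x \<in> \<Omega>. H x > 0} = {x \<in> space lebesgue. indicat_real \<Omega> x *\<^sub>R H x > 0}"
      by (auto simp: indicator_def)
    also have "\<dots> \<in> sets lebesgue" using m by measurable
    finally show "{x \<in> \<Omega>. H x > 0} \<in> sets lebesgue" .
    fix K assume K: "compact K" "K \<subseteq> {x \<in> \<Omega>. H x > 0}"
    then have K\<Omega>: "K \<subseteq> \<Omega>" by auto
    have i: "integrable lebesgue (\<lambda>x. indicator K x * H x)"
      using locally_integrable_integrable_on_compact[OF H K(1) K\<Omega>] by simp
    have "AE x in lebesgue. indicator K x * H x = 0"
    proof (subst integral_nonneg_eq_0_iff_AE[OF i, symmetric])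
      show "AE x in lebesgue. 0 \<le> indicator K x * H x"
        using K(2) by (intro AE_I2) (auto simp: indicator_def intro: less_imp_le)
      show "(\<integral>x. indicator K x * H x \<partial>lebesgue) = 0"
        by (rule integral_compact_eq_zero[OF \<Omega> H z K(1) K\<Omega>])
    qed
    then have "AE x in lebesgue. x \<notin> K"
    proof eventually_elim
      case (elim x)
      show ?case
      proof
        assume "x \<in> K"
        then have "H x > 0" using K(2) by auto
        then show False using elim \<open>x \<in> K\<close> by simp
      qed
    qed
    then show "K \<in> null_sets lebesgue"
      using compact_lebesgue[OF K(1)] by (simp add: AE_iff_null_sets)
  qed
  have "locally_integrable \<Omega> (\<lambda>x. - H x)" using locally_integrable_scaleR[OF H, of "-1"] by simp
  from pos[OF this] z have n: "{x \<in> \<Omega>. - H x > 0} \<in> null_sets lebesgue" by simp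
  have "AE x in lebesgue. x \<notin> {x \<in> \<Omega>. H x > 0}" "AE x in lebesgue. x \<notin> {x \<in> \<Omega>. - H x > 0}"
    using AE_not_in[OF pos[OF H z]] AE_not_in[OF n] by auto
  then have "AE x in lebesgue. x \<in> \<Omega> \<longrightarrow> H x = 0" by eventually_elim auto
  then show ?thesis by (simp add: AE_lebesgue_on_iff open_lebesgue[OF \<Omega>])
qed

section \<open>Square integrable functions\<close>

lemma L2_iff:
  "L2 \<Omega> f \<longleftrightarrow> f \<in> borel_measurable (lebesgue_on \<Omega>) \<and> sqn (lebesgue_on \<Omega>) f < \<infinity>"
  unfolding L2_def sqn_def by (auto simp: integrable_iff_bounded)

lemma L2_measurable: "L2 \<Omega> f \<Longrightarrow> f \<in> borel_measurable (lebesgue_on \<Omega>)"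
  by (simp add: L2_def)

lemma sqn_eq_integral:
  assumes "L2 \<Omega> f"
  shows "sqn (lebesgue_on \<Omega>) f = ennreal (LINT x|lebesgue_on \<Omega>. (norm (f x))\<^sup>2)"
  using assms unfolding L2_def sqn_def by (intro nn_integral_eq_integral) auto

lemma L2_scaleR: "L2 \<Omega> f \<Longrightarrow> L2 \<Omega> (\<lambda>x. c *\<^sub>R f x)"
  by (auto simp: L2_def power_mult_distrib)

lemma L2_add: assumes "L2 \<Omega> f" "L2 \<Omega> g" shows "L2 \<Omega> (\<lambda>x. f x + g x)"
proof -
  have "sqn (lebesgue_on \<Omega>) (\<lambda>x. f x + g x) \<le> 2 * sqn (lebesgue_on \<Omega>) f + 2 * sqn (lebesgue_on \<Omega>) g"
    using assms by (intro sqn_add_le L2_measurable)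
  also have "\<dots> < \<infinity>" using assms by (simp add: L2_iff ennreal_mult_less_top)
  finally show ?thesis unfolding L2_iff using assms by (intro conjI borel_measurable_add L2_measurable)
qed

lemma L2_diff: "L2 \<Omega> f \<Longrightarrow> L2 \<Omega> g \<Longrightarrow> L2 \<Omega> (\<lambda>x. f x - g x)"
  using L2_add[of \<Omega> f "\<lambda>x. (-1) *\<^sub>R g x"] L2_scaleR[of \<Omega> g "-1"] by simp

lemma L2_bound:
  assumes "L2 \<Omega> g" "f \<in> borel_measurable (lebesgue_on \<Omega>)" "AE x in lebesgue_on \<Omega>. norm (f x) \<le> norm (g x)"
  shows "L2 \<Omega> f"
  using assms sqn_mono_AE[OF assms(3)] by (auto simp: L2_iff)

lemma L2_bounded:
  assumes "f \<in> borel_measurable (lebesgue_on \<Omega>)" "AE x in lebesgue_on \<Omega>. norm (f x) \<le> C" "\<Omega> \<in> lmeasurable"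
  shows "L2 \<Omega> f"
proof -
  interpret finite_measure "lebesgue_on \<Omega>" using assms(3) by (rule finite_measure_lebesgue_on)
  have "sqn (lebesgue_on \<Omega>) f \<le> (\<integral>\<^sup>+x. ennreal (C\<^sup>2) \<partial>lebesgue_on \<Omega>)"
    unfolding sqn_def using assms(2)
    by (intro nn_integral_mono_AE) (auto elim!: eventually_mono intro!: ennreal_leI power_mono)
  also have "\<dots> < \<infinity>"
    using emeasure_finite[of "space (lebesgue_on \<Omega>)"] ennreal_less_top[of "C\<^sup>2"]
    unfolding nn_integral_const infinity_ennreal_def ennreal_mult_less_top less_top by blast
  finally show ?thesis unfolding L2_iff using assms by blast
qed

lemma L2_mono:
  fixes f :: "real^'n::finite \<Rightarrow> 'b::euclidean_space"
  assumes "L2 \<Omega> f" "\<Omega>' \<subseteq> \<Omega>" "\<Omega>' \<in> sets lebesgue" "\<Omega> \<in> sets lebesgue"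
  shows "L2 \<Omega>' f"
proof -
  have "(\<lambda>x. indicat_real \<Omega> x *\<^sub>R f x) \<in> borel_measurable lebesgue"
    using L2_measurable[OF assms(1)] integrable_lebesgue_on_iff(3)[OF assms(4), of f] by blast
  then have "(\<lambda>x. indicator \<Omega>' x *\<^sub>R (indicat_real \<Omega> x *\<^sub>R f x)) \<in> borel_measurable lebesgue"
    by (rule borel_measurable_scaleR[OF borel_measurable_indicator[OF assms(3)]])
  moreover have "(\<lambda>x. indicator \<Omega>' x *\<^sub>R (indicat_real \<Omega> x *\<^sub>R f x)) = (\<lambda>x. indicat_real \<Omega>' x *\<^sub>R f x)"
    using assms(2) by (auto simp: indicator_def fun_eq_iff)
  ultimately show ?thesis
    using assms integrable_lebesgue_on_subset[of \<Omega> "\<lambda>x. (norm (f x))\<^sup>2" \<Omega>']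
    by (simp add: L2_def integrable_lebesgue_on_iff(3))
qed

lemma L2_locally_integrable:
  fixes f :: "real^'n::finite \<Rightarrow> 'b::euclidean_space"
  assumes "L2 \<Omega> f" "\<Omega> \<in> sets lebesgue"
  shows "locally_integrable \<Omega> f"
  unfolding locally_integrable_def
proof (intro allI impI)
  fix K assume K: "compact K \<and> K \<subseteq> \<Omega>"
  then have f: "L2 K f" using L2_mono[OF assms(1)] assms(2) compact_lebesgue by blast
  interpret finite_measure "lebesgue_on K"
    using K by (intro finite_measure_lebesgue_on lmeasurable_compact) auto
  show "integrable (lebesgue_on K) f"
  proof (rule Bochner_Integration.integrable_bound)
    show "integrable (lebesgue_on K) (\<lambda>x. 1 + (norm (f x))\<^sup>2)" using f by (simp add: L2_def)
    show "AE x in lebesgue_on K. norm (f x) \<le> norm (1 + (norm (f x))\<^sup>2)"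
    proof (rule AE_I2)
      fix x
      have "2 * norm (f x) \<le> 1 + (norm (f x))\<^sup>2" using sum_squares_bound[of 1 "norm (f x)"] by simp
      then show "norm (f x) \<le> norm (1 + (norm (f x))\<^sup>2)" using norm_ge_zero[of "f x"] unfolding real_norm_def by linarith
    qed
  qed (use f in \<open>simp add: L2_def\<close>)
qed

lemma integrable_inner_L2:
  fixes f g :: "real^'n::finite \<Rightarrow> 'b::euclidean_space"
  assumes "L2 \<Omega> f" "L2 \<Omega> g"
  shows "integrable (lebesgue_on \<Omega>) (\<lambda>x. f x \<bullet> g x)"
    and "integrable (lebesgue_on \<Omega>) (\<lambda>x. norm (f x) * norm (g x))"
proof -
  have i: "integrable (lebesgue_on \<Omega>) (\<lambda>x. (norm (f x))\<^sup>2 + (norm (g x))\<^sup>2)"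
    using assms by (simp add: L2_def)
  have le: "norm (f x) * norm (g x) \<le> (norm (f x))\<^sup>2 + (norm (g x))\<^sup>2" for x
    using sum_squares_bound[of "norm (f x)" "norm (g x)"] mult_nonneg_nonneg[OF norm_ge_zero norm_ge_zero, of "f x" "g x"] by linarith
  show "integrable (lebesgue_on \<Omega>) (\<lambda>x. f x \<bullet> g x)"
  proof (rule Bochner_Integration.integrable_bound[OF i])
    show "AE x in lebesgue_on \<Omega>. norm (f x \<bullet> g x) \<le> norm ((norm (f x))\<^sup>2 + (norm (g x))\<^sup>2)"
      using order_trans[OF Cauchy_Schwarz_ineq2 le] by (intro AE_I2) simp
  qed (use assms in \<open>auto simp: L2_def\<close>)
  show "integrable (lebesgue_on \<Omega>) (\<lambda>x. norm (f x) * norm (g x))"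
  proof (rule Bochner_Integration.integrable_bound[OF i])
    show "AE x in lebesgue_on \<Omega>. norm (norm (f x) * norm (g x)) \<le> norm ((norm (f x))\<^sup>2 + (norm (g x))\<^sup>2)"
      using le by (intro AE_I2) simp
  qed (use assms in \<open>auto simp: L2_def\<close>)
qed

lemma Cauchy_Schwarz_L2:
  fixes f g :: "real^'n::finite \<Rightarrow> 'b::euclidean_space"
  assumes "L2 \<Omega> f" "L2 \<Omega> g"
  shows "(LINT x|lebesgue_on \<Omega>. norm (f x) * norm (g x))
      \<le> sqrt (LINT x|lebesgue_on \<Omega>. (norm (f x))\<^sup>2) * sqrt (LINT x|lebesgue_on \<Omega>. (norm (g x))\<^sup>2)"
proof -
  have n: "(LINT x|lebesgue_on \<Omega>. norm (f x) * norm (g x)) \<ge> 0" by simp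
  have "ennreal (LINT x|lebesgue_on \<Omega>. norm (f x) * norm (g x)) = (\<integral>\<^sup>+x. ennreal (norm (f x)) * ennreal (norm (g x)) \<partial>lebesgue_on \<Omega>)"
    using integrable_inner_L2(2)[OF assms]
    by (subst nn_integral_eq_integral[symmetric]) (auto simp: ennreal_mult)
  also have "\<dots>\<^sup>2 \<le> (\<integral>\<^sup>+x. (ennreal (norm (f x)))\<^sup>2 \<partial>lebesgue_on \<Omega>) * (\<integral>\<^sup>+x. (ennreal (norm (g x)))\<^sup>2 \<partial>lebesgue_on \<Omega>)"
    using L2_measurable[OF assms(1)] L2_measurable[OF assms(2)]
    by (intro Cauchy_Schwarz_nn_integral) auto
  also have "\<dots> = sqn (lebesgue_on \<Omega>) f * sqn (lebesgue_on \<Omega>) g"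
    by (simp add: sqn_def ennreal_power)
  also have "\<dots> = ennreal ((LINT x|lebesgue_on \<Omega>. (norm (f x))\<^sup>2) * (LINT x|lebesgue_on \<Omega>. (norm (g x))\<^sup>2))"
    using assms by (simp add: sqn_eq_integral ennreal_mult)
  finally have "(LINT x|lebesgue_on \<Omega>. norm (f x) * norm (g x))\<^sup>2
      \<le> (LINT x|lebesgue_on \<Omega>. (norm (f x))\<^sup>2) * (LINT x|lebesgue_on \<Omega>. (norm (g x))\<^sup>2)"
    using n by (subst (asm) ennreal_power) (auto simp: ennreal_le_iff)
  then show ?thesis using n by (simp flip: real_sqrt_mult add: real_le_rsqrt)
qed

lemma inner_integral_L2_bound:
  fixes f g :: "real^'n::finite \<Rightarrow> 'b::euclidean_space"
  assumes "L2 \<Omega> f" "L2 \<Omega> g"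
  shows "\<bar>LINT x|lebesgue_on \<Omega>. f x \<bullet> g x\<bar>
      \<le> sqrt (LINT x|lebesgue_on \<Omega>. (norm (f x))\<^sup>2) * sqrt (LINT x|lebesgue_on \<Omega>. (norm (g x))\<^sup>2)"
proof -
  have "\<bar>LINT x|lebesgue_on \<Omega>. f x \<bullet> g x\<bar> \<le> (LINT x|lebesgue_on \<Omega>. \<bar>f x \<bullet> g x\<bar>)"
    using integral_norm_bound[of "lebesgue_on \<Omega>" "\<lambda>x. f x \<bullet> g x"] by simp
  also have "\<dots> \<le> (LINT x|lebesgue_on \<Omega>. norm (f x) * norm (g x))"
    using integrable_inner_L2[OF assms] by (intro integral_mono) (auto intro: Cauchy_Schwarz_ineq2)
  also note Cauchy_Schwarz_L2[OF assms]
  finally show ?thesis .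
qed

section \<open>Weak gradients\<close>

text \<open>Test functions vanish outside \<Omega>, so all integrals may be taken over the whole
  space. In this form they do not mention \<Omega> any more, which makes restriction to smaller open
  sets immediate.\<close>

lemma has_weak_gradient_iff:
  fixes u :: "real^'n::finite \<Rightarrow> real^'m::finite"
  assumes "open \<Omega>"
  shows "has_weak_gradient \<Omega> u G \<longleftrightarrow> locally_integrable \<Omega> u \<and> locally_integrable \<Omega> G \<and>
     (\<forall>\<phi>. test_function \<Omega> \<phi> \<longrightarrow> (\<forall>i j. (\<integral>x. u x $ j * partial_deriv i \<phi> x \<partial>lebesgue)
              = - (\<integral>x. G x $ j $ i * \<phi> x \<partial>lebesgue)))"
proof -
  have "(LINT x|lebesgue_on \<Omega>. u x $ j * partial_deriv i \<phi> x) = (\<integral>x. u x $ j * partial_deriv i \<phi> x \<partial>lebesgue)"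
       "(LINT x|lebesgue_on \<Omega>. G x $ j $ i * \<phi> x) = (\<integral>x. G x $ j $ i * \<phi> x \<partial>lebesgue)"
    if "test_function \<Omega> \<phi>" for \<phi> i j
    using test_functionD(6)[OF that] test_functionD(6)[OF test_function_partial_deriv[OF that]] open_lebesgue[OF assms]
    by (auto intro!: integral_lebesgue_on_support)
  then show ?thesis unfolding has_weak_gradient_def by (intro conj_cong refl) auto
qed

lemma has_weak_gradientD:
  fixes u :: "real^'n::finite \<Rightarrow> real^'m::finite"
  assumes "open \<Omega>" "has_weak_gradient \<Omega> u G"
  shows "locally_integrable \<Omega> u" "locally_integrable \<Omega> G"
    "test_function \<Omega> \<phi> \<Longrightarrow> (\<integral>x. u x $ j * partial_deriv i \<phi> x \<partial>lebesgue) = - (\<integral>x. G x $ j $ i * \<phi> x \<partial>lebesgue)"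
    "test_function \<Omega> \<phi> \<Longrightarrow> integrable lebesgue (\<lambda>x. u x $ j * \<phi> x)"
    "test_function \<Omega> \<phi> \<Longrightarrow> integrable lebesgue (\<lambda>x. G x $ j $ i * \<phi> x)"
proof -
  show l: "locally_integrable \<Omega> u" "locally_integrable \<Omega> G"
    using assms by (auto simp: has_weak_gradient_def)
  show "test_function \<Omega> \<phi> \<Longrightarrow> (\<integral>x. u x $ j * partial_deriv i \<phi> x \<partial>lebesgue) = - (\<integral>x. G x $ j $ i * \<phi> x \<partial>lebesgue)"
    using assms has_weak_gradient_iff by blast
  show "test_function \<Omega> \<phi> \<Longrightarrow> integrable lebesgue (\<lambda>x. u x $ j * \<phi> x)"
    using integrable_test_locally_integrable[OF locally_integrable_bounded_linear[OF l(1) bounded_linear_vec_nth[of j]], of \<phi>]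
    by (simp add: mult.commute)
  have "bounded_linear (\<lambda>M::real^'n^'m. M $ j $ i)"
    using bounded_linear_compose[OF bounded_linear_vec_nth bounded_linear_vec_nth] .
  then show "test_function \<Omega> \<phi> \<Longrightarrow> integrable lebesgue (\<lambda>x. G x $ j $ i * \<phi> x)"
    using integrable_test_locally_integrable[OF locally_integrable_bounded_linear[OF l(2)], of "\<lambda>M. M $ j $ i" \<phi>]
    by (simp add: mult.commute)
qed

lemma has_weak_gradient_unique:
  fixes u :: "real^'n::finite \<Rightarrow> real^'m::finite"
  assumes \<Omega>: "open \<Omega>" and G: "has_weak_gradient \<Omega> u G" and G': "has_weak_gradient \<Omega> u' G'"
    and eq: "AE x in lebesgue_on \<Omega>. u x = u' x"
  shows "AE x in lebesgue_on \<Omega>. G x = G' x"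
proof -
  have "AE x in lebesgue_on \<Omega>. G x $ j $ i - G' x $ j $ i = 0" for i j
  proof (rule fundamental_lemma[OF \<Omega>])
    have bl: "bounded_linear (\<lambda>M::real^'n^'m. M $ j $ i)"
      using bounded_linear_compose[OF bounded_linear_vec_nth bounded_linear_vec_nth] .
    have "locally_integrable \<Omega> (\<lambda>x. G x + (-1) *\<^sub>R G' x)"
      by (intro locally_integrable_add locally_integrable_scaleR has_weak_gradientD(2)[OF \<Omega> G] has_weak_gradientD(2)[OF \<Omega> G'])
    from locally_integrable_bounded_linear[OF this bl]
    show "locally_integrable \<Omega> (\<lambda>x. G x $ j $ i - G' x $ j $ i)" by simp
    fix \<phi> :: "real^'n \<Rightarrow> real" assume \<phi>: "test_function \<Omega> \<phi>"
    have "(\<integral>x. \<phi> x * (G x $ j $ i - G' x $ j $ i) \<partial>lebesgue) = (\<integral>x. G x $ j $ i * \<phi> x - G' x $ j $ i * \<phi> x \<partial>lebesgue)"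
      by (simp add: algebra_simps)
    also have "\<dots> = (\<integral>x. G x $ j $ i * \<phi> x \<partial>lebesgue) - (\<integral>x. G' x $ j $ i * \<phi> x \<partial>lebesgue)"
      using has_weak_gradientD(5)[OF \<Omega> G \<phi>] has_weak_gradientD(5)[OF \<Omega> G' \<phi>] by simp
    also have "\<dots> = (\<integral>x. u' x $ j * partial_deriv i \<phi> x \<partial>lebesgue) - (\<integral>x. u x $ j * partial_deriv i \<phi> x \<partial>lebesgue)"
      using has_weak_gradientD(3)[OF \<Omega> G \<phi>] has_weak_gradientD(3)[OF \<Omega> G' \<phi>] by simp
    also have "(\<integral>x. u' x $ j * partial_deriv i \<phi> x \<partial>lebesgue) = (\<integral>x. u x $ j * partial_deriv i \<phi> x \<partial>lebesgue)"
    proof (rule integral_cong_AE)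
      have t: "test_function \<Omega> (partial_deriv i \<phi>)" using test_function_partial_deriv[OF \<phi>] .
      show "(\<lambda>x. u' x $ j * partial_deriv i \<phi> x) \<in> borel_measurable lebesgue" "(\<lambda>x. u x $ j * partial_deriv i \<phi> x) \<in> borel_measurable lebesgue"
        using has_weak_gradientD(4)[OF \<Omega> G' t] has_weak_gradientD(4)[OF \<Omega> G t] by (auto simp: borel_measurable_integrable)
      have "AE x in lebesgue. x \<in> \<Omega> \<longrightarrow> u x = u' x" using eq by (simp add: AE_lebesgue_on_iff open_lebesgue[OF \<Omega>])
      then show "AE x in lebesgue. u' x $ j * partial_deriv i \<phi> x = u x $ j * partial_deriv i \<phi> x"
      proof eventually_elim
        case (elim x)
        then show ?case using test_functionD(6)[OF t, of x] by (cases "x \<in> \<Omega>") auto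
      qed
    qed
    finally show "(\<integral>x. \<phi> x * (G x $ j $ i - G' x $ j $ i) \<partial>lebesgue) = 0" by simp
  qed
  then have "AE x in lebesgue_on \<Omega>. \<forall>j\<in>UNIV. \<forall>i\<in>UNIV. G x $ j $ i - G' x $ j $ i = 0"
    by (intro AE_finite_allI) auto
  then show ?thesis by eventually_elim (auto simp: vec_eq_iff)
qed

lemma has_weak_gradient_mono:
  fixes u :: "real^'n::finite \<Rightarrow> real^'m::finite"
  assumes "has_weak_gradient \<Omega> u G" "open \<Omega>" "open \<Omega>'" "\<Omega>' \<subseteq> \<Omega>"
  shows "has_weak_gradient \<Omega>' u G"
  using assms unfolding has_weak_gradient_iff[OF assms(2)] has_weak_gradient_iff[OF assms(3)]
  by (meson locally_integrable_mono test_function_mono)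

lemma has_weak_gradient_cong:
  fixes u :: "real^'n::finite \<Rightarrow> real^'m::finite"
  assumes "has_weak_gradient \<Omega> u G" "\<And>x. x \<in> \<Omega> \<Longrightarrow> u' x = u x" "\<And>x. x \<in> \<Omega> \<Longrightarrow> G' x = G x"
  shows "has_weak_gradient \<Omega> u' G'"
proof -
  have "(LINT x|lebesgue_on \<Omega>. u' x $ j * p x) = (LINT x|lebesgue_on \<Omega>. u x $ j * p x)"
    "(LINT x|lebesgue_on \<Omega>. G' x $ j $ i * p x) = (LINT x|lebesgue_on \<Omega>. G x $ j $ i * p x)" for i j p
    using assms(2,3) by (auto intro!: Bochner_Integration.integral_cong simp: space_restrict_space)
  moreover have "locally_integrable \<Omega> u'" "locally_integrable \<Omega> G'"
    using assms locally_integrable_cong[of \<Omega> u' u] locally_integrable_cong[of \<Omega> G' G] by (auto simp: has_weak_gradient_def)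
  ultimately show ?thesis using assms(1) by (simp add: has_weak_gradient_def)
qed

lemma has_weak_gradient_add:
  fixes u :: "real^'n::finite \<Rightarrow> real^'m::finite"
  assumes \<Omega>: "open \<Omega>" and G: "has_weak_gradient \<Omega> u G" and G': "has_weak_gradient \<Omega> u' G'"
  shows "has_weak_gradient \<Omega> (\<lambda>x. u x + u' x) (\<lambda>x. G x + G' x)"
  unfolding has_weak_gradient_iff[OF \<Omega>]
proof (intro conjI allI impI)
  show "locally_integrable \<Omega> (\<lambda>x. u x + u' x)" "locally_integrable \<Omega> (\<lambda>x. G x + G' x)"
    using has_weak_gradientD(1,2)[OF \<Omega> G] has_weak_gradientD(1,2)[OF \<Omega> G'] by (auto intro: locally_integrable_add)
  fix \<phi> :: "real^'n \<Rightarrow> real" and i j assume \<phi>: "test_function \<Omega> \<phi>"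
  note t = test_function_partial_deriv[OF \<phi>, of i]
  show "(\<integral>x. (u x + u' x) $ j * partial_deriv i \<phi> x \<partial>lebesgue) = - (\<integral>x. (G x + G' x) $ j $ i * \<phi> x \<partial>lebesgue)"
    using has_weak_gradientD(3,5)[OF \<Omega> G \<phi>, of j i] has_weak_gradientD(3,5)[OF \<Omega> G' \<phi>, of j i]
      has_weak_gradientD(4)[OF \<Omega> G t, of j] has_weak_gradientD(4)[OF \<Omega> G' t, of j]
    by (simp add: distrib_right)
qed

lemma has_weak_gradient_scaleR:
  fixes u :: "real^'n::finite \<Rightarrow> real^'m::finite"
  assumes \<Omega>: "open \<Omega>" and G: "has_weak_gradient \<Omega> u G"
  shows "has_weak_gradient \<Omega> (\<lambda>x. c *\<^sub>R u x) (\<lambda>x. c *\<^sub>R G x)"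
  unfolding has_weak_gradient_iff[OF \<Omega>]
proof (intro conjI allI impI)
  show "locally_integrable \<Omega> (\<lambda>x. c *\<^sub>R u x)" "locally_integrable \<Omega> (\<lambda>x. c *\<^sub>R G x)"
    using has_weak_gradientD(1,2)[OF \<Omega> G] by (auto intro: locally_integrable_scaleR)
  fix \<phi> :: "real^'n \<Rightarrow> real" and i j assume \<phi>: "test_function \<Omega> \<phi>"
  show "(\<integral>x. (c *\<^sub>R u x) $ j * partial_deriv i \<phi> x \<partial>lebesgue) = - (\<integral>x. (c *\<^sub>R G x) $ j $ i * \<phi> x \<partial>lebesgue)"
    using has_weak_gradientD(3)[OF \<Omega> G \<phi>, of j i] by (simp add: mult.assoc)
qed

lemma has_weak_gradient_diff:
  fixes u :: "real^'n::finite \<Rightarrow> real^'m::finite"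
  assumes \<Omega>: "open \<Omega>" and G: "has_weak_gradient \<Omega> u G" and G': "has_weak_gradient \<Omega> u' G'"
  shows "has_weak_gradient \<Omega> (\<lambda>x. u x - u' x) (\<lambda>x. G x - G' x)"
  using has_weak_gradient_add[OF \<Omega> G has_weak_gradient_scaleR[OF \<Omega> G', of "-1"]] by simp

text \<open>Translation invariance in disguise: the convolution of \<phi> with the indicator of a
  large ball is constant near 0, where it equals the integral of \<phi>; its partial derivative at
  0, which is the integral of \<open>partial_deriv i \<phi>\<close>, therefore vanishes.\<close>

lemma integral_partial_deriv_eq_zero:
  fixes \<phi> :: "real^'n::finite \<Rightarrow> real"
  assumes \<phi>: "test_function UNIV \<phi>"
  shows "(\<integral>x. partial_deriv i \<phi> x \<partial>lebesgue) = 0"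
proof -
  obtain R where R: "R > 0" "\<And>x. x \<in> closure {x. \<phi> x \<noteq> 0} \<Longrightarrow> norm x \<le> R"
    using test_functionD(4)[OF \<phi>] compact_imp_bounded bounded_pos by metis
  have z: "\<phi> x = 0" "partial_deriv i \<phi> x = 0" if "norm x > R" for x
    using R(2)[of x] that closure_subset[of "{x. \<phi> x \<noteq> 0}"] support_partial_deriv[of i \<phi>] by auto
  define f where "f = (indicator (cball 0 (R + 1)) :: real^'n \<Rightarrow> real)"
  have f: "integrable lebesgue f"
    unfolding f_def using lmeasurable_cball[of 0 "R + 1"] by (auto simp: fmeasurable_def)
  have eq: "mollify \<psi> f x = (\<integral>y. \<psi> (x - y) \<partial>lebesgue)" if "\<And>x. norm x > R \<Longrightarrow> \<psi> x = 0" "norm x < 1" for \<psi> x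
  proof -
    have "\<psi> (x - y) *\<^sub>R f y = \<psi> (x - y)" for y
    proof (cases "norm y \<le> R + 1")
      case False
      then have "norm (x - y) > R" using that(2) norm_triangle_ineq2[of y x] by (simp add: norm_minus_commute)
      then show ?thesis using that(1) by simp
    qed (simp add: f_def)
    then show ?thesis unfolding mollify_def by (simp only:)
  qed
  have tr: "(\<integral>y. \<psi> (x - y) \<partial>lebesgue) = (\<integral>y. \<psi> y \<partial>lebesgue)" if "test_function UNIV \<psi>" for \<psi> :: "real^'n \<Rightarrow> real" and x
  proof -
    note b = integrable_test_function(3)[OF that]
    have "(\<integral>y. \<psi> (x - y) \<partial>lebesgue) = (\<integral>y. \<psi> (x - y) \<partial>lborel)"
      using b by (intro integral_completion) auto
    also have "\<dots> = (\<integral>y. \<psi> y \<partial>distr lborel borel (\<lambda>y. x - y))"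
      using b by (subst integral_distr) auto
    also have "\<dots> = (\<integral>y. \<psi> y \<partial>lborel)" by (simp only: distr_lborel_reflection)
    also have "\<dots> = (\<integral>y. \<psi> y \<partial>lebesgue)" using b by (intro integral_completion[symmetric]) auto
    finally show ?thesis .
  qed
  have c: "mollify \<phi> f x = (\<integral>y. \<phi> y \<partial>lebesgue)" if "norm x < 1" for x
    using eq[of \<phi> x] z(1) tr[OF \<phi>] that by simp
  have "((\<lambda>x. \<integral>y. \<phi> y \<partial>lebesgue) has_derivative (\<lambda>h. 0)) (at (0::real^'n))" by simp
  then have "(mollify \<phi> f has_derivative (\<lambda>h. 0)) (at 0)"
    by (rule has_derivative_transform_within_open[of _ _ _ _ "ball 0 1"]) (auto simp: c)
  from partial_deriv_eqI[OF this, of i] have "mollify (partial_deriv i \<phi>) f 0 = 0"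
    by (simp add: partial_deriv_mollify[OF f \<phi>])
  then show ?thesis using eq[of "partial_deriv i \<phi>" 0] z(2) tr[OF test_function_partial_deriv[OF \<phi>], of i 0] by simp
qed

lemma integrable_imp_locally_continuous:
  fixes f :: "real^'n::finite \<Rightarrow> 'b::euclidean_space"
  assumes "continuous_on UNIV f"
  shows "locally_integrable \<Omega> f"
  unfolding locally_integrable_def
proof (intro allI impI)
  fix K :: "(real^'n) set" assume K: "compact K \<and> K \<subseteq> \<Omega>"
  have "integrable lborel (\<lambda>x. indicator K x *\<^sub>R f x)"
    using K assms by (intro borel_integrable_compact) (auto intro: continuous_on_subset)
  moreover have "(\<lambda>x. indicator K x *\<^sub>R f x) \<in> borel_measurable borel"
    using K borel_measurable_continuous_onI[OF assms] by (auto intro!: borel_measurable_scaleR borel_measurable_indicator borel_compact)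
  ultimately show "integrable (lebesgue_on K) f"
    using K compact_lebesgue[of K] by (simp add: integrable_lebesgue_on_iff integrable_completion)
qed

lemma has_weak_gradient_const: "open \<Omega> \<Longrightarrow> has_weak_gradient \<Omega> (\<lambda>x. c) (\<lambda>x. 0)"
  for \<Omega> :: "(real^'n::finite) set" and c :: "real^'m::finite"
  using integral_partial_deriv_eq_zero[OF test_function_mono[of \<Omega> _ UNIV]]
  by (auto simp: has_weak_gradient_iff intro!: integrable_imp_locally_continuous)

definition jacobian :: "(real^'n::finite \<Rightarrow> real^'m::finite) \<Rightarrow> real^'n \<Rightarrow> real^'n^'m" where
  "jacobian f x = (\<chi> j i. partial_deriv i f x $ j)"

text \<open>The product of a test function with a component of \<open>f\<close> is again a test
  function, so the product rule and \<open>integral_partial_deriv_eq_zero\<close> give integration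
  by parts.\<close>

lemma has_weak_gradient_smooth:
  fixes f :: "real^'n::finite \<Rightarrow> real^'m::finite"
  assumes \<Omega>: "open \<Omega>" and f: "\<And>k. Ck k f"
  shows "has_weak_gradient \<Omega> f (jacobian f)"
  unfolding has_weak_gradient_iff[OF \<Omega>]
proof (intro conjI allI impI)
  have "Ck 0 f" "Ck (Suc 0) f" using f by blast+
  then have d: "\<And>x. f differentiable (at x)" and c: "continuous_on UNIV f" "\<And>i. continuous_on UNIV (partial_deriv i f)"
    by auto
  show "locally_integrable \<Omega> f" using c by (intro integrable_imp_locally_continuous)
  have "continuous_on UNIV (jacobian f)"
    unfolding jacobian_def by (intro continuous_on_vec_lambda continuous_on_component c)
  then show "locally_integrable \<Omega> (jacobian f)" by (rule integrable_imp_locally_continuous)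
  fix \<phi> :: "real^'n \<Rightarrow> real" and i j assume \<phi>: "test_function \<Omega> \<phi>"
  have fj: "Ck k (\<lambda>x. f x $ j)" for k using Ck_component[OF f] .
  have pfj: "Ck k (\<lambda>x. partial_deriv i f x $ j)" for k
    using f[of "Suc k"] by (intro Ck_component) simp
  have t: "test_function \<Omega> (\<lambda>x. \<phi> x * f x $ j)" using \<phi> fj by (rule test_function_mult)
  have t1: "test_function \<Omega> (\<lambda>x. \<phi> x * partial_deriv i f x $ j)" using \<phi> pfj by (rule test_function_mult)
  have t2: "test_function \<Omega> (\<lambda>x. partial_deriv i \<phi> x * f x $ j)"
    using test_function_partial_deriv[OF \<phi>] fj by (rule test_function_mult)
  have "partial_deriv i (\<lambda>x. \<phi> x * f x $ j) x = \<phi> x * partial_deriv i f x $ j + partial_deriv i \<phi> x * f x $ j" for x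
    using partial_deriv_scaleR[OF test_functionD(3)[OF \<phi>, of x] partial_deriv_component(2)[OF d[of x], of j], of i]
    unfolding partial_deriv_component(1)[OF d] by (simp only: real_scaleR_def)
  then have "0 = (\<integral>x. \<phi> x * partial_deriv i f x $ j + partial_deriv i \<phi> x * f x $ j \<partial>lebesgue)"
    using integral_partial_deriv_eq_zero[OF test_function_mono[OF t], of i] by simp
  also have "\<dots> = (\<integral>x. \<phi> x * partial_deriv i f x $ j \<partial>lebesgue) + (\<integral>x. partial_deriv i \<phi> x * f x $ j \<partial>lebesgue)"
    using integrable_test_function(2)[OF t1] integrable_test_function(2)[OF t2] by (rule Bochner_Integration.integral_add)
  finally show "(\<integral>x. f x $ j * partial_deriv i \<phi> x \<partial>lebesgue) = - (\<integral>x. jacobian f x $ j $ i * \<phi> x \<partial>lebesgue)"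
    by (simp add: jacobian_def mult.commute)
qed

text \<open>Outside the support of the cutoff \<open>\<eta>\<close> the product vanishes, whatever the values of \<open>u\<close> and \<open>G\<close>
  there; this extends a map from \<open>\<Omega>\<close> to the whole space.\<close>

lemma has_weak_gradient_cutoff:
  fixes u :: "real^'n::finite \<Rightarrow> real^'m::finite" and \<eta> :: "real^'n \<Rightarrow> real"
  assumes \<Omega>: "open \<Omega>" and G: "has_weak_gradient \<Omega> u G" and \<eta>: "test_function \<Omega> \<eta>"
  shows "has_weak_gradient UNIV (\<lambda>x. \<eta> x *\<^sub>R u x) (\<lambda>x. \<eta> x *\<^sub>R G x + (\<chi> j i. u x $ j * partial_deriv i \<eta> x))"
  unfolding has_weak_gradient_iff[OF open_UNIV]
proof (intro conjI allI impI)
  note l = has_weak_gradientD(1,2)[OF \<Omega> G]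
  note t\<eta> = test_function_partial_deriv[OF \<eta>]
  show "locally_integrable UNIV (\<lambda>x. \<eta> x *\<^sub>R u x)"
    by (intro locally_integrable_of_integrable integrable_test_locally_integrable[OF l(1) \<eta>])
  \<comment> \<open>The rank one matrix is split into its columns, each of which is a bounded linear
    image of the integrable map \<open>partial_deriv i \<eta> x *\<^sub>R u x\<close>.\<close>
  have "(\<lambda>x. (\<chi> j i. u x $ j * partial_deriv i \<eta> x) :: real^'n^'m) = (\<lambda>x. \<Sum>i\<in>UNIV. (\<chi> j. axis i ((partial_deriv i \<eta> x *\<^sub>R u x) $ j)))"
    by (auto simp: fun_eq_iff vec_eq_iff axis_def if_distrib cong: if_cong)
  moreover have "integrable lebesgue (\<lambda>x. \<Sum>i\<in>UNIV. (\<chi> j. axis i ((partial_deriv i \<eta> x *\<^sub>R u x) $ j)) :: real^'n^'m)"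
  proof (rule Bochner_Integration.integrable_sum)
    fix i
    have "linear (\<lambda>v::real^'m. (\<chi> j. axis i (v $ j)) :: real^'n^'m)"
      by (rule linearI) (auto simp: vec_eq_iff axis_def)
    then have "bounded_linear (\<lambda>v::real^'m. (\<chi> j. axis i (v $ j)) :: real^'n^'m)"
      by (simp add: linear_conv_bounded_linear)
    from integrable_bounded_linear[OF this integrable_test_locally_integrable[OF l(1) t\<eta>[of i]]]
    show "integrable lebesgue (\<lambda>x. (\<chi> j. axis i ((partial_deriv i \<eta> x *\<^sub>R u x) $ j)) :: real^'n^'m)" by simp
  qed
  ultimately have "integrable lebesgue (\<lambda>x. (\<chi> j i. u x $ j * partial_deriv i \<eta> x) :: real^'n^'m)" by metis
  then show "locally_integrable UNIV (\<lambda>x. \<eta> x *\<^sub>R G x + (\<chi> j i. u x $ j * partial_deriv i \<eta> x))"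
    by (intro locally_integrable_add locally_integrable_of_integrable integrable_test_locally_integrable[OF l(2) \<eta>])
  fix \<phi> :: "real^'n \<Rightarrow> real" and i j assume \<phi>: "test_function UNIV \<phi>"
  have t: "test_function \<Omega> (\<lambda>x. \<eta> x * \<phi> x)" by (rule test_function_mult[OF \<eta> test_functionD(1)[OF \<phi>]])
  have t1: "test_function \<Omega> (\<lambda>x. partial_deriv i \<eta> x * \<phi> x)" by (rule test_function_mult[OF t\<eta> test_functionD(1)[OF \<phi>]])
  have t2: "test_function \<Omega> (\<lambda>x. \<eta> x * partial_deriv i \<phi> x)"
    by (rule test_function_mult[OF \<eta> test_functionD(1)[OF test_function_partial_deriv[OF \<phi>]]])
  have p: "partial_deriv i (\<lambda>x. \<eta> x * \<phi> x) x = \<eta> x * partial_deriv i \<phi> x + partial_deriv i \<eta> x * \<phi> x" for x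
    using partial_deriv_scaleR[OF test_functionD(3)[OF \<eta>] test_functionD(3)[OF \<phi>], of i x] by simp
  have "(\<integral>x. u x $ j * (\<eta> x * partial_deriv i \<phi> x) \<partial>lebesgue) + (\<integral>x. u x $ j * (partial_deriv i \<eta> x * \<phi> x) \<partial>lebesgue)
      = (\<integral>x. u x $ j * partial_deriv i (\<lambda>x. \<eta> x * \<phi> x) x \<partial>lebesgue)"
    unfolding p using has_weak_gradientD(4)[OF \<Omega> G t1, of j] has_weak_gradientD(4)[OF \<Omega> G t2, of j]
    by (simp add: distrib_left)
  also have "\<dots> = - (\<integral>x. G x $ j $ i * (\<eta> x * \<phi> x) \<partial>lebesgue)"
    by (rule has_weak_gradientD(3)[OF \<Omega> G t])
  finally have "(\<integral>x. u x $ j * (\<eta> x * partial_deriv i \<phi> x) \<partial>lebesgue)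
      = - ((\<integral>x. G x $ j $ i * (\<eta> x * \<phi> x) \<partial>lebesgue) + (\<integral>x. u x $ j * (partial_deriv i \<eta> x * \<phi> x) \<partial>lebesgue))" by simp
  also have "\<dots> = - (\<integral>x. G x $ j $ i * (\<eta> x * \<phi> x) + u x $ j * (partial_deriv i \<eta> x * \<phi> x) \<partial>lebesgue)"
    using has_weak_gradientD(4)[OF \<Omega> G t1, of j] has_weak_gradientD(5)[OF \<Omega> G t, of j i]
    by (subst Bochner_Integration.integral_add) auto
  finally show "(\<integral>x. (\<eta> x *\<^sub>R u x) $ j * partial_deriv i \<phi> x \<partial>lebesgue)
      = - (\<integral>x. (\<eta> x *\<^sub>R G x + (\<chi> j i. u x $ j * partial_deriv i \<eta> x)) $ j $ i * \<phi> x \<partial>lebesgue)"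
    by (simp add: algebra_simps)
qed

lemma W12D:
  fixes u :: "real^'n::finite \<Rightarrow> real^'m::finite"
  assumes "open \<Omega>" "u \<in> W12 \<Omega>"
  shows "L2 \<Omega> u" "has_weak_gradient \<Omega> u (weak_gradient \<Omega> u)" "L2 \<Omega> (weak_gradient \<Omega> u)"
proof -
  obtain G where G: "has_weak_gradient \<Omega> u G" "L2 \<Omega> G" and u: "L2 \<Omega> u"
    using assms(2) by (auto simp: W12_def)
  show "L2 \<Omega> u" by fact
  show h: "has_weak_gradient \<Omega> u (weak_gradient \<Omega> u)"
    unfolding weak_gradient_def by (rule someI[of "has_weak_gradient \<Omega> u", OF G(1)])
  have "AE x in lebesgue_on \<Omega>. weak_gradient \<Omega> u x = G x"
    using has_weak_gradient_unique[OF assms(1) h G(1)] by simp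
  then show "L2 \<Omega> (weak_gradient \<Omega> u)"
    by (intro L2_bound[OF G(2)] measurable_of_locally_integrable[OF assms(1)] has_weak_gradientD(2)[OF assms(1) h])
       (auto elim: eventually_mono)
qed

lemma W12I: "L2 \<Omega> u \<Longrightarrow> has_weak_gradient \<Omega> u G \<Longrightarrow> L2 \<Omega> G \<Longrightarrow> u \<in> W12 \<Omega>"
  by (auto simp: W12_def)

lemma weak_gradient_AE:
  fixes u :: "real^'n::finite \<Rightarrow> real^'m::finite"
  assumes "open \<Omega>" "has_weak_gradient \<Omega> u G"
  shows "AE x in lebesgue_on \<Omega>. weak_gradient \<Omega> u x = G x"
proof -
  have "has_weak_gradient \<Omega> u (weak_gradient \<Omega> u)"
    unfolding weak_gradient_def by (rule someI[of "has_weak_gradient \<Omega> u", OF assms(2)])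
  then show ?thesis using has_weak_gradient_unique[OF assms(1) _ assms(2)] by simp
qed

lemma W12_add:
  fixes u :: "real^'n::finite \<Rightarrow> real^'m::finite"
  assumes "open \<Omega>" "u \<in> W12 \<Omega>" "v \<in> W12 \<Omega>"
  shows "(\<lambda>x. u x + v x) \<in> W12 \<Omega>"
  using W12D[OF assms(1,2)] W12D[OF assms(1,3)] assms(1) by (blast intro: W12I L2_add has_weak_gradient_add)

lemma W12_scaleR:
  fixes u :: "real^'n::finite \<Rightarrow> real^'m::finite"
  assumes "open \<Omega>" "u \<in> W12 \<Omega>"
  shows "(\<lambda>x. c *\<^sub>R u x) \<in> W12 \<Omega>"
  using W12D[OF assms] assms(1) by (blast intro: W12I L2_scaleR has_weak_gradient_scaleR)

lemma W12_diff:
  fixes u :: "real^'n::finite \<Rightarrow> real^'m::finite"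
  assumes "open \<Omega>" "u \<in> W12 \<Omega>" "v \<in> W12 \<Omega>"
  shows "(\<lambda>x. u x - v x) \<in> W12 \<Omega>"
  using W12D[OF assms(1,2)] W12D[OF assms(1,3)] assms(1) by (blast intro: W12I L2_diff has_weak_gradient_diff)

section \<open>Null sequences in \<open>ennreal\<close>, restricted seminorms, Borel
  representatives\<close>

lemma ennreal_tendsto_zero_iff:
  "((f :: nat \<Rightarrow> ennreal) \<longlonglongrightarrow> 0) \<longleftrightarrow> (\<forall>e>0. \<forall>\<^sub>F k in sequentially. f k \<le> ennreal e)"
proof
  assume f: "f \<longlonglongrightarrow> 0"
  show "\<forall>e>0. \<forall>\<^sub>F k in sequentially. f k \<le> ennreal e"
  proof (intro allI impI)
    fix e :: real assume "e > 0"
    then have "\<forall>\<^sub>F k in sequentially. f k < ennreal e" using order_tendstoD(2)[OF f, of "ennreal e"] by simp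
    then show "\<forall>\<^sub>F k in sequentially. f k \<le> ennreal e" by eventually_elim simp
  qed
next
  assume f: "\<forall>e>0. \<forall>\<^sub>F k in sequentially. f k \<le> ennreal e"
  show "f \<longlonglongrightarrow> 0"
  proof (rule order_tendstoI)
    fix a :: ennreal assume "0 < a"
    then obtain b where b: "0 < b" "b < a" using dense by blast
    then have bt: "b < top" using top.not_eq_extremum by fastforce
    define e where "e = enn2real b"
    have e: "ennreal e = b" "e > 0"
      using b bt by (auto simp: e_def enn2real_positive_iff)
    have "\<forall>\<^sub>F k in sequentially. f k \<le> ennreal e" using f e(2) by blast
    then show "\<forall>\<^sub>F k in sequentially. f k < a" by eventually_elim (use e b in auto)
  qed simp
qed

lemma tendsto_zero_le_ennreal:
  fixes f g :: "nat \<Rightarrow> ennreal"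
  assumes "g \<longlonglongrightarrow> 0" "\<And>k. f k \<le> g k"
  shows "f \<longlonglongrightarrow> 0"
  by (rule tendsto_sandwich[OF _ _ tendsto_const assms(1)]) (use assms(2) in auto)

lemma sqn_restrict:
  assumes "S \<in> sets lebesgue"
  shows "sqn (lebesgue_on S) f = (\<integral>\<^sup>+x. ennreal ((norm (f x))\<^sup>2) * indicator S x \<partial>lebesgue)"
  unfolding sqn_def using assms by (simp add: nn_integral_restrict_space)

lemma sqn_restrict_mono:
  assumes "S \<in> sets lebesgue" "T \<in> sets lebesgue" "S \<subseteq> T"
  shows "sqn (lebesgue_on S) f \<le> sqn (lebesgue_on T) f"
  unfolding sqn_restrict[OF assms(1)] sqn_restrict[OF assms(2)]
  using assms(3) by (intro nn_integral_mono) (auto simp: indicator_def)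

lemma sqn_restrict_support:
  assumes "S \<in> sets lebesgue" "\<And>x. x \<notin> S \<Longrightarrow> f x = 0"
  shows "sqn (lebesgue_on S) f = sqn lebesgue f"
  unfolding sqn_restrict[OF assms(1)] unfolding sqn_def
  using assms(2) by (intro nn_integral_cong) (auto simp: indicator_def)

text \<open>Assembled from representatives of the finitely many coordinates. It gives access to
  \<open>lborel\<close>, where translations, reflections and Fubini are available.\<close>

lemma borel_representative:
  fixes f :: "'a::euclidean_space \<Rightarrow> 'b::euclidean_space"
  assumes "f \<in> borel_measurable lebesgue"
  obtains g where "g \<in> borel_measurable borel" "AE x in lebesgue. f x = g x"
proof -
  have "\<exists>h\<in>borel_measurable lborel. AE x in lborel. f x \<bullet> b = h x" for b
    using assms by (intro completion_ex_borel_measurable_real) auto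
  then obtain h where h: "\<And>b. h b \<in> borel_measurable lborel" "\<And>b. AE x in lborel. f x \<bullet> b = h b x" by metis
  show ?thesis
  proof (rule that[of "\<lambda>x. \<Sum>b\<in>Basis. h b x *\<^sub>R b"])
    have [measurable]: "h b \<in> borel_measurable borel" for b using h(1) by simp
    show "(\<lambda>x. \<Sum>b\<in>Basis. h b x *\<^sub>R b) \<in> borel_measurable borel" by measurable
    have "AE x in lborel. \<forall>b\<in>Basis. f x \<bullet> b = h b x" using h(2) by (intro AE_finite_allI) auto
    then have "AE x in lborel. f x = (\<Sum>b\<in>Basis. h b x *\<^sub>R b)"
    proof eventually_elim
      case (elim x)
      then show ?case using euclidean_representation[of "f x"] by simp
    qed
    then show "AE x in lebesgue. f x = (\<Sum>b\<in>Basis. h b x *\<^sub>R b)" by (rule AE_completion)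
  qed
qed

section \<open>Mollification of Sobolev maps\<close>

lemma mollify_cong_AE:
  fixes f :: "real^'n::finite \<Rightarrow> 'b::euclidean_space"
  assumes f: "integrable lebesgue f" and g: "g \<in> borel_measurable lebesgue" and eq: "AE x in lebesgue. f x = g x"
    and \<rho>: "test_function UNIV (\<rho> :: real^'n \<Rightarrow> real)"
  shows "mollify \<rho> f = mollify \<rho> g"
proof
  fix x
  have "integrable lebesgue g" by (rule integrable_cong_AE_imp[OF f g eq])
  then have "(\<lambda>y. \<rho> (x - y) *\<^sub>R g y) \<in> borel_measurable lebesgue"
    by (intro borel_measurable_integrable integrable_test_scaleR(2)[OF _ \<rho>])
  then show "mollify \<rho> f x = mollify \<rho> g x"
    unfolding mollify_def using integrable_test_scaleR(2)[OF f \<rho>, of x] eq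
    by (intro integral_cong_AE) (auto elim: eventually_mono)
qed

lemma sqn_lebesgue_lborel:
  fixes g :: "'a::euclidean_space \<Rightarrow> 'b::euclidean_space"
  assumes "AE x in lebesgue. f x = g x"
  shows "sqn lebesgue f = sqn lborel g"
proof -
  have "sqn lebesgue f = sqn lebesgue g" using assms by (intro sqn_cong_AE) (auto elim: eventually_mono)
  then show ?thesis by (simp add: sqn_def nn_integral_completion)
qed

lemma sqn_mollify_le:
  fixes f :: "real^'n::finite \<Rightarrow> 'b::euclidean_space"
  assumes f: "integrable lborel f" and \<epsilon>: "\<epsilon> > 0"
    and B: "\<And>y. norm y \<le> \<epsilon> \<Longrightarrow> sqn lborel (\<lambda>x. f (x - y) - f x) \<le> B"
  shows "sqn lborel (\<lambda>x. mollify (mollifier \<epsilon>) f x - f x) \<le> B"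
proof -
  note m = mollifier[OF \<epsilon>, where ?'n='n]
  obtain C where C: "\<And>x. norm (mollifier \<epsilon> (x::real^'n)) \<le> C"
    using test_function_bounded[OF m(1)] by blast
  show ?thesis
  proof (rule sqn_mollify_diff_le[OF f _ m(2) _ m(4) _ B])
    show "(mollifier \<epsilon> :: real^'n \<Rightarrow> real) \<in> borel_measurable borel" using integrable_test_function(3)[OF m(1)] .
    show "mollifier \<epsilon> (y::real^'n) \<le> C" for y using C[of y] by simp
    show "mollifier \<epsilon> y = 0" if "norm y > \<epsilon>" for y :: "real^'n" using m(3) that by simp
  qed
qed

lemma sqn_mollify_tendsto:
  fixes f :: "real^'n::finite \<Rightarrow> 'b::euclidean_space"
  assumes f: "integrable lebesgue f" and L: "L2 UNIV f" and \<epsilon>: "\<And>k. \<epsilon> k > 0" "\<epsilon> \<longlonglongrightarrow> 0"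
  shows "(\<lambda>k. sqn lebesgue (\<lambda>x. mollify (mollifier (\<epsilon> k)) f x - f x)) \<longlonglongrightarrow> 0"
proof -
  obtain g where g: "g \<in> borel_measurable borel" and eq: "AE x in lebesgue. f x = g x"
    using borel_representative[of f] f by (auto simp: borel_measurable_integrable)
  have gl: "g \<in> borel_measurable lebesgue" using g by (intro measurable_completion) simp
  have "integrable lebesgue g" by (rule integrable_cong_AE_imp[OF f gl eq])
  then have ig: "integrable lborel g" using g by (simp add: integrable_completion)
  have fin: "sqn lborel g < \<infinity>"
    using L sqn_lebesgue_lborel[OF eq] by (simp add: L2_iff lebesgue_on_UNIV_eq)
  have s: "sqn lebesgue (\<lambda>x. mollify (mollifier (\<epsilon> k)) f x - f x) = sqn lborel (\<lambda>x. mollify (mollifier (\<epsilon> k)) g x - g x)" for k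
    using eq mollify_cong_AE[OF f gl eq mollifier(1)[OF \<epsilon>(1)]]
    by (intro sqn_lebesgue_lborel) (auto elim: eventually_mono)
  show ?thesis unfolding s ennreal_tendsto_zero_iff
  proof (intro allI impI)
    fix e :: real assume e: "e > 0"
    obtain d where d: "d > 0" "\<And>y. norm y \<le> d \<Longrightarrow> sqn lborel (\<lambda>x. g (x - y) - g x) \<le> ennreal e"
      using sqn_translation_continuous[OF g fin e] by blast
    have "\<forall>\<^sub>F k in sequentially. \<epsilon> k < d" using order_tendstoD(2)[OF \<epsilon>(2) d(1)] .
    then show "\<forall>\<^sub>F k in sequentially. sqn lborel (\<lambda>x. mollify (mollifier (\<epsilon> k)) g x - g x) \<le> ennreal e"
    proof eventually_elim
      case (elim k)
      show ?case by (rule sqn_mollify_le[OF ig \<epsilon>(1)]) (use d elim in auto)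
    qed
  qed
qed

text \<open>The reflected kernel \<open>y \<mapsto> \<rho> (x - y)\<close> is an admissible test
  function. Reflection changes the sign of its partial derivatives, and this sign cancels the one
  from integration by parts.\<close>

lemma jacobian_mollify:
  fixes f :: "real^'n::finite \<Rightarrow> real^'m::finite"
  assumes G: "has_weak_gradient UNIV f G" and f: "integrable lebesgue f" and iG: "integrable lebesgue G"
    and \<rho>: "test_function UNIV (\<rho> :: real^'n \<Rightarrow> real)"
  shows "jacobian (mollify \<rho> f) = mollify \<rho> G"
proof (rule ext, subst vec_eq_iff, intro allI, subst vec_eq_iff, intro allI)
  fix x j i
  define \<phi> where "\<phi> y = \<rho> (x - y)" for y
  have \<phi>: "test_function UNIV \<phi>" unfolding \<phi>_def using test_function_reflect[OF \<rho>] .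
  have p: "partial_deriv i \<phi> y = - partial_deriv i \<rho> (x - y)" for y
    using partial_deriv_affine(1)[of \<rho> x "-1" y i] test_functionD(3)[OF \<rho>] by (simp add: \<phi>_def[abs_def])
  have "jacobian (mollify \<rho> f) x $ j $ i = mollify (partial_deriv i \<rho>) f x $ j"
    by (simp add: jacobian_def partial_deriv_mollify[OF f \<rho>])
  also have "\<dots> = (\<integral>y. (partial_deriv i \<rho> (x - y) *\<^sub>R f y) $ j \<partial>lebesgue)"
    unfolding mollify_def
    using integral_bounded_linear[OF bounded_linear_vec_nth[of j] integrable_test_scaleR(2)[OF f test_function_partial_deriv[OF \<rho>]], of i x] by simp
  also have "\<dots> = - (\<integral>y. f y $ j * partial_deriv i \<phi> y \<partial>lebesgue)"
    by (simp add: p mult.commute)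
  also have "\<dots> = (\<integral>y. G y $ j $ i * \<phi> y \<partial>lebesgue)"
    using has_weak_gradientD(3)[OF open_UNIV G \<phi>] by simp
  also have "\<dots> = (\<integral>y. (\<rho> (x - y) *\<^sub>R G y) $ j $ i \<partial>lebesgue)"
    by (simp add: \<phi>_def mult.commute)
  also have "\<dots> = mollify \<rho> G x $ j $ i"
    unfolding mollify_def
    using integral_bounded_linear[OF bounded_linear_compose[OF bounded_linear_vec_nth[of i] bounded_linear_vec_nth[of j]]
      integrable_test_scaleR(2)[OF iG \<rho>], of x] by simp
  finally show "jacobian (mollify \<rho> f) x $ j $ i = mollify \<rho> G x $ j $ i" .
qed

lemma norm_matrix_vector_le:
  fixes A :: "real^'n::finite^'m::finite"
  shows "norm (\<chi> j. A $ j \<bullet> y) \<le> norm A * norm y"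
proof (rule power2_le_imp_le)
  have n: "(norm v)\<^sup>2 = (\<Sum>j\<in>UNIV. (norm (v $ j))\<^sup>2)" for v :: "'c::real_inner^'m"
    by (simp add: norm_vec_def L2_set_def sum_nonneg)
  have "(norm (\<chi> j. A $ j \<bullet> y))\<^sup>2 = (\<Sum>j\<in>UNIV. (A $ j \<bullet> y)\<^sup>2)"
    unfolding n by simp
  also have "\<dots> \<le> (\<Sum>j\<in>UNIV. (norm (A $ j))\<^sup>2 * (norm y)\<^sup>2)"
    using Cauchy_Schwarz_ineq by (intro sum_mono) (simp add: power2_norm_eq_inner)
  also have "\<dots> = (norm A * norm y)\<^sup>2"
    by (simp only: power_mult_distrib n[of A] sum_distrib_right)
  finally show "(norm (\<chi> j. A $ j \<bullet> y))\<^sup>2 \<le> (norm A * norm y)\<^sup>2" .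
qed auto

text \<open>The increment \<open>g (x - y) - g x\<close> is the average over \<open>t\<close> in the
  unit interval of a directional derivative at \<open>x - t *\<^sub>R y\<close>. Jensen and Fubini
  reduce the claim to the seminorm of a translated derivative, which does not depend on
  \<open>t\<close>.\<close>

lemma sqn_translation_smooth:
  fixes g :: "real^'n::finite \<Rightarrow> real^'m::finite"
  assumes g: "test_function UNIV g"
  shows "sqn lborel (\<lambda>x. g (x - y) - g x) \<le> ennreal ((norm y)\<^sup>2) * sqn lborel (jacobian g)"
proof -
  note pg = test_functionD(2)[OF test_function_partial_deriv[OF g]]
  have mg[measurable]: "partial_deriv i g \<in> borel_measurable borel" for i
    using pg by (rule borel_measurable_continuous_onI)
  have cj: "continuous_on UNIV (jacobian g)"
    unfolding jacobian_def by (intro continuous_on_vec_lambda continuous_on_component pg)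
  have mj[measurable]: "jacobian g \<in> borel_measurable borel" using cj by (rule borel_measurable_continuous_onI)
  define D where "D x = (\<Sum>i\<in>UNIV. (- y) $ i *\<^sub>R partial_deriv i g x)" for x
  have mD[measurable]: "D \<in> borel_measurable borel" unfolding D_def by measurable
  have cD: "continuous_on UNIV D" unfolding D_def by (intro continuous_intros pg)
  have Dle: "norm (D x) \<le> norm (jacobian g x) * norm y" for x
  proof -
    have "D x = (\<chi> j. jacobian g x $ j \<bullet> (- y))"
      by (simp add: D_def vec_eq_iff jacobian_def inner_vec_def sum_negf mult.commute)
    then show ?thesis using norm_matrix_vector_le[of "jacobian g x" "- y"] by simp
  qed
  define M where "M = density lborel (\<lambda>t. ennreal (indicator {0..1::real} t))"
  have [measurable_cong]: "sets M = sets borel" by (simp add: M_def)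
  have sp: "emeasure M (space M) = 1" by (simp add: M_def emeasure_density ennreal_indicator)
  interpret M: finite_measure M by (rule finite_measureI) (simp add: sp)
  interpret P: pair_sigma_finite M lborel ..
  have ftc: "integrable M (\<lambda>t. D (x - t *\<^sub>R y))" "(\<integral>t. D (x - t *\<^sub>R y) \<partial>M) = g (x - y) - g x" for x
  proof -
    have "has_bochner_integral lborel (\<lambda>t. indicator {0..1} t *\<^sub>R D (x - t *\<^sub>R y)) (g (x - 1 *\<^sub>R y) - g (x - 0 *\<^sub>R y))"
    proof (rule has_bochner_integral_FTC_Icc)
      fix t :: real
      have "((\<lambda>t. x - t *\<^sub>R y) has_derivative (\<lambda>s. s *\<^sub>R (- y))) (at t within {0..1})"
        by (auto intro!: derivative_eq_intros)
      from has_derivative_compose[OF this has_derivative_partial_deriv[OF test_functionD(3)[OF g]]]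
      show "((\<lambda>t. g (x - t *\<^sub>R y)) has_vector_derivative D (x - t *\<^sub>R y)) (at t within {0..1})"
        by (simp add: has_vector_derivative_def D_def scaleR_sum_right)
    next
      show "continuous_on {0..1} (\<lambda>t. D (x - t *\<^sub>R y))"
        by (intro continuous_on_compose2[OF cD] continuous_intros) auto
    qed simp
    then have b: "integrable lborel (\<lambda>t. indicator {0..1} t *\<^sub>R D (x - t *\<^sub>R y))"
      "(\<integral>t. indicator {0..1} t *\<^sub>R D (x - t *\<^sub>R y) \<partial>lborel) = g (x - y) - g x"
      by (auto simp: has_bochner_integral_iff)
    show "integrable M (\<lambda>t. D (x - t *\<^sub>R y))" unfolding M_def by (subst integrable_density) (use b in auto)
    show "(\<integral>t. D (x - t *\<^sub>R y) \<partial>M) = g (x - y) - g x" unfolding M_def by (subst integral_density) (use b in auto)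
  qed
  have "sqn lborel (\<lambda>x. g (x - y) - g x) \<le> (\<integral>\<^sup>+x. (\<integral>\<^sup>+t. ennreal ((norm (D (x - t *\<^sub>R y)))\<^sup>2) \<partial>M) \<partial>lborel)"
    unfolding sqn_def using norm_integral_sq_le[OF sp ftc(1)] by (intro nn_integral_mono) (simp add: ftc(2))
  also have "\<dots> = (\<integral>\<^sup>+t. (\<integral>\<^sup>+x. ennreal ((norm (D (x - t *\<^sub>R y)))\<^sup>2) \<partial>lborel) \<partial>M)"
    by (rule P.Fubini') measurable
  also have "\<dots> = (\<integral>\<^sup>+t. sqn lborel D \<partial>M)"
    using sqn_translation[OF mD] by (simp add: sqn_def)
  also have "\<dots> = sqn lborel D" using sp by simp
  also have "\<dots> \<le> (\<integral>\<^sup>+x. ennreal ((norm y)\<^sup>2) * ennreal ((norm (jacobian g x))\<^sup>2) \<partial>lborel)"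
    unfolding sqn_def
  proof (rule nn_integral_mono)
    fix x
    have "(norm (D x))\<^sup>2 \<le> (norm (jacobian g x) * norm y)\<^sup>2" by (rule power_mono[OF Dle]) simp
    then show "ennreal ((norm (D x))\<^sup>2) \<le> ennreal ((norm y)\<^sup>2) * ennreal ((norm (jacobian g x))\<^sup>2)"
      by (simp add: ennreal_mult[symmetric] power_mult_distrib mult.commute ennreal_leI)
  qed
  also have "\<dots> = ennreal ((norm y)\<^sup>2) * sqn lborel (jacobian g)"
    unfolding sqn_def by (rule nn_integral_cmult) measurable
  finally show ?thesis .
qed

lemma L2_test_function:
  fixes \<psi> :: "real^'n::finite \<Rightarrow> 'b::euclidean_space"
  assumes "test_function \<Omega> \<psi>"
  shows "L2 UNIV \<psi>"
proof -
  obtain C where C: "C > 0" "\<And>x. norm (\<psi> x) \<le> C" using test_function_bounded[OF assms] by blast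
  define K where "K = closure {x. \<psi> x \<noteq> 0}"
  have K: "compact K" using test_functionD(4)[OF assms] by (simp add: K_def)
  have m: "\<psi> \<in> borel_measurable lebesgue" by (rule borel_measurable_integrable[OF integrable_test_function(2)[OF assms]])
  have "L2 K \<psi>"
  proof (rule L2_bounded)
    show "\<psi> \<in> borel_measurable (lebesgue_on K)" using m by (rule measurable_restrict_space1)
    show "K \<in> lmeasurable" using K by (rule lmeasurable_compact)
    show "AE x in lebesgue_on K. norm (\<psi> x) \<le> C" using C by (intro AE_I2)
  qed
  moreover have "\<psi> x = 0" if "x \<notin> K" for x
    using that closure_subset[of "{x. \<psi> x \<noteq> 0}"] by (auto simp: K_def)
  ultimately have "sqn lebesgue \<psi> < \<infinity>"
    using sqn_restrict_support[OF compact_lebesgue[OF K], of \<psi>] by (simp add: L2_iff)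
  then show ?thesis using m by (simp add: L2_iff lebesgue_on_UNIV_eq)
qed

text \<open>The weak gradient is a closed operator: both sides of the integration by parts formula
  are pairings with a fixed test function, hence continuous in \<open>L\<^sup>2\<close>.\<close>

lemma has_weak_gradient_limit:
  fixes u :: "real^'n::finite \<Rightarrow> real^'m::finite"
  assumes \<Omega>: "open \<Omega>" and u: "L2 \<Omega> u" "L2 \<Omega> G"
    and uk: "\<And>k. L2 \<Omega> (f k)" "\<And>k. L2 \<Omega> (F k)" "\<And>k. has_weak_gradient \<Omega> (f k) (F k)"
    and lim: "(\<lambda>k. sqn (lebesgue_on \<Omega>) (\<lambda>x. f k x - u x)) \<longlonglongrightarrow> 0"
      "(\<lambda>k. sqn (lebesgue_on \<Omega>) (\<lambda>x. F k x - G x)) \<longlonglongrightarrow> 0"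
  shows "has_weak_gradient \<Omega> u G"
  unfolding has_weak_gradient_def
proof (intro conjI allI impI)
  show "locally_integrable \<Omega> u" "locally_integrable \<Omega> G"
    using u open_lebesgue[OF \<Omega>] by (auto intro: L2_locally_integrable)
  fix \<phi> :: "real^'n \<Rightarrow> real" and i j assume \<phi>: "test_function \<Omega> \<phi>"
  have L2test: "L2 \<Omega> \<psi>" if "test_function \<Omega> \<psi>" for \<psi> :: "real^'n \<Rightarrow> real"
    using L2_mono[OF L2_test_function[OF that], of \<Omega>] open_lebesgue[OF \<Omega>] by simp
  \<comment> \<open>A general functional \<open>L\<close> of norm at most 1 covers both the
    components of \<open>f k\<close> and the matrix entries of \<open>F k\<close>.\<close>
  have conv: "(\<lambda>k. LINT x|lebesgue_on \<Omega>. L (h k x) * \<psi> x) \<longlonglongrightarrow> (LINT x|lebesgue_on \<Omega>. L (h0 x) * \<psi> x)"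
    if h: "\<And>k. L2 \<Omega> (h k)" "L2 \<Omega> h0" "(\<lambda>k. sqn (lebesgue_on \<Omega>) (\<lambda>x. h k x - h0 x)) \<longlonglongrightarrow> 0"
      and L: "bounded_linear L" "\<And>v. \<bar>L v\<bar> \<le> norm v" and \<psi>: "test_function \<Omega> \<psi>"
    for h :: "nat \<Rightarrow> real^'n \<Rightarrow> 'z::euclidean_space" and h0 L and \<psi> :: "real^'n \<Rightarrow> real"
  proof -
    have L2L: "L2 \<Omega> (\<lambda>x. L (v x))" if "L2 \<Omega> v" for v
      by (rule L2_bound[OF that])
         (use L2_measurable[OF that] L in \<open>auto intro: borel_measurable_continuous_on linear_continuous_on\<close>)
    define a where "a k = sqrt (LINT x|lebesgue_on \<Omega>. (norm (h k x - h0 x))\<^sup>2)" for k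
    define b where "b = sqrt (LINT x|lebesgue_on \<Omega>. (norm (\<psi> x))\<^sup>2)"
    have d: "L2 \<Omega> (\<lambda>x. h k x - h0 x)" for k using h by (intro L2_diff)
    have "(\<lambda>k. enn2real (sqn (lebesgue_on \<Omega>) (\<lambda>x. h k x - h0 x))) \<longlonglongrightarrow> 0"
      using tendsto_enn2real[OF h(3)[folded ennreal_0]] by simp
    then have "(\<lambda>k. LINT x|lebesgue_on \<Omega>. (norm (h k x - h0 x))\<^sup>2) \<longlonglongrightarrow> 0"
      by (simp add: sqn_eq_integral[OF d])
    then have a: "a \<longlonglongrightarrow> 0" unfolding a_def using tendsto_real_sqrt[of _ 0] by simp
    have "\<bar>(LINT x|lebesgue_on \<Omega>. L (h k x) * \<psi> x) - (LINT x|lebesgue_on \<Omega>. L (h0 x) * \<psi> x)\<bar> \<le> a k * b" for k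
    proof -
      have "(LINT x|lebesgue_on \<Omega>. L (h k x) * \<psi> x) - (LINT x|lebesgue_on \<Omega>. L (h0 x) * \<psi> x)
          = (LINT x|lebesgue_on \<Omega>. L (h k x) * \<psi> x - L (h0 x) * \<psi> x)"
        using integrable_inner_L2(1)[OF L2L[OF h(1)] L2test[OF \<psi>]] integrable_inner_L2(1)[OF L2L[OF h(2)] L2test[OF \<psi>]]
        by (subst Bochner_Integration.integral_diff) auto
      also have "\<dots> = (LINT x|lebesgue_on \<Omega>. L (h k x - h0 x) \<bullet> \<psi> x)"
        using L(1) by (simp add: bounded_linear.linear linear_diff left_diff_distrib)
      also have "\<bar>\<dots>\<bar> \<le> sqrt (LINT x|lebesgue_on \<Omega>. (norm (L (h k x - h0 x)))\<^sup>2) * b"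
        unfolding b_def by (rule inner_integral_L2_bound[OF L2L[OF d] L2test[OF \<psi>]])
      also have "\<dots> \<le> a k * b"
        unfolding a_def b_def using L2L[OF d] d L(2)
        by (intro mult_right_mono real_sqrt_le_mono integral_mono) (auto simp: L2_def abs_le_square_iff[symmetric])
      finally show ?thesis .
    qed
    then have le: "norm ((LINT x|lebesgue_on \<Omega>. L (h k x) * \<psi> x) - (LINT x|lebesgue_on \<Omega>. L (h0 x) * \<psi> x)) \<le> a k * b" for k
      by simp
    have "(\<lambda>k. a k * b) \<longlonglongrightarrow> 0" using tendsto_mult_right[OF a, of b] by simp
    then have "(\<lambda>k. (LINT x|lebesgue_on \<Omega>. L (h k x) * \<psi> x) - (LINT x|lebesgue_on \<Omega>. L (h0 x) * \<psi> x)) \<longlonglongrightarrow> 0"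
      by (rule Lim_null_comparison[OF always_eventually[OF allI[OF le]]])
    then show ?thesis by (simp add: LIM_zero_iff)
  qed
  have c1: "(\<lambda>k. LINT x|lebesgue_on \<Omega>. f k x $ j * partial_deriv i \<phi> x) \<longlonglongrightarrow> (LINT x|lebesgue_on \<Omega>. u x $ j * partial_deriv i \<phi> x)"
    using component_le_norm_cart
    by (intro conv[OF uk(1) u(1) lim(1) bounded_linear_vec_nth _ test_function_partial_deriv[OF \<phi>]])
  have "\<bar>M $ j $ i\<bar> \<le> norm M" for M :: "real^'n^'m"
    using component_le_norm_cart[of "M $ j" i] Finite_Cartesian_Product.norm_nth_le[of M j] by linarith
  then have c2: "(\<lambda>k. LINT x|lebesgue_on \<Omega>. F k x $ j $ i * \<phi> x) \<longlonglongrightarrow> (LINT x|lebesgue_on \<Omega>. G x $ j $ i * \<phi> x)"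
    by (intro conv[OF uk(2) u(2) lim(2) bounded_linear_compose[OF bounded_linear_vec_nth bounded_linear_vec_nth] _ \<phi>])
  have "(LINT x|lebesgue_on \<Omega>. f k x $ j * partial_deriv i \<phi> x) = - (LINT x|lebesgue_on \<Omega>. F k x $ j $ i * \<phi> x)" for k
    using uk(3)[of k] \<phi> by (simp add: has_weak_gradient_def)
  then have "(\<lambda>k. LINT x|lebesgue_on \<Omega>. f k x $ j * partial_deriv i \<phi> x) \<longlonglongrightarrow> - (LINT x|lebesgue_on \<Omega>. G x $ j $ i * \<phi> x)"
    using tendsto_minus[OF c2] by simp
  then show "(LINT x|lebesgue_on \<Omega>. u x $ j * partial_deriv i \<phi> x) = - (LINT x|lebesgue_on \<Omega>. G x $ j $ i * \<phi> x)"
    using c1 LIMSEQ_unique by blast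
qed

section \<open>Completeness of \<open>L\<^sup>2\<close>\<close>

text \<open>The squared increments are summable even with weights \<open>4 ^ k\<close>, since 4/8 is
  less than 1. Almost everywhere the weighted series is finite, so the increments themselves are
  bounded by a multiple of \<open>(1/2) ^ k\<close>.\<close>

lemma AE_convergent_fast_Cauchy:
  fixes f :: "nat \<Rightarrow> 'a \<Rightarrow> 'b::euclidean_space"
  assumes [measurable]: "\<And>k. f k \<in> borel_measurable M"
    and fast: "\<And>k. sqn M (\<lambda>x. f (Suc k) x - f k x) \<le> ennreal ((1/8) ^ k)"
  shows "AE x in M. convergent (\<lambda>k. f k x)"
proof -
  define s where "s x = (\<Sum>k. ennreal (4 ^ k) * ennreal ((norm (f (Suc k) x - f k x))\<^sup>2))" for x
  have sm[measurable]: "s \<in> borel_measurable M" unfolding s_def by measurable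
  have "(\<integral>\<^sup>+x. s x \<partial>M) = (\<Sum>k. ennreal (4 ^ k) * sqn M (\<lambda>x. f (Suc k) x - f k x))"
    unfolding s_def sqn_def by (subst nn_integral_suminf) (simp_all add: nn_integral_cmult)
  also have "\<dots> \<le> (\<Sum>k. ennreal ((1/2) ^ k))"
  proof (rule suminf_le)
    fix k :: nat
    have "ennreal (4 ^ k) * sqn M (\<lambda>x. f (Suc k) x - f k x) \<le> ennreal (4 ^ k) * ennreal ((1/8) ^ k)"
      by (intro mult_left_mono fast) simp
    also have "\<dots> = ennreal ((1/2) ^ k)"
      by (simp add: ennreal_mult[symmetric] flip: power_mult_distrib)
    finally show "ennreal (4 ^ k) * sqn M (\<lambda>x. f (Suc k) x - f k x) \<le> ennreal ((1/2) ^ k)" .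
  qed auto
  also have "\<dots> = ennreal (\<Sum>k. (1/2) ^ k)" by (intro suminf_ennreal2) (auto intro: summable_geometric)
  finally have "(\<integral>\<^sup>+x. s x \<partial>M) \<noteq> \<infinity>" by (auto simp: top_unique)
  then have "AE x in M. s x \<noteq> \<infinity>" by (intro nn_integral_PInf_AE) auto
  then show ?thesis
  proof eventually_elim
    case (elim x)
    define K where "K = enn2real (s x)"
    have K: "s x = ennreal K" "K \<ge> 0" using elim by (auto simp: K_def less_top)
    have le: "norm (f (Suc k) x - f k x) \<le> sqrt K * (1/2) ^ k" for k
    proof -
      have "ennreal (4 ^ k) * ennreal ((norm (f (Suc k) x - f k x))\<^sup>2) \<le> s x"
        unfolding s_def using sum_le_suminf[of "\<lambda>k. ennreal (4 ^ k) * ennreal ((norm (f (Suc k) x - f k x))\<^sup>2)" "{k}"] by simp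
      then have "4 ^ k * (norm (f (Suc k) x - f k x))\<^sup>2 \<le> K"
        using K by (simp add: ennreal_mult[symmetric])
      moreover have four: "(4::real) ^ k = 2 ^ k * 2 ^ k" by (simp flip: power_mult_distrib)
      ultimately have "(2 ^ k * norm (f (Suc k) x - f k x))\<^sup>2 \<le> K"
        using four by (simp add: power_mult_distrib power2_eq_square mult_ac)
      then have "2 ^ k * norm (f (Suc k) x - f k x) \<le> sqrt K" by (rule real_le_rsqrt)
      then show ?thesis by (simp add: power_divide divide_simps mult.commute)
    qed
    have "summable (\<lambda>k. f (Suc k) x - f k x)"
      by (rule summable_comparison_test'[where g="\<lambda>k. sqrt K * (1/2) ^ k" and N=0])
         (use le in \<open>auto intro!: summable_mult summable_geometric\<close>)
    then have "convergent (\<lambda>n. \<Sum>k<n. f (Suc k) x - f k x)" by (simp add: summable_iff_convergent)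
    then have "convergent (\<lambda>n. f n x - f 0 x)" by (simp add: sum_lessThan_telescope[of "\<lambda>k. f k x"])
    then have "convergent (\<lambda>n. (f n x - f 0 x) + f 0 x)" by (intro convergent_add convergent_const)
    then show ?case by simp
  qed
qed

text \<open>The distance may change with the index \<open>m\<close>. With the distance over the ball
  of radius \<open>m\<close>, one subsequence is fast on all balls at the same time.\<close>

lemma fast_subsequence:
  assumes "\<And>e m. e > 0 \<Longrightarrow> \<exists>N. \<forall>i\<ge>N. \<forall>j\<ge>N. (d :: nat \<Rightarrow> nat \<Rightarrow> nat \<Rightarrow> ennreal) m i j \<le> ennreal e"
  obtains r where "strict_mono (r :: nat \<Rightarrow> nat)" "\<And>k i j. i \<ge> k \<Longrightarrow> j \<ge> k \<Longrightarrow> d k (r i) (r j) \<le> ennreal ((1/8) ^ k)"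
proof -
  have "\<forall>k. \<exists>N. \<forall>i\<ge>N. \<forall>j\<ge>N. d k i j \<le> ennreal ((1/8) ^ k)"
    using assms by simp
  then obtain N where N: "\<And>k i j. i \<ge> N k \<Longrightarrow> j \<ge> N k \<Longrightarrow> d k i j \<le> ennreal ((1/8) ^ k)" by metis
  \<comment> \<open>The sum dominates every \<open>N i\<close> with \<open>i \<le> k\<close>
    although \<open>N\<close> need not be monotone; the summand \<open>k\<close> makes
    \<open>r\<close> strictly increasing.\<close>
  define r where "r k = (\<Sum>i\<le>k. N i) + k" for k
  have "strict_mono r" unfolding strict_mono_Suc_iff by (simp add: r_def)
  moreover have "r i \<ge> N k" if "i \<ge> k" for i k
    using member_le_sum[of k "{..i}" N] that by (simp add: r_def)
  ultimately show ?thesis using that N by blast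
qed

text \<open>The Riesz-Fischer argument: a fast subsequence converges almost everywhere, and Fatou's
  lemma turns the Cauchy estimate into an estimate against the limit, for the full sequence.\<close>

lemma L2_complete:
  fixes f :: "nat \<Rightarrow> real^'n::finite \<Rightarrow> 'b::euclidean_space"
  assumes L: "\<And>k. L2 \<Omega> (f k)"
    and C: "\<And>e. e > 0 \<Longrightarrow> \<exists>N. \<forall>i\<ge>N. \<forall>j\<ge>N. sqn (lebesgue_on \<Omega>) (\<lambda>x. f i x - f j x) \<le> ennreal e"
  obtains h where "L2 \<Omega> h" "(\<lambda>k. sqn (lebesgue_on \<Omega>) (\<lambda>x. f k x - h x)) \<longlonglongrightarrow> 0"
proof -
  let ?M = "lebesgue_on \<Omega>"
  have [measurable]: "f k \<in> borel_measurable ?M" for k using L by (rule L2_measurable)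
  obtain r where r: "strict_mono (r :: nat \<Rightarrow> nat)"
    and rr: "\<And>k i j. i \<ge> k \<Longrightarrow> j \<ge> k \<Longrightarrow> sqn ?M (\<lambda>x. f (r i) x - f (r j) x) \<le> ennreal ((1/8) ^ k)"
    using fast_subsequence[of "\<lambda>m i j. sqn ?M (\<lambda>x. f i x - f j x)"] C by blast
  have conv: "AE x in ?M. convergent (\<lambda>k. f (r k) x)"
    by (rule AE_convergent_fast_Cauchy) (use rr in auto)
  define h where "h x = lim (\<lambda>k. f (r k) x)" for x
  have [measurable]: "h \<in> borel_measurable ?M" unfolding h_def by (rule borel_measurable_lim_metric) measurable
  have lim: "AE x in ?M. (\<lambda>k. f (r k) x) \<longlonglongrightarrow> h x"
    using conv by eventually_elim (simp add: h_def convergent_LIMSEQ_iff)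
  have le: "sqn ?M (\<lambda>x. f i x - h x) \<le> ennreal e" if N: "\<forall>i\<ge>N. \<forall>j\<ge>N. sqn ?M (\<lambda>x. f i x - f j x) \<le> ennreal e" "i \<ge> N" for i N e
  proof -
    have "sqn ?M (\<lambda>x. f i x - h x) = (\<integral>\<^sup>+x. liminf (\<lambda>k. ennreal ((norm (f i x - f (r k) x))\<^sup>2)) \<partial>?M)"
      unfolding sqn_def
    proof (rule nn_integral_cong_AE, use lim in eventually_elim)
      case (elim x)
      have "(\<lambda>k. ennreal ((norm (f i x - f (r k) x))\<^sup>2)) \<longlonglongrightarrow> ennreal ((norm (f i x - h x))\<^sup>2)"
        by (intro tendsto_ennrealI tendsto_intros elim)
      then show ?case using lim_imp_Liminf[OF sequentially_bot] by metis
    qed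
    also have "\<dots> \<le> liminf (\<lambda>k. sqn ?M (\<lambda>x. f i x - f (r k) x))"
      unfolding sqn_def by (rule nn_integral_liminf) measurable
    also have "\<dots> \<le> limsup (\<lambda>k. sqn ?M (\<lambda>x. f i x - f (r k) x))"
      by (rule Liminf_le_Limsup) simp
    also have "\<dots> \<le> ennreal e"
    proof (rule Limsup_bounded)
      show "\<forall>\<^sub>F k in sequentially. sqn ?M (\<lambda>x. f i x - f (r k) x) \<le> ennreal e"
        using eventually_ge_at_top[of N]
      proof eventually_elim
        case (elim k)
        have "r k \<ge> N" using elim seq_suble[OF r, of k] by linarith
        then show ?case using N by blast
      qed
    qed
    finally show ?thesis .
  qed
  have t: "(\<lambda>k. sqn ?M (\<lambda>x. f k x - h x)) \<longlonglongrightarrow> 0"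
    unfolding ennreal_tendsto_zero_iff
  proof (intro allI impI)
    fix e :: real assume "e > 0"
    then obtain N where "\<forall>i\<ge>N. \<forall>j\<ge>N. sqn ?M (\<lambda>x. f i x - f j x) \<le> ennreal e" using C by blast
    then have "sqn ?M (\<lambda>x. f k x - h x) \<le> ennreal e" if "k \<ge> N" for k using le that by blast
    then show "\<forall>\<^sub>F k in sequentially. sqn ?M (\<lambda>x. f k x - h x) \<le> ennreal e"
      by (rule eventually_sequentiallyI)
  qed
  obtain N where "\<forall>i\<ge>N. \<forall>j\<ge>N. sqn ?M (\<lambda>x. f i x - f j x) \<le> ennreal 1" using C[of 1] by auto
  then have "sqn ?M (\<lambda>x. f N x - h x) \<le> ennreal 1" using le by blast
  then have "sqn ?M (\<lambda>x. f N x - h x) < \<infinity>" by (metis ennreal_less_top infinity_ennreal_def order_le_less_trans)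
  then have "L2 \<Omega> (\<lambda>x. f N x - h x)" by (simp add: L2_iff)
  from L2_diff[OF L[of N] this] have "L2 \<Omega> h" by simp
  then show ?thesis using that t by blast
qed

section \<open>Compactly supported Sobolev maps\<close>

text \<open>Maps cut off by a smooth function. Compact support makes \<open>f\<close> and
  \<open>G\<close> integrable, as mollification requires, and allows work on the whole space, where
  translations act.\<close>

locale compact_sobolev =
  fixes f :: "real^'n::finite \<Rightarrow> real^'m::finite" and G S
  assumes grad: "has_weak_gradient UNIV f G" and S: "compact S"
    and f0: "\<And>x. x \<notin> S \<Longrightarrow> f x = 0" and G0: "\<And>x. x \<notin> S \<Longrightarrow> G x = 0"
    and fL2: "L2 UNIV f" and GL2: "L2 UNIV G"
begin

lemma integrable_f: "integrable lebesgue f" and integrable_G: "integrable lebesgue G"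
proof -
  have "(\<lambda>x. indicator S x *\<^sub>R f x) = f" "(\<lambda>x. indicator S x *\<^sub>R G x) = G"
    using f0 G0 by (auto simp: indicator_def fun_eq_iff)
  then show "integrable lebesgue f" "integrable lebesgue G"
    using locally_integrable_integrable_on_compact[OF has_weak_gradientD(1)[OF open_UNIV grad] S]
      locally_integrable_integrable_on_compact[OF has_weak_gradientD(2)[OF open_UNIV grad] S] by simp_all
qed

lemma test_function_mollify_f:
  assumes "\<epsilon> > 0"
  shows "test_function UNIV (mollify (mollifier \<epsilon>) f)"
  by (rule test_function_mollify[OF integrable_f mollifier(1)[OF assms] S f0, of \<epsilon>])
     (simp_all add: mollifier(3)[OF assms])

text \<open>The translation estimate for smooth maps is applied to mollifications \<open>h k\<close>
  of \<open>f\<close>, whose Jacobians are mollifications of \<open>G\<close>, and survives the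
  limit. The resulting bound depends on \<open>f\<close> only through its gradient, hence is uniform
  over families with bounded gradients, which is the source of compactness.\<close>

lemma sqn_mollify_diff_le_gradient:
  assumes \<epsilon>: "\<epsilon> > 0"
  shows "sqn lebesgue (\<lambda>x. mollify (mollifier \<epsilon>) f x - f x) \<le> ennreal (8 * \<epsilon>\<^sup>2) * sqn lebesgue G"
proof -
  obtain g where g[measurable]: "g \<in> borel_measurable borel" and eq: "AE x in lebesgue. f x = g x"
    using borel_representative[of f] integrable_f by (auto simp: borel_measurable_integrable)
  have gl: "g \<in> borel_measurable lebesgue" using g by (intro measurable_completion) simp
  have ig: "integrable lborel g"
    using integrable_cong_AE_imp[OF integrable_f gl eq] g by (simp add: integrable_completion)
  define \<delta> where "\<delta> k = 1 / real (Suc k)" for k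
  have \<delta>: "\<delta> k > 0" "\<delta> \<longlonglongrightarrow> 0" for k
    using LIMSEQ_inverse_real_of_nat by (auto simp: \<delta>_def[abs_def] inverse_eq_divide)
  define h where "h k = mollify (mollifier (\<delta> k)) f" for k
  have th: "test_function UNIV (h k)" for k unfolding h_def using test_function_mollify_f[OF \<delta>(1)] .
  note hm[measurable] = integrable_test_function(3)[OF th]
  have jh: "jacobian (h k) = mollify (mollifier (\<delta> k)) G" for k
    unfolding h_def by (rule jacobian_mollify[OF grad integrable_f integrable_G mollifier(1)[OF \<delta>(1)]])
  have jm: "jacobian (h k) \<in> borel_measurable borel" for k
  proof (rule borel_measurable_continuous_onI)
    show "continuous_on UNIV (jacobian (h k))"
      unfolding jacobian_def
      by (intro continuous_on_vec_lambda continuous_on_component test_functionD(2)[OF test_function_partial_deriv[OF th]])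
  qed
  then have jml: "jacobian (h k) \<in> borel_measurable lebesgue" for k by (intro measurable_completion) simp
  have 1: "(\<lambda>k. sqn lborel (\<lambda>x. h k x - g x)) \<longlonglongrightarrow> 0"
  proof -
    have "sqn lebesgue (\<lambda>x. h k x - f x) = sqn lborel (\<lambda>x. h k x - g x)" for k
      using eq by (intro sqn_lebesgue_lborel) (auto elim: eventually_mono)
    then show ?thesis using sqn_mollify_tendsto[OF integrable_f fL2 \<delta>] by (simp add: h_def)
  qed
  have 2: "(\<lambda>k. sqn lebesgue (\<lambda>x. jacobian (h k) x - G x)) \<longlonglongrightarrow> 0"
    unfolding jh by (rule sqn_mollify_tendsto[OF integrable_G GL2 \<delta>])
  have le: "sqn lborel (\<lambda>x. g (x - y) - g x) \<le> ennreal (8 * \<epsilon>\<^sup>2) * sqn lebesgue G" if y: "norm y \<le> \<epsilon>" for y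
  proof -
    \<comment> \<open>Collects the terms that vanish as \<open>k\<close> grows. In
      \<open>4 * \<epsilon>\<^sup>2\<close> one factor 2 comes from separating the increment of
      \<open>h k\<close>, the other from separating the error of its Jacobian; the 8 of the
      statement is only rounded up.\<close>
    define B where "B k = 8 * sqn lborel (\<lambda>x. h k x - g x) + ennreal (4 * \<epsilon>\<^sup>2) * sqn lebesgue (\<lambda>x. jacobian (h k) x - G x)" for k
    have "B \<longlonglongrightarrow> 8 * 0 + ennreal (4 * \<epsilon>\<^sup>2) * 0"
      unfolding B_def by (intro tendsto_add ennreal_tendsto_cmult 1 2) auto
    then have B: "B \<longlonglongrightarrow> 0" by simp
    have "sqn lborel (\<lambda>x. g (x - y) - g x) \<le> B k + ennreal (4 * \<epsilon>\<^sup>2) * sqn lebesgue G" for k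
    proof -
      have ma: "(\<lambda>x. g (x - y) - h k (x - y)) \<in> borel_measurable lborel" by measurable
      have mb: "(\<lambda>x. g x - h k x) \<in> borel_measurable lborel" by measurable
      have "sqn lborel (\<lambda>x. g (x - y) - g x)
          = sqn lborel (\<lambda>x. ((g (x - y) - h k (x - y)) - (g x - h k x)) + (h k (x - y) - h k x))" by (simp add: algebra_simps)
      also have "\<dots> \<le> 2 * sqn lborel (\<lambda>x. (g (x - y) - h k (x - y)) - (g x - h k x)) + 2 * sqn lborel (\<lambda>x. h k (x - y) - h k x)"
        by (intro sqn_add_le) measurable
      also have "\<dots> \<le> 2 * (2 * sqn lborel (\<lambda>x. g (x - y) - h k (x - y)) + 2 * sqn lborel (\<lambda>x. g x - h k x)) + 2 * (ennreal (\<epsilon>\<^sup>2) * sqn lborel (jacobian (h k)))"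
      proof (intro add_mono mult_left_mono sqn_diff_le)
        have "sqn lborel (\<lambda>x. h k (x - y) - h k x) \<le> ennreal ((norm y)\<^sup>2) * sqn lborel (jacobian (h k))"
          by (rule sqn_translation_smooth[OF th])
        also have "\<dots> \<le> ennreal (\<epsilon>\<^sup>2) * sqn lborel (jacobian (h k))"
          using y by (intro mult_right_mono ennreal_leI power_mono) auto
        finally show "sqn lborel (\<lambda>x. h k (x - y) - h k x) \<le> ennreal (\<epsilon>\<^sup>2) * sqn lborel (jacobian (h k))" .
      qed (use ma mb in auto)
      also have "sqn lborel (\<lambda>x. g (x - y) - h k (x - y)) = sqn lborel (\<lambda>x. g x - h k x)"
        by (rule sqn_translation[of "\<lambda>x. g x - h k x"]) (intro borel_measurable_diff g hm)
      also have "sqn lborel (\<lambda>x. g x - h k x) = sqn lborel (\<lambda>x. h k x - g x)" by (rule sqn_minus_commute)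
      also have "sqn lborel (jacobian (h k)) = sqn lebesgue (jacobian (h k))"
        by (rule sqn_lebesgue_lborel[symmetric]) simp
      also have "2 * (2 * sqn lborel (\<lambda>x. h k x - g x) + 2 * sqn lborel (\<lambda>x. h k x - g x)) + 2 * (ennreal (\<epsilon>\<^sup>2) * sqn lebesgue (jacobian (h k)))
          \<le> 8 * sqn lborel (\<lambda>x. h k x - g x) + 2 * (ennreal (\<epsilon>\<^sup>2) * (2 * sqn lebesgue (\<lambda>x. jacobian (h k) x - G x) + 2 * sqn lebesgue G))"
      proof (intro add_mono mult_left_mono)
        have "2 * (2 * a + 2 * a) = 8 * a" for a :: ennreal
          by (simp add: distrib_left mult.assoc[symmetric] distrib_right[symmetric])
        then show "2 * (2 * sqn lborel (\<lambda>x. h k x - g x) + 2 * sqn lborel (\<lambda>x. h k x - g x)) \<le> 8 * sqn lborel (\<lambda>x. h k x - g x)" by simp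
        have "sqn lebesgue (\<lambda>x. (jacobian (h k) x - G x) + G x) \<le> 2 * sqn lebesgue (\<lambda>x. jacobian (h k) x - G x) + 2 * sqn lebesgue G"
          using jml integrable_G by (intro sqn_add_le borel_measurable_diff) auto
        then show "sqn lebesgue (jacobian (h k)) \<le> 2 * sqn lebesgue (\<lambda>x. jacobian (h k) x - G x) + 2 * sqn lebesgue G" by simp
      qed auto
      also have "\<dots> = B k + ennreal (4 * \<epsilon>\<^sup>2) * sqn lebesgue G"
      proof -
        have "2 * (ennreal (\<epsilon>\<^sup>2) * (2 * a + 2 * b)) = ennreal (4 * \<epsilon>\<^sup>2) * a + ennreal (4 * \<epsilon>\<^sup>2) * b" for a b
        proof -
          have "ennreal (4 * \<epsilon>\<^sup>2) = 2 * (2 * ennreal (\<epsilon>\<^sup>2))" by (simp only: two_mult_ennreal) simp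
          then show ?thesis by (simp only: distrib_left mult_ac)
        qed
        then show ?thesis by (simp add: B_def add.assoc)
      qed
      finally show ?thesis .
    qed
    moreover have "(\<lambda>k. B k + ennreal (4 * \<epsilon>\<^sup>2) * sqn lebesgue G) \<longlonglongrightarrow> 0 + ennreal (4 * \<epsilon>\<^sup>2) * sqn lebesgue G"
      by (intro tendsto_add B tendsto_const)
    ultimately have "sqn lborel (\<lambda>x. g (x - y) - g x) \<le> ennreal (4 * \<epsilon>\<^sup>2) * sqn lebesgue G"
      using LIMSEQ_le_const[of _ "0 + ennreal (4 * \<epsilon>\<^sup>2) * sqn lebesgue G"] by simp
    also have "\<dots> \<le> ennreal (8 * \<epsilon>\<^sup>2) * sqn lebesgue G"
      by (intro mult_right_mono ennreal_leI) auto
    finally show ?thesis .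
  qed
  have "sqn lebesgue (\<lambda>x. mollify (mollifier \<epsilon>) f x - f x) = sqn lborel (\<lambda>x. mollify (mollifier \<epsilon>) g x - g x)"
    using eq mollify_cong_AE[OF integrable_f gl eq mollifier(1)[OF \<epsilon>]]
    by (intro sqn_lebesgue_lborel) (auto elim: eventually_mono)
  then show ?thesis using sqn_mollify_le[OF ig \<epsilon> le] by simp
qed

end

section \<open>The \<open>W12\<close> norm through seminorms, approximation by test functions,
  extension by zero\<close>

lemma W12_norm_square:
  fixes u :: "real^'n::finite \<Rightarrow> real^'m::finite"
  assumes \<Omega>: "open \<Omega>" and u: "L2 \<Omega> u" "has_weak_gradient \<Omega> u G" "L2 \<Omega> G"
  shows "ennreal ((W12_norm \<Omega> u)\<^sup>2) = sqn (lebesgue_on \<Omega>) u + sqn (lebesgue_on \<Omega>) G"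
    and "W12_norm \<Omega> u \<ge> 0"
proof -
  have W: "u \<in> W12 \<Omega>" using u by (rule W12I)
  note w = W12D[OF \<Omega> W]
  have "(W12_norm \<Omega> u)\<^sup>2 = (LINT x|lebesgue_on \<Omega>. (norm (u x))\<^sup>2) + (LINT x|lebesgue_on \<Omega>. (norm (weak_gradient \<Omega> u x))\<^sup>2)"
    unfolding W12_norm_def using w by (simp add: L2_def)
  then have "ennreal ((W12_norm \<Omega> u)\<^sup>2) = sqn (lebesgue_on \<Omega>) u + sqn (lebesgue_on \<Omega>) (weak_gradient \<Omega> u)"
    using w by (simp add: sqn_eq_integral)
  also have "sqn (lebesgue_on \<Omega>) (weak_gradient \<Omega> u) = sqn (lebesgue_on \<Omega>) G"
    using weak_gradient_AE[OF \<Omega> u(2)] by (intro sqn_cong_AE) (auto elim: eventually_mono)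
  finally show "ennreal ((W12_norm \<Omega> u)\<^sup>2) = sqn (lebesgue_on \<Omega>) u + sqn (lebesgue_on \<Omega>) G" .
  show "W12_norm \<Omega> u \<ge> 0" by (simp add: W12_norm_def)
qed

lemma W12_norm_tendsto_iff:
  fixes u :: "nat \<Rightarrow> real^'n::finite \<Rightarrow> real^'m::finite"
  assumes \<Omega>: "open \<Omega>" and u: "\<And>k. L2 \<Omega> (u k)" "\<And>k. has_weak_gradient \<Omega> (u k) (G k)" "\<And>k. L2 \<Omega> (G k)"
  shows "(\<lambda>k. W12_norm \<Omega> (u k)) \<longlonglongrightarrow> 0 \<longleftrightarrow>
    (\<lambda>k. sqn (lebesgue_on \<Omega>) (u k)) \<longlonglongrightarrow> 0 \<and> (\<lambda>k. sqn (lebesgue_on \<Omega>) (G k)) \<longlonglongrightarrow> 0"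
proof -
  note sq = W12_norm_square[OF \<Omega> u]
  have "(\<lambda>k. W12_norm \<Omega> (u k)) \<longlonglongrightarrow> 0 \<longleftrightarrow> (\<lambda>k. (W12_norm \<Omega> (u k))\<^sup>2) \<longlonglongrightarrow> 0"
  proof
    assume "(\<lambda>k. W12_norm \<Omega> (u k)) \<longlonglongrightarrow> 0"
    from tendsto_power[OF this, of 2] show "(\<lambda>k. (W12_norm \<Omega> (u k))\<^sup>2) \<longlonglongrightarrow> 0" by simp
  next
    assume "(\<lambda>k. (W12_norm \<Omega> (u k))\<^sup>2) \<longlonglongrightarrow> 0"
    from tendsto_real_sqrt[OF this] show "(\<lambda>k. W12_norm \<Omega> (u k)) \<longlonglongrightarrow> 0" using sq(2) by simp
  qed
  also have "\<dots> \<longleftrightarrow> (\<lambda>k. ennreal ((W12_norm \<Omega> (u k))\<^sup>2)) \<longlonglongrightarrow> ennreal 0"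
    by (rule tendsto_ennreal_iff[symmetric]) auto
  also have "\<dots> \<longleftrightarrow> (\<lambda>k. sqn (lebesgue_on \<Omega>) (u k) + sqn (lebesgue_on \<Omega>) (G k)) \<longlonglongrightarrow> 0"
    unfolding sq(1) by simp
  also have "\<dots> \<longleftrightarrow> (\<lambda>k. sqn (lebesgue_on \<Omega>) (u k)) \<longlonglongrightarrow> 0 \<and> (\<lambda>k. sqn (lebesgue_on \<Omega>) (G k)) \<longlonglongrightarrow> 0"
  proof safe
    assume s: "(\<lambda>k. sqn (lebesgue_on \<Omega>) (u k) + sqn (lebesgue_on \<Omega>) (G k)) \<longlonglongrightarrow> 0"
    show "(\<lambda>k. sqn (lebesgue_on \<Omega>) (u k)) \<longlonglongrightarrow> 0" by (rule tendsto_zero_le_ennreal[OF s]) simp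
    show "(\<lambda>k. sqn (lebesgue_on \<Omega>) (G k)) \<longlonglongrightarrow> 0" by (rule tendsto_zero_le_ennreal[OF s]) simp
  next
    assume "(\<lambda>k. sqn (lebesgue_on \<Omega>) (u k)) \<longlonglongrightarrow> 0" "(\<lambda>k. sqn (lebesgue_on \<Omega>) (G k)) \<longlonglongrightarrow> 0"
    from tendsto_add[OF this] show "(\<lambda>k. sqn (lebesgue_on \<Omega>) (u k) + sqn (lebesgue_on \<Omega>) (G k)) \<longlonglongrightarrow> 0" by simp
  qed
  finally show ?thesis .
qed

lemma L2_UNIV_mono:
  fixes f :: "real^'n::finite \<Rightarrow> 'b::euclidean_space"
  shows "L2 UNIV f \<Longrightarrow> open \<Omega> \<Longrightarrow> L2 \<Omega> f"
  using L2_mono[of UNIV f \<Omega>] open_lebesgue by auto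

lemma L2_jacobian:
  fixes \<phi> :: "real^'n::finite \<Rightarrow> real^'m::finite"
  assumes "test_function \<Omega> \<phi>"
  shows "L2 UNIV (jacobian \<phi>)"
proof -
  have "L2 UNIV (\<lambda>x. (\<chi> j. axis i (partial_deriv i \<phi> x $ j)) :: real^'n^'m)" for i
  proof (rule L2_bound[OF L2_test_function[OF test_function_partial_deriv[OF assms, of i]]])
    have c: "continuous_on UNIV (partial_deriv i \<phi>)" using test_functionD(2)[OF test_function_partial_deriv[OF assms]] .
    have ce: "continuous_on UNIV (\<lambda>x. if k = i then partial_deriv i \<phi> x $ j else 0)" for j k
      by (cases "k = i") (auto intro!: continuous_intros c)
    have "continuous_on UNIV (\<lambda>x. (\<chi> j k. if k = i then partial_deriv i \<phi> x $ j else 0) :: real^'n^'m)"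
      by (intro continuous_on_vec_lambda ce)
    then have "continuous_on UNIV (\<lambda>x. (\<chi> j. axis i (partial_deriv i \<phi> x $ j)) :: real^'n^'m)"
      by (simp add: axis_def eq_commute[of i])
    then show "(\<lambda>x. (\<chi> j. axis i (partial_deriv i \<phi> x $ j)) :: real^'n^'m) \<in> borel_measurable (lebesgue_on UNIV)"
      by (simp add: lebesgue_on_UNIV_eq borel_measurable_continuous_onI measurable_completion)
    show "AE x in lebesgue_on UNIV. norm ((\<chi> j. axis i (partial_deriv i \<phi> x $ j)) :: real^'n^'m) \<le> norm (partial_deriv i \<phi> x)"
      by (intro AE_I2) (simp add: norm_eq_sqrt_inner inner_vec_def[of "\<chi> j. axis i (_ $ j)"] inner_axis_axis inner_vec_def[of "_ :: real^'m"])
  qed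
  moreover have "jacobian \<phi> = (\<lambda>x. \<Sum>i\<in>UNIV. (\<chi> j. axis i (partial_deriv i \<phi> x $ j)))"
    by (auto simp: jacobian_def fun_eq_iff vec_eq_iff axis_def if_distrib cong: if_cong)
  moreover have "L2 UNIV (\<lambda>x. \<Sum>i\<in>I. h i x)" if "\<And>i. L2 UNIV (h i)" for I :: "'n set" and h :: "'n \<Rightarrow> real^'n \<Rightarrow> real^'n^'m"
  proof -
    have "L2 UNIV (\<lambda>x. 0 :: real^'n^'m)" by (simp add: L2_def)
    then show ?thesis using that by (induction I rule: infinite_finite_induct) (auto intro: L2_add)
  qed
  ultimately show ?thesis by simp
qed

lemma sqn_open_le:
  fixes f :: "real^'n::finite \<Rightarrow> 'b::euclidean_space"
  shows "open \<Omega> \<Longrightarrow> sqn (lebesgue_on \<Omega>) f \<le> sqn lebesgue f"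
  using sqn_restrict_mono[OF open_lebesgue, of \<Omega> UNIV f] by (simp add: lebesgue_on_UNIV_eq)

text \<open>At scales below the distance from \<open>S\<close> to the complement of \<Omega>,
  mollifications are test functions in \<Omega>, and they converge together with their Jacobians.
  This is how the glued maps become admissible variations.\<close>

lemma (in compact_sobolev) in_W12_0:
  assumes \<Omega>: "open \<Omega>" "S \<subseteq> \<Omega>"
  shows "f \<in> W12_0 \<Omega>"
proof -
  have "\<exists>\<delta>>0. \<forall>x y. x \<in> S \<longrightarrow> norm (y - x) \<le> \<delta> \<longrightarrow> y \<in> \<Omega>"
  proof -
    obtain \<delta> where "\<delta> > 0" "(\<Union>x\<in>S. cball x \<delta>) \<subseteq> \<Omega>"
      using compact_subset_open_imp_cball_epsilon_subset[OF S \<Omega>] by blast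
    then show ?thesis by (intro exI[of _ \<delta>]) (force simp: dist_norm norm_minus_commute)
  qed
  then obtain \<delta> where \<delta>: "\<delta> > 0" "\<And>x y. x \<in> S \<Longrightarrow> norm (y - x) \<le> \<delta> \<Longrightarrow> y \<in> \<Omega>" by blast
  define \<epsilon> where "\<epsilon> k = \<delta> / real (Suc k)" for k
  have \<epsilon>: "\<epsilon> k > 0" "\<epsilon> \<longlonglongrightarrow> 0" "\<epsilon> k \<le> \<delta>" for k
  proof -
    show "\<epsilon> k > 0" "\<epsilon> k \<le> \<delta>" using \<delta>(1) by (auto simp: \<epsilon>_def divide_simps)
    show "\<epsilon> \<longlonglongrightarrow> 0"
      using tendsto_mult_right[OF LIMSEQ_inverse_real_of_nat, of \<delta>] by (simp add: \<epsilon>_def[abs_def] divide_inverse mult.commute)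
  qed
  define \<phi> where "\<phi> k = mollify (mollifier (\<epsilon> k)) f" for k
  have t: "test_function \<Omega> (\<phi> k)" for k
    unfolding \<phi>_def
    by (rule test_function_mollify[OF integrable_f mollifier(1)[OF \<epsilon>(1)] S f0, of "\<epsilon> k"])
       (auto simp: mollifier(3)[OF \<epsilon>(1)] intro: \<delta>(2) order_trans[OF _ \<epsilon>(3)])
  have j: "jacobian (\<phi> k) = mollify (mollifier (\<epsilon> k)) G" for k
    unfolding \<phi>_def by (rule jacobian_mollify[OF grad integrable_f integrable_G mollifier(1)[OF \<epsilon>(1)]])
  have fW: "has_weak_gradient \<Omega> f G" by (rule has_weak_gradient_mono[OF grad open_UNIV \<Omega>(1)]) simp
  have "(\<lambda>k. W12_norm \<Omega> (\<lambda>x. \<phi> k x - f x)) \<longlonglongrightarrow> 0"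
  proof (subst W12_norm_tendsto_iff[OF \<Omega>(1), where G="\<lambda>k x. jacobian (\<phi> k) x - G x"])
    show "L2 \<Omega> (\<lambda>x. \<phi> k x - f x)" "L2 \<Omega> (\<lambda>x. jacobian (\<phi> k) x - G x)" for k
      by (intro L2_diff L2_UNIV_mono[OF _ \<Omega>(1)] L2_test_function[OF t] L2_jacobian[OF t] fL2 GL2)+
    show "has_weak_gradient \<Omega> (\<lambda>x. \<phi> k x - f x) (\<lambda>x. jacobian (\<phi> k) x - G x)" for k
      by (rule has_weak_gradient_diff[OF \<Omega>(1) has_weak_gradient_smooth[OF \<Omega>(1) test_functionD(1)[OF t]] fW])
    show "(\<lambda>k. sqn (lebesgue_on \<Omega>) (\<lambda>x. \<phi> k x - f x)) \<longlonglongrightarrow> 0 \<and>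
      (\<lambda>k. sqn (lebesgue_on \<Omega>) (\<lambda>x. jacobian (\<phi> k) x - G x)) \<longlonglongrightarrow> 0"
    proof
      show "(\<lambda>k. sqn (lebesgue_on \<Omega>) (\<lambda>x. \<phi> k x - f x)) \<longlonglongrightarrow> 0"
        unfolding \<phi>_def
        by (rule tendsto_zero_le_ennreal[OF sqn_mollify_tendsto[OF integrable_f fL2 \<epsilon>(1,2)]])
           (rule sqn_open_le[OF \<Omega>(1)])
      show "(\<lambda>k. sqn (lebesgue_on \<Omega>) (\<lambda>x. jacobian (\<phi> k) x - G x)) \<longlonglongrightarrow> 0"
        unfolding j
        by (rule tendsto_zero_le_ennreal[OF sqn_mollify_tendsto[OF integrable_G GL2 \<epsilon>(1,2)]])
           (rule sqn_open_le[OF \<Omega>(1)])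
    qed
  qed
  moreover have "f \<in> W12 \<Omega>" by (rule W12I[OF L2_UNIV_mono[OF fL2 \<Omega>(1)] fW L2_UNIV_mono[OF GL2 \<Omega>(1)]])
  ultimately show ?thesis using t by (auto simp: W12_0_def)
qed

lemma L2_extend_zero:
  fixes f :: "real^'n::finite \<Rightarrow> 'b::euclidean_space"
  assumes \<Omega>: "open \<Omega>" and f: "L2 \<Omega> f"
  shows "L2 UNIV (\<lambda>x. if x \<in> \<Omega> then f x else 0)"
proof -
  have eq: "(\<lambda>x. if x \<in> \<Omega> then f x else 0) = (\<lambda>x. indicator \<Omega> x *\<^sub>R f x)" by auto
  have m: "(\<lambda>x. if x \<in> \<Omega> then f x else 0) \<in> borel_measurable lebesgue"
    unfolding eq using L2_measurable[OF f] by (simp add: integrable_lebesgue_on_iff(3)[OF open_lebesgue[OF \<Omega>]])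
  have "sqn lebesgue (\<lambda>x. if x \<in> \<Omega> then f x else 0) = sqn (lebesgue_on \<Omega>) (\<lambda>x. if x \<in> \<Omega> then f x else 0)"
    by (rule sqn_restrict_support[symmetric]) (use open_lebesgue[OF \<Omega>] in auto)
  also have "\<dots> = sqn (lebesgue_on \<Omega>) f"
    unfolding sqn_def by (intro nn_integral_cong) (auto simp: space_restrict_space)
  finally show ?thesis using f m by (simp add: L2_iff lebesgue_on_UNIV_eq)
qed

text \<open>The approximating test functions already live on the whole space and vanish off
  \<Omega>; the extension by zero is their limit there, so closedness of the weak gradient applies.
  It lets a competitor on \<Omega> be viewed on a larger ball.\<close>

lemma W12_0_extend_zero:
  fixes v :: "real^'n::finite \<Rightarrow> real^'m::finite"
  assumes \<Omega>: "open \<Omega>" and v: "v \<in> W12_0 \<Omega>"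
  shows "has_weak_gradient UNIV (\<lambda>x. if x \<in> \<Omega> then v x else 0) (\<lambda>x. if x \<in> \<Omega> then weak_gradient \<Omega> v x else 0)"
proof -
  obtain \<phi> where vW: "v \<in> W12 \<Omega>" and t: "\<And>k. test_function \<Omega> (\<phi> k)"
    and lim: "(\<lambda>k. W12_norm \<Omega> (\<lambda>x. \<phi> k x - v x)) \<longlonglongrightarrow> 0"
    using v by (auto simp: W12_0_def)
  note w = W12D[OF \<Omega> vW]
  have L: "L2 UNIV (\<phi> k)" "L2 UNIV (jacobian (\<phi> k))" for k
    using L2_test_function[OF t] L2_jacobian[OF t] by auto
  have lims: "(\<lambda>k. sqn (lebesgue_on \<Omega>) (\<lambda>x. \<phi> k x - v x)) \<longlonglongrightarrow> 0 \<and>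
      (\<lambda>k. sqn (lebesgue_on \<Omega>) (\<lambda>x. jacobian (\<phi> k) x - weak_gradient \<Omega> v x)) \<longlonglongrightarrow> 0"
  proof (subst W12_norm_tendsto_iff[OF \<Omega>, symmetric])
    show "L2 \<Omega> (\<lambda>x. \<phi> k x - v x)" "L2 \<Omega> (\<lambda>x. jacobian (\<phi> k) x - weak_gradient \<Omega> v x)" for k
      by (intro L2_diff L2_UNIV_mono[OF L(1) \<Omega>] L2_UNIV_mono[OF L(2) \<Omega>] w)+
    show "has_weak_gradient \<Omega> (\<lambda>x. \<phi> k x - v x) (\<lambda>x. jacobian (\<phi> k) x - weak_gradient \<Omega> v x)" for k
      by (rule has_weak_gradient_diff[OF \<Omega> has_weak_gradient_smooth[OF \<Omega> test_functionD(1)[OF t]] w(2)])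
  qed (rule lim)
  have ext: "sqn (lebesgue_on UNIV) (\<lambda>x. g x - (if x \<in> \<Omega> then h x else 0)) = sqn (lebesgue_on \<Omega>) (\<lambda>x. g x - h x)"
    if "\<And>x. x \<notin> \<Omega> \<Longrightarrow> g x = 0" for g h :: "real^'n \<Rightarrow> 'z::euclidean_space"
  proof -
    have "sqn (lebesgue_on UNIV) (\<lambda>x. g x - (if x \<in> \<Omega> then h x else 0)) = sqn (lebesgue_on \<Omega>) (\<lambda>x. g x - (if x \<in> \<Omega> then h x else 0))"
      unfolding lebesgue_on_UNIV_eq using that open_lebesgue[OF \<Omega>] by (intro sqn_restrict_support[symmetric]) auto
    also have "\<dots> = sqn (lebesgue_on \<Omega>) (\<lambda>x. g x - h x)"
      unfolding sqn_def by (intro nn_integral_cong) (auto simp: space_restrict_space)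
    finally show ?thesis .
  qed
  have j0: "jacobian (\<phi> k) x = 0" if "x \<notin> \<Omega>" for k x
    using test_functionD(6)[OF test_function_partial_deriv[OF t] that] by (simp add: jacobian_def vec_eq_iff)
  show ?thesis
  proof (rule has_weak_gradient_limit[OF open_UNIV _ _ L])
    show "has_weak_gradient UNIV (\<phi> k) (jacobian (\<phi> k))" for k
      by (rule has_weak_gradient_smooth[OF open_UNIV test_functionD(1)[OF t]])
    show "(\<lambda>k. sqn (lebesgue_on UNIV) (\<lambda>x. \<phi> k x - (if x \<in> \<Omega> then v x else 0))) \<longlonglongrightarrow> 0"
      using lims test_functionD(6)[OF t] by (subst ext) auto
    show "(\<lambda>k. sqn (lebesgue_on UNIV) (\<lambda>x. jacobian (\<phi> k) x - (if x \<in> \<Omega> then weak_gradient \<Omega> v x else 0))) \<longlonglongrightarrow> 0"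
      using lims j0 by (subst ext) auto
  qed (use L2_extend_zero[OF \<Omega> w(1)] L2_extend_zero[OF \<Omega> w(3)] in auto)
qed

section \<open>Midpoint hulls and weak convergence\<close>

text \<open>The elements are convex combinations with dyadic weights. Binary averages are all that
  the parallelogram identity asks for, and any inequality stable under averaging passes to the hull
  by induction.\<close>

inductive_set midpoint_hull :: "('a \<Rightarrow> 'b::real_vector) set \<Rightarrow> ('a \<Rightarrow> 'b) set" for F where
  base: "f \<in> F \<Longrightarrow> f \<in> midpoint_hull F"
| midpoint: "f \<in> midpoint_hull F \<Longrightarrow> g \<in> midpoint_hull F \<Longrightarrow> (\<lambda>x. (1/2) *\<^sub>R f x + (1/2) *\<^sub>R g x) \<in> midpoint_hull F"

lemma midpoint_hull_mono: "F \<subseteq> F' \<Longrightarrow> midpoint_hull F \<subseteq> midpoint_hull F'"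
proof
  fix f assume "F \<subseteq> F'" "f \<in> midpoint_hull F"
  then show "f \<in> midpoint_hull F'"
    by (induction rule: midpoint_hull.induct[OF \<open>f \<in> midpoint_hull F\<close>]) (auto intro: midpoint_hull.intros)
qed

lemma norm_midpoint_sq: "(norm ((1/2) *\<^sub>R a + (1/2) *\<^sub>R b :: 'b::real_inner))\<^sup>2
    = (1/2) * (norm a)\<^sup>2 + (1/2) * (norm b)\<^sup>2 - (1/4) * (norm (a - b))\<^sup>2"
  by (simp add: power2_norm_eq_inner inner_simps inner_commute field_simps)

text \<open>An almost minimising sequence of a quadratic form over decreasing midpoint convex sets is
  Cauchy, by the parallelogram identity.\<close>

lemma midpoint_Cauchy:
  fixes S :: "nat \<Rightarrow> 'x set" and q :: "'x \<Rightarrow> real" and d :: "'x \<Rightarrow> 'x \<Rightarrow> real"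
  assumes S: "\<And>m. S (Suc m) \<subseteq> S m" "\<And>m. S m \<noteq> {}"
    and mid: "\<And>m x y. x \<in> S m \<Longrightarrow> y \<in> S m \<Longrightarrow> \<exists>z\<in>S m. q z = q x / 2 + q y / 2 - d x y / 4"
    and q: "\<And>x. x \<in> S 0 \<Longrightarrow> 0 \<le> q x" "\<And>x. x \<in> S 0 \<Longrightarrow> q x \<le> C"
  obtains g where "\<And>m. g m \<in> S m" "\<And>e. e > 0 \<Longrightarrow> \<exists>N. \<forall>i\<ge>N. \<forall>j\<ge>N. d (g i) (g j) \<le> e"
proof -
  have mono: "m \<le> n \<Longrightarrow> S n \<subseteq> S m" for m n
    using lift_Suc_antimono_le[of S] S(1) by blast
  have S0: "x \<in> S m \<Longrightarrow> x \<in> S 0" for x m using mono[of 0 m] by blast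
  \<comment> \<open>The sets shrink, so these infima increase; being bounded by \<open>C\<close>,
    they converge. That \<open>g m\<close> is within \<open>1 / Suc m\<close> of the infimum then
    makes late members almost minimal in every earlier set as well.\<close>
  define I where "I m = Inf (q ` S m)" for m
  have bdd: "bdd_below (q ` S m)" for m
    using q(1) S0 by (intro bdd_belowI[of _ 0]) auto
  have Ile: "I m \<le> q x" if "x \<in> S m" for m x
    unfolding I_def using bdd that by (intro cInf_lower) auto
  have IC: "I m \<le> C" for m using S(2)[of m] Ile q(2) S0 by (metis all_not_in_conv order_trans)
  have Imono: "I m \<le> I n" if "m \<le> n" for m n
    unfolding I_def using S(2)[of n] bdd mono[OF that] by (intro cInf_superset_mono) auto
  have "convergent I"
    by (rule incseq_convergent[of I C]) (use Imono IC in \<open>auto simp: incseq_def convergent_def\<close>)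
  then have cau: "Cauchy I" by (rule convergent_Cauchy)
  have "\<exists>x\<in>S m. q x < I m + 1 / Suc m" for m
    using cInf_lessD[of "q ` S m" "I m + 1 / Suc m"] S(2)[of m] by (auto simp: I_def)
  then obtain g where g: "\<And>m. g m \<in> S m" "\<And>m. q (g m) < I m + 1 / Suc m" by metis
  have "\<exists>N. \<forall>i\<ge>N. \<forall>j\<ge>N. d (g i) (g j) \<le> e" if e: "e > 0" for e
  proof -
    obtain N1 where N1: "\<And>m n. m \<ge> N1 \<Longrightarrow> n \<ge> N1 \<Longrightarrow> dist (I m) (I n) < e / 8"
      using cau e unfolding Cauchy_def by (metis zero_less_divide_iff zero_less_numeral)
    obtain N2 where N2: "8 / e < real N2" using reals_Archimedean2 by blast
    show ?thesis
    proof (intro exI[of _ "max N1 N2"] allI impI)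
      fix i j assume ij: "max N1 N2 \<le> i" "max N1 N2 \<le> j"
      have small: "1 / real (Suc k) \<le> e / 8" if "max N1 N2 \<le> k" for k
      proof -
        have "8 / e < real (Suc k)" using N2 that by linarith
        then show ?thesis using e by (simp add: field_simps)
      qed
      define m where "m = min i j"
      have m: "max N1 N2 \<le> m" "m \<le> i" "m \<le> j" using ij by (auto simp: m_def)
      have gm: "g i \<in> S m" "g j \<in> S m" using g(1) mono m by blast+
      obtain z where z: "z \<in> S m" "q z = q (g i) / 2 + q (g j) / 2 - d (g i) (g j) / 4"
        using mid[OF gm] by blast
      \<comment> \<open>The midpoint \<open>z\<close> lies in \<open>S m\<close>, so
        \<open>d (g i) (g j) / 4\<close> is at most the mean of \<open>q (g i)\<close> and
        \<open>q (g j)\<close> minus \<open>I m\<close>. Either value exceeds \<open>I m\<close> by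
        less than \<open>e / 8\<close>, from the drift of the infima, plus \<open>e / 8\<close>,
        from near minimality.\<close>
      have "\<bar>I i - I m\<bar> < e / 8" "\<bar>I j - I m\<bar> < e / 8"
        using N1[of i m] N1[of j m] ij m by (auto simp: dist_real_def)
      then show "d (g i) (g j) \<le> e"
        using Ile[OF z(1)] z(2) g(2)[of i] g(2)[of j] small[OF ij(1)] small[OF ij(2)]
        unfolding abs_less_iff by linarith
    qed
  qed
  then show ?thesis using that g(1) by blast
qed

lemma midpoint_hull_W12:
  fixes F :: "(real^'n::finite \<Rightarrow> real^'m::finite) set"
  assumes \<Omega>: "open \<Omega>" and F: "F \<subseteq> W12 \<Omega>" and f: "f \<in> midpoint_hull F"
  shows "f \<in> W12 \<Omega>"
  using f by induction (use F \<Omega> in \<open>auto intro!: W12_add W12_scaleR\<close>)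

lemma weak_gradient_midpoint:
  fixes f g :: "real^'n::finite \<Rightarrow> real^'m::finite"
  assumes \<Omega>: "open \<Omega>" and f: "f \<in> W12 \<Omega>" and g: "g \<in> W12 \<Omega>"
  shows "AE x in lebesgue_on \<Omega>. weak_gradient \<Omega> (\<lambda>x. (1/2) *\<^sub>R f x + (1/2) *\<^sub>R g x) x
    = (1/2) *\<^sub>R weak_gradient \<Omega> f x + (1/2) *\<^sub>R weak_gradient \<Omega> g x"
  by (intro weak_gradient_AE[OF \<Omega>] has_weak_gradient_add[OF \<Omega>] has_weak_gradient_scaleR[OF \<Omega>] W12D[OF \<Omega>] f g)

lemma integral_norm_midpoint_sq:
  fixes f g :: "real^'n::finite \<Rightarrow> 'b::euclidean_space"
  assumes f: "L2 \<Omega> f" and g: "L2 \<Omega> g" and h: "h \<in> borel_measurable (lebesgue_on \<Omega>)"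
    and eq: "AE x in lebesgue_on \<Omega>. h x = (1/2) *\<^sub>R f x + (1/2) *\<^sub>R g x"
  shows "(LINT x|lebesgue_on \<Omega>. (norm (h x))\<^sup>2) = (LINT x|lebesgue_on \<Omega>. (norm (f x))\<^sup>2) / 2
    + (LINT x|lebesgue_on \<Omega>. (norm (g x))\<^sup>2) / 2 - (LINT x|lebesgue_on \<Omega>. (norm (f x - g x))\<^sup>2) / 4"
proof -
  note d = L2_diff[OF f g]
  have "(LINT x|lebesgue_on \<Omega>. (norm (h x))\<^sup>2)
      = (LINT x|lebesgue_on \<Omega>. (1/2) * (norm (f x))\<^sup>2 + (1/2) * (norm (g x))\<^sup>2 - (1/4) * (norm (f x - g x))\<^sup>2)"
  proof (rule integral_cong_AE)
    show "AE x in lebesgue_on \<Omega>. (norm (h x))\<^sup>2 = (1/2) * (norm (f x))\<^sup>2 + (1/2) * (norm (g x))\<^sup>2 - (1/4) * (norm (f x - g x))\<^sup>2"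
      using eq by eventually_elim (simp only: norm_midpoint_sq)
    show "(\<lambda>x. (1/2) * (norm (f x))\<^sup>2 + (1/2) * (norm (g x))\<^sup>2 - (1/4) * (norm (f x - g x))\<^sup>2) \<in> borel_measurable (lebesgue_on \<Omega>)"
      using L2_measurable[OF f] L2_measurable[OF g] by measurable
  qed (use h in measurable)
  also have "\<dots> = (LINT x|lebesgue_on \<Omega>. (1/2) * (norm (f x))\<^sup>2) + (LINT x|lebesgue_on \<Omega>. (1/2) * (norm (g x))\<^sup>2)
      - (LINT x|lebesgue_on \<Omega>. (1/4) * (norm (f x - g x))\<^sup>2)"
    using f g d unfolding L2_def
    by (subst Bochner_Integration.integral_diff) (auto intro!: Bochner_Integration.integrable_add)
  finally show ?thesis by simp
qed

text \<open>Mazur's lemma with iterated midpoints instead of general convex combinations; a linear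
  functional that is at least \<open>c\<close> on all \<open>u k\<close> is at least \<open>c\<close> on iterated midpoints, too.\<close>

lemma midpoint_hull_converges:
  fixes u :: "nat \<Rightarrow> real^'n::finite \<Rightarrow> real^'m::finite"
  assumes \<Omega>: "open \<Omega>" and u: "\<And>k. u k \<in> W12 \<Omega>"
    and bound: "\<And>k. (LINT x|lebesgue_on \<Omega>. (norm (weak_gradient \<Omega> (u k) x))\<^sup>2) \<le> C"
    and w: "L2 \<Omega> w" and lim: "(\<lambda>k. sqn (lebesgue_on \<Omega>) (\<lambda>x. u k x - w x)) \<longlonglongrightarrow> 0"
  obtains g where "w \<in> W12 \<Omega>" "\<And>m. g m \<in> midpoint_hull {u k | k. k \<ge> m}"
    "(\<lambda>m. W12_norm \<Omega> (\<lambda>x. g m x - w x)) \<longlonglongrightarrow> 0"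
proof -
  define S where "S m = midpoint_hull {u k | k. k \<ge> m}" for m
  have SW: "f \<in> W12 \<Omega>" if "f \<in> S m" for f m
    using midpoint_hull_W12[OF \<Omega> _ that[unfolded S_def]] u by auto
  define q where "q f = (LINT x|lebesgue_on \<Omega>. (norm (weak_gradient \<Omega> f x))\<^sup>2)" for f :: "real^'n \<Rightarrow> real^'m"
  define d where "d f h = (LINT x|lebesgue_on \<Omega>. (norm (weak_gradient \<Omega> f x - weak_gradient \<Omega> h x))\<^sup>2)"
    for f h :: "real^'n \<Rightarrow> real^'m"
  have d0: "d f h \<ge> 0" for f h by (simp add: d_def)
  have qmid: "q (\<lambda>x. (1/2) *\<^sub>R f x + (1/2) *\<^sub>R h x) = q f / 2 + q h / 2 - d f h / 4" if "f \<in> W12 \<Omega>" "h \<in> W12 \<Omega>" for f h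
    unfolding q_def d_def
    by (rule integral_norm_midpoint_sq[OF W12D(3)[OF \<Omega> that(1)] W12D(3)[OF \<Omega> that(2)] _ weak_gradient_midpoint[OF \<Omega> that]])
       (intro L2_measurable W12D(3)[OF \<Omega>] W12_add[OF \<Omega>] W12_scaleR[OF \<Omega>] that)
  have qC: "q f \<le> C" if "f \<in> S m" for f m
    using that unfolding S_def
  proof induction
    case (base f)
    then show ?case using bound by (auto simp: q_def)
  next
    case (midpoint f g)
    then have "f \<in> W12 \<Omega>" "g \<in> W12 \<Omega>" using SW by (auto simp: S_def)
    then show ?case using qmid[of f g] midpoint d0[of f g] by simp
  qed
  obtain g where g: "\<And>m. g m \<in> S m" and gC: "\<And>e. e > 0 \<Longrightarrow> \<exists>N. \<forall>i\<ge>N. \<forall>j\<ge>N. d (g i) (g j) \<le> e"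
  proof (rule midpoint_Cauchy[of S q d C])
    show "S (Suc m) \<subseteq> S m" for m unfolding S_def by (intro midpoint_hull_mono) auto
    show "S m \<noteq> {}" for m
      unfolding S_def using midpoint_hull.base[of "u m" "{u k | k. k \<ge> m}"] by auto
    show "\<exists>z\<in>S m. q z = q x / 2 + q y / 2 - d x y / 4" if "x \<in> S m" "y \<in> S m" for m x y
      using qmid[OF SW[OF that(1)] SW[OF that(2)]] midpoint_hull.midpoint[OF that[unfolded S_def]] unfolding S_def by blast
    show "q x \<ge> 0" for x by (simp add: q_def)
  qed (use qC in blast)+
  note gW = W12D[OF \<Omega> SW[OF g]]
  obtain H where H: "L2 \<Omega> H" "(\<lambda>k. sqn (lebesgue_on \<Omega>) (\<lambda>x. weak_gradient \<Omega> (g k) x - H x)) \<longlonglongrightarrow> 0"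
  proof (rule L2_complete[OF gW(3)])
    fix e :: real assume "e > 0"
    then obtain N where "\<forall>i\<ge>N. \<forall>j\<ge>N. d (g i) (g j) \<le> e" using gC by blast
    then show "\<exists>N. \<forall>i\<ge>N. \<forall>j\<ge>N. sqn (lebesgue_on \<Omega>) (\<lambda>x. weak_gradient \<Omega> (g i) x - weak_gradient \<Omega> (g j) x) \<le> ennreal e"
      using sqn_eq_integral[OF L2_diff[OF gW(3) gW(3)]] by (auto simp: d_def intro!: exI[of _ N] ennreal_leI)
  qed
  \<comment> \<open>The squared distance to \<open>w\<close> is convex, so a bound valid for all
    \<open>u k\<close> with \<open>k \<ge> m\<close> holds on their whole hull. Hence the choice of
    \<open>g\<close>, made for the gradients alone, does not disturb convergence to
    \<open>w\<close>.\<close>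
  have le: "sqn (lebesgue_on \<Omega>) (\<lambda>x. f x - w x) \<le> b"
    if f: "f \<in> S m" and b: "\<And>k. k \<ge> m \<Longrightarrow> sqn (lebesgue_on \<Omega>) (\<lambda>x. u k x - w x) \<le> b" for f m b
    using f unfolding S_def
  proof induction
    case (base f)
    then show ?case using b by auto
  next
    case (midpoint f h)
    have fh: "L2 \<Omega> (\<lambda>x. f x - w x)" "L2 \<Omega> (\<lambda>x. h x - w x)"
      using SW midpoint.hyps W12D(1)[OF \<Omega>] w unfolding S_def by (auto intro!: L2_diff)
    have "sqn (lebesgue_on \<Omega>) (\<lambda>x. (1/2) *\<^sub>R f x + (1/2) *\<^sub>R h x - w x)
        \<le> (\<integral>\<^sup>+x. ennreal (1/2) * ennreal ((norm (f x - w x))\<^sup>2) + ennreal (1/2) * ennreal ((norm (h x - w x))\<^sup>2) \<partial>lebesgue_on \<Omega>)"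
      unfolding sqn_def
    proof (rule nn_integral_mono)
      fix x
      have e: "(1/2) *\<^sub>R f x + (1/2) *\<^sub>R h x - w x = (1/2) *\<^sub>R (f x - w x) + (1/2) *\<^sub>R (h x - w x)"
        by (simp add: scaleR_diff_right flip: scaleR_left.add)
      have "(norm ((1/2) *\<^sub>R f x + (1/2) *\<^sub>R h x - w x))\<^sup>2 \<le> (1/2) * (norm (f x - w x))\<^sup>2 + (1/2) * (norm (h x - w x))\<^sup>2"
        unfolding e norm_midpoint_sq by simp
      then have "ennreal ((norm ((1/2) *\<^sub>R f x + (1/2) *\<^sub>R h x - w x))\<^sup>2) \<le> ennreal ((1/2) * (norm (f x - w x))\<^sup>2 + (1/2) * (norm (h x - w x))\<^sup>2)"
        by (rule ennreal_leI)
      then show "ennreal ((norm ((1/2) *\<^sub>R f x + (1/2) *\<^sub>R h x - w x))\<^sup>2)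
          \<le> ennreal (1/2) * ennreal ((norm (f x - w x))\<^sup>2) + ennreal (1/2) * ennreal ((norm (h x - w x))\<^sup>2)"
        by (simp only: ennreal_plus ennreal_mult zero_le_power2 mult_nonneg_nonneg zero_le_divide_1_iff zero_le_numeral)
    qed
    also have "\<dots> = ennreal (1/2) * sqn (lebesgue_on \<Omega>) (\<lambda>x. f x - w x) + ennreal (1/2) * sqn (lebesgue_on \<Omega>) (\<lambda>x. h x - w x)"
      unfolding sqn_def using L2_measurable[OF fh(1)] L2_measurable[OF fh(2)]
      by (subst nn_integral_add) (auto simp: nn_integral_cmult)
    also have "\<dots> \<le> ennreal (1/2) * b + ennreal (1/2) * b"
      using midpoint.IH by (intro add_mono mult_left_mono) auto
    also have "\<dots> = ennreal (1/2 + 1/2) * b"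
      by (subst ennreal_plus) (auto simp: distrib_right)
    also have "\<dots> = b" by simp
    finally show ?case .
  qed
  have gw: "(\<lambda>m. sqn (lebesgue_on \<Omega>) (\<lambda>x. g m x - w x)) \<longlonglongrightarrow> 0"
    unfolding ennreal_tendsto_zero_iff
  proof (intro allI impI)
    fix e :: real assume "e > 0"
    then obtain N where N: "\<And>k. k \<ge> N \<Longrightarrow> sqn (lebesgue_on \<Omega>) (\<lambda>x. u k x - w x) \<le> ennreal e"
      using lim unfolding ennreal_tendsto_zero_iff eventually_sequentially by blast
    show "\<forall>\<^sub>F m in sequentially. sqn (lebesgue_on \<Omega>) (\<lambda>x. g m x - w x) \<le> ennreal e"
      by (rule eventually_sequentiallyI[of N], rule le[OF g]) (use N order_trans in blast)
  qed
  have wH: "has_weak_gradient \<Omega> w H"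
    by (rule has_weak_gradient_limit[OF \<Omega> w H(1) gW(1) gW(3) gW(2) gw H(2)])
  have "w \<in> W12 \<Omega>" by (rule W12I[OF w wH H(1)])
  moreover have "(\<lambda>m. W12_norm \<Omega> (\<lambda>x. g m x - w x)) \<longlonglongrightarrow> 0"
    by (subst W12_norm_tendsto_iff[OF \<Omega> L2_diff[OF gW(1) w] has_weak_gradient_diff[OF \<Omega> gW(2) wH] L2_diff[OF gW(3) H(1)]])
       (use gw H(2) in blast)
  ultimately show ?thesis using that g unfolding S_def by blast
qed

text \<open>If a functional stayed away from its value at \<open>w\<close> along a subsequence, it
  would do so on the midpoint hulls of that subsequence. These contain maps that converge to
  \<open>w\<close> in norm, and the functional is bounded.\<close>

lemma weakly_converges_W12I:
  fixes u :: "nat \<Rightarrow> real^'n::finite \<Rightarrow> real^'m::finite"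
  assumes \<Omega>: "open \<Omega>" and u: "\<And>k. u k \<in> W12 \<Omega>"
    and bound: "\<And>k. (LINT x|lebesgue_on \<Omega>. (norm (weak_gradient \<Omega> (u k) x))\<^sup>2) \<le> C"
    and w: "L2 \<Omega> w" and lim: "(\<lambda>k. sqn (lebesgue_on \<Omega>) (\<lambda>x. u k x - w x)) \<longlonglongrightarrow> 0"
  shows "weakly_converges_W12 \<Omega> u w"
proof -
  have wW: "w \<in> W12 \<Omega>" using midpoint_hull_converges[OF assms] by blast
  \<comment> \<open>Only deviations from above are excluded here, because averaging preserves
    one-sided inequalities only; deviations from below are those of \<open>- l\<close>.\<close>
  have ev: "\<forall>\<^sub>F k in sequentially. l (u k) - l w < e" if l: "l \<in> W12_dual \<Omega>" and e: "e > 0" for l e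
  proof (rule ccontr)
    assume "\<not> (\<forall>\<^sub>F k in sequentially. l (u k) - l w < e)"
    then have "infinite {k. l (u k) - l w \<ge> e}"
      by (simp add: not_eventually frequently_sequentially infinite_nat_iff_unbounded_le not_less)
    then obtain r where r: "strict_mono (r :: nat \<Rightarrow> nat)" "\<And>k. l (u (r k)) - l w \<ge> e"
      using infinite_enumerate by blast
    have add: "\<And>f g. f \<in> W12 \<Omega> \<Longrightarrow> g \<in> W12 \<Omega> \<Longrightarrow> l (\<lambda>x. f x + g x) = l f + l g"
      and sc: "\<And>c f. f \<in> W12 \<Omega> \<Longrightarrow> l (\<lambda>x. c *\<^sub>R f x) = c * l f"
      using l by (auto simp: W12_dual_def)
    obtain B where B: "\<forall>f\<in>W12 \<Omega>. \<bar>l f\<bar> \<le> B * W12_norm \<Omega> f"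
      using l unfolding W12_dual_def by blast
    have lim': "(\<lambda>k. sqn (lebesgue_on \<Omega>) (\<lambda>x. u (r k) x - w x)) \<longlonglongrightarrow> 0"
      using LIMSEQ_subseq_LIMSEQ[OF lim r(1)] by (simp add: o_def)
    obtain g where g: "\<And>m. g m \<in> midpoint_hull {u (r k) | k. k \<ge> m}"
      "(\<lambda>m. W12_norm \<Omega> (\<lambda>x. g m x - w x)) \<longlonglongrightarrow> 0"
      using midpoint_hull_converges[of \<Omega> "\<lambda>k. u (r k)" C w, OF \<Omega> u bound w lim'] by blast
    have gW: "g m \<in> W12 \<Omega>" for m
      using midpoint_hull_W12[OF \<Omega> _ g(1)] u by auto
    have "l f - l w \<ge> e" if "f \<in> midpoint_hull {u (r k) | k. k \<ge> m}" for f m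
      using that
    proof induction
      case (base f)
      then show ?case using r(2) by auto
    next
      case (midpoint f h)
      then have W: "f \<in> W12 \<Omega>" "h \<in> W12 \<Omega>" using midpoint_hull_W12[OF \<Omega>, of "{u (r k) | k. k \<ge> m}"] u by auto
      then have "l (\<lambda>x. (1/2) *\<^sub>R f x + (1/2) *\<^sub>R h x) = (1/2) * l f + (1/2) * l h"
        using add[OF W12_scaleR[OF \<Omega> W(1), of "1/2"] W12_scaleR[OF \<Omega> W(2), of "1/2"]] sc[OF W(1)] sc[OF W(2)] by simp
      then show ?case using midpoint.IH by simp
    qed
    then have ge: "l (g m) - l w \<ge> e" for m using g(1) by blast
    have "e \<le> B * W12_norm \<Omega> (\<lambda>x. g m x - w x)" for m
    proof -
      have "l (\<lambda>x. g m x + (-1) *\<^sub>R w x) = l (g m) - l w"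
        using add[OF gW W12_scaleR[OF \<Omega> wW, of "-1"]] sc[OF wW, of "-1"] by simp
      then have "l (\<lambda>x. g m x - w x) = l (g m) - l w" by simp
      then show ?thesis using bspec[OF B W12_diff[OF \<Omega> gW wW], of m] ge[of m] by linarith
    qed
    moreover have "(\<lambda>m. B * W12_norm \<Omega> (\<lambda>x. g m x - w x)) \<longlonglongrightarrow> B * 0"
      by (intro tendsto_mult_left g(2))
    ultimately have "e \<le> 0" using LIMSEQ_le_const[of _ "B * 0" e] by auto
    then show False using e by simp
  qed
  have "(\<lambda>k. l (u k)) \<longlonglongrightarrow> l w" if l: "l \<in> W12_dual \<Omega>" for l
  proof -
    have l': "(\<lambda>f. - l f) \<in> W12_dual \<Omega>"
      using l unfolding W12_dual_def by auto
    show ?thesis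
    proof (rule LIMSEQ_I)
      fix e :: real assume e: "e > 0"
      have "\<forall>\<^sub>F k in sequentially. norm (l (u k) - l w) < e"
        using ev[OF l e] ev[OF l' e] by eventually_elim (simp add: abs_less_iff)
      then show "\<exists>no. \<forall>n\<ge>no. norm (l (u n) - l w) < e" by (simp add: eventually_sequentially)
    qed
  qed
  then show ?thesis using u wW by (simp add: weakly_converges_W12_def)
qed

section \<open>Compactness\<close>

lemma diagonal_convergent:
  fixes b :: "nat \<Rightarrow> 'i \<Rightarrow> 'a::euclidean_space"
  assumes I: "countable I" and M: "\<And>k i. i \<in> I \<Longrightarrow> norm (b k i) \<le> M"
  obtains r where "strict_mono (r :: nat \<Rightarrow> nat)" "\<And>i. i \<in> I \<Longrightarrow> convergent (\<lambda>k. b (r k) i)"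
proof (cases "I = {}")
  case True
  then show ?thesis using that[of id] by (simp add: strict_mono_id)
next
  case False
  define c where "c = from_nat_into I"
  have cI: "c n \<in> I" for n using False by (simp add: c_def from_nat_into)
  interpret D: subseqs "\<lambda>n s. convergent (\<lambda>k. b (s k) (c n))"
  proof
    fix n and s :: "nat \<Rightarrow> nat"
    have "bounded (range (\<lambda>k. b (s k) (c n)))" using M[OF cI] by (auto intro: boundedI)
    then obtain l r where "strict_mono (r :: nat \<Rightarrow> nat)" "((\<lambda>k. b (s k) (c n)) \<circ> r) \<longlonglongrightarrow> l"
      using bounded_imp_convergent_subsequence by blast
    then show "\<exists>r'. strict_mono r' \<and> convergent (\<lambda>k. b ((s \<circ> r') k) (c n))"
      by (auto simp: o_def convergent_def)
  qed
  have "convergent (\<lambda>k. b (D.diagseq k) (c n))" for n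
  proof -
    \<comment> \<open>The diagonal sequence is a subsequence of the \<open>n\<close>-th one only
      from index \<open>Suc n\<close> on; the shift is undone right after.\<close>
    have "convergent (\<lambda>k. b ((D.diagseq \<circ> (+) (Suc n)) k) (c n))"
    proof (rule D.diagseq_holds)
      fix r s :: "nat \<Rightarrow> nat" and n assume "strict_mono r" "convergent (\<lambda>k. b (s k) (c n))"
      then show "convergent (\<lambda>k. b ((s \<circ> r) k) (c n))"
        using convergent_subseq_convergent[of "\<lambda>k. b (s k) (c n)" r] by (simp add: o_def)
    qed
    then have "convergent (\<lambda>k. b (D.diagseq (k + Suc n)) (c n))" by (simp add: o_def add.commute)
    then show ?thesis by (rule convergent_ignore_initial_segment[THEN iffD1])
  qed
  moreover have "\<exists>n. i = c n" if "i \<in> I" for i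
    using from_nat_into_surj[OF I that] by (auto simp: c_def)
  ultimately show ?thesis using that[OF D.subseq_diagseq] by metis
qed

lemma norm_mollify_mollifier_le:
  fixes f :: "real^'n::finite \<Rightarrow> 'b::euclidean_space"
  assumes f: "integrable lebesgue f" and D: "\<And>x. norm (f x) \<le> D" and \<epsilon>: "\<epsilon> > 0"
  shows "norm (mollify (mollifier \<epsilon>) f x) \<le> D"
proof -
  note m = mollifier[OF \<epsilon>, where ?'n='n]
  have i: "integrable lebesgue (\<lambda>y. mollifier \<epsilon> (x - y))"
    using integrable_test_function(2)[OF test_function_reflect[OF m(1)]] .
  have "norm (mollify (mollifier \<epsilon>) f x) \<le> (\<integral>y. norm (mollifier \<epsilon> (x - y) *\<^sub>R f y) \<partial>lebesgue)"
    unfolding mollify_def by (rule integral_norm_bound)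
  also have "\<dots> \<le> (\<integral>y. D * mollifier \<epsilon> (x - y) \<partial>lebesgue)"
  proof (rule integral_mono)
    show "integrable lebesgue (\<lambda>y. norm (mollifier \<epsilon> (x - y) *\<^sub>R f y))"
      by (intro integrable_norm integrable_test_scaleR(2)[OF f m(1)])
    show "integrable lebesgue (\<lambda>y. D * mollifier \<epsilon> (x - y))" using i by simp
    show "norm (mollifier \<epsilon> (x - y) *\<^sub>R f y) \<le> D * mollifier \<epsilon> (x - y)" for y
      using m(2)[of "x - y"] mult_left_mono[OF D[of y] m(2)[of "x - y"]] by (simp add: mult.commute)
  qed
  also have "\<dots> = D" using integral_mollifier[OF \<epsilon>, of x] by simp
  finally show ?thesis .
qed

text \<open>The kernel is uniformly continuous and the \<open>f k\<close> share a bound and a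
  support, so the mollifications are equicontinuous uniformly in \<open>k\<close>; convergence on a
  dense set therefore spreads to every point.\<close>

lemma mollify_convergent_of_dense:
  fixes f :: "nat \<Rightarrow> real^'n::finite \<Rightarrow> 'b::euclidean_space"
  assumes f: "\<And>k. integrable lebesgue (f k)" and S: "compact S" "\<And>k x. x \<notin> S \<Longrightarrow> f k x = 0"
    and D: "\<And>k x. norm (f k x) \<le> D" and \<rho>: "test_function UNIV (\<rho> :: real^'n \<Rightarrow> real)"
    and Q: "\<And>X. open X \<Longrightarrow> X \<noteq> {} \<Longrightarrow> \<exists>q\<in>Q. q \<in> X"
    and conv: "\<And>q. q \<in> Q \<Longrightarrow> convergent (\<lambda>k. mollify \<rho> (f k) q)"
  shows "convergent (\<lambda>k. mollify \<rho> (f k) x)"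
proof -
  define V where "V = measure lebesgue S"
  have iS: "integrable lebesgue (indicator S :: real^'n \<Rightarrow> real)" "(\<integral>x. indicator S x \<partial>lebesgue) = V"
    using lmeasurable_compact[OF S(1)] by (auto simp: V_def fmeasurable_def)
  have V: "V \<ge> 0" by (simp add: V_def)
  have D0: "D \<ge> 0" using D[of 0 0] norm_ge_zero order_trans by blast
  have "Cauchy (\<lambda>k. mollify \<rho> (f k) x)"
  proof (rule metric_CauchyI)
    fix e :: real assume e: "e > 0"
    define e' where "e' = e / (3 * (D * V + 1))"
    have DV: "D * V \<ge> 0" using D0 V by simp
    then have e': "e' > 0" "e' * (D * V) < e / 3" using e by (auto simp: e'_def divide_simps)
    have z: "\<rho> x = 0" if "x \<notin> closure {x. \<rho> x \<noteq> 0}" for x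
      using that closure_subset[of "{x. \<rho> x \<noteq> 0}"] by auto
    obtain d where d: "d > 0" "\<And>x y. norm (x - y) < d \<Longrightarrow> norm (\<rho> x - \<rho> y) < e'"
      using continuous_compact_support_uniform[OF test_functionD(2,4)[OF \<rho>] z e'(1)] by blast
    obtain q where q: "q \<in> Q" "q \<in> ball x d" using Q[of "ball x d"] d(1) by auto
    have near: "norm (mollify \<rho> (f k) x - mollify \<rho> (f k) q) < e / 3" for k
    proof -
      note i = integrable_test_scaleR(2)[OF f \<rho>]
      have "mollify \<rho> (f k) x - mollify \<rho> (f k) q = (\<integral>y. (\<rho> (x - y) - \<rho> (q - y)) *\<^sub>R f k y \<partial>lebesgue)"
        unfolding mollify_def scaleR_left_diff_distrib using i by simp
      also have "norm \<dots> \<le> (\<integral>y. norm ((\<rho> (x - y) - \<rho> (q - y)) *\<^sub>R f k y) \<partial>lebesgue)"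
        by (rule integral_norm_bound)
      also have "\<dots> \<le> (\<integral>y. (e' * D) * indicator S y \<partial>lebesgue)"
      proof (rule integral_mono)
        show "integrable lebesgue (\<lambda>y. norm ((\<rho> (x - y) - \<rho> (q - y)) *\<^sub>R f k y))"
          unfolding scaleR_left_diff_distrib using i by (intro integrable_norm Bochner_Integration.integrable_diff)
        show "integrable lebesgue (\<lambda>y. (e' * D) * indicator S y)" using iS by simp
        fix y
        have "norm (\<rho> (x - y) - \<rho> (q - y)) \<le> e'" using d(2)[of "x - y" "q - y"] q(2) by (simp add: dist_norm)
        then have "norm ((\<rho> (x - y) - \<rho> (q - y)) *\<^sub>R f k y) \<le> e' * D"
          using D[of k y] e'(1) by (simp add: mult_mono)
        then show "norm ((\<rho> (x - y) - \<rho> (q - y)) *\<^sub>R f k y) \<le> (e' * D) * indicator S y"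
          using S(2)[of y k] by (cases "y \<in> S") auto
      qed
      also have "\<dots> = e' * (D * V)" using iS by simp
      also have "\<dots> < e / 3" by (rule e')
      finally show ?thesis .
    qed
    have "Cauchy (\<lambda>k. mollify \<rho> (f k) q)" using conv[OF q(1)] by (rule convergent_Cauchy)
    then obtain N where N: "\<And>m n. m \<ge> N \<Longrightarrow> n \<ge> N \<Longrightarrow> dist (mollify \<rho> (f m) q) (mollify \<rho> (f n) q) < e / 3"
      using e unfolding Cauchy_def by (metis divide_pos_pos zero_less_numeral)
    show "\<exists>N. \<forall>m\<ge>N. \<forall>n\<ge>N. dist (mollify \<rho> (f m) x) (mollify \<rho> (f n) x) < e"
    proof (intro exI[of _ N] allI impI)
      fix m n assume "m \<ge> N" "n \<ge> N"
      then have "dist (mollify \<rho> (f m) q) (mollify \<rho> (f n) q) < e / 3" by (rule N)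
      moreover have "dist (mollify \<rho> (f m) x) (mollify \<rho> (f n) x)
          \<le> dist (mollify \<rho> (f m) x) (mollify \<rho> (f m) q) + dist (mollify \<rho> (f m) q) (mollify \<rho> (f n) q)
            + dist (mollify \<rho> (f n) q) (mollify \<rho> (f n) x)"
        by (meson add_mono dist_triangle dist_triangle_le order_refl order_trans)
      ultimately show "dist (mollify \<rho> (f m) x) (mollify \<rho> (f n) x) < e"
        using near[of m] near[of n] by (simp add: dist_norm norm_minus_commute)
    qed
  qed
  then show ?thesis by (simp add: Cauchy_convergent_iff)
qed

text \<open>The difference of two members is the difference of their mollifications plus two
  mollification errors. The errors are small uniformly in the index once \<epsilon> is chosen from
  the gradient bound; only then does the index grow, and dominated convergence handles the
  mollifications at that fixed scale.\<close>

lemma L2_Cauchy_of_mollify_convergent: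
  fixes f :: "nat \<Rightarrow> real^'n::finite \<Rightarrow> real^'m::finite"
  assumes cs: "\<And>k. compact_sobolev (f k) (G k) S" and D: "\<And>k x. norm (f k x) \<le> D"
    and C: "\<And>k. sqn lebesgue (G k) \<le> ennreal C"
    and conv: "\<And>\<epsilon> x. \<epsilon> \<in> range (\<lambda>j. 1 / real (Suc j)) \<Longrightarrow> convergent (\<lambda>k. mollify (mollifier \<epsilon>) (f k) x)"
    and e: "e > 0"
  shows "\<exists>N. \<forall>i\<ge>N. \<forall>j\<ge>N. sqn lebesgue (\<lambda>x. f i x - f j x) \<le> ennreal e"
proof -
  note int = compact_sobolev.integrable_f[OF cs]
  have S: "compact S" and f0: "\<And>k x. x \<notin> S \<Longrightarrow> f k x = 0"
    using cs by (auto simp: compact_sobolev_def)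
  define C' where "C' = max C 0"
  have C': "C' \<ge> 0" "\<And>k. sqn lebesgue (G k) \<le> ennreal C'"
  proof -
    show "C' \<ge> 0" by (simp add: C'_def)
    show "sqn lebesgue (G k) \<le> ennreal C'" for k
      using C[of k] ennreal_leI[of C C'] by (simp add: C'_def order_trans)
  qed
  \<comment> \<open>The scale is a reciprocal of an integer because convergence is available for
    these countably many scales. The threshold gives
    \<open>48 * \<epsilon>\<^sup>2 * C' \<le> e / 2\<close>; the errors total
    \<open>64 * \<epsilon>\<^sup>2 * C'\<close>, at most two thirds of \<open>e\<close>, and the
    mollified difference adds \<open>e / 4\<close>.\<close>
  obtain j where j: "96 * (C' + 1) / e < real j" using reals_Archimedean2 by blast
  define \<epsilon> where "\<epsilon> = 1 / real (Suc j)"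
  have \<epsilon>: "\<epsilon> > 0" "\<epsilon> \<in> range (\<lambda>j. 1 / real (Suc j))" by (auto simp: \<epsilon>_def)
  have e2: "48 * \<epsilon>\<^sup>2 * C' \<le> e / 2"
  proof -
    have "96 * (C' + 1) < e * real (Suc j)" using j e by (simp add: field_simps)
    then have "48 * \<epsilon> * C' \<le> e / 2" by (simp add: \<epsilon>_def divide_simps)
    moreover have "\<epsilon>\<^sup>2 \<le> \<epsilon>" by (simp add: \<epsilon>_def power2_eq_square divide_simps)
    ultimately show ?thesis using C'(1) mult_right_mono[of "\<epsilon>\<^sup>2" \<epsilon> "48 * C'"] by (simp add: mult_ac)
  qed
  define m where "m k = mollify (mollifier \<epsilon>) (f k)" for k
  define m0 where "m0 x = lim (\<lambda>k. m k x)" for x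
  have mm[measurable]: "m k \<in> borel_measurable lebesgue" for k
    unfolding m_def by (intro borel_measurable_integrable integrable_test_function(2)[OF compact_sobolev.test_function_mollify_f[OF cs \<epsilon>(1)]])
  have lim: "(\<lambda>k. m k x) \<longlonglongrightarrow> m0 x" for x
    unfolding m0_def m_def using conv[OF \<epsilon>(2)] by (simp add: convergent_LIMSEQ_iff)
  have m0m[measurable]: "m0 \<in> borel_measurable lebesgue"
    unfolding m0_def by (rule borel_measurable_lim_metric) (rule mm)
  have mb: "norm (m k x) \<le> D" for k x
    unfolding m_def by (rule norm_mollify_mollifier_le[OF int D \<epsilon>(1)])
  have m0b: "norm (m0 x) \<le> D" for x
    by (rule LIMSEQ_le_const2[OF tendsto_norm[OF lim]]) (use mb in auto)
  define T where "T = {x + y | x y. x \<in> S \<and> y \<in> cball 0 \<epsilon>}"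
  have T: "compact T" unfolding T_def using S by (intro compact_sums) auto
  have mT: "m k x = 0" if "x \<notin> T" for k x
    unfolding m_def
  proof (rule mollify_eq_zero)
    fix y assume "f k y \<noteq> 0"
    then have "y \<in> S" using f0 by blast
    show "mollifier \<epsilon> (x - y) = 0"
    proof (rule mollifier(3)[OF \<epsilon>(1)], rule ccontr)
      assume "\<not> \<epsilon> \<le> norm (x - y)"
      then have "x = y + (x - y)" "x - y \<in> cball 0 \<epsilon>" by auto
      then show False using that \<open>y \<in> S\<close> unfolding T_def by blast
    qed
  qed
  have m0T: "m0 x = 0" if "x \<notin> T" for x
    using lim[of x] mT[OF that] by (simp add: LIMSEQ_const_iff)
  have "(\<lambda>k. sqn lebesgue (\<lambda>x. m k x - m0 x)) \<longlonglongrightarrow> 0"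
  proof (rule sqn_tendsto_zero_dominated[where w="\<lambda>x. ennreal ((2 * D)\<^sup>2) * indicator T x"])
    show "AE x in lebesgue. ennreal ((norm (m k x - m0 x))\<^sup>2) \<le> ennreal ((2 * D)\<^sup>2) * indicator T x" for k
    proof (rule AE_I2)
      fix x
      have "norm (m k x - m0 x) \<le> 2 * D" using norm_triangle_ineq4[of "m k x" "m0 x"] mb[of k x] m0b[of x] by linarith
      then have "(norm (m k x - m0 x))\<^sup>2 \<le> (2 * D)\<^sup>2" by (intro power_mono) auto
      then show "ennreal ((norm (m k x - m0 x))\<^sup>2) \<le> ennreal ((2 * D)\<^sup>2) * indicator T x"
        using mT[of x k] m0T[of x] by (cases "x \<in> T") (auto intro: ennreal_leI)
    qed
    have Tm: "T \<in> sets lebesgue" "emeasure lebesgue T < \<infinity>"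
      using lmeasurable_compact[OF T] by (auto simp: fmeasurable_def)
    then show "(\<integral>\<^sup>+x. ennreal ((2 * D)\<^sup>2) * indicator T x \<partial>lebesgue) < \<infinity>"
      by (subst nn_integral_cmult_indicator) (auto simp: ennreal_mult_less_top)
    show "(\<lambda>x. ennreal ((2 * D)\<^sup>2) * indicator T x) \<in> borel_measurable lebesgue"
      using Tm(1) by measurable
    show "AE x in lebesgue. (\<lambda>k. m k x - m0 x) \<longlonglongrightarrow> 0"
      using lim by (intro AE_I2) (simp add: LIM_zero)
  qed measurable
  then obtain N where N: "\<And>k. k \<ge> N \<Longrightarrow> sqn lebesgue (\<lambda>x. m k x - m0 x) \<le> ennreal (e / 32)"
    using e unfolding ennreal_tendsto_zero_iff eventually_sequentially by (metis zero_less_divide_iff zero_less_numeral)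
  have fm[measurable]: "f k \<in> borel_measurable lebesgue" for k using int by (rule borel_measurable_integrable)
  have A: "sqn lebesgue (\<lambda>x. m k x - f k x) \<le> ennreal (8 * \<epsilon>\<^sup>2 * C')" for k
  proof -
    have "sqn lebesgue (\<lambda>x. m k x - f k x) \<le> ennreal (8 * \<epsilon>\<^sup>2) * sqn lebesgue (G k)"
      unfolding m_def by (rule compact_sobolev.sqn_mollify_diff_le_gradient[OF cs \<epsilon>(1)])
    also have "\<dots> \<le> ennreal (8 * \<epsilon>\<^sup>2) * ennreal C'" by (intro mult_left_mono C') simp
    finally show ?thesis using C' by (simp add: ennreal_mult)
  qed
  show ?thesis
  proof (intro exI[of _ N] allI impI)
    fix i k assume ik: "N \<le> i" "N \<le> k"
    have "sqn lebesgue (\<lambda>x. m i x - m k x) = sqn lebesgue (\<lambda>x. (m i x - m0 x) - (m k x - m0 x))" by simp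
    also have "\<dots> \<le> 2 * sqn lebesgue (\<lambda>x. m i x - m0 x) + 2 * sqn lebesgue (\<lambda>x. m k x - m0 x)"
      by (rule sqn_diff_le) measurable
    also have "\<dots> \<le> 2 * ennreal (e / 32) + 2 * ennreal (e / 32)"
      by (intro add_mono mult_left_mono N ik) auto
    also have "\<dots> = ennreal (e / 8)" using e by (simp add: two_mult_ennreal flip: ennreal_plus)
    finally have B: "sqn lebesgue (\<lambda>x. m i x - m k x) \<le> ennreal (e / 8)" .
    have AA: "sqn lebesgue (\<lambda>x. (m i x - f i x) - (m k x - f k x)) \<le> 2 * ennreal (8 * \<epsilon>\<^sup>2 * C') + 2 * ennreal (8 * \<epsilon>\<^sup>2 * C')"
    proof -
      have "sqn lebesgue (\<lambda>x. (m i x - f i x) - (m k x - f k x)) \<le> 2 * sqn lebesgue (\<lambda>x. m i x - f i x) + 2 * sqn lebesgue (\<lambda>x. m k x - f k x)"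
        by (rule sqn_diff_le) measurable
      also have "\<dots> \<le> 2 * ennreal (8 * \<epsilon>\<^sup>2 * C') + 2 * ennreal (8 * \<epsilon>\<^sup>2 * C')"
        by (intro add_mono mult_left_mono A) auto
      finally show ?thesis .
    qed
    have "sqn lebesgue (\<lambda>x. f i x - f k x) = sqn lebesgue (\<lambda>x. (m i x - m k x) - ((m i x - f i x) - (m k x - f k x)))"
      by (simp add: algebra_simps)
    also have "\<dots> \<le> 2 * sqn lebesgue (\<lambda>x. m i x - m k x) + 2 * sqn lebesgue (\<lambda>x. (m i x - f i x) - (m k x - f k x))"
      by (rule sqn_diff_le) measurable
    also have "\<dots> \<le> 2 * ennreal (e / 8) + 2 * (2 * ennreal (8 * \<epsilon>\<^sup>2 * C') + 2 * ennreal (8 * \<epsilon>\<^sup>2 * C'))"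
      by (intro add_mono mult_left_mono B AA) auto
    also have "\<dots> = ennreal (e / 4 + 64 * \<epsilon>\<^sup>2 * C')"
      using e C' by (simp add: two_mult_ennreal algebra_simps flip: ennreal_plus)
    also have "\<dots> \<le> ennreal e"
    proof (rule ennreal_leI)
      have "64 * \<epsilon>\<^sup>2 * C' \<le> (2 / 3) * e" using e2 by linarith
      then show "e / 4 + 64 * \<epsilon>\<^sup>2 * C' \<le> e" using e by linarith
    qed
    finally show "sqn lebesgue (\<lambda>x. f i x - f k x) \<le> ennreal e" .
  qed
qed

section \<open>Products with cutoffs and local Sobolev maps\<close>

definition outer :: "real^'m::finite \<Rightarrow> real^'n::finite \<Rightarrow> real^'n^'m" where
  "outer a b = (\<chi> j i. a $ j * b $ i)"

definition gradient :: "(real^'n::finite \<Rightarrow> real) \<Rightarrow> real^'n \<Rightarrow> real^'n" where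
  "gradient \<eta> x = (\<chi> i. partial_deriv i \<eta> x)"

lemma norm_outer: "norm (outer a b) = norm a * norm b"
proof -
  have n: "(norm v)\<^sup>2 = (\<Sum>j\<in>UNIV. (norm (v $ j))\<^sup>2)" for v :: "'c::real_inner^'k::finite"
    by (simp add: norm_vec_def L2_set_def sum_nonneg)
  have "(norm (outer a b))\<^sup>2 = (\<Sum>j\<in>UNIV. \<Sum>i\<in>UNIV. (norm (a $ j))\<^sup>2 * (norm (b $ i))\<^sup>2)"
    by (simp add: n outer_def power_mult_distrib)
  also have "\<dots> = (norm a * norm b)\<^sup>2"
    by (simp only: power_mult_distrib n sum_product)
  finally show ?thesis by (simp add: power2_eq_iff_nonneg)
qed

lemma gradient_bounded:
  assumes "test_function \<Omega> \<eta>"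
  obtains B where "B \<ge> 0" "\<And>x. norm (gradient \<eta> x) \<le> B"
proof -
  have "\<exists>C. \<forall>x. norm (partial_deriv i \<eta> x) \<le> C" for i
    using test_function_bounded[OF test_function_partial_deriv[OF assms]] by metis
  then obtain C where C: "\<And>i x. norm (partial_deriv i \<eta> x) \<le> C i" by metis
  have le: "norm (gradient \<eta> x) \<le> (\<Sum>i\<in>UNIV. C i)" for x
  proof -
    have "norm (gradient \<eta> x) \<le> (\<Sum>i\<in>UNIV. \<bar>gradient \<eta> x $ i\<bar>)" by (rule norm_le_l1_cart)
    also have "\<dots> \<le> (\<Sum>i\<in>UNIV. C i)" using C by (intro sum_mono) (simp add: gradient_def)
    finally show ?thesis .
  qed
  show ?thesis by (rule that[OF order_trans[OF norm_ge_zero le[of 0]] le])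
qed

lemma gradient_eq_zero:
  assumes "test_function \<Omega> \<eta>" "x \<notin> closure {x. \<eta> x \<noteq> 0}"
  shows "gradient \<eta> x = 0"
  using support_partial_deriv[of _ \<eta>] assms(2) by (auto simp: gradient_def vec_eq_iff)

lemma gradient_eq_zero_open:
  assumes "open U" "x \<in> U" "\<And>y. y \<in> U \<Longrightarrow> \<eta> y = c"
  shows "gradient \<eta> x = 0"
proof -
  have "(\<eta> has_derivative (\<lambda>h. 0)) (at x)"
    by (rule has_derivative_transform_within_open[of "\<lambda>_. c" _ _ UNIV U]) (use assms in auto)
  then show ?thesis by (simp add: gradient_def partial_deriv_eqI vec_eq_iff)
qed

text \<open>Turns a map known on \<Omega> only into one with compact support on the whole space. The
  gradient bound involves the original map through its two seminorms only, so it is uniform along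
  bounded sequences.\<close>

lemma cutoff_sobolev:
  fixes u :: "real^'n::finite \<Rightarrow> real^'m::finite" and \<eta> :: "real^'n \<Rightarrow> real"
  assumes \<Omega>: "open \<Omega>" and u: "L2 \<Omega> u" "has_weak_gradient \<Omega> u G" "L2 \<Omega> G"
    and \<eta>: "test_function \<Omega> \<eta>" "\<And>x. \<bar>\<eta> x\<bar> \<le> 1" and B: "\<And>x. norm (gradient \<eta> x) \<le> B"
  shows "compact_sobolev (\<lambda>x. \<eta> x *\<^sub>R u x) (\<lambda>x. \<eta> x *\<^sub>R G x + outer (u x) (gradient \<eta> x)) (closure {x. \<eta> x \<noteq> 0})"
    and "sqn lebesgue (\<lambda>x. \<eta> x *\<^sub>R G x + outer (u x) (gradient \<eta> x))
      \<le> 2 * sqn (lebesgue_on \<Omega>) G + ennreal (2 * B\<^sup>2) * sqn (lebesgue_on \<Omega>) u"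
proof -
  let ?G = "\<lambda>x. \<eta> x *\<^sub>R G x + outer (u x) (gradient \<eta> x)"
  have grad: "has_weak_gradient UNIV (\<lambda>x. \<eta> x *\<^sub>R u x) ?G"
    using has_weak_gradient_cutoff[OF \<Omega> u(2) \<eta>(1)] by (simp add: outer_def gradient_def)
  have zero: "\<eta> x = 0" "gradient \<eta> x = 0" if "x \<notin> closure {x. \<eta> x \<noteq> 0}" for x
    using that gradient_eq_zero[OF \<eta>(1) that] closure_subset[of "{x. \<eta> x \<noteq> 0}"] by auto
  have zero\<Omega>: "\<eta> x = 0" "gradient \<eta> x = 0" if "x \<notin> \<Omega>" for x
    using zero[of x] that test_functionD(5)[OF \<eta>(1)] by auto
  have le: "(norm (?G x))\<^sup>2 \<le> 2 * (norm (G x))\<^sup>2 + 2 * B\<^sup>2 * (norm (u x))\<^sup>2" for x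
  proof -
    have "norm (\<eta> x *\<^sub>R G x) \<le> norm (G x)" using \<eta>(2)[of x] by (simp add: mult_left_le_one_le)
    then have "(norm (\<eta> x *\<^sub>R G x))\<^sup>2 \<le> (norm (G x))\<^sup>2" by (intro power_mono) auto
    moreover have "norm (outer (u x) (gradient \<eta> x)) \<le> norm (u x) * B"
      unfolding norm_outer using B by (intro mult_left_mono) auto
    then have "(norm (outer (u x) (gradient \<eta> x)))\<^sup>2 \<le> (norm (u x) * B)\<^sup>2" by (intro power_mono) auto
    ultimately show ?thesis
      using norm_add_sq_le[of "\<eta> x *\<^sub>R G x" "outer (u x) (gradient \<eta> x)"] by (simp add: power_mult_distrib mult_ac)
  qed
  have "sqn lebesgue ?G = sqn (lebesgue_on \<Omega>) ?G"
    using zero\<Omega> by (intro sqn_restrict_support[symmetric] open_lebesgue[OF \<Omega>]) (simp add: outer_def vec_eq_iff)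
  also have "\<dots> \<le> (\<integral>\<^sup>+x. 2 * ennreal ((norm (G x))\<^sup>2) + ennreal (2 * B\<^sup>2) * ennreal ((norm (u x))\<^sup>2) \<partial>lebesgue_on \<Omega>)"
    unfolding sqn_def
  proof (rule nn_integral_mono)
    fix x
    have "ennreal ((norm (?G x))\<^sup>2) \<le> ennreal (2 * (norm (G x))\<^sup>2 + 2 * B\<^sup>2 * (norm (u x))\<^sup>2)"
      by (rule ennreal_leI[OF le])
    also have "\<dots> = ennreal (2 * (norm (G x))\<^sup>2) + ennreal (2 * B\<^sup>2 * (norm (u x))\<^sup>2)" by (rule ennreal_plus) auto
    also have "\<dots> = 2 * ennreal ((norm (G x))\<^sup>2) + ennreal (2 * B\<^sup>2) * ennreal ((norm (u x))\<^sup>2)"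
      by (subst ennreal_mult[of "2 * B\<^sup>2"]) (auto simp: two_mult_ennreal)
    finally show "ennreal ((norm (?G x))\<^sup>2) \<le> 2 * ennreal ((norm (G x))\<^sup>2) + ennreal (2 * B\<^sup>2) * ennreal ((norm (u x))\<^sup>2)" .
  qed
  also have "\<dots> = 2 * sqn (lebesgue_on \<Omega>) G + ennreal (2 * B\<^sup>2) * sqn (lebesgue_on \<Omega>) u"
    unfolding sqn_def using L2_measurable[OF u(1)] L2_measurable[OF u(3)]
    by (subst nn_integral_add) (auto simp: nn_integral_cmult)
  finally show sq: "sqn lebesgue ?G \<le> 2 * sqn (lebesgue_on \<Omega>) G + ennreal (2 * B\<^sup>2) * sqn (lebesgue_on \<Omega>) u" .
  also have "\<dots> < \<infinity>" using u(1,3) by (simp add: L2_iff ennreal_mult_less_top)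
  finally have fin: "sqn lebesgue ?G < \<infinity>" .
  show "compact_sobolev (\<lambda>x. \<eta> x *\<^sub>R u x) ?G (closure {x. \<eta> x \<noteq> 0})"
  proof
    show "has_weak_gradient UNIV (\<lambda>x. \<eta> x *\<^sub>R u x) ?G" by fact
    show "compact (closure {x. \<eta> x \<noteq> 0})" by (rule test_functionD(4)[OF \<eta>(1)])
    show "\<eta> x *\<^sub>R u x = 0" "?G x = 0" if "x \<notin> closure {x. \<eta> x \<noteq> 0}" for x
      using zero[OF that] by (auto simp: outer_def vec_eq_iff)
    show "L2 UNIV (\<lambda>x. \<eta> x *\<^sub>R u x)"
    proof (rule L2_bound[OF L2_extend_zero[OF \<Omega> u(1)]])
      show "(\<lambda>x. \<eta> x *\<^sub>R u x) \<in> borel_measurable (lebesgue_on UNIV)"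
        using measurable_of_locally_integrable[OF open_UNIV has_weak_gradientD(1)[OF open_UNIV grad]] .
      show "AE x in lebesgue_on UNIV. norm (\<eta> x *\<^sub>R u x) \<le> norm (if x \<in> \<Omega> then u x else 0)"
        using \<eta>(2) zero\<Omega> by (intro AE_I2) (auto simp: mult_left_le_one_le)
    qed
    show "L2 UNIV ?G"
      using fin measurable_of_locally_integrable[OF open_UNIV has_weak_gradientD(2)[OF open_UNIV grad]]
      by (simp add: L2_iff lebesgue_on_UNIV_eq)
  qed
qed

lemma ball_cutoff:
  obtains \<eta> :: "real^'n::finite \<Rightarrow> real" where "test_function (ball 0 (R + 2)) \<eta>"
    "\<And>x. 0 \<le> \<eta> x" "\<And>x. \<eta> x \<le> 1" "\<And>x. norm x \<le> R \<Longrightarrow> \<eta> x = 1"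
proof -
  have ne: "insert 0 (cball (0::real^'n) R) \<noteq> {}" by simp
  \<comment> \<open>\<open>insert 0\<close> keeps the set nonempty when \<open>R\<close> is negative
    and does nothing otherwise.\<close>
  obtain \<eta> :: "real^'n \<Rightarrow> real" where \<eta>: "test_function {x. infdist x (insert 0 (cball (0::real^'n) R)) < 1} \<eta>"
    "\<And>x. 0 \<le> \<eta> x" "\<And>x. \<eta> x \<le> 1" "\<And>x. infdist x (insert 0 (cball 0 R)) \<le> 1 / 4 \<Longrightarrow> \<eta> x = 1"
    by (rule cutoff_exists[of "insert 0 (cball (0::real^'n) R)" 1]) auto
  show ?thesis
  proof (cases "R \<ge> 0")
    case True
    then have eq: "insert 0 (cball (0::real^'n) R) = cball 0 R" by auto
    have "{x. infdist x (cball (0::real^'n) R) < 1} \<subseteq> ball 0 (R + 2)"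
    proof safe
      fix x :: "real^'n" assume x: "infdist x (cball 0 R) < 1"
      obtain y where "y \<in> cball (0::real^'n) R" "infdist x (cball 0 R) = dist x y"
        using infdist_attains_inf[of "cball (0::real^'n) R" x] True by auto
      then show "x \<in> ball 0 (R + 2)" using x norm_triangle_ineq2[of x y] by (simp add: dist_norm)
    qed
    then show ?thesis using that[of \<eta>] \<eta> unfolding eq by (auto intro: test_function_mono)
  next
    case False
    have "test_function (ball 0 (R + 2)) (\<lambda>x::real^'n. 0 :: real)"
      by (rule test_functionI[of _ "{}"]) auto
    moreover have "\<not> norm x \<le> R" for x :: "real^'n" using False norm_ge_zero[of x] by linarith
    ultimately show ?thesis using that[of "\<lambda>x. 0"] by simp
  qed
qed

lemma W12_loc_D:
  "u \<in> W12_loc \<Longrightarrow> open \<Omega> \<Longrightarrow> bounded \<Omega> \<Longrightarrow> u \<in> W12 \<Omega>"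
  by (simp add: W12_loc_def)

lemma W12_loc_measurable:
  fixes u :: "real^'n::finite \<Rightarrow> real^'m::finite"
  assumes "u \<in> W12_loc"
  shows "u \<in> borel_measurable lebesgue"
proof -
  have "locally_integrable UNIV u"
    unfolding locally_integrable_def
  proof (intro allI impI)
    fix K :: "(real^'n) set" assume K: "compact K \<and> K \<subseteq> UNIV"
    obtain R where R: "K \<subseteq> ball 0 R" using bounded_subset_ballD[OF compact_imp_bounded, of K 0] K by auto
    have "u \<in> W12 (ball 0 R)" using W12_loc_D[OF assms] by auto
    then have "locally_integrable (ball 0 R) u" by (intro L2_locally_integrable W12D(1) open_lebesgue open_ball)
    then show "integrable (lebesgue_on K) u" using K R by (simp add: locally_integrable_def)
  qed
  from measurable_of_locally_integrable[OF open_UNIV this] show ?thesis by (simp add: lebesgue_on_UNIV_eq)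
qed

lemma sqn_bounded_le:
  fixes u :: "real^'n::finite \<Rightarrow> 'b::euclidean_space"
  assumes "\<And>x. norm (u x) \<le> D" "\<Omega> \<in> lmeasurable"
  shows "sqn (lebesgue_on \<Omega>) u \<le> ennreal (D\<^sup>2 * measure lebesgue \<Omega>)"
proof -
  have "sqn (lebesgue_on \<Omega>) u \<le> (\<integral>\<^sup>+x. ennreal (D\<^sup>2) * indicator \<Omega> x \<partial>lebesgue)"
    unfolding sqn_restrict[OF fmeasurableD[OF assms(2)]] using assms(1)
    by (intro nn_integral_mono mult_right_mono ennreal_leI power_mono) auto
  also have "\<dots> = ennreal (D\<^sup>2) * ennreal (measure lebesgue \<Omega>)"
    by (subst nn_integral_cmult_indicator[OF fmeasurableD[OF assms(2)]]) (simp only: emeasure_eq_measure2[OF assms(2)])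
  finally show ?thesis by (simp add: ennreal_mult)
qed

text \<open>Rellich's theorem for all balls at once. Cutting off at every integer radius yields
  integrable maps with bounded gradients; a subsequence along which their mollifications converge is
  Cauchy in \<open>L\<^sup>2\<close> of each ball, and a second, fast subsequence converges almost
  everywhere.\<close>

theorem rellich_subsequence:
  fixes u :: "nat \<Rightarrow> real^'n::finite \<Rightarrow> real^'m::finite"
  assumes u: "\<And>k. u k \<in> W12_loc" and D: "\<And>k x. norm (u k x) \<le> D"
    and bound: "\<And>R. \<exists>C. \<forall>k. (LINT x|lebesgue_on (ball 0 R). (norm (weak_gradient (ball 0 R) (u k) x))\<^sup>2) \<le> C"
  obtains r where "strict_mono (r :: nat \<Rightarrow> nat)" "AE x in lebesgue. convergent (\<lambda>k. u (r k) x)"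
proof -
  have D0: "D \<ge> 0" using D[of 0 0] norm_ge_zero order_trans by blast
  have "\<exists>\<eta>::real^'n \<Rightarrow> real. test_function (ball 0 (real R + 2)) \<eta> \<and> (\<forall>x. 0 \<le> \<eta> x \<and> \<eta> x \<le> 1) \<and> (\<forall>x. norm x \<le> real R \<longrightarrow> \<eta> x = 1)" for R :: nat
    by (rule ball_cutoff[of "real R"]) auto
  then obtain \<eta> where \<eta>: "\<And>R. test_function (ball 0 (real R + 2)) (\<eta> R)"
    "\<And>R (x::real^'n). 0 \<le> \<eta> R x" "\<And>R x. \<eta> R x \<le> (1::real)" "\<And>R x. norm x \<le> real R \<Longrightarrow> \<eta> R x = 1" by metis
  define F where "F R k x = \<eta> R x *\<^sub>R u k x" for R k x
  define S where "S R = closure {x. \<eta> R x \<noteq> 0}" for R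
  define G where "G R k x = \<eta> R x *\<^sub>R weak_gradient (ball 0 (real R + 2)) (u k) x + outer (u k x) (gradient (\<eta> R) x)" for R k x
  have uW: "u k \<in> W12 (ball 0 R)" for k R using W12_loc_D[OF u] by auto
  note w = W12D[OF open_ball uW]
  have "\<exists>B. \<forall>x. norm (gradient (\<eta> R) x) \<le> B" for R using gradient_bounded[OF \<eta>(1)] by metis
  then obtain B where B: "\<And>R x. norm (gradient (\<eta> R) x) \<le> B R" by metis
  have \<eta>1: "\<bar>\<eta> R x\<bar> \<le> 1" for R x using \<eta>(2,3)[of R x] by simp
  note cut = cutoff_sobolev[OF open_ball w \<eta>(1) \<eta>1 B]
  have cs: "compact_sobolev (F R k) (G R k) (S R)" for R k
    using cut(1) unfolding F_def[abs_def] G_def[abs_def] S_def .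
  have FD: "norm (F R k x) \<le> D" for R k x
    using mult_mono[OF \<eta>(3)[of R x] D[of k x]] \<eta>(2)[of R x] by (simp add: F_def)
  have "\<exists>C. \<forall>k. sqn lebesgue (G R k) \<le> ennreal C" for R
  proof -
    let ?b = "ball (0::real^'n) (real R + 2)"
    obtain C where C: "\<And>k. (LINT x|lebesgue_on ?b. (norm (weak_gradient ?b (u k) x))\<^sup>2) \<le> C" using bound by blast
    have C0: "C \<ge> 0" using C[of 0] by (rule order_trans[rotated]) simp
    define V where "V = D\<^sup>2 * measure lebesgue ?b"
    have V0: "V \<ge> 0" by (simp add: V_def)
    have "sqn lebesgue (G R k) \<le> ennreal (2 * C + 2 * (B R)\<^sup>2 * V)" for k
    proof -
      have "sqn lebesgue (G R k) \<le> 2 * sqn (lebesgue_on ?b) (weak_gradient ?b (u k)) + ennreal (2 * (B R)\<^sup>2) * sqn (lebesgue_on ?b) (u k)"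
        using cut(2) unfolding G_def[abs_def] .
      also have "\<dots> \<le> 2 * ennreal C + ennreal (2 * (B R)\<^sup>2) * ennreal V"
      proof (intro add_mono mult_left_mono)
        show "sqn (lebesgue_on ?b) (weak_gradient ?b (u k)) \<le> ennreal C"
          using C sqn_eq_integral[OF w(3)] by (simp add: ennreal_leI)
        show "sqn (lebesgue_on ?b) (u k) \<le> ennreal V"
          unfolding V_def by (rule sqn_bounded_le[OF D lmeasurable_ball])
      qed auto
      also have "\<dots> = ennreal (2 * C + 2 * (B R)\<^sup>2 * V)"
        using C0 V0 by (simp add: two_mult_ennreal ennreal_mult[symmetric] ennreal_plus[symmetric] del: ennreal_plus)
      finally show ?thesis .
    qed
    then show ?thesis by blast
  qed
  then obtain C where C: "\<And>R k. sqn lebesgue (G R k) \<le> ennreal (C R)" by metis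
  obtain Q :: "(real^'n) set" where Q: "countable Q" "\<And>X. open X \<Longrightarrow> X \<noteq> {} \<Longrightarrow> \<exists>q\<in>Q. q \<in> X"
    using countable_dense_setE by metis
  \<comment> \<open>Triples of radius, mollification scale and point of a dense set: countably many
    bounded sequences, to which one diagonal subsequence applies.\<close>
  define I where "I = (UNIV :: nat set) \<times> (UNIV :: nat set) \<times> Q"
  have cI: "countable I" unfolding I_def using Q(1) by auto
  define b where "b k = (\<lambda>(R, j, q). mollify (mollifier (1 / real (Suc j))) (F R k) q)" for k
  have "norm (b k i) \<le> D" for k i
    unfolding b_def
    by (cases i) (auto intro!: norm_mollify_mollifier_le FD compact_sobolev.integrable_f[OF cs])
  then obtain r where r: "strict_mono (r :: nat \<Rightarrow> nat)" and conv: "\<And>i. i \<in> I \<Longrightarrow> convergent (\<lambda>k. b (r k) i)"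
    using diagonal_convergent[OF cI] by metis
  have CL: "\<exists>N. \<forall>i\<ge>N. \<forall>j\<ge>N. sqn lebesgue (\<lambda>x. F R (r i) x - F R (r j) x) \<le> ennreal e" if "e > 0" for e R
  proof (rule L2_Cauchy_of_mollify_convergent[OF cs FD C _ that])
    fix \<epsilon> x assume "\<epsilon> \<in> range (\<lambda>j. 1 / real (Suc j))"
    then obtain j where j: "\<epsilon> = 1 / real (Suc j)" by blast
    then have \<epsilon>: "\<epsilon> > 0" by simp
    show "convergent (\<lambda>k. mollify (mollifier \<epsilon>) (F R (r k)) x)"
    proof (rule mollify_convergent_of_dense[OF compact_sobolev.integrable_f[OF cs] _ _ FD mollifier(1)[OF \<epsilon>] Q(2)])
      show "compact (S R)" "\<And>k x. x \<notin> S R \<Longrightarrow> F R (r k) x = 0"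
        using cs by (auto simp: compact_sobolev_def)
      show "convergent (\<lambda>k. mollify (mollifier \<epsilon>) (F R (r k)) q)" if "q \<in> Q" for q
        using conv[of "(R, j, q)"] that by (simp add: I_def b_def j)
    qed
  qed
  have um: "u k \<in> borel_measurable lebesgue" for k using W12_loc_measurable[OF u] .
  \<comment> \<open>The first argument, the radius, is also the index in
    \<open>fast_subsequence\<close>, so the rate improves while the ball grows.\<close>
  define d where "d R i j = sqn (lebesgue_on (ball 0 (real R))) (\<lambda>x. u (r i) x - u (r j) x)" for R :: nat and i j
  have dC: "\<exists>N. \<forall>i\<ge>N. \<forall>j\<ge>N. d R i j \<le> ennreal e" if "e > 0" for e R
  proof -
    have "d R i j \<le> sqn lebesgue (\<lambda>x. F R (r i) x - F R (r j) x)" for i j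
    proof -
      have "d R i j = sqn (lebesgue_on (ball 0 (real R))) (\<lambda>x. F R (r i) x - F R (r j) x)"
        unfolding d_def sqn_def using \<eta>(4)
        by (intro nn_integral_cong) (auto simp: space_restrict_space F_def)
      also have "\<dots> \<le> sqn lebesgue (\<lambda>x. F R (r i) x - F R (r j) x)" by (rule sqn_open_le[OF open_ball])
      finally show ?thesis .
    qed
    then show ?thesis using CL[OF that, of R] by (meson order_trans)
  qed
  obtain s where s: "strict_mono (s :: nat \<Rightarrow> nat)" and ds: "\<And>k i j. i \<ge> k \<Longrightarrow> j \<ge> k \<Longrightarrow> d k (s i) (s j) \<le> ennreal ((1/8) ^ k)"
    using fast_subsequence[of d] dC by metis
  have "AE x in lebesgue_on (ball 0 (real R)). convergent (\<lambda>k. u (r (s k)) x)" for R :: nat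
  proof -
    \<comment> \<open>Shifting by \<open>R\<close> ensures that the ball controlled at index
      \<open>k + R\<close> contains the ball of radius \<open>R\<close>.\<close>
    have "AE x in lebesgue_on (ball 0 (real R)). convergent (\<lambda>k. u (r (s (k + R))) x)"
    proof (rule AE_convergent_fast_Cauchy)
      show "u (r (s (k + R))) \<in> borel_measurable (lebesgue_on (ball 0 (real R)))" for k
        using um by (rule measurable_restrict_space1)
      show "sqn (lebesgue_on (ball 0 (real R))) (\<lambda>x. u (r (s (Suc k + R))) x - u (r (s (k + R))) x) \<le> ennreal ((1/8) ^ k)" for k
      proof -
        have "sqn (lebesgue_on (ball 0 (real R))) (\<lambda>x. u (r (s (Suc k + R))) x - u (r (s (k + R))) x) \<le> d (k + R) (s (Suc k + R)) (s (k + R))"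
          unfolding d_def by (intro sqn_restrict_mono open_lebesgue) (auto intro: subset_ball)
        also have "\<dots> \<le> ennreal ((1/8) ^ (k + R))" by (rule ds) auto
        also have "\<dots> \<le> ennreal ((1/8) ^ k)" by (intro ennreal_leI power_decreasing) auto
        finally show ?thesis .
      qed
    qed
    then show ?thesis
      by eventually_elim (rule convergent_ignore_initial_segment[THEN iffD1])
  qed
  then have "AE x in lebesgue. \<forall>R::nat. x \<in> ball 0 (real R) \<longrightarrow> convergent (\<lambda>k. u (r (s k)) x)"
    by (subst AE_all_countable) (auto simp: AE_lebesgue_on_iff[OF open_lebesgue[OF open_ball]])
  then have "AE x in lebesgue. convergent (\<lambda>k. u (r (s k)) x)"
  proof eventually_elim
    case (elim x)
    obtain R where "norm x < real R" using reals_Archimedean2 by blast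
    then show ?case using elim by auto
  qed
  then show ?thesis using that[of "r \<circ> s"] strict_mono_o[OF r s] by (simp add: o_def)
qed

section \<open>The potentials\<close>

text \<open>A coefficient equal to 1 forces the other ones to vanish, so the combination is a point
  of \<open>A\<close>. Off \<open>A\<close> the strict bound on the coefficients thus holds for
  every representation, and convexity becomes available for the values of the maps.\<close>

lemma S_hull_closed_eq:
  fixes A :: "(real^'m::finite) set"
  assumes A: "finite A"
  shows "S_hull_closed A = convex hull A" and "S_hull A = convex hull A - A"
proof -
  have 1: "S_hull_closed A \<subseteq> convex hull A"
    unfolding S_hull_closed_def S_hull_def convex_hull_finite[OF A]
  proof (intro Un_least subsetI)
    fix y assume "y \<in> {\<Sum>a\<in>A. c a *\<^sub>R a |c. sum c A = 1 \<and> (\<forall>a\<in>A. 0 \<le> c a \<and> c a < 1)} - A"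
    then show "y \<in> {y. \<exists>u. (\<forall>x\<in>A. 0 \<le> u x) \<and> sum u A = 1 \<and> (\<Sum>x\<in>A. u x *\<^sub>R x) = y}" by blast
  next
    fix y assume "y \<in> A"
    then have "y \<in> convex hull A" by (rule hull_inc)
    then show "y \<in> {y. \<exists>u. (\<forall>x\<in>A. 0 \<le> u x) \<and> sum u A = 1 \<and> (\<Sum>x\<in>A. u x *\<^sub>R x) = y}"
      unfolding convex_hull_finite[OF A] .
  qed
  have 2: "convex hull A - A \<subseteq> S_hull A"
  proof
    fix y assume y: "y \<in> convex hull A - A"
    then obtain c where c: "\<And>a. a \<in> A \<Longrightarrow> 0 \<le> c a" "sum c A = 1" "(\<Sum>a\<in>A. c a *\<^sub>R a) = y"
      unfolding convex_hull_finite[OF A] by blast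
    have "c a < 1" if a: "a \<in> A" for a
    proof (rule ccontr)
      assume ge: "\<not> c a < 1"
      have s: "sum c A = c a + sum c (A - {a})" by (rule sum.remove[OF A a])
      have "sum c (A - {a}) \<ge> 0" using c(1) by (intro sum_nonneg) auto
      then have "sum c (A - {a}) = 0" "c a = 1" using s c(2) ge by linarith+
      then have z: "\<forall>b\<in>A - {a}. c b = 0" using A c(1) by (subst (asm) sum_nonneg_eq_0_iff) auto
      have "y = c a *\<^sub>R a + (\<Sum>b\<in>A - {a}. c b *\<^sub>R b)" unfolding c(3)[symmetric] by (rule sum.remove[OF A a])
      also have "\<dots> = a" using z \<open>c a = 1\<close> by simp
      finally show False using y a by blast
    qed
    then show "y \<in> S_hull A" unfolding S_hull_def using y c by blast
  qed
  have 3: "S_hull A \<inter> A = {}" by (auto simp: S_hull_def)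
  show "S_hull A = convex hull A - A" using 1 2 3 by (auto simp: S_hull_closed_def)
  then show "S_hull_closed A = convex hull A" using hull_subset[of A convex] by (auto simp: S_hull_closed_def)
qed

lemma W_alpha_nonneg: "W_alpha A \<alpha> p \<ge> 0"
  by (simp add: W_alpha_def prod_nonneg)

text \<open>As \<open>D \<ge> 1\<close>, each exponent may be raised to 2; the bound no longer
  contains \<alpha>.\<close>

lemma W_alpha_le:
  assumes D: "D \<ge> 1" "\<And>a. a \<in> A \<Longrightarrow> norm (p - a) \<le> D" and \<alpha>: "0 < \<alpha>" "\<alpha> < 2"
  shows "W_alpha A \<alpha> p \<le> (D\<^sup>2) ^ card A"
proof -
  have "W_alpha A \<alpha> p \<le> (\<Prod>a\<in>A. D\<^sup>2)"
    unfolding W_alpha_def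
  proof (rule prod_mono, intro conjI)
    fix a assume a: "a \<in> A"
    have "norm (p - a) powr \<alpha> \<le> D powr \<alpha>" using D(2)[OF a] \<alpha> by (intro powr_mono2) auto
    also have "\<dots> \<le> D powr 2" using D(1) \<alpha> by (intro powr_mono) auto
    also have "\<dots> = D\<^sup>2" using D(1) by (simp add: powr_numeral)
    finally show "norm (p - a) powr \<alpha> \<le> D\<^sup>2" .
  qed simp
  then show ?thesis by simp
qed

lemma W_alpha_zero: "finite A \<Longrightarrow> p \<in> A \<Longrightarrow> W_alpha A \<alpha> p = 0"
  by (auto simp: W_alpha_def intro!: prod_zero bexI[of _ p])

text \<open>Point and exponent vary together, which is harmless when all bases stay away from 0. At
  a point of \<open>A\<close> the limit would depend on how fast \<open>f k\<close> approaches it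
  compared with \<alpha>.\<close>

lemma W_alpha_tendsto:
  assumes "finite A" "p \<notin> A" "\<alpha> \<longlonglongrightarrow> 0" "f \<longlonglongrightarrow> p"
  shows "(\<lambda>k. W_alpha A (\<alpha> k) (f k)) \<longlonglongrightarrow> 1"
proof -
  have "(\<lambda>k. W_alpha A (\<alpha> k) (f k)) \<longlonglongrightarrow> (\<Prod>a\<in>A. norm (p - a) powr 0)"
    unfolding W_alpha_def using assms(2) by (intro tendsto_prod tendsto_powr tendsto_intros assms(3,4)) auto
  moreover have "(\<Prod>a\<in>A. norm (p - a) powr 0) = 1" using assms(2) by (intro prod.neutral) auto
  ultimately show ?thesis by simp
qed

lemma W_alpha_measurable:
  fixes A :: "(real^'m::finite) set"
  shows "W_alpha A \<alpha> \<in> borel_measurable borel"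
proof -
  have "(\<lambda>p. \<Prod>a\<in>A. norm (p - a) powr \<alpha>) \<in> borel_measurable borel" by measurable
  then show ?thesis by (simp add: W_alpha_def[abs_def])
qed

lemma W_zero_measurable:
  fixes A :: "(real^'m::finite) set"
  assumes "finite A"
  shows "W_zero A \<in> borel_measurable borel"
proof -
  have "convex hull A \<in> sets borel" using assms by (intro borel_compact compact_convex_hull finite_imp_compact)
  moreover have "A \<in> sets borel" using assms by (intro borel_closed finite_imp_closed)
  ultimately have "S_hull A \<in> sets borel" unfolding S_hull_closed_eq(2)[OF assms] by auto
  then show ?thesis unfolding W_zero_def by measurable
qed

section \<open>Balls are Lipschitz domains\<close>

text \<open>Admits balls as test domains for the minimality of \<open>u k\<close>. Near
  \<open>p\<close>, the ball is the region above a hemisphere, seen along the inner normal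
  \<nu>.\<close>

lemma lipschitz_domain_ball:
  assumes R: "R > 0"
  shows "lipschitz_domain (ball (0::real^'n::finite) R)"
  unfolding lipschitz_domain_def
proof
  fix p :: "real^'n" assume "p \<in> frontier (ball 0 R)"
  then have p: "norm p = R" using R by (simp add: frontier_ball)
  define \<nu> where "\<nu> = (- (1 / R)) *\<^sub>R p"
  \<comment> \<open>The hemisphere graph is steep near its equator and undefined beyond. Freezing it
    at distance \<open>R / 2\<close> from the axis makes it globally Lipschitz, and points within
    \<open>R / 2\<close> of \<open>p\<close> do not notice.\<close>
  define m where "m y = min (norm y) (R / 2)" for y :: "real^'n"
  define \<gamma> where "\<gamma> y = - sqrt (R\<^sup>2 - (m y)\<^sup>2)" for y :: "real^'n"
  have \<nu>: "norm \<nu> = 1" using p R by (simp add: \<nu>_def)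
  then have \<nu>\<nu>: "\<nu> \<bullet> \<nu> = 1" by (simp add: norm_eq_1)
  have p\<nu>: "p = (- R) *\<^sub>R \<nu>" using R by (simp add: \<nu>_def)
  have m: "0 \<le> m y" "m y \<le> R / 2" for y using R by (auto simp: m_def)
  have sq: "sqrt (R\<^sup>2 - (m y)\<^sup>2) \<ge> R / 2" for y
  proof (rule real_le_rsqrt)
    have "(m y)\<^sup>2 \<le> (R / 2)\<^sup>2" using m[of y] by (intro power_mono) auto
    moreover have "(R / 2)\<^sup>2 = R\<^sup>2 / 4" by (simp add: power_divide)
    ultimately show "(R / 2)\<^sup>2 \<le> R\<^sup>2 - (m y)\<^sup>2" using zero_le_power2[of R] by linarith
  qed
  have nn: "R\<^sup>2 - (m y)\<^sup>2 \<ge> 0" for y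
    using power_mono[of "m y" R 2] m[of y] R by simp
  have lip: "1-lipschitz_on UNIV \<gamma>"
  proof (rule lipschitz_onI)
    fix y z :: "real^'n"
    define a b where "a = sqrt (R\<^sup>2 - (m y)\<^sup>2)" and "b = sqrt (R\<^sup>2 - (m z)\<^sup>2)"
    \<comment> \<open>In \<open>a\<^sup>2 - b\<^sup>2 = (m z)\<^sup>2 - (m y)\<^sup>2\<close> the
      factor \<open>a + b\<close> is at least \<open>R\<close>, which is at least
      \<open>m z + m y\<close>; cancelling yields the Lipschitz constant 1.\<close>
    have ab: "a + b \<ge> R" using sq[of y] sq[of z] by (simp add: a_def b_def)
    have "(a - b) * (a + b) = a\<^sup>2 - b\<^sup>2" by (simp add: power2_eq_square algebra_simps)
    also have "\<dots> = (m z)\<^sup>2 - (m y)\<^sup>2" using nn by (simp add: a_def b_def)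
    also have "\<dots> = (m z - m y) * (m z + m y)" by (simp add: power2_eq_square algebra_simps)
    finally have "\<bar>(a - b) * (a + b)\<bar> = \<bar>(m z - m y) * (m z + m y)\<bar>" by (rule arg_cong)
    then have "\<bar>a - b\<bar> * (a + b) = \<bar>m z - m y\<bar> * (m z + m y)"
      using ab R m[of y] m[of z] by (simp add: abs_mult)
    also have "\<dots> \<le> \<bar>m z - m y\<bar> * (a + b)" using ab m[of y] m[of z] by (intro mult_left_mono) auto
    finally have "\<bar>a - b\<bar> \<le> \<bar>m z - m y\<bar>" using ab R by simp
    also have "\<dots> \<le> \<bar>norm z - norm y\<bar>" by (auto simp: m_def min_def)
    also have "\<dots> \<le> norm (y - z)" using norm_triangle_ineq3[of z y] by (simp add: norm_minus_commute)
    finally show "dist (\<gamma> y) (\<gamma> z) \<le> 1 * dist y z" by (simp add: \<gamma>_def a_def b_def dist_norm abs_minus_commute)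
  qed simp
  have "ball 0 R \<inter> ball p (R / 2) = {x \<in> ball p (R / 2). \<gamma> (x - (x \<bullet> \<nu>) *\<^sub>R \<nu>) < x \<bullet> \<nu>}"
  proof (intro set_eqI)
    fix x
    have "x \<in> ball 0 R \<longleftrightarrow> \<gamma> (x - (x \<bullet> \<nu>) *\<^sub>R \<nu>) < x \<bullet> \<nu>" if x: "x \<in> ball p (R / 2)"
    proof -
      define s where "s = x \<bullet> \<nu>"
      define y where "y = x - s *\<^sub>R \<nu>"
      define t where "t = (x - p) \<bullet> \<nu>"
      have xp: "norm (x - p) < R / 2" using x by (simp add: dist_norm norm_minus_commute)
      have st: "s = t - R" unfolding s_def t_def p\<nu> using \<nu>\<nu> by (simp add: inner_simps)
      have "\<bar>t\<bar> \<le> norm (x - p)" using Cauchy_Schwarz_ineq2[of "x - p" \<nu>] \<nu> by (simp add: t_def)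
      \<comment> \<open>The negative sign selects the half of the sphere next to \<open>p\<close>,
        so that membership in the ball becomes a single inequality for \<open>s\<close>.\<close>
      then have s0: "s < 0" using st xp R by linarith
      have yp: "y = (x - p) - t *\<^sub>R \<nu>" unfolding y_def st p\<nu> by (simp add: algebra_simps)
      have "(norm y)\<^sup>2 = (norm (x - p))\<^sup>2 - t\<^sup>2"
        unfolding yp power2_norm_eq_inner t_def using \<nu>\<nu>
        by (simp add: inner_diff_left inner_diff_right inner_commute power2_eq_square)
      then have "(norm y)\<^sup>2 \<le> (norm (x - p))\<^sup>2" by simp
      then have "norm y < R / 2" using xp by (meson norm_ge_zero order_le_less_trans power2_le_imp_le)
      then have my: "m y = norm y" by (simp add: m_def)
      have xx: "(norm x)\<^sup>2 = (norm y)\<^sup>2 + s\<^sup>2"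
        unfolding y_def power2_norm_eq_inner s_def using \<nu>\<nu>
        by (simp add: inner_diff_left inner_diff_right inner_commute power2_eq_square)
      have "x \<in> ball 0 R \<longleftrightarrow> (norm x)\<^sup>2 < R\<^sup>2"
        using R by (simp add: linorder_not_le[symmetric] power_mono_iff)
      also have "\<dots> \<longleftrightarrow> (- s)\<^sup>2 < R\<^sup>2 - (m y)\<^sup>2" unfolding xx my by auto
      also have "\<dots> \<longleftrightarrow> - s < sqrt (R\<^sup>2 - (m y)\<^sup>2)"
      proof
        show "(- s)\<^sup>2 < R\<^sup>2 - (m y)\<^sup>2 \<Longrightarrow> - s < sqrt (R\<^sup>2 - (m y)\<^sup>2)" by (rule real_less_rsqrt)
        assume "- s < sqrt (R\<^sup>2 - (m y)\<^sup>2)"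
        then have "(- s)\<^sup>2 < (sqrt (R\<^sup>2 - (m y)\<^sup>2))\<^sup>2" using s0 by (intro power_strict_mono) auto
        then show "(- s)\<^sup>2 < R\<^sup>2 - (m y)\<^sup>2" using nn by simp
      qed
      also have "\<dots> \<longleftrightarrow> \<gamma> y < s" by (auto simp: \<gamma>_def)
      finally show ?thesis by (simp add: y_def s_def)
    qed
    then show "x \<in> ball 0 R \<inter> ball p (R / 2) \<longleftrightarrow> x \<in> {x \<in> ball p (R / 2). \<gamma> (x - (x \<bullet> \<nu>) *\<^sub>R \<nu>) < x \<bullet> \<nu>}" by auto
  qed
  then show "\<exists>r>0. \<exists>\<nu> \<gamma> L. norm \<nu> = 1 \<and> L-lipschitz_on UNIV (\<gamma> :: real^'n \<Rightarrow> real) \<and>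
        ball 0 R \<inter> ball p r = {x \<in> ball p r. \<gamma> (x - (x \<bullet> \<nu>) *\<^sub>R \<nu>) < x \<bullet> \<nu>}"
    using \<nu> lip R half_gt_zero by blast
qed

section \<open>Comparison of energies\<close>

text \<open>Real integrals replace extended ones because the comparison arguments subtract energies;
  an arbitrary weak gradient may stand for the chosen one.\<close>

lemma energy_eq:
  fixes u :: "real^'n::finite \<Rightarrow> real^'m::finite"
  assumes \<Omega>: "open \<Omega>" and u: "has_weak_gradient \<Omega> u G" "L2 \<Omega> G"
    and W: "integrable (lebesgue_on \<Omega>) (\<lambda>x. W (u x))" "\<And>p. W p \<ge> 0"
  shows "energy W \<Omega> u = ennreal ((1/2) * (LINT x|lebesgue_on \<Omega>. (norm (G x))\<^sup>2) + (LINT x|lebesgue_on \<Omega>. W (u x)))"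
proof -
  have "energy W \<Omega> u = (\<integral>\<^sup>+x. ennreal ((1/2) * (norm (G x))\<^sup>2 + W (u x)) \<partial>lebesgue_on \<Omega>)"
    unfolding energy_def using weak_gradient_AE[OF \<Omega> u(1)]
    by (intro nn_integral_cong_AE) (auto elim: eventually_mono)
  also have "\<dots> = ennreal (LINT x|lebesgue_on \<Omega>. (1/2) * (norm (G x))\<^sup>2 + W (u x))"
    using u(2) W by (intro nn_integral_eq_integral) (auto simp: L2_def)
  also have "(LINT x|lebesgue_on \<Omega>. (1/2) * (norm (G x))\<^sup>2 + W (u x))
      = (1/2) * (LINT x|lebesgue_on \<Omega>. (norm (G x))\<^sup>2) + (LINT x|lebesgue_on \<Omega>. W (u x))"
    using u(2) W by (subst Bochner_Integration.integral_add) (auto simp: L2_def)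
  finally show ?thesis .
qed

lemma integrable_bounded_lebesgue_on:
  fixes f :: "real^'n::finite \<Rightarrow> real"
  assumes "f \<in> borel_measurable (lebesgue_on \<Omega>)" "AE x in lebesgue_on \<Omega>. \<bar>f x\<bar> \<le> C" "\<Omega> \<in> lmeasurable"
  shows "integrable (lebesgue_on \<Omega>) f"
proof -
  interpret finite_measure "lebesgue_on \<Omega>" using assms(3) by (rule finite_measure_lebesgue_on)
  show ?thesis using assms by (intro integrable_const_bound[of _ C]) auto
qed

lemma convex_combination_mem:
  fixes x y :: "'a::real_vector"
  assumes "convex K" "x \<in> K" "y \<in> K" "0 \<le> t" "t \<le> 1"
  shows "x + t *\<^sub>R (y - x) \<in> K"
  using convexD_alt[OF assms(1-3) assms(4,5)] by (simp add: algebra_simps)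

text \<open>The variation \<open>\<eta> (z - u)\<close> has compact support in the ball, hence lies
  in \<open>W12_0\<close>, and it is bounded because the new values are convex combinations of
  points of the hull. The target \<open>z\<close> is left open: it is a constant point of
  \<open>A\<close> for the gradient bound, and the extended competitor of the limit for
  minimality.\<close>

lemma minimizer_compare:
  fixes u z :: "real^'n::finite \<Rightarrow> real^'m::finite" and \<eta> :: "real^'n \<Rightarrow> real"
  assumes A: "finite A" and \<alpha>: "0 < \<alpha>" "\<alpha> < 2" and R: "R > 0"
    and min: "energy_minimizer (J_alpha A \<alpha>) u" and uK: "\<And>x. u x \<in> convex hull A"
    and z: "L2 (ball 0 R) z" "has_weak_gradient (ball 0 R) z Z" "L2 (ball 0 R) Z"
    and zK: "AE x in lebesgue_on (ball 0 R). z x \<in> convex hull A"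
    and \<eta>: "test_function (ball 0 R) \<eta>" "\<And>x. 0 \<le> \<eta> x" "\<And>x. \<eta> x \<le> 1"
    and D: "D \<ge> 1" "\<forall>p\<in>convex hull A. \<forall>a\<in>A. norm (p - a) \<le> D" "\<forall>p\<in>convex hull A. norm p \<le> D"
  defines "B \<equiv> ball (0::real^'n) R"
  defines "g \<equiv> weak_gradient B u"
  shows "L2 B (\<lambda>x. g x + (\<eta> x *\<^sub>R (Z x - g x) + outer (z x - u x) (gradient \<eta> x)))" (is ?L)
    and "integrable (lebesgue_on B) (\<lambda>x. W_alpha A \<alpha> (u x))" (is ?I1)
    and "integrable (lebesgue_on B) (\<lambda>x. W_alpha A \<alpha> (u x + \<eta> x *\<^sub>R (z x - u x)))" (is ?I2)
    and "(1/2) * (LINT x|lebesgue_on B. (norm (g x))\<^sup>2) + (LINT x|lebesgue_on B. W_alpha A \<alpha> (u x))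
      \<le> (1/2) * (LINT x|lebesgue_on B. (norm (g x + (\<eta> x *\<^sub>R (Z x - g x) + outer (z x - u x) (gradient \<eta> x))))\<^sup>2)
        + (LINT x|lebesgue_on B. W_alpha A \<alpha> (u x + \<eta> x *\<^sub>R (z x - u x)))" (is ?C)
proof -
  have oB: "open B" and bB: "bounded B" and lB: "B \<in> lmeasurable" by (auto simp: B_def)
  have uW: "u \<in> W12 B" using min W12_loc_D[OF _ oB bB] by (auto simp: energy_minimizer_in_def)
  note w = W12D[OF oB uW, folded g_def]
  define v where "v x = \<eta> x *\<^sub>R (z x - u x)" for x
  obtain M where M: "\<And>x. norm (gradient \<eta> x) \<le> M" using gradient_bounded[OF \<eta>(1)] by blast
  have \<eta>1: "\<bar>\<eta> x\<bar> \<le> 1" for x using \<eta>(2,3)[of x] by simp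
  have cs: "compact_sobolev v (\<lambda>x. \<eta> x *\<^sub>R (Z x - g x) + outer (z x - u x) (gradient \<eta> x)) (closure {x. \<eta> x \<noteq> 0})"
    unfolding v_def
    by (rule cutoff_sobolev(1)[OF oB L2_diff[OF z(1)[folded B_def] w(1)] has_weak_gradient_diff[OF oB z(2)[folded B_def] w(2)]
        L2_diff[OF z(3)[folded B_def] w(3)] \<eta>(1)[folded B_def] \<eta>1 M])
  interpret C: compact_sobolev v "\<lambda>x. \<eta> x *\<^sub>R (Z x - g x) + outer (z x - u x) (gradient \<eta> x)" "closure {x. \<eta> x \<noteq> 0}"
    by (rule cs)
  have vW: "v \<in> W12_0 B"
    using test_functionD(5)[OF \<eta>(1)] by (intro C.in_W12_0 oB) (simp add: B_def)
  note vg = has_weak_gradient_mono[OF C.grad open_UNIV oB subset_UNIV]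
  show L: ?L by (rule L2_add[OF w(3) L2_UNIV_mono[OF C.GL2 oB]])
  have grad: "has_weak_gradient B (\<lambda>x. u x + v x) (\<lambda>x. g x + (\<eta> x *\<^sub>R (Z x - g x) + outer (z x - u x) (gradient \<eta> x)))"
    by (rule has_weak_gradient_add[OF oB w(2) vg])
  have uvK: "AE x in lebesgue_on B. u x + v x \<in> convex hull A"
    using zK[folded B_def]
  proof eventually_elim
    case (elim x)
    then show ?case unfolding v_def using uK \<eta>(2,3) by (intro convex_combination_mem) auto
  qed
  have um: "u \<in> borel_measurable (lebesgue_on B)" using w(1) by (rule L2_measurable)
  have vm: "v \<in> borel_measurable (lebesgue_on B)" using L2_UNIV_mono[OF C.fL2 oB] by (rule L2_measurable)
  have Wle: "\<bar>W_alpha A \<alpha> p\<bar> \<le> (D\<^sup>2) ^ card A" if "p \<in> convex hull A" for p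
    using W_alpha_le[OF D(1) _ \<alpha>, of A p] D(2) that W_alpha_nonneg[of A \<alpha> p] by simp
  show I1: ?I1
    using measurable_compose[OF um W_alpha_measurable] Wle uK lB
    by (intro integrable_bounded_lebesgue_on[of _ _ "(D\<^sup>2) ^ card A"]) auto
  have I2: "integrable (lebesgue_on B) (\<lambda>x. W_alpha A \<alpha> (u x + v x))"
  proof (rule integrable_bounded_lebesgue_on[OF _ _ lB])
    show "(\<lambda>x. W_alpha A \<alpha> (u x + v x)) \<in> borel_measurable (lebesgue_on B)"
      by (rule measurable_compose[OF borel_measurable_add[OF um vm] W_alpha_measurable])
    show "AE x in lebesgue_on B. \<bar>W_alpha A \<alpha> (u x + v x)\<bar> \<le> (D\<^sup>2) ^ card A"
      using uvK by eventually_elim (rule Wle)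
  qed
  then show ?I2 by (simp add: v_def)
  have Lv: "Linf B v"
    unfolding Linf_def
  proof (intro conjI vm exI[of _ "2 * D"])
    show "AE x in lebesgue_on B. norm (v x) \<le> 2 * D"
      using uvK
    proof eventually_elim
      case (elim x)
      have "norm (v x) \<le> norm (u x + v x) + norm (u x)" using norm_triangle_ineq4[of "u x + v x" "u x"] by simp
      then show ?case using bspec[OF D(3) elim] bspec[OF D(3) uK[of x]] by linarith
    qed
  qed
  have "J_alpha A \<alpha> B u \<le> J_alpha A \<alpha> B (\<lambda>x. u x + v x)"
    using min oB bB lipschitz_domain_ball[OF R] vW Lv unfolding energy_minimizer_in_def B_def by blast
  then have "ennreal ((1/2) * (LINT x|lebesgue_on B. (norm (g x))\<^sup>2) + (LINT x|lebesgue_on B. W_alpha A \<alpha> (u x)))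
     \<le> ennreal ((1/2) * (LINT x|lebesgue_on B. (norm (g x + (\<eta> x *\<^sub>R (Z x - g x) + outer (z x - u x) (gradient \<eta> x))))\<^sup>2)
        + (LINT x|lebesgue_on B. W_alpha A \<alpha> (u x + v x)))"
    unfolding J_alpha_def
    by (simp only: energy_eq[OF oB w(2,3) I1 W_alpha_nonneg] energy_eq[OF oB grad L I2 W_alpha_nonneg])
  then show ?C
    by (subst (asm) ennreal_le_iff) (auto simp: v_def W_alpha_nonneg intro!: add_nonneg_nonneg integral_nonneg_AE)
qed

section \<open>The uniform gradient bound\<close>

text \<open>Here \<open>p\<close> is the unsquared cutoff and \<open>m\<close> bounds its gradient
  times the displacement. The mixed term carries a factor \<open>p\<close>, and
  \<open>(p * G - 4 * m)\<^sup>2 \<ge> 0\<close> absorbs it into half of the gain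
  \<open>p * p * G\<^sup>2\<close>, at the price of \<open>8 * m\<^sup>2\<close>; the square of the
  second summand adds \<open>4 * m\<^sup>2\<close>.\<close>

lemma quadratic_cutoff_bound:
  fixes p m G :: real
  assumes "0 \<le> p" "p \<le> 1" "0 \<le> m" "0 \<le> G"
  shows "((1 - p * p) * G + 2 * p * m)\<^sup>2 \<le> (1 - p * p / 2) * G\<^sup>2 + 12 * m\<^sup>2"
proof -
  have p2: "0 \<le> p * p" "p * p \<le> 1" using assms mult_mono[of p 1 p 1] by auto
  have 1: "(1 - p * p)\<^sup>2 * G\<^sup>2 \<le> (1 - p * p) * G\<^sup>2"
    using p2 mult_right_mono[of "1 - p * p" 1 "1 - p * p"] by (intro mult_right_mono) (auto simp: power2_eq_square)
  have "4 * (1 - p * p) * p * m * G \<le> 4 * 1 * p * m * G"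
    using p2 assms by (intro mult_right_mono mult_left_mono) auto
  moreover have "0 \<le> (p * G - 4 * m)\<^sup>2" by simp
  then have "8 * (p * G * m) \<le> (p * p) * G\<^sup>2 + 16 * m\<^sup>2" by (simp add: power2_eq_square algebra_simps)
  ultimately have 2: "4 * (1 - p * p) * p * m * G \<le> p * p / 2 * G\<^sup>2 + 8 * m\<^sup>2" by (simp add: algebra_simps)
  have 3: "4 * (p * p) * m\<^sup>2 \<le> 4 * m\<^sup>2" using p2 mult_right_mono[of "p * p" 1 "m\<^sup>2"] by simp
  have "((1 - p * p) * G + 2 * p * m)\<^sup>2 = (1 - p * p)\<^sup>2 * G\<^sup>2 + 4 * (1 - p * p) * p * m * G + 4 * (p * p) * m\<^sup>2"
    by (simp add: power2_eq_square algebra_simps)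
  also have "\<dots> \<le> (1 - p * p) * G\<^sup>2 + (p * p / 2 * G\<^sup>2 + 8 * m\<^sup>2) + 4 * m\<^sup>2"
    using 1 2 3 by linarith
  also have "\<dots> = (1 - p * p / 2) * G\<^sup>2 + 12 * m\<^sup>2" by (simp add: algebra_simps)
  finally show ?thesis .
qed

lemma gradient_square:
  fixes \<phi> :: "real^'n::finite \<Rightarrow> real"
  assumes "test_function \<Omega> \<phi>"
  shows "gradient (\<lambda>x. \<phi> x * \<phi> x) x = (2 * \<phi> x) *\<^sub>R gradient \<phi> x"
  using partial_deriv_scaleR[OF test_functionD(3)[OF assms] test_functionD(3)[OF assms], of _ x]
  by (simp add: gradient_def vec_eq_iff mult.commute)

lemma integral_lebesgue_on_subset_mono:
  fixes f g :: "real^'n::finite \<Rightarrow> real"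
  assumes "S \<subseteq> T" "S \<in> sets lebesgue" "T \<in> sets lebesgue"
    and "integrable (lebesgue_on S) f" "integrable (lebesgue_on T) g"
    and "AE x in lebesgue. x \<in> S \<longrightarrow> f x \<le> g x" "\<And>x. g x \<ge> 0"
  shows "(LINT x|lebesgue_on S. f x) \<le> (LINT x|lebesgue_on T. g x)"
  unfolding integrable_lebesgue_on_iff(2)[OF assms(2)] integrable_lebesgue_on_iff(2)[OF assms(3)]
proof (rule integral_mono_AE)
  show "AE x in lebesgue. indicat_real S x *\<^sub>R f x \<le> indicat_real T x *\<^sub>R g x"
    using assms(6) by eventually_elim (use assms(1,7) in \<open>auto simp: indicator_def\<close>)
qed (use assms in \<open>auto simp: integrable_lebesgue_on_iff(1)\<close>)

text \<open>Replacing \<open>u\<close> by a convex combination with \<open>a\<close> lowers the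
  gradient energy by a fixed fraction of its weighted integral, and raises the potential by a
  bounded amount at most. Minimality forbids a net gain, whence a constant that depends neither on
  the exponent nor on the minimizer.\<close>

lemma minimizer_gradient_bound:
  fixes A :: "(real^'m::finite) set" and R :: real
  assumes A: "finite A" "a \<in> A"
    and D: "D \<ge> 1" "\<forall>p\<in>convex hull A. \<forall>a\<in>A. norm (p - a) \<le> D" "\<forall>p\<in>convex hull A. norm p \<le> D"
  obtains C where "\<And>\<alpha> (u :: real^'n::finite \<Rightarrow> real^'m). 0 < \<alpha> \<Longrightarrow> \<alpha> < 2 \<Longrightarrow> energy_minimizer (J_alpha A \<alpha>) u
    \<Longrightarrow> (\<And>x. u x \<in> convex hull A)
    \<Longrightarrow> (LINT x|lebesgue_on (ball 0 R). (norm (weak_gradient (ball 0 R) u x))\<^sup>2) \<le> C"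
proof -
  \<comment> \<open>The radius \<open>R\<close> may be nonpositive; the cutoff and the comparison
    ball are built on \<open>R1\<close> instead.\<close>
  define R1 where "R1 = max R 1"
  define B where "B = ball (0::real^'n) (R1 + 2)"
  have R1: "R1 + 2 > 0" "R \<le> R1" by (auto simp: R1_def)
  have oB: "open B" and lB: "B \<in> lmeasurable" and sub: "ball 0 R \<subseteq> B" using R1 by (auto simp: B_def)
  obtain \<phi> :: "real^'n \<Rightarrow> real" where \<phi>: "test_function (ball 0 (R1 + 2)) \<phi>"
    "\<And>x. 0 \<le> \<phi> x" "\<And>x. \<phi> x \<le> 1" "\<And>x. norm x \<le> R1 \<Longrightarrow> \<phi> x = 1" by (rule ball_cutoff[of R1]) blast
  obtain M where M: "M \<ge> 0" "\<And>x. norm (gradient \<phi> x) \<le> M" using gradient_bounded[OF \<phi>(1)] by blast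
  define \<eta> where "\<eta> x = \<phi> x * \<phi> x" for x
  have \<eta>t: "test_function (ball 0 (R1 + 2)) \<eta>"
    unfolding \<eta>_def using \<phi>(1) test_functionD(1)[OF \<phi>(1)] by (rule test_function_mult)
  have \<eta>: "0 \<le> \<eta> x" "\<eta> x \<le> 1" for x
    using \<phi>(2,3)[of x] mult_mono[of "\<phi> x" 1 "\<phi> x" 1] by (auto simp: \<eta>_def)
  define m where "m = M * D"
  have m0: "m \<ge> 0" using M(1) D(1) by (simp add: m_def)
  define V where "V = measure lebesgue B"
  define W where "W = (D\<^sup>2) ^ card A"
  show ?thesis
  \<comment> \<open>After cancelling \<open>(1/2) * (norm (g x))\<^sup>2\<close>, a quarter of the
    integral of \<open>\<eta> x * (norm (g x))\<^sup>2\<close> remains on the left, against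
    \<open>6 * m\<^sup>2 * V\<close> from the cutoff and \<open>W * V\<close> from the
    potential.\<close>
  proof (rule that[of "4 * (6 * m\<^sup>2 + W) * V"])
    fix \<alpha> and u :: "real^'n \<Rightarrow> real^'m"
    assume \<alpha>: "0 < \<alpha>" "\<alpha> < 2" and min: "energy_minimizer (J_alpha A \<alpha>) u" and uK: "\<And>x. u x \<in> convex hull A"
    have uW: "u \<in> W12 S" if "open S" "bounded S" for S
      using min W12_loc_D[OF _ that] by (auto simp: energy_minimizer_in_def)
    define g where "g = weak_gradient B u"
    note w = W12D[OF oB uW[OF oB], folded g_def]
    have bB: "bounded B" by (simp add: B_def)
    have za: "L2 B (\<lambda>x. a)" "L2 B (\<lambda>x. 0 :: real^'n^'m)"
    proof -
      show "L2 B (\<lambda>x. a)" by (rule L2_bounded[of _ _ "norm a"]) (use lB in auto)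
    qed (simp add: L2_def)
    define q where "q x = outer (a - u x) (gradient \<eta> x)" for x
    define N where "N x = g x + (\<eta> x *\<^sub>R (0 - g x) + q x)" for x
    have aK: "a \<in> convex hull A" using A(2) by (rule hull_inc)
    note cmp = minimizer_compare[OF A(1) \<alpha> R1(1) min uK za(1)[unfolded B_def] has_weak_gradient_const[OF open_ball] za(2)[unfolded B_def]
        AE_I2[OF aK] \<eta>t \<eta> D, folded B_def, folded g_def q_def, folded N_def]
    let ?I = "\<lambda>f. LINT x|lebesgue_on B. f x"
    have iG: "integrable (lebesgue_on B) (\<lambda>x. (norm (g x))\<^sup>2)" using w(3) bB by (simp add: L2_def)
    have i\<eta>: "integrable (lebesgue_on B) (\<lambda>x. \<eta> x * (norm (g x))\<^sup>2)"
    proof (rule Bochner_Integration.integrable_bound[OF iG])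
      have "\<eta> \<in> borel_measurable (lebesgue_on B)"
        by (intro measurable_restrict_space1 borel_measurable_integrable integrable_test_function(2)[OF \<eta>t])
      then show "(\<lambda>x. \<eta> x * (norm (g x))\<^sup>2) \<in> borel_measurable (lebesgue_on B)" using iG by (intro borel_measurable_times) auto
      show "AE x in lebesgue_on B. norm (\<eta> x * (norm (g x))\<^sup>2) \<le> norm ((norm (g x))\<^sup>2)"
        using \<eta> by (intro AE_I2) (simp add: abs_mult mult_left_le_one_le)
    qed
    interpret fm: finite_measure "lebesgue_on B" using lB by (rule finite_measure_lebesgue_on)
    have mV: "?I (\<lambda>x. c) = c * V" for c :: real
      using lB by (simp add: V_def measure_restrict_space fmeasurable_def mult.commute)
    have Nle: "(norm (N x))\<^sup>2 \<le> (norm (g x))\<^sup>2 - \<eta> x * (norm (g x))\<^sup>2 / 2 + 12 * m\<^sup>2" for x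
    proof -
      have "N x = (1 - \<eta> x) *\<^sub>R g x + q x" by (simp add: N_def algebra_simps)
      then have "norm (N x) \<le> norm ((1 - \<eta> x) *\<^sub>R g x) + norm (q x)" using norm_triangle_ineq by metis
      also have "norm ((1 - \<eta> x) *\<^sub>R g x) = (1 - \<phi> x * \<phi> x) * norm (g x)" using \<eta>(2)[of x] by (simp add: \<eta>_def)
      also have "norm (q x) \<le> 2 * \<phi> x * m"
      proof -
        have "gradient \<eta> x = (2 * \<phi> x) *\<^sub>R gradient \<phi> x" unfolding \<eta>_def[abs_def] by (rule gradient_square[OF \<phi>(1)])
        then have "norm (q x) = norm (u x - a) * (2 * \<phi> x * norm (gradient \<phi> x))"
          using \<phi>(2)[of x] by (simp add: q_def norm_outer norm_minus_commute)
        also have "\<dots> \<le> D * (2 * \<phi> x * M)"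
          using D(2) uK A(2) M(2) \<phi>(2)[of x] D(1) by (intro mult_mono) auto
        finally show ?thesis by (simp add: m_def mult_ac)
      qed
      finally have "norm (N x) \<le> (1 - \<phi> x * \<phi> x) * norm (g x) + 2 * \<phi> x * m" by simp
      then have "(norm (N x))\<^sup>2 \<le> ((1 - \<phi> x * \<phi> x) * norm (g x) + 2 * \<phi> x * m)\<^sup>2" by (intro power_mono) auto
      also have "\<dots> \<le> (1 - \<phi> x * \<phi> x / 2) * (norm (g x))\<^sup>2 + 12 * m\<^sup>2"
        using \<phi>(2,3)[of x] m0 by (intro quadratic_cutoff_bound) auto
      finally show ?thesis by (simp add: \<eta>_def algebra_simps)
    qed
    have "?I (\<lambda>x. (norm (N x))\<^sup>2) \<le> ?I (\<lambda>x. (norm (g x))\<^sup>2 - \<eta> x * (norm (g x))\<^sup>2 / 2 + 12 * m\<^sup>2)"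
      using cmp(1) iG i\<eta> Nle by (intro integral_mono) (auto simp: L2_def)
    also have "\<dots> = ?I (\<lambda>x. (norm (g x))\<^sup>2) - ?I (\<lambda>x. \<eta> x * (norm (g x))\<^sup>2) / 2 + 12 * m\<^sup>2 * V"
      using iG i\<eta> mV[of "12 * m\<^sup>2"] by simp
    finally have 1: "?I (\<lambda>x. (norm (N x))\<^sup>2) \<le> ?I (\<lambda>x. (norm (g x))\<^sup>2) - ?I (\<lambda>x. \<eta> x * (norm (g x))\<^sup>2) / 2 + 12 * m\<^sup>2 * V" .
    have 2: "?I (\<lambda>x. W_alpha A \<alpha> (u x)) \<ge> 0" by (simp add: W_alpha_nonneg)
    have "?I (\<lambda>x. W_alpha A \<alpha> (u x + \<eta> x *\<^sub>R (a - u x))) \<le> ?I (\<lambda>x. W)"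
    proof (rule integral_mono[OF cmp(3)])
      fix x
      have "u x + \<eta> x *\<^sub>R (a - u x) \<in> convex hull A" using uK aK \<eta> by (intro convex_combination_mem) auto
      then show "W_alpha A \<alpha> (u x + \<eta> x *\<^sub>R (a - u x)) \<le> W"
        unfolding W_def using D by (intro W_alpha_le \<alpha>) auto
    qed (rule fm.integrable_const)
    then have 3: "?I (\<lambda>x. W_alpha A \<alpha> (u x + \<eta> x *\<^sub>R (a - u x))) \<le> W * V" by (simp only: mV)
    have 4: "?I (\<lambda>x. \<eta> x * (norm (g x))\<^sup>2) \<le> 4 * (6 * m\<^sup>2 + W) * V"
      using cmp(4) 1 2 3 by (simp add: algebra_simps)
    have "(LINT x|lebesgue_on (ball 0 R). (norm (weak_gradient (ball 0 R) u x))\<^sup>2) \<le> ?I (\<lambda>x. \<eta> x * (norm (g x))\<^sup>2)"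
    proof (rule integral_lebesgue_on_subset_mono[OF sub open_lebesgue[OF open_ball] open_lebesgue[OF oB] _ i\<eta>])
      show "integrable (lebesgue_on (ball 0 R)) (\<lambda>x. (norm (weak_gradient (ball 0 R) u x))\<^sup>2)"
        using W12D(3)[OF open_ball uW] by (simp add: L2_def)
      have "AE x in lebesgue_on (ball 0 R). weak_gradient (ball 0 R) u x = g x"
        by (rule weak_gradient_AE[OF open_ball has_weak_gradient_mono[OF w(2)[OF bB] oB open_ball sub]])
      then have "AE x in lebesgue. x \<in> ball 0 R \<longrightarrow> weak_gradient (ball 0 R) u x = g x"
        by (simp add: AE_lebesgue_on_iff open_lebesgue)
      then show "AE x in lebesgue. x \<in> ball 0 R \<longrightarrow> (norm (weak_gradient (ball 0 R) u x))\<^sup>2 \<le> \<eta> x * (norm (g x))\<^sup>2"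
        by eventually_elim (use \<phi>(4) R1(2) in \<open>auto simp: \<eta>_def\<close>)
      show "\<eta> x * (norm (g x))\<^sup>2 \<ge> 0" for x using \<eta> by simp
    qed
    then show "(LINT x|lebesgue_on (ball 0 R). (norm (weak_gradient (ball 0 R) u x))\<^sup>2) \<le> 4 * (6 * m\<^sup>2 + W) * V"
      using 4 by linarith
  qed
qed

section \<open>The limit map\<close>

lemma limit_map_exists:
  fixes u :: "nat \<Rightarrow> real^'n::finite \<Rightarrow> real^'m::finite"
  assumes u: "\<And>k. u k \<in> borel_measurable lebesgue" and K: "closed K" "\<And>k x. u k x \<in> K"
    and D: "\<And>p. p \<in> K \<Longrightarrow> norm p \<le> D" and conv: "AE x in lebesgue. convergent (\<lambda>k. u k x)"
  obtains w where "w \<in> borel_measurable lebesgue" "\<And>x. w x \<in> K" "AE x in lebesgue. (\<lambda>k. u k x) \<longlonglongrightarrow> w x"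
    "\<And>\<Omega>. \<Omega> \<in> lmeasurable \<Longrightarrow> (\<lambda>k. sqn (lebesgue_on \<Omega>) (\<lambda>x. u k x - w x)) \<longlonglongrightarrow> 0"
proof -
  \<comment> \<open>At points of divergence \<open>u 0 x\<close> serves as a default, so that all
    values of \<open>w\<close> lie in \<open>K\<close>, without exceptional set.\<close>
  define w where "w x = (if convergent (\<lambda>k. u k x) then lim (\<lambda>k. u k x) else u 0 x)" for x
  have lim: "AE x in lebesgue. (\<lambda>k. u k x) \<longlonglongrightarrow> w x"
    using conv by eventually_elim (simp add: w_def convergent_LIMSEQ_iff)
  have "(\<lambda>x. lim (\<lambda>k. u k x)) \<in> borel_measurable lebesgue" by (rule borel_measurable_lim_metric[OF u])
  then have wm: "w \<in> borel_measurable lebesgue"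
    by (rule borel_measurable_AE) (use conv in \<open>auto elim!: eventually_mono simp: w_def\<close>)
  have wK: "w x \<in> K" for x
  proof (cases "convergent (\<lambda>k. u k x)")
    case True
    then have "(\<lambda>k. u k x) \<longlonglongrightarrow> w x" by (simp add: w_def convergent_LIMSEQ_iff)
    then show ?thesis by (rule closed_sequentially[OF K(1) K(2)])
  next
    case False
    then show ?thesis using K(2) by (simp add: w_def)
  qed
  have "(\<lambda>k. sqn (lebesgue_on \<Omega>) (\<lambda>x. u k x - w x)) \<longlonglongrightarrow> 0" if \<Omega>: "\<Omega> \<in> lmeasurable" for \<Omega>
  proof (rule sqn_tendsto_zero_dominated[where w="\<lambda>x. ennreal ((2 * D)\<^sup>2)"])
    interpret finite_measure "lebesgue_on \<Omega>" using \<Omega> by (rule finite_measure_lebesgue_on)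
    show "(\<lambda>x. u k x - w x) \<in> borel_measurable (lebesgue_on \<Omega>)" for k
      by (intro measurable_restrict_space1 borel_measurable_diff u wm)
    show "AE x in lebesgue_on \<Omega>. ennreal ((norm (u k x - w x))\<^sup>2) \<le> ennreal ((2 * D)\<^sup>2)" for k
    proof (rule AE_I2)
      fix x
      have "norm (u k x - w x) \<le> 2 * D"
        using norm_triangle_ineq4[of "u k x" "w x"] D[OF K(2)[of k x]] D[OF wK[of x]] by linarith
      then show "ennreal ((norm (u k x - w x))\<^sup>2) \<le> ennreal ((2 * D)\<^sup>2)" by (intro ennreal_leI power_mono) auto
    qed
    show "(\<integral>\<^sup>+x. ennreal ((2 * D)\<^sup>2) \<partial>lebesgue_on \<Omega>) < \<infinity>"
      using emeasure_finite[of "space (lebesgue_on \<Omega>)"] ennreal_less_top[of "(2 * D)\<^sup>2"]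
      unfolding nn_integral_const infinity_ennreal_def ennreal_mult_less_top less_top by blast
    have "AE x in lebesgue. x \<in> \<Omega> \<longrightarrow> (\<lambda>k. u k x - w x) \<longlonglongrightarrow> 0"
      using lim by eventually_elim (simp add: LIM_zero)
    then show "AE x in lebesgue_on \<Omega>. (\<lambda>k. u k x - w x) \<longlonglongrightarrow> 0"
      using \<Omega> by (simp add: AE_lebesgue_on_iff fmeasurableD)
  qed simp
  then show ?thesis using that wm wK lim by blast
qed

section \<open>Minimality of the limit\<close>

lemma Cauchy_Schwarz_L2_norms:
  fixes f :: "real^'n::finite \<Rightarrow> 'b::euclidean_space" and g :: "real^'n \<Rightarrow> 'c::euclidean_space"
  assumes "L2 \<Omega> f" "L2 \<Omega> g"
  shows "integrable (lebesgue_on \<Omega>) (\<lambda>x. norm (f x) * norm (g x))"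
    and "(LINT x|lebesgue_on \<Omega>. norm (f x) * norm (g x))
      \<le> sqrt (LINT x|lebesgue_on \<Omega>. (norm (f x))\<^sup>2) * sqrt (LINT x|lebesgue_on \<Omega>. (norm (g x))\<^sup>2)"
proof -
  have "L2 \<Omega> (\<lambda>x. norm (f x))" "L2 \<Omega> (\<lambda>x. norm (g x))"
    using assms by (auto simp: L2_def)
  from integrable_inner_L2(2)[OF this] Cauchy_Schwarz_L2[OF this]
  show "integrable (lebesgue_on \<Omega>) (\<lambda>x. norm (f x) * norm (g x))"
    "(LINT x|lebesgue_on \<Omega>. norm (f x) * norm (g x))
      \<le> sqrt (LINT x|lebesgue_on \<Omega>. (norm (f x))\<^sup>2) * sqrt (LINT x|lebesgue_on \<Omega>. (norm (g x))\<^sup>2)"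
    by simp_all
qed

text \<open>The functionals through which weak convergence is exploited: with \<open>h\<close> the
  weighted gradient of the limit they yield lower semicontinuity.\<close>

lemma gradient_functional_in_dual:
  fixes h :: "real^'n::finite \<Rightarrow> real^'n^'m::finite"
  assumes \<Omega>: "open \<Omega>" and h: "L2 \<Omega> h"
  shows "(\<lambda>f. LINT x|lebesgue_on \<Omega>. h x \<bullet> weak_gradient \<Omega> f x) \<in> W12_dual \<Omega>"
  unfolding W12_dual_def
proof (intro CollectI conjI ballI allI)
  note i = integrable_inner_L2(1)[OF h W12D(3)[OF \<Omega>]]
  fix f g :: "real^'n \<Rightarrow> real^'m" assume f: "f \<in> W12 \<Omega>" and g: "g \<in> W12 \<Omega>"
  have "AE x in lebesgue_on \<Omega>. weak_gradient \<Omega> (\<lambda>x. f x + g x) x = weak_gradient \<Omega> f x + weak_gradient \<Omega> g x"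
    by (rule weak_gradient_AE[OF \<Omega> has_weak_gradient_add[OF \<Omega> W12D(2)[OF \<Omega> f] W12D(2)[OF \<Omega> g]]])
  then have "(LINT x|lebesgue_on \<Omega>. h x \<bullet> weak_gradient \<Omega> (\<lambda>x. f x + g x) x)
      = (LINT x|lebesgue_on \<Omega>. h x \<bullet> weak_gradient \<Omega> f x + h x \<bullet> weak_gradient \<Omega> g x)"
    using i[OF W12_add[OF \<Omega> f g]] i[OF f] i[OF g]
    by (intro integral_cong_AE) (auto elim!: eventually_mono simp: inner_add_right)
  then show "(LINT x|lebesgue_on \<Omega>. h x \<bullet> weak_gradient \<Omega> (\<lambda>x. f x + g x) x)
      = (LINT x|lebesgue_on \<Omega>. h x \<bullet> weak_gradient \<Omega> f x) + (LINT x|lebesgue_on \<Omega>. h x \<bullet> weak_gradient \<Omega> g x)"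
    using i[OF f] i[OF g] by simp
next
  note i = integrable_inner_L2(1)[OF h W12D(3)[OF \<Omega>]]
  fix c :: real and f :: "real^'n \<Rightarrow> real^'m" assume f: "f \<in> W12 \<Omega>"
  have "AE x in lebesgue_on \<Omega>. weak_gradient \<Omega> (\<lambda>x. c *\<^sub>R f x) x = c *\<^sub>R weak_gradient \<Omega> f x"
    by (rule weak_gradient_AE[OF \<Omega> has_weak_gradient_scaleR[OF \<Omega> W12D(2)[OF \<Omega> f]]])
  then have "(LINT x|lebesgue_on \<Omega>. h x \<bullet> weak_gradient \<Omega> (\<lambda>x. c *\<^sub>R f x) x)
      = (LINT x|lebesgue_on \<Omega>. c * (h x \<bullet> weak_gradient \<Omega> f x))"
    using i[OF W12_scaleR[OF \<Omega> f]] i[OF f]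
    by (intro integral_cong_AE) (auto elim!: eventually_mono)
  then show "(LINT x|lebesgue_on \<Omega>. h x \<bullet> weak_gradient \<Omega> (\<lambda>x. c *\<^sub>R f x) x) = c * (LINT x|lebesgue_on \<Omega>. h x \<bullet> weak_gradient \<Omega> f x)"
    by simp
next
  show "\<exists>C. \<forall>f\<in>W12 \<Omega>. \<bar>LINT x|lebesgue_on \<Omega>. h x \<bullet> weak_gradient \<Omega> f x\<bar> \<le> C * W12_norm \<Omega> f"
  proof (intro exI ballI)
    fix f :: "real^'n \<Rightarrow> real^'m" assume f: "f \<in> W12 \<Omega>"
    note w = W12D[OF \<Omega> f]
    have "\<bar>LINT x|lebesgue_on \<Omega>. h x \<bullet> weak_gradient \<Omega> f x\<bar>
        \<le> sqrt (LINT x|lebesgue_on \<Omega>. (norm (h x))\<^sup>2) * sqrt (LINT x|lebesgue_on \<Omega>. (norm (weak_gradient \<Omega> f x))\<^sup>2)"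
      by (rule inner_integral_L2_bound[OF h w(3)])
    also have "\<dots> \<le> sqrt (LINT x|lebesgue_on \<Omega>. (norm (h x))\<^sup>2) * W12_norm \<Omega> f"
      unfolding W12_norm_def using w(1,3)
      by (intro mult_left_mono real_sqrt_le_mono integral_mono) (auto simp: L2_def)
    finally show "\<bar>LINT x|lebesgue_on \<Omega>. h x \<bullet> weak_gradient \<Omega> f x\<bar> \<le> sqrt (LINT x|lebesgue_on \<Omega>. (norm (h x))\<^sup>2) * W12_norm \<Omega> f" .
  qed
qed

text \<open>Here \<open>u\<close> and \<alpha> stand for the extracted subsequence, and the last
  assumptions record what compactness provides. \<open>D\<close> bounds the hull and its distances
  to \<open>A\<close>.\<close>

locale minimizer_limit =
  fixes A :: "(real^'m::finite) set" and \<alpha> :: "nat \<Rightarrow> real"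
    and u :: "nat \<Rightarrow> real^'n::finite \<Rightarrow> real^'m" and w :: "real^'n \<Rightarrow> real^'m" and D :: real
  assumes A: "finite A" and \<alpha>: "\<And>k. 0 < \<alpha> k" "\<And>k. \<alpha> k < 2" "\<alpha> \<longlonglongrightarrow> 0"
    and min: "\<And>k. energy_minimizer (J_alpha A (\<alpha> k)) (u k)" and uK: "\<And>k x. u k x \<in> convex hull A"
    and D: "D \<ge> 1" "\<forall>p\<in>convex hull A. \<forall>a\<in>A. norm (p - a) \<le> D" "\<forall>p\<in>convex hull A. norm p \<le> D"
    and bound: "\<And>R. \<exists>C. \<forall>k. (LINT x|lebesgue_on (ball 0 R). (norm (weak_gradient (ball 0 R) (u k) x))\<^sup>2) \<le> C"
    and wm: "w \<in> borel_measurable lebesgue" and wK: "\<And>x. w x \<in> convex hull A"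
    and wlim: "AE x in lebesgue. (\<lambda>k. u k x) \<longlonglongrightarrow> w x"
    and sqnlim: "\<And>\<Omega>. \<Omega> \<in> lmeasurable \<Longrightarrow> (\<lambda>k. sqn (lebesgue_on \<Omega>) (\<lambda>x. u k x - w x)) \<longlonglongrightarrow> 0"
begin

lemma uW: "open \<Omega> \<Longrightarrow> bounded \<Omega> \<Longrightarrow> u k \<in> W12 \<Omega>"
  using min[of k] W12_loc_D by (auto simp: energy_minimizer_in_def)

lemma weakly_converges:
  assumes \<Omega>: "open \<Omega>" "bounded \<Omega>"
  shows "weakly_converges_W12 \<Omega> u w"
proof -
  obtain R where R: "\<Omega> \<subseteq> ball 0 R" using bounded_subset_ballD[OF \<Omega>(2), of 0] by auto
  obtain C where C: "\<And>k. (LINT x|lebesgue_on (ball 0 R). (norm (weak_gradient (ball 0 R) (u k) x))\<^sup>2) \<le> C"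
    using bound by blast
  have l\<Omega>: "\<Omega> \<in> lmeasurable" using \<Omega> by (simp add: lmeasurable_open)
  show ?thesis
  proof (rule weakly_converges_W12I[OF \<Omega>(1) uW[OF \<Omega>] _ _ sqnlim[OF l\<Omega>]])
    show "L2 \<Omega> w"
      by (rule L2_bounded[OF measurable_restrict_space1[OF wm] _ l\<Omega>, of D]) (use D(3) wK in auto)
    fix k
    note W = W12D[OF \<Omega>(1) uW[OF \<Omega>], of k]
    note WB = W12D[OF open_ball uW[OF open_ball bounded_ball], of 0 R k]
    have "AE x in lebesgue. x \<in> \<Omega> \<longrightarrow> weak_gradient \<Omega> (u k) x = weak_gradient (ball 0 R) (u k) x"
      using weak_gradient_AE[OF \<Omega>(1) has_weak_gradient_mono[OF WB(2) open_ball \<Omega>(1) R]]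
      by (simp add: AE_lebesgue_on_iff[OF open_lebesgue[OF \<Omega>(1)]])
    then have ae: "AE x in lebesgue. x \<in> \<Omega> \<longrightarrow> (norm (weak_gradient \<Omega> (u k) x))\<^sup>2 \<le> (norm (weak_gradient (ball 0 R) (u k) x))\<^sup>2"
      by eventually_elim simp
    have "(LINT x|lebesgue_on \<Omega>. (norm (weak_gradient \<Omega> (u k) x))\<^sup>2)
        \<le> (LINT x|lebesgue_on (ball 0 R). (norm (weak_gradient (ball 0 R) (u k) x))\<^sup>2)"
      by (rule integral_lebesgue_on_subset_mono[OF R open_lebesgue[OF \<Omega>(1)] open_lebesgue[OF open_ball] _ _ ae])
         (use W(3) WB(3) in \<open>auto simp: L2_def\<close>)
    then show "(LINT x|lebesgue_on \<Omega>. (norm (weak_gradient \<Omega> (u k) x))\<^sup>2) \<le> C" using C[of k] by linarith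
  qed
qed

lemma wW: "open \<Omega> \<Longrightarrow> bounded \<Omega> \<Longrightarrow> w \<in> W12 \<Omega>"
  using weakly_converges by (auto simp: weakly_converges_W12_def)

lemma W_zero_eq: "p \<in> convex hull A \<Longrightarrow> W_zero A p = (if p \<in> A then 0 else 1)"
  by (simp add: W_zero_def S_hull_closed_eq(2)[OF A] indicator_def)

lemma W_alpha_bounds:
  assumes "p \<in> convex hull A"
  shows "0 \<le> W_alpha A (\<alpha> k) p" "W_alpha A (\<alpha> k) p \<le> (D\<^sup>2) ^ card A" "\<bar>W_alpha A (\<alpha> k) p\<bar> \<le> (D\<^sup>2) ^ card A"
  using W_alpha_le[OF D(1) _ \<alpha>(1,2), of A p k] D(2) assms W_alpha_nonneg[of A "\<alpha> k" p] by simp_all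

lemma W_zero_bounds: "0 \<le> W_zero A p" "W_zero A p \<le> 1"
  by (auto simp: W_zero_def indicator_def)

text \<open>At a fixed point the limit is correct even on \<open>A\<close>, where every
  \<open>W_alpha A (\<alpha> k)\<close> vanishes. So the potentials of a fixed competitor converge
  everywhere, in contrast with those of the moving maps \<open>u k\<close>.\<close>

lemma W_alpha_tendsto_W_zero:
  assumes "p \<in> convex hull A"
  shows "(\<lambda>k. W_alpha A (\<alpha> k) p) \<longlonglongrightarrow> W_zero A p"
proof (cases "p \<in> A")
  case True
  then show ?thesis using W_zero_eq[OF assms] W_alpha_zero[OF A True] by simp
next
  case False
  then show ?thesis using W_zero_eq[OF assms] W_alpha_tendsto[OF A False \<alpha>(3) tendsto_const] by simp
qed

lemma W_zero_integrable:
  fixes f :: "real^'n \<Rightarrow> real^'m"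
  assumes "f \<in> borel_measurable (lebesgue_on S)" "S \<in> lmeasurable"
  shows "integrable (lebesgue_on S) (\<lambda>x. W_zero A (f x))"
  using measurable_compose[OF assms(1) W_zero_measurable[OF A]] assms(2) W_zero_bounds
  by (intro integrable_bounded_lebesgue_on[of _ _ 1]) auto

text \<open>Passing to the limit in the comparison of \<open>u k\<close> with \<open>u k + \<eta> (z - u k)\<close>, where \<open>z\<close> agrees
  with \<open>w\<close> outside \<open>\<Omega>\<close>. Only the layer \<open>V - E\<close>, where \<open>0 < \<eta> < 1\<close>, produces an error in the potential.\<close>

lemma limit_inequality:
  fixes \<eta> :: "real^'n \<Rightarrow> real"
  assumes R: "R > 0" and \<Omega>: "open \<Omega>" "\<Omega> \<subseteq> E" and E: "E \<in> sets lebesgue" "E \<subseteq> V"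
    and V: "V \<in> sets lebesgue" "V \<subseteq> ball 0 R"
    and z: "L2 (ball 0 R) z" "has_weak_gradient (ball 0 R) z Z" "L2 (ball 0 R) Z"
    and zK: "AE x in lebesgue_on (ball 0 R). z x \<in> convex hull A" and zw: "\<And>x. x \<notin> \<Omega> \<Longrightarrow> z x = w x"
    and \<eta>: "test_function V \<eta>" "\<And>x. 0 \<le> \<eta> x" "\<And>x. \<eta> x \<le> 1" "\<And>x. x \<in> E \<Longrightarrow> \<eta> x = 1"
  defines "B \<equiv> ball (0::real^'n) R"
  shows "(1/2) * (LINT x|lebesgue_on B. \<eta> x * (norm (weak_gradient B w x))\<^sup>2) + (LINT x|lebesgue_on B. indicator E x * W_zero A (w x))
    \<le> (1/2) * (LINT x|lebesgue_on B. \<eta> x * (norm (Z x))\<^sup>2) + (LINT x|lebesgue_on B. indicator E x * W_zero A (z x))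
      + (D\<^sup>2) ^ card A * measure lebesgue (V - E)"
proof -
  have oB: "open B" and bB: "bounded B" and lB: "B \<in> lmeasurable" by (auto simp: B_def)
  note z = z[folded B_def] and zK = zK[folded B_def] and V = V[folded B_def]
  let ?I = "\<lambda>f. LINT x|lebesgue_on B. f x"
  define Mw where "Mw = (D\<^sup>2) ^ card A"
  define gu where "gu k = weak_gradient B (u k)" for k
  define gw where "gw = weak_gradient B w"
  note Wu = W12D[OF oB uW[OF oB bB], folded gu_def]
  note Ww = W12D[OF oB wW[OF oB bB], folded gw_def]
  have \<eta>B: "test_function B \<eta>" using \<eta>(1) V(2) by (rule test_function_mono)
  have \<eta>m: "\<eta> \<in> borel_measurable (lebesgue_on B)"
    by (intro measurable_restrict_space1 borel_measurable_integrable integrable_test_function(2)[OF \<eta>B])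
  obtain M where M: "M \<ge> 0" "\<And>x. norm (gradient \<eta> x) \<le> M" using gradient_bounded[OF \<eta>B] by blast
  obtain C where C: "\<And>k. ?I (\<lambda>x. (norm (gu k x))\<^sup>2) \<le> C" using bound[of R] by (auto simp: gu_def B_def)
  define b where "b = ?I (\<lambda>x. (norm (Z x))\<^sup>2)"
  define d where "d k = ?I (\<lambda>x. (norm (u k x - w x))\<^sup>2)" for k
  have d0: "d k \<ge> 0" for k by (simp add: d_def)
  have L2d: "L2 B (\<lambda>x. u k x - w x)" for k by (rule L2_diff[OF Wu(1) Ww(1)])
  have dlim: "d \<longlonglongrightarrow> 0"
  proof -
    have "(\<lambda>k. enn2real (sqn (lebesgue_on B) (\<lambda>x. u k x - w x))) \<longlonglongrightarrow> 0"
      using tendsto_enn2real[OF sqnlim[OF lB, folded ennreal_0]] by simp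
    then show ?thesis by (simp add: sqn_eq_integral[OF L2d] d_def[abs_def])
  qed
  define q where "q k x = outer (z x - u k x) (gradient \<eta> x)" for k x
  define P where "P k x = gu k x + \<eta> x *\<^sub>R (Z x - gu k x)" for k x
  \<comment> \<open>On \<Omega> the cutoff is constant, so its gradient vanishes although
    \<open>z - u k\<close> need not be small there; off \<Omega> the competitor equals
    \<open>w\<close>, and \<open>u k - w\<close> is small in \<open>L\<^sup>2\<close>.\<close>
  have qle: "norm (q k x) \<le> M * norm (u k x - w x)" for k x
  proof (cases "x \<in> \<Omega>")
    case True
    have "gradient \<eta> x = 0" using gradient_eq_zero_open[OF \<Omega>(1) True, of \<eta> 1] \<eta>(4) \<Omega>(2) by blast
    then show ?thesis using M(1) by (simp add: q_def norm_outer)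
  next
    case False
    have "norm (q k x) = norm (gradient \<eta> x) * norm (u k x - w x)"
      using zw[OF False] by (simp add: q_def norm_outer norm_minus_commute mult.commute)
    then show ?thesis using M(2)[of x] by (simp add: mult_right_mono)
  qed
  \<comment> \<open>\<open>P k x\<close> is a convex combination of the two gradients. Convexity of
    the square puts the weight \<open>1 - \<eta> x\<close> on the gradient of \<open>u k\<close>,
    which no Young type inequality with a constant above 1 would do.\<close>
  have Ple: "(norm (P k x))\<^sup>2 \<le> (1 - \<eta> x) * (norm (gu k x))\<^sup>2 + \<eta> x * (norm (Z x))\<^sup>2"
    and Ple': "norm (P k x) \<le> norm (gu k x) + norm (Z x)" for k x
  proof -
    have "(norm (P k x))\<^sup>2 = (1 - \<eta> x) * (norm (gu k x))\<^sup>2 + \<eta> x * (norm (Z x))\<^sup>2 - \<eta> x * (1 - \<eta> x) * (norm (gu k x - Z x))\<^sup>2"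
      unfolding P_def power2_norm_eq_inner
      by (simp add: inner_add_left inner_add_right inner_diff_left inner_diff_right inner_commute algebra_simps)
    moreover have "\<eta> x * (1 - \<eta> x) * (norm (gu k x - Z x))\<^sup>2 \<ge> 0" using \<eta>(2,3) by simp
    ultimately show "(norm (P k x))\<^sup>2 \<le> (1 - \<eta> x) * (norm (gu k x))\<^sup>2 + \<eta> x * (norm (Z x))\<^sup>2" by linarith
    have "P k x = (1 - \<eta> x) *\<^sub>R gu k x + \<eta> x *\<^sub>R Z x" by (simp add: P_def algebra_simps)
    then have "norm (P k x) \<le> norm ((1 - \<eta> x) *\<^sub>R gu k x) + norm (\<eta> x *\<^sub>R Z x)" using norm_triangle_ineq by metis
    also have "\<dots> \<le> norm (gu k x) + norm (Z x)"
      using \<eta>(2,3)[of x] by (intro add_mono) (auto simp: mult_left_le_one_le)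
    finally show "norm (P k x) \<le> norm (gu k x) + norm (Z x)" .
  qed
  have Nle: "(norm (P k x + q k x))\<^sup>2 \<le> (1 - \<eta> x) * (norm (gu k x))\<^sup>2 + \<eta> x * (norm (Z x))\<^sup>2
      + 2 * M * (norm (gu k x) * norm (u k x - w x)) + 2 * M * (norm (Z x) * norm (u k x - w x)) + M\<^sup>2 * (norm (u k x - w x))\<^sup>2" for k x
  proof -
    have "(norm (P k x + q k x))\<^sup>2 \<le> (norm (P k x) + norm (q k x))\<^sup>2"
      by (intro power_mono norm_triangle_ineq) auto
    also have "\<dots> = (norm (P k x))\<^sup>2 + 2 * (norm (P k x) * norm (q k x)) + (norm (q k x))\<^sup>2"
      by (simp add: power2_eq_square algebra_simps)
    also have "\<dots> \<le> ((1 - \<eta> x) * (norm (gu k x))\<^sup>2 + \<eta> x * (norm (Z x))\<^sup>2)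
        + 2 * ((norm (gu k x) + norm (Z x)) * (M * norm (u k x - w x))) + (M * norm (u k x - w x))\<^sup>2"
      by (intro add_mono Ple mult_left_mono mult_mono Ple' qle power_mono) (use M(1) in auto)
    finally show ?thesis by (simp add: power_mult_distrib algebra_simps)
  qed
  have i\<eta>: "integrable (lebesgue_on B) (\<lambda>x. \<eta> x * h x)" if h: "integrable (lebesgue_on B) h" for h :: "real^'n \<Rightarrow> real"
  proof (rule Bochner_Integration.integrable_bound[OF h])
    show "(\<lambda>x. \<eta> x * h x) \<in> borel_measurable (lebesgue_on B)" using \<eta>m h by (intro borel_measurable_times) auto
    show "AE x in lebesgue_on B. norm (\<eta> x * h x) \<le> norm (h x)"
      using \<eta>(2,3) by (intro AE_I2) (simp add: abs_mult mult_left_le_one_le)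
  qed
  have isq: "integrable (lebesgue_on B) (\<lambda>x. (norm (h x))\<^sup>2)" if "L2 B h" for h :: "real^'n \<Rightarrow> 'z::euclidean_space"
    using that by (simp add: L2_def)
  note igu = isq[OF Wu(3)] and igw = isq[OF Ww(3)] and iZ = isq[OF z(3)] and id = isq[OF L2d]
  note i1 = Cauchy_Schwarz_L2_norms(1)[OF Wu(3) L2d] and i2 = Cauchy_Schwarz_L2_norms(1)[OF z(3) L2d]
  \<comment> \<open>Lower semicontinuity by the tangent inequality: the weighted square at
    \<open>gu k\<close> is at least the one at \<open>gw\<close> plus twice the pairing of
    \<open>h\<close> with \<open>gu k - gw\<close>, and weak convergence removes the
    pairing.\<close>
  define h where "h x = \<eta> x *\<^sub>R gw x" for x
  have L2h: "L2 B h"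
  proof (rule L2_bound[OF Ww(3)])
    show "h \<in> borel_measurable (lebesgue_on B)"
      unfolding h_def using \<eta>m L2_measurable[OF Ww(3)] by (rule borel_measurable_scaleR)
    show "AE x in lebesgue_on B. norm (h x) \<le> norm (gw x)"
      using \<eta>(2,3) by (intro AE_I2) (simp add: h_def mult_left_le_one_le)
  qed
  define l where "l f = ?I (\<lambda>x. h x \<bullet> weak_gradient B f x)" for f :: "real^'n \<Rightarrow> real^'m"
  have "l \<in> W12_dual B" unfolding l_def[abs_def] by (rule gradient_functional_in_dual[OF oB L2h])
  then have llim: "(\<lambda>k. l (u k)) \<longlonglongrightarrow> l w"
    using weakly_converges[OF oB bB] by (simp add: weakly_converges_W12_def)
  define Gw where "Gw = ?I (\<lambda>x. \<eta> x * (norm (gw x))\<^sup>2)"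
  define GZ where "GZ = ?I (\<lambda>x. \<eta> x * (norm (Z x))\<^sup>2)"
  \<comment> \<open>Half of the three error integrals in \<open>Nle\<close>, estimated by
    Cauchy-Schwarz with \<open>C\<close> and \<open>b\<close> bounding the gradients; each term
    contains a factor that tends to 0 with \<open>d k\<close>.\<close>
  define \<epsilon> where "\<epsilon> k = M * (sqrt C * sqrt (d k)) + M * (sqrt b * sqrt (d k)) + (1/2) * (M\<^sup>2 * d k)" for k
  have \<epsilon>lim: "\<epsilon> \<longlonglongrightarrow> 0"
  proof -
    have "\<epsilon> \<longlonglongrightarrow> M * (sqrt C * sqrt 0) + M * (sqrt b * sqrt 0) + (1/2) * (M\<^sup>2 * 0)"
      unfolding \<epsilon>_def by (intro tendsto_intros dlim)
    then show ?thesis by simp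
  qed
  define Wu1 where "Wu1 k x = W_alpha A (\<alpha> k) (u k x)" for k x
  define Wz1 where "Wz1 k x = W_alpha A (\<alpha> k) (u k x + \<eta> x *\<^sub>R (z x - u k x))" for k x
  note cmp = minimizer_compare[OF A \<alpha>(1) \<alpha>(2) R min uK z[unfolded B_def] zK[unfolded B_def] \<eta>B[unfolded B_def] \<eta>(2,3) D, folded B_def,
      folded gu_def q_def Wu1_def Wz1_def]
  have N_eq: "gu k x + (\<eta> x *\<^sub>R (Z x - gu k x) + q k x) = P k x + q k x" for k x by (simp add: P_def)
  \<comment> \<open>The unweighted gradient integral of \<open>u k\<close> occurs on both sides of
    the comparison and cancels. What remains on the left carries the weight \<eta>, to which the
    tangent inequality applies.\<close>
  have grad: "(1/2) * Gw + (l (u k) - l w) + ?I (Wu1 k) - ?I (Wz1 k) \<le> (1/2) * GZ + \<epsilon> k" for k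
  proof -
    have C0: "C \<ge> 0" using C[of 0] by (rule order_trans[rotated]) simp
    have cs1: "?I (\<lambda>x. norm (gu k x) * norm (u k x - w x)) \<le> sqrt C * sqrt (d k)"
      using Cauchy_Schwarz_L2_norms(2)[OF Wu(3) L2d, of k k] unfolding d_def
      by (rule order_trans) (intro mult_right_mono real_sqrt_le_mono C, simp)
    have cs2: "?I (\<lambda>x. norm (Z x) * norm (u k x - w x)) \<le> sqrt b * sqrt (d k)"
      using Cauchy_Schwarz_L2_norms(2)[OF z(3) L2d, of k] by (simp add: d_def b_def)
    have "?I (\<lambda>x. (norm (P k x + q k x))\<^sup>2) \<le> ?I (\<lambda>x. ((norm (gu k x))\<^sup>2 - \<eta> x * (norm (gu k x))\<^sup>2) + \<eta> x * (norm (Z x))\<^sup>2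
      + 2 * M * (norm (gu k x) * norm (u k x - w x)) + 2 * M * (norm (Z x) * norm (u k x - w x)) + M\<^sup>2 * (norm (u k x - w x))\<^sup>2)"
    proof (rule integral_mono)
      show "integrable (lebesgue_on B) (\<lambda>x. (norm (P k x + q k x))\<^sup>2)" using isq[OF cmp(1)[of k, unfolded N_eq]] .
      show "integrable (lebesgue_on B) (\<lambda>x. ((norm (gu k x))\<^sup>2 - \<eta> x * (norm (gu k x))\<^sup>2) + \<eta> x * (norm (Z x))\<^sup>2
        + 2 * M * (norm (gu k x) * norm (u k x - w x)) + 2 * M * (norm (Z x) * norm (u k x - w x)) + M\<^sup>2 * (norm (u k x - w x))\<^sup>2)"
        using igu i\<eta>[OF igu] i\<eta>[OF iZ] i1 i2 id
        by (intro Bochner_Integration.integrable_add Bochner_Integration.integrable_diff integrable_mult_right)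
    qed (use Nle in \<open>simp add: algebra_simps\<close>)
    also have "\<dots> = ?I (\<lambda>x. (norm (gu k x))\<^sup>2) - ?I (\<lambda>x. \<eta> x * (norm (gu k x))\<^sup>2) + GZ
        + 2 * M * ?I (\<lambda>x. norm (gu k x) * norm (u k x - w x)) + 2 * M * ?I (\<lambda>x. norm (Z x) * norm (u k x - w x)) + M\<^sup>2 * d k"
      using igu[of k] i\<eta>[OF igu[of k]] i\<eta>[OF iZ] i1[of k k] i2[of k] id[of k]
      by (simp add: GZ_def d_def)
    also have "\<dots> \<le> ?I (\<lambda>x. (norm (gu k x))\<^sup>2) - ?I (\<lambda>x. \<eta> x * (norm (gu k x))\<^sup>2) + GZ + 2 * \<epsilon> k"
    proof -
      have "2 * M * ?I (\<lambda>x. norm (gu k x) * norm (u k x - w x)) \<le> 2 * M * (sqrt C * sqrt (d k))"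
        "2 * M * ?I (\<lambda>x. norm (Z x) * norm (u k x - w x)) \<le> 2 * M * (sqrt b * sqrt (d k))"
        using cs1 cs2 M(1) by (auto intro: mult_left_mono)
      then show ?thesis by (simp add: \<epsilon>_def algebra_simps)
    qed
    finally have 1: "?I (\<lambda>x. (norm (P k x + q k x))\<^sup>2) \<le> ?I (\<lambda>x. (norm (gu k x))\<^sup>2) - ?I (\<lambda>x. \<eta> x * (norm (gu k x))\<^sup>2) + GZ + 2 * \<epsilon> k" .
    have "?I (\<lambda>x. \<eta> x * (norm (gw x))\<^sup>2 + 2 * (h x \<bullet> gu k x - h x \<bullet> gw x)) \<le> ?I (\<lambda>x. \<eta> x * (norm (gu k x))\<^sup>2)"
    proof (rule integral_mono)
      show "integrable (lebesgue_on B) (\<lambda>x. \<eta> x * (norm (gw x))\<^sup>2 + 2 * (h x \<bullet> gu k x - h x \<bullet> gw x))"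
        using i\<eta>[OF igw] integrable_inner_L2(1)[OF L2h Wu(3)] integrable_inner_L2(1)[OF L2h Ww(3)]
        by (intro Bochner_Integration.integrable_add Bochner_Integration.integrable_diff integrable_mult_right)
      show "integrable (lebesgue_on B) (\<lambda>x. \<eta> x * (norm (gu k x))\<^sup>2)" by (rule i\<eta>[OF igu])
      fix x
      have "\<eta> x * (norm (gu k x))\<^sup>2 - (\<eta> x * (norm (gw x))\<^sup>2 + 2 * (h x \<bullet> gu k x - h x \<bullet> gw x)) = \<eta> x * (norm (gu k x - gw x))\<^sup>2"
        unfolding h_def power2_norm_eq_inner
        by (simp add: inner_diff_left inner_diff_right inner_commute algebra_simps)
      moreover have "\<dots> \<ge> 0" using \<eta>(2) by simp
      ultimately show "\<eta> x * (norm (gw x))\<^sup>2 + 2 * (h x \<bullet> gu k x - h x \<bullet> gw x) \<le> \<eta> x * (norm (gu k x))\<^sup>2" by linarith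
    qed
    moreover have "?I (\<lambda>x. \<eta> x * (norm (gw x))\<^sup>2 + 2 * (h x \<bullet> gu k x - h x \<bullet> gw x)) = Gw + 2 * (l (u k) - l w)"
      using i\<eta>[OF igw] integrable_inner_L2(1)[OF L2h Wu(3), of k] integrable_inner_L2(1)[OF L2h Ww(3)]
      by (simp add: Gw_def l_def gu_def gw_def)
    ultimately have 2: "Gw + 2 * (l (u k) - l w) \<le> ?I (\<lambda>x. \<eta> x * (norm (gu k x))\<^sup>2)" by simp
    show ?thesis using cmp(4)[of k, unfolded N_eq] 1 2 by (simp add: algebra_simps)
  qed
  have Em: "E \<in> sets lebesgue" by (rule E(1))
  have EB: "E \<subseteq> B" using E(2) V(2) by blast
  have iE: "integrable (lebesgue_on B) (\<lambda>x. indicator E x * f x)"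
    if f: "integrable (lebesgue_on B) f" for f :: "real^'n \<Rightarrow> real"
    using integrable_mult_indicator[of E "lebesgue_on B" f] f Em EB by (simp add: sets_restrict_space_iff open_lebesgue[OF oB])
  have zm: "z \<in> borel_measurable (lebesgue_on B)" using z(1) by (rule L2_measurable)
  have Wzm: "(\<lambda>x. W_alpha A (\<alpha> k) (z x)) \<in> borel_measurable (lebesgue_on B)" for k
    by (rule measurable_compose[OF zm W_alpha_measurable])
  have iWz: "integrable (lebesgue_on B) (\<lambda>x. W_alpha A (\<alpha> k) (z x))" for k
    by (rule integrable_bounded_lebesgue_on[OF Wzm _ lB, of _ Mw])
       (use zK W_alpha_bounds(3) in \<open>auto elim!: eventually_mono simp: Mw_def\<close>)
  define VE where "VE = measure lebesgue (V - E)"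
  have lV: "V \<in> lmeasurable" using V lB fmeasurableI2 by blast
  have lVE: "V - E \<in> lmeasurable" using lV Em by (rule fmeasurable_Diff)
  have iVE: "integrable (lebesgue_on B) (\<lambda>x. indicat_real (V - E) x)" "?I (\<lambda>x. indicator (V - E) x) = VE"
  proof -
    have s: "(\<lambda>x. indicat_real B x *\<^sub>R indicat_real (V - E) x) = indicator (V - E)"
      using V(2) by (auto simp: indicator_def fun_eq_iff)
    show "integrable (lebesgue_on B) (\<lambda>x. indicat_real (V - E) x)"
      unfolding integrable_lebesgue_on_iff(1)[OF open_lebesgue[OF oB]] s using lVE by (simp add: lmeasurable_iff_integrable)
    show "?I (\<lambda>x. indicator (V - E) x) = VE"
      unfolding integrable_lebesgue_on_iff(2)[OF open_lebesgue[OF oB]] s VE_def by simp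
  qed
  \<comment> \<open>On \<open>E\<close> the competitor is exactly \<open>z\<close>; outside
    \<open>V\<close> it is \<open>u k\<close> and nothing changes; on the layer the bounds
    \<open>Mw\<close> above and 0 below are used.\<close>
  have pot: "?I (Wz1 k) - ?I (Wu1 k) \<le> ?I (\<lambda>x. indicator E x * W_alpha A (\<alpha> k) (z x)) - ?I (\<lambda>x. indicator E x * Wu1 k x) + Mw * VE" for k
  proof -
    have "?I (\<lambda>x. Wz1 k x - Wu1 k x) \<le> ?I (\<lambda>x. indicator E x * W_alpha A (\<alpha> k) (z x) - indicator E x * Wu1 k x + Mw * indicator (V - E) x)"
    proof (rule integral_mono_AE)
      show "integrable (lebesgue_on B) (\<lambda>x. Wz1 k x - Wu1 k x)"
        using cmp(2,3)[of k] by (intro Bochner_Integration.integrable_diff)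
      show "integrable (lebesgue_on B) (\<lambda>x. indicator E x * W_alpha A (\<alpha> k) (z x) - indicator E x * Wu1 k x + Mw * indicator (V - E) x)"
        using iE[OF iWz] iE[OF cmp(2)[of k]] iVE(1)
        by (intro Bochner_Integration.integrable_add Bochner_Integration.integrable_diff integrable_mult_right)
      show "AE x in lebesgue_on B. Wz1 k x - Wu1 k x \<le> indicator E x * W_alpha A (\<alpha> k) (z x) - indicator E x * Wu1 k x + Mw * indicator (V - E) x"
        using zK
      proof eventually_elim
        case (elim x)
        consider "x \<in> E" | "x \<in> V - E" | "x \<notin> V" using E(2) by blast
        then show ?case
        proof cases
          case 1
          then show ?thesis using \<eta>(4)[OF 1] by (simp add: Wz1_def)
        next
          case 2
          have "u k x + \<eta> x *\<^sub>R (z x - u k x) \<in> convex hull A" using uK elim \<eta>(2,3) by (intro convex_combination_mem) auto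
          then have "Wz1 k x \<le> Mw" unfolding Wz1_def Mw_def by (rule W_alpha_bounds(2))
          moreover have "Wu1 k x \<ge> 0" unfolding Wu1_def by (rule W_alpha_bounds(1)[OF uK])
          ultimately show ?thesis using 2 by simp
        next
          case 3
          then have "\<eta> x = 0" "x \<notin> E" using test_functionD(6)[OF \<eta>(1) 3] E(2) by auto
          then show ?thesis using 3 by (simp add: Wz1_def Wu1_def)
        qed
      qed
    qed
    then show ?thesis using cmp(2,3)[of k] iE[OF iWz[of k]] iE[OF cmp(2)[of k]] iVE by simp
  qed
  \<comment> \<open>Where \<open>w\<close> lies in \<open>A\<close> the potential of
    \<open>u k\<close> need not converge; the factor \<open>nA\<close> drops it, which only
    decreases the left side. What is left converges pointwise and is dominated.\<close>
  define nA where "nA x = (if w x \<in> A then 0 else 1::real)" for x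
  have nA_eq: "nA x = W_zero A (w x)" for x using W_zero_eq[OF wK] by (simp add: nA_def)
  have wmB: "w \<in> borel_measurable (lebesgue_on B)" using Ww(1) by (rule L2_measurable)
  have nAm: "nA \<in> borel_measurable (lebesgue_on B)"
    using measurable_compose[OF wmB W_zero_measurable[OF A]] by (simp add: nA_eq[abs_def])
  have low: "?I (\<lambda>x. indicator E x * (nA x * Wu1 k x)) \<le> ?I (\<lambda>x. indicator E x * Wu1 k x)"
    and inA: "integrable (lebesgue_on B) (\<lambda>x. nA x * Wu1 k x)" for k
  proof -
    show n: "integrable (lebesgue_on B) (\<lambda>x. nA x * Wu1 k x)"
    proof (rule Bochner_Integration.integrable_bound[OF cmp(2)[of k]])
      show "(\<lambda>x. nA x * Wu1 k x) \<in> borel_measurable (lebesgue_on B)" using nAm cmp(2)[of k] by (intro borel_measurable_times) auto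
    qed (auto simp: nA_def)
    show "?I (\<lambda>x. indicator E x * (nA x * Wu1 k x)) \<le> ?I (\<lambda>x. indicator E x * Wu1 k x)"
      using iE[OF n] iE[OF cmp(2)[of k]] W_alpha_bounds(1)[OF uK]
      by (intro integral_mono) (auto simp: nA_def indicator_def Wu1_def)
  qed
  interpret fm: finite_measure "lebesgue_on B" using lB by (rule finite_measure_lebesgue_on)
  have lim1: "(\<lambda>k. ?I (\<lambda>x. indicator E x * W_alpha A (\<alpha> k) (z x))) \<longlonglongrightarrow> ?I (\<lambda>x. indicator E x * W_zero A (z x))"
  proof (rule integral_dominated_convergence[where w="\<lambda>x. Mw"])
    show "(\<lambda>x. indicat_real E x * W_zero A (z x)) \<in> borel_measurable (lebesgue_on B)"
      using iE[OF W_zero_integrable[OF zm lB]] by (rule borel_measurable_integrable)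
    show "(\<lambda>x. indicat_real E x * W_alpha A (\<alpha> k) (z x)) \<in> borel_measurable (lebesgue_on B)" for k
      using iE[OF iWz] by (rule borel_measurable_integrable)
    show "integrable (lebesgue_on B) (\<lambda>x. Mw)" by (rule fm.integrable_const)
    show "AE x in lebesgue_on B. (\<lambda>k. indicat_real E x * W_alpha A (\<alpha> k) (z x)) \<longlonglongrightarrow> indicat_real E x * W_zero A (z x)"
      using zK by eventually_elim (intro tendsto_mult_left W_alpha_tendsto_W_zero)
    show "AE x in lebesgue_on B. norm (indicat_real E x * W_alpha A (\<alpha> k) (z x)) \<le> Mw" for k
      using zK
    proof eventually_elim
      case (elim x)
      have "\<bar>W_alpha A (\<alpha> k) (z x)\<bar> \<le> Mw" unfolding Mw_def by (rule W_alpha_bounds(3)[OF elim])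
      then show ?case using D(1) by (auto simp: indicator_def Mw_def)
    qed
  qed
  have lim2: "(\<lambda>k. ?I (\<lambda>x. indicator E x * (nA x * Wu1 k x))) \<longlonglongrightarrow> ?I (\<lambda>x. indicator E x * W_zero A (w x))"
  proof (rule integral_dominated_convergence[where w="\<lambda>x. Mw"])
    show "(\<lambda>x. indicat_real E x * W_zero A (w x)) \<in> borel_measurable (lebesgue_on B)"
      using iE[OF W_zero_integrable[OF wmB lB]] by (rule borel_measurable_integrable)
    show "(\<lambda>x. indicat_real E x * (nA x * Wu1 k x)) \<in> borel_measurable (lebesgue_on B)" for k
      using iE[OF inA] by (rule borel_measurable_integrable)
    show "integrable (lebesgue_on B) (\<lambda>x. Mw)" by (rule fm.integrable_const)
    have "AE x in lebesgue_on B. (\<lambda>k. u k x) \<longlonglongrightarrow> w x"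
      using wlim unfolding AE_lebesgue_on_iff[OF open_lebesgue[OF oB]] by eventually_elim simp
    then show "AE x in lebesgue_on B. (\<lambda>k. indicat_real E x * (nA x * Wu1 k x)) \<longlonglongrightarrow> indicat_real E x * W_zero A (w x)"
    proof eventually_elim
      case (elim x)
      have "(\<lambda>k. nA x * Wu1 k x) \<longlonglongrightarrow> W_zero A (w x)"
      proof (cases "w x \<in> A")
        case True
        then show ?thesis using nA_eq[of x] by (simp add: nA_def)
      next
        case False
        then show ?thesis using nA_eq[of x] W_alpha_tendsto[OF A False \<alpha>(3) elim] by (simp add: nA_def Wu1_def)
      qed
      then show ?case by (rule tendsto_mult_left)
    qed
    show "AE x in lebesgue_on B. norm (indicat_real E x * (nA x * Wu1 k x)) \<le> Mw" for k
    proof (rule AE_I2)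
      fix x
      have "\<bar>Wu1 k x\<bar> \<le> Mw" unfolding Mw_def Wu1_def by (rule W_alpha_bounds(3)[OF uK])
      then show "norm (indicat_real E x * (nA x * Wu1 k x)) \<le> Mw" using D(1) by (auto simp: indicator_def nA_def Mw_def)
    qed
  qed
  have "(1/2) * Gw + (l (u k) - l w) + ?I (\<lambda>x. indicator E x * (nA x * Wu1 k x))
      \<le> (1/2) * GZ + \<epsilon> k + ?I (\<lambda>x. indicator E x * W_alpha A (\<alpha> k) (z x)) + Mw * VE" for k
    using grad[of k] pot[of k] low[of k] by linarith
  moreover have "(\<lambda>k. (1/2) * Gw + (l (u k) - l w) + ?I (\<lambda>x. indicator E x * (nA x * Wu1 k x)))
      \<longlonglongrightarrow> (1/2) * Gw + (l w - l w) + ?I (\<lambda>x. indicator E x * W_zero A (w x))"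
    by (intro tendsto_intros llim lim2)
  moreover have "(\<lambda>k. (1/2) * GZ + \<epsilon> k + ?I (\<lambda>x. indicator E x * W_alpha A (\<alpha> k) (z x)) + Mw * VE)
      \<longlonglongrightarrow> (1/2) * GZ + 0 + ?I (\<lambda>x. indicator E x * W_zero A (z x)) + Mw * VE"
    by (intro tendsto_intros \<epsilon>lim lim1)
  ultimately have "(1/2) * Gw + (l w - l w) + ?I (\<lambda>x. indicator E x * W_zero A (w x))
      \<le> (1/2) * GZ + 0 + ?I (\<lambda>x. indicator E x * W_zero A (z x)) + Mw * VE"
    by (intro LIMSEQ_le) auto
  then show ?thesis by (simp add: Gw_def GZ_def gw_def Mw_def VE_def)
qed

end

text \<open>The layers are bounded and decrease to the empty set because \<open>E\<close> is closed,
  so continuity from above applies.\<close>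

lemma measure_shrinking_neighbourhood:
  fixes E :: "(real^'n::finite) set"
  assumes E: "compact E" "E \<noteq> {}"
  shows "(\<lambda>j. measure lebesgue ({x. infdist x E < 1 / real (Suc j)} - E)) \<longlonglongrightarrow> 0"
proof -
  define S where "S j = {x. infdist x E < 1 / real (Suc j)} - E" for j
  have o: "open {x. infdist x E < c}" for c
    by (intro open_Collect_less continuous_on_infdist continuous_intros)
  have Sm: "S j \<in> sets lebesgue" for j
    unfolding S_def using o E by (intro sets.Diff open_lebesgue compact_lebesgue)
  have S0: "S j \<in> lmeasurable" for j
  proof (rule bounded_set_imp_lmeasurable[OF _ Sm])
    have "S j \<subseteq> {x. infdist x E \<le> 1}"
    proof
      fix x assume "x \<in> S j"
      then have "infdist x E < 1 / real (Suc j)" by (simp add: S_def)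
      also have "\<dots> \<le> 1" by simp
      finally show "x \<in> {x. infdist x E \<le> 1}" by simp
    qed
    then show "bounded (S j)"
      using compact_infdist_le[OF E(2,1), of 1] bounded_subset compact_imp_bounded by (metis zero_less_one)
  qed
  have dS: "decseq S"
  proof (rule decseq_SucI)
    fix j
    have "1 / real (Suc (Suc j)) \<le> 1 / real (Suc j)" by (simp add: divide_simps)
    then show "S (Suc j) \<subseteq> S j" by (auto simp: S_def)
  qed
  have S1: "(\<Inter>j. S j) = {}"
  proof (rule ccontr)
    assume "(\<Inter>j. S j) \<noteq> {}"
    then obtain x where x: "\<And>j. x \<in> S j" by blast
    have "infdist x E > 0"
      using x[of 0] E by (simp add: S_def infdist_pos_not_in_closed compact_imp_closed)
    then obtain j where "1 / real (Suc j) < infdist x E" using nat_approx_posE by (metis)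
    then show False using x[of j] by (simp add: S_def)
  qed
  have rS: "range S \<subseteq> sets lebesgue" using Sm by blast
  have "(\<lambda>j. emeasure lebesgue (S j)) \<longlonglongrightarrow> emeasure lebesgue (\<Inter>j. S j)"
    by (rule Lim_emeasure_decseq[OF rS dS]) (use fmeasurableD2[OF S0] in \<open>simp add: infinity_ennreal_def\<close>)
  then have "(\<lambda>j. ennreal (measure lebesgue (S j))) \<longlonglongrightarrow> ennreal 0"
    using S0 by (simp add: emeasure_eq_measure2 S1 flip: ennreal_0)
  then show ?thesis unfolding S_def by (subst (asm) tendsto_ennreal_iff) auto
qed

context minimizer_limit
begin

text \<open>The competitor is extended to a ball by \<open>w\<close>, and
  \<open>limit_inequality\<close> is applied with cutoffs for ever smaller neighbourhoods of the
  closure. Off \<Omega> both sides have equal integrands, so for each \<open>j\<close> the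
  inequality reduces to one over \<Omega> with the measure of the layer as only error.\<close>

lemma J_zero_minimal:
  assumes \<Omega>: "open \<Omega>" "bounded \<Omega>" and v: "v \<in> W12_0 \<Omega>"
    and vK: "AE x in lebesgue_on \<Omega>. w x + v x \<in> convex hull A"
  shows "J_zero A \<Omega> w \<le> J_zero A \<Omega> (\<lambda>x. w x + v x)"
proof (cases "\<Omega> = {}")
  \<comment> \<open>Treated apart because neighbourhoods are measured by \<open>infdist\<close> to a
    nonempty set.\<close>
  case True
  then have "J_zero A \<Omega> w = 0" by (simp add: J_zero_def energy_def nn_integral_restrict_space)
  then show ?thesis by simp
next
  case False
  \<comment> \<open>The closure is compact, so there are cutoffs equal to 1 on it. The boundary of
    \<Omega> may have positive measure, but there \<open>z\<close> equals \<open>w\<close> and its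
    contributions cancel.\<close>
  define E where "E = closure \<Omega>"
  have E: "compact E" "E \<noteq> {}" "\<Omega> \<subseteq> E"
    using \<Omega>(2) False closure_subset by (auto simp: E_def)
  obtain R0 where R0: "R0 > 0" "E \<subseteq> ball 0 R0" using bounded_subset_ballD[OF compact_imp_bounded[OF E(1)], of 0] by blast
  \<comment> \<open>The neighbourhoods \<open>V j\<close> have radius at most 1, so all of them fit
    into the ball of radius \<open>R0 + 1\<close>.\<close>
  define R where "R = R0 + 1"
  define B where "B = ball (0::real^'n) R"
  have R: "R > 0" using R0 by (simp add: R_def)
  have oB: "open B" and bB: "bounded B" and lB: "B \<in> lmeasurable" by (auto simp: B_def)
  define V where "V j = {x. infdist x E < 1 / real (Suc j)}" for j
  have oV: "open (V j)" for j
    unfolding V_def by (intro open_Collect_less continuous_on_infdist continuous_intros)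
  have VB: "V j \<subseteq> B" for j
  proof
    fix x assume "x \<in> V j"
    then have x: "infdist x E < 1 / real (Suc j)" by (simp add: V_def)
    have "1 / real (Suc j) \<le> 1" by simp
    then have "infdist x E < 1" using x by linarith
    moreover obtain y where y: "y \<in> E" "infdist x E = dist x y"
      using infdist_attains_inf[OF compact_imp_closed[OF E(1)] E(2)] by blast
    moreover have "norm y < R0" using R0(2) y(1) by auto
    ultimately show "x \<in> B" using norm_triangle_ineq2[of x y] by (simp add: B_def R_def dist_norm)
  qed
  have EV: "E \<subseteq> V j" for j by (auto simp: V_def)
  have \<Omega>B: "\<Omega> \<subseteq> B" using E(3) EV VB by blast
  have vW: "v \<in> W12 \<Omega>" using v by (simp add: W12_0_def)
  note Wv = W12D[OF \<Omega>(1) vW] and Ww = W12D[OF oB wW[OF oB bB]]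
  define z where "z x = w x + (if x \<in> \<Omega> then v x else 0)" for x
  define Z where "Z x = weak_gradient B w x + (if x \<in> \<Omega> then weak_gradient \<Omega> v x else 0)" for x
  have z: "L2 B z" "L2 B Z"
    unfolding z_def[abs_def] Z_def[abs_def]
    by (intro L2_add Ww L2_UNIV_mono[OF L2_extend_zero[OF \<Omega>(1)] oB] Wv)+
  have zZ: "has_weak_gradient B z Z"
    unfolding z_def[abs_def] Z_def[abs_def]
    by (rule has_weak_gradient_add[OF oB Ww(2) has_weak_gradient_mono[OF W12_0_extend_zero[OF \<Omega>(1) v] open_UNIV oB subset_UNIV]])
  have zK: "AE x in lebesgue_on B. z x \<in> convex hull A"
    using vK wK unfolding AE_lebesgue_on_iff[OF open_lebesgue[OF oB]] AE_lebesgue_on_iff[OF open_lebesgue[OF \<Omega>(1)]]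
    by (auto elim!: eventually_mono simp: z_def)
  let ?g = "weak_gradient B w"
  let ?M = "lebesgue_on \<Omega>"
  have sub: "(LINT x|lebesgue_on B. indicator \<Omega> x * f x) = (LINT x|?M. f x)" for f :: "real^'n \<Rightarrow> real"
  proof -
    have "(\<lambda>x. indicat_real B x *\<^sub>R (indicator \<Omega> x * f x)) = (\<lambda>x. indicat_real \<Omega> x *\<^sub>R f x)"
      using \<Omega>B by (auto simp: indicator_def fun_eq_iff)
    then show ?thesis
      unfolding integrable_lebesgue_on_iff(2)[OF open_lebesgue[OF oB]] integrable_lebesgue_on_iff(2)[OF open_lebesgue[OF \<Omega>(1)]]
      by simp
  qed
  have L\<Omega>: "L2 \<Omega> ?g" "L2 \<Omega> Z"
    using L2_mono[OF _ \<Omega>B] open_lebesgue[OF \<Omega>(1)] open_lebesgue[OF oB] Ww(3) z(2) by blast+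
  have l\<Omega>: "\<Omega> \<in> lmeasurable" using \<Omega> by (simp add: lmeasurable_open)
  have wm\<Omega>: "w \<in> borel_measurable ?M" by (rule measurable_restrict_space1[OF wm])
  have zm\<Omega>: "(\<lambda>x. w x + v x) \<in> borel_measurable ?M"
    using wm\<Omega> L2_measurable[OF Wv(1)] by (rule borel_measurable_add)
  have iw: "integrable ?M (\<lambda>x. W_zero A (w x))" and iz: "integrable ?M (\<lambda>x. W_zero A (w x + v x))"
    using W_zero_integrable[OF wm\<Omega> l\<Omega>] W_zero_integrable[OF zm\<Omega> l\<Omega>] by auto
  define a where "a = (LINT x|?M. (norm (?g x))\<^sup>2)"
  define b where "b = (LINT x|?M. (norm (Z x))\<^sup>2)"
  define c where "c = (LINT x|?M. W_zero A (w x))"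
  define e where "e = (LINT x|?M. W_zero A (w x + v x))"
  define Mw where "Mw = (D\<^sup>2) ^ card A"
  have "(1/2) * a + c \<le> (1/2) * b + e + Mw * measure lebesgue (V j - E)" for j
  proof -
    obtain \<eta> :: "real^'n \<Rightarrow> real" where \<eta>: "test_function (V j) \<eta>" "\<And>x. 0 \<le> \<eta> x" "\<And>x. \<eta> x \<le> 1"
      "\<And>x. infdist x E \<le> 1 / real (Suc j) / 4 \<Longrightarrow> \<eta> x = 1"
      using cutoff_exists[OF E(1,2), of "1 / real (Suc j)"] unfolding V_def by auto
    have \<eta>E: "\<eta> x = 1" if "x \<in> E" for x using that by (intro \<eta>(4)) simp
    let ?I = "\<lambda>f. LINT x|lebesgue_on B. f x"
    have \<eta>m: "\<eta> \<in> borel_measurable (lebesgue_on B)"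
      by (intro measurable_restrict_space1 borel_measurable_integrable integrable_test_function(2)[OF \<eta>(1)])
    have i\<eta>: "integrable (lebesgue_on B) (\<lambda>x. \<eta> x * (norm (h x))\<^sup>2)" if "L2 B h" for h :: "real^'n \<Rightarrow> real^'n^'m"
    proof (rule Bochner_Integration.integrable_bound[of _ "\<lambda>x. (norm (h x))\<^sup>2"])
      show "integrable (lebesgue_on B) (\<lambda>x. (norm (h x))\<^sup>2)" using that by (simp add: L2_def)
      show "(\<lambda>x. \<eta> x * (norm (h x))\<^sup>2) \<in> borel_measurable (lebesgue_on B)"
        using \<eta>m L2_measurable[OF that]
        by (intro borel_measurable_times borel_measurable_power borel_measurable_norm[THEN measurable_compose[rotated]])
      show "AE x in lebesgue_on B. norm (\<eta> x * (norm (h x))\<^sup>2) \<le> norm ((norm (h x))\<^sup>2)"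
        using \<eta>(2,3) by (intro AE_I2) (simp add: abs_mult mult_left_le_one_le)
    qed
    have EB: "E \<subseteq> B" using EV VB by blast
    have iE: "integrable (lebesgue_on B) (\<lambda>x. indicator E x * W_zero A (f x))"
      if f: "f \<in> borel_measurable (lebesgue_on B)" for f :: "real^'n \<Rightarrow> real^'m"
      using integrable_mult_indicator[of E "lebesgue_on B", OF _ W_zero_integrable[OF f lB]] compact_lebesgue[OF E(1)] EB
      by (simp add: sets_restrict_space_iff open_lebesgue[OF oB])
    have ineq: "(1/2) * ?I (\<lambda>x. \<eta> x * (norm (?g x))\<^sup>2) + ?I (\<lambda>x. indicator E x * W_zero A (w x))
      \<le> (1/2) * ?I (\<lambda>x. \<eta> x * (norm (Z x))\<^sup>2) + ?I (\<lambda>x. indicator E x * W_zero A (z x)) + Mw * measure lebesgue (V j - E)"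
      unfolding B_def Mw_def
      by (rule limit_inequality[OF R \<Omega>(1) E(3) compact_lebesgue[OF E(1)] EV open_lebesgue[OF oV] VB[unfolded B_def]
          z(1)[unfolded B_def] zZ[unfolded B_def] z(2)[unfolded B_def] zK[unfolded B_def] _ \<eta>(1-3) \<eta>E])
         (simp_all add: z_def)
    \<comment> \<open>On \<Omega> the cutoff is 1, and off \<Omega> the map \<open>Z\<close> is the
      gradient of \<open>w\<close> by definition; taking the difference thus removes \<eta> and its
      dependence on \<open>j\<close>.\<close>
    have 1: "?I (\<lambda>x. \<eta> x * (norm (Z x))\<^sup>2) - ?I (\<lambda>x. \<eta> x * (norm (?g x))\<^sup>2) = b - a"
    proof -
      have "?I (\<lambda>x. \<eta> x * (norm (Z x))\<^sup>2) - ?I (\<lambda>x. \<eta> x * (norm (?g x))\<^sup>2)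
          = ?I (\<lambda>x. \<eta> x * (norm (Z x))\<^sup>2 - \<eta> x * (norm (?g x))\<^sup>2)"
        using i\<eta>[OF z(2)] i\<eta>[OF Ww(3)] by simp
      also have "(\<lambda>x. \<eta> x * (norm (Z x))\<^sup>2 - \<eta> x * (norm (?g x))\<^sup>2) = (\<lambda>x. indicator \<Omega> x * ((norm (Z x))\<^sup>2 - (norm (?g x))\<^sup>2))"
        using \<eta>E E(3) by (auto simp: fun_eq_iff Z_def indicator_def)
      also have "?I (\<lambda>x. indicator \<Omega> x * ((norm (Z x))\<^sup>2 - (norm (?g x))\<^sup>2)) = b - a"
        unfolding sub a_def b_def using L\<Omega> by (simp add: L2_def)
      finally show ?thesis .
    qed
    have 2: "?I (\<lambda>x. indicator E x * W_zero A (z x)) - ?I (\<lambda>x. indicator E x * W_zero A (w x)) = e - c"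
    proof -
      have "?I (\<lambda>x. indicator E x * W_zero A (z x)) - ?I (\<lambda>x. indicator E x * W_zero A (w x))
          = ?I (\<lambda>x. indicator E x * W_zero A (z x) - indicator E x * W_zero A (w x))"
        using iE[OF L2_measurable[OF z(1)]] iE[OF L2_measurable[OF Ww(1)]] by simp
      also have "(\<lambda>x. indicator E x * W_zero A (z x) - indicator E x * W_zero A (w x))
          = (\<lambda>x. indicator \<Omega> x * (W_zero A (w x + v x) - W_zero A (w x)))"
        using E(3) by (auto simp: fun_eq_iff z_def indicator_def)
      also have "?I (\<lambda>x. indicator \<Omega> x * (W_zero A (w x + v x) - W_zero A (w x))) = e - c"
        unfolding sub e_def c_def using iw iz by simp
      finally show ?thesis .
    qed
    show ?thesis using ineq 1 2 by (simp add: algebra_simps)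
  qed
  moreover have "(\<lambda>j. (1/2) * b + e + Mw * measure lebesgue (V j - E)) \<longlonglongrightarrow> (1/2) * b + e + Mw * 0"
    unfolding V_def by (intro tendsto_intros measure_shrinking_neighbourhood E)
  ultimately have le: "(1/2) * a + c \<le> (1/2) * b + e"
    using LIMSEQ_le_const[of _ "(1/2) * b + e + Mw * 0"] by auto
  have "J_zero A \<Omega> w = ennreal ((1/2) * a + c)"
    unfolding J_zero_def a_def c_def
    by (rule energy_eq[OF \<Omega>(1) has_weak_gradient_mono[OF Ww(2) oB \<Omega>(1) \<Omega>B] L\<Omega>(1) iw W_zero_bounds(1)])
  moreover have "has_weak_gradient \<Omega> (\<lambda>x. w x + v x) Z"
    by (rule has_weak_gradient_cong[OF has_weak_gradient_mono[OF zZ oB \<Omega>(1) \<Omega>B]]) (auto simp: z_def)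
  then have "J_zero A \<Omega> (\<lambda>x. w x + v x) = ennreal ((1/2) * b + e)"
    unfolding J_zero_def b_def e_def by (rule energy_eq[OF \<Omega>(1) _ L\<Omega>(2) iz W_zero_bounds(1)])
  ultimately show ?thesis using le by (simp add: ennreal_leI)
qed

lemma limit_minimizer: "energy_minimizer_in (S_hull_closed A) (J_zero A) w"
  unfolding energy_minimizer_in_def S_hull_closed_eq(1)[OF A]
proof (intro conjI allI impI)
  show "w \<in> W12_loc" using wW by (simp add: W12_loc_def)
  show "Linf UNIV w"
    unfolding Linf_def lebesgue_on_UNIV_eq using wm D(3) wK by (intro conjI exI[of _ D] AE_I2) auto
  show "AE x in lebesgue. w x \<in> convex hull A" using wK by simp
qed (use J_zero_minimal in blast)

lemma limit_weakly_converges: "weakly_converges_W12_loc u w"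
  unfolding weakly_converges_W12_loc_def using weakly_converges by blast

end

theorem lemma2p9:
  fixes A :: "(real^'m) set"
    and \<alpha> :: "nat \<Rightarrow> real"
    and u :: "nat \<Rightarrow> real^'n \<Rightarrow> real^'m"
  assumes "finite A" and "card A \<ge> 2"
    and "\<And>k. 0 < \<alpha> k \<and> \<alpha> k < 2"
    and "\<alpha> \<longlonglongrightarrow> 0"
    and "\<And>k. energy_minimizer (J_alpha A (\<alpha> k)) (u k)"
    and "\<And>k x. u k x \<in> S_hull_closed A"
  shows "\<exists>r w. strict_mono r \<and>
           weakly_converges_W12_loc (u \<circ> r) w \<and>
           energy_minimizer_in (S_hull_closed A) (J_zero A) w"
proof -
  note hull = S_hull_closed_eq(1)[OF assms(1)]
  have uK: "u k x \<in> convex hull A" for k x using assms(6) by (simp add: hull)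
  have cK: "compact (convex hull A)"
    by (intro compact_convex_hull finite_imp_compact assms(1))
  obtain a where a: "a \<in> A" using assms(2) by (metis card.empty equals0I not_numeral_le_zero)
  obtain D0 where D0: "\<And>p. p \<in> convex hull A \<Longrightarrow> norm p \<le> D0"
    using compact_imp_bounded[OF cK] unfolding bounded_iff by blast
  \<comment> \<open>Twice the norm bound dominates all distances within the hull; the maximum with 1
    is what raising the exponents to 2 requires.\<close>
  define D where "D = max 1 (2 * D0)"
  have AK: "p \<in> convex hull A" if "p \<in> A" for p using that by (rule hull_inc)
  have "D0 \<ge> 0" using D0[OF AK[OF a]] norm_ge_zero[of a] by linarith
  then have D: "D \<ge> 1" "\<forall>p\<in>convex hull A. \<forall>a\<in>A. norm (p - a) \<le> D" "\<forall>p\<in>convex hull A. norm p \<le> D"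
    using D0 AK norm_triangle_ineq4 by (auto simp: D_def intro!: order_trans[OF norm_triangle_ineq4] max.coboundedI2)
      (smt (verit))+
  have uloc: "u k \<in> W12_loc" for k using assms(5) by (simp add: energy_minimizer_in_def)
  have bound: "\<exists>C. \<forall>k. (LINT x|lebesgue_on (ball 0 R). (norm (weak_gradient (ball 0 R) (u k) x))\<^sup>2) \<le> C" for R
    by (rule minimizer_gradient_bound[OF assms(1) a D, of R]) (use assms(3,5) uK in blast)
  have uD: "norm (u k x) \<le> D" for k x using D(3) uK by blast
  obtain r where r: "strict_mono r" and conv: "AE x in lebesgue. convergent (\<lambda>k. u (r k) x)"
    using rellich_subsequence[OF uloc uD bound] by blast
  obtain w where w: "w \<in> borel_measurable lebesgue" "\<And>x. w x \<in> convex hull A" "AE x in lebesgue. (\<lambda>k. u (r k) x) \<longlonglongrightarrow> w x"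
    "\<And>\<Omega>. \<Omega> \<in> lmeasurable \<Longrightarrow> (\<lambda>k. sqn (lebesgue_on \<Omega>) (\<lambda>x. u (r k) x - w x)) \<longlonglongrightarrow> 0"
    by (rule limit_map_exists[of "\<lambda>k. u (r k)", OF W12_loc_measurable[OF uloc] compact_imp_closed[OF cK] uK D0 conv]) (assumption | rule that)+
  \<comment> \<open>The locale is entered with the subsequence, so its conclusions speak about
    \<open>u \<circ> r\<close>. A gradient bound uniform in \<open>k\<close> is inherited by
    it.\<close>
  interpret minimizer_limit A "\<alpha> \<circ> r" "u \<circ> r" w D
  proof
    show "(\<alpha> \<circ> r) \<longlonglongrightarrow> 0" using assms(4) r by (rule LIMSEQ_subseq_LIMSEQ)
    show "\<exists>C. \<forall>k. (LINT x|lebesgue_on (ball 0 R). (norm (weak_gradient (ball 0 R) ((u \<circ> r) k) x))\<^sup>2) \<le> C" for R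
      using bound[of R] by auto
  qed (use assms(1,3,5) uK D w in auto)
  show ?thesis using r limit_weakly_converges limit_minimizer by blast
qed

end
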